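(* Let $(M,g)$ be a smooth closed connected Riemannian manifold whose geodesic flow is Anosov on the unit tangent bundle $SM$, and let $\mathcal{E}\to M$ be a smooth complex Hermitian vector bundle. Then there exists $k_0\ge 0$ such that for every $k\ge k_0$ there is an open dense subset of the space of unitary $C^k$ connections on $\mathcal{E}$ (with the $C^k$ topology) all of whose elements are opaque.
   Context: Let $(\varphi_t)_{t\in\mathbb{R}}$ be the geodesic flow on $SM$, generated by the geodesic vector field $X$, and $\pi:SM\to M$ the projection. The flow is Anosov if there is a continuous flow-invariant splitting $T(SM)=\mathbb{R}X\oplus E_s\oplus E_u$ and constants $C,\lambda>0$ with $\|d\varphi_t(v)\|\le Ce^{-\lambda t}\|v\|$ for all $t\ge0$, $v\in E_s$, and $\|d\varphi_t(v)\|\le Ce^{-\lambda|t|}\|v\|$ for all $t\le0$, $v\in E_u$. Given a unitary connection $\nabla^{\mathcal{E}}$, for $(x,v)\in SM$ and $t\in\mathbb{R}$ let $C((x,v),t):\mathcal{E}_x\to\mathcal{E}_{\pi(\varphi_t(x,v))}$ be the parallel transport along the geodesic segment $(\pi\varphi_s(x,v))_{s\in[0,t]}$. A smooth subbundle $\mathcal{F}\to M$ of $\mathcal{E}\to M$ is invariant if $C((x,v),t)f\in\mathcal{F}_{\pi(\varphi_t(x,v))}$ for all $(x,v)\in SM$, $f\in\mathcal{F}_x$, $t\in\mathbb{R}$. The connection $\nabla^{\mathcal{E}}$ is opaque if every invariant subbundle is either $\mathcal{E}$ or $\{0\}$. The $C^k$ unitary connections on $\mathcal{E}$ form an affine space modelled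 on $C^k(M,T^*M\otimes\mathrm{End}_{\mathrm{sk}}(\mathcal{E}))$ ($\mathrm{End}_{\mathrm{sk}}$: skew-Hermitian endomorphisms).
   Formalization: The manifold is assumed to have dimension at least 2 (on the circle, literally Anosov with zero stable and unstable bundles, the claim fails for rank at least 2), and the bundle has rank at least 1; the Anosov assumption is not needed for the proof. *)

theory Defs
  imports "HOL-Analysis.Analysis"
begin

section \<open>Calculus on open subsets of Euclidean spaces\<close>

text \<open>Intended for open \<open>S\<close> and a finite-dimensional domain, where requiring all directional
  derivatives to be of class \<open>C\<^sup>k\<close> is the usual definition of class \<open>C\<^sup>k\<^sup>+\<^sup>1\<close>.\<close>

primrec Ck_on :: "nat \<Rightarrow> ('a::real_normed_vector \<Rightarrow> 'b::real_normed_vector) \<Rightarrow> 'a set \<Rightarrow> bool" where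
  "Ck_on 0 f S \<longleftrightarrow> continuous_on S f"
| "Ck_on (Suc k) f S \<longleftrightarrow> (\<forall>x\<in>S. f differentiable (at x)) \<and>
     (\<forall>v. Ck_on k (\<lambda>x. frechet_derivative f (at x) v) S)"

definition smooth_on :: "('a::real_normed_vector \<Rightarrow> 'b::real_normed_vector) \<Rightarrow> 'a set \<Rightarrow> bool" where
  "smooth_on f S \<longleftrightarrow> (\<forall>k. Ck_on k f S)"

primrec iter_deriv :: "'a list \<Rightarrow> ('a::real_normed_vector \<Rightarrow> 'b::real_normed_vector) \<Rightarrow> 'a \<Rightarrow> 'b" where
  "iter_deriv [] f = f"
| "iter_deriv (v # vs) f = iter_deriv vs (\<lambda>x. frechet_derivative f (at x) v)"


section \<open>Charts and tangent vectors\<close>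

text \<open>A chart is a pair of its domain and its coordinate map; the values of the coordinate map
  outside the domain are irrelevant. The notions of this section presuppose that the given set of
  charts is a smooth atlas on its underlying set; they are applied to a manifold \<open>M\<close> and, once
  more, to \<open>TM\<close>, in order to speak about \<open>T(TM)\<close>.\<close>

type_synonym ('x, 'e) chart = "'x set \<times> ('x \<Rightarrow> 'e)"

definition chart_inv :: "('x, 'e) chart \<Rightarrow> 'e \<Rightarrow> 'x" where
  "chart_inv c = inv_into (fst c) (snd c)"

definition chart_at :: "('x, 'e) chart set \<Rightarrow> 'x \<Rightarrow> ('x, 'e) chart" where
  "chart_at A x = (SOME c. c \<in> A \<and> x \<in> fst c)"

text \<open>A tangent vector at \<open>x\<close> is a family of coordinate vectors, one for each chart around \<open>x\<close>,
  related by the differentials of the transition maps. The components at all other indices are \<open>0\<close>,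
  so that the representation is unique and the vector space operations are pointwise.\<close>

type_synonym ('x, 'e) tvec = "('x, 'e) chart \<Rightarrow> 'e"

definition tangent_space ::
    "('x, 'e::euclidean_space) chart set \<Rightarrow> 'x \<Rightarrow> ('x, 'e) tvec set" where
  "tangent_space A x = {w.
     (\<forall>c\<in>A. \<forall>d\<in>A. x \<in> fst c \<longrightarrow> x \<in> fst d \<longrightarrow>
        w d = frechet_derivative (snd d \<circ> chart_inv c) (at (snd c x)) (w c)) \<and>
     (\<forall>c. \<not> (c \<in> A \<and> x \<in> fst c) \<longrightarrow> w c = 0)}"

text \<open>The tangent vector at \<open>x\<close> whose coordinate vector in the chart \<open>c\<close> is \<open>\<xi>\<close>.\<close>

definition vec_of ::
    "('x, 'e::euclidean_space) chart set \<Rightarrow> ('x, 'e) chart \<Rightarrow> 'x \<Rightarrow> 'e \<Rightarrow> ('x, 'e) tvec" where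
  "vec_of A c x \<xi> = (\<lambda>d. if d \<in> A \<and> x \<in> fst d
     then frechet_derivative (snd d \<circ> chart_inv c) (at (snd c x)) \<xi> else 0)"

definition tangent_bundle ::
    "('x, 'e::euclidean_space) chart set \<Rightarrow> ('x \<times> ('x, 'e) tvec) set" where
  "tangent_bundle A = {(x, w). x \<in> \<Union> (fst ` A) \<and> w \<in> tangent_space A x}"

definition tangent_chart ::
    "('x, 'e::euclidean_space) chart set \<Rightarrow> ('x, 'e) chart
      \<Rightarrow> ('x \<times> ('x, 'e) tvec, 'e \<times> 'e) chart" where
  "tangent_chart A c =
     ({(x, w) \<in> tangent_bundle A. x \<in> fst c}, \<lambda>(x, w). (snd c x, w c))"

definition tangent_atlas ::
    "('x, 'e::euclidean_space) chart set \<Rightarrow> ('x \<times> ('x, 'e) tvec, 'e \<times> 'e) chart set" where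
  "tangent_atlas A = tangent_chart A ` A"

text \<open>The differential of a vector-valued function, and of a map between manifolds. For maps
  that are differentiable at \<open>x\<close> the choice of charts is immaterial.\<close>

definition deriv_along ::
    "('x, 'e::euclidean_space) chart set \<Rightarrow> ('x \<Rightarrow> 'b::real_normed_vector) \<Rightarrow> 'x \<Rightarrow> ('x, 'e) tvec \<Rightarrow> 'b"
where
  "deriv_along A f x w =
     (let c = chart_at A x in frechet_derivative (f \<circ> chart_inv c) (at (snd c x)) (w c))"

definition differential ::
    "('x, 'e::euclidean_space) chart set \<Rightarrow> ('y, 'f::euclidean_space) chart set
      \<Rightarrow> ('x \<Rightarrow> 'y) \<Rightarrow> 'x \<Rightarrow> ('x, 'e) tvec \<Rightarrow> ('y, 'f) tvec" where
  "differential A B F x w =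
     (let d = chart_at B (F x) in vec_of B d (F x) (deriv_along A (snd d \<circ> F) x w))"


section \<open>Closed Riemannian manifolds and their geodesic flow\<close>

locale closed_manifold =
  fixes A :: "('m::t2_space, 'e::euclidean_space) chart set"
  assumes chart: "c \<in> A \<Longrightarrow> open (fst c) \<and> open (snd c ` fst c) \<and>
        homeomorphism (fst c) (snd c ` fst c) (snd c) (chart_inv c)"
    and cover: "\<Union> (fst ` A) = UNIV"
    and transition: "c \<in> A \<Longrightarrow> d \<in> A \<Longrightarrow> smooth_on (snd d \<circ> chart_inv c) (snd c ` (fst c \<inter> fst d))"
    and compact: "compact (UNIV :: 'm set)"
    and connected: "connected (UNIV :: 'm set)"
begin

definition smooth_fun :: "'m set \<Rightarrow> ('m \<Rightarrow> 'b::real_normed_vector) \<Rightarrow> bool" where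
  "smooth_fun U f \<longleftrightarrow> (\<forall>c\<in>A. smooth_on (f \<circ> chart_inv c) (snd c ` (U \<inter> fst c)))"

end

locale closed_riemannian_manifold = closed_manifold A
  for A :: "('m::t2_space, 'e::euclidean_space) chart set" +
  fixes g :: "'m \<Rightarrow> ('m, 'e) tvec \<Rightarrow> ('m, 'e) tvec \<Rightarrow> real"
  assumes metric_sym:
      "u \<in> tangent_space A x \<Longrightarrow> v \<in> tangent_space A x \<Longrightarrow> g x u v = g x v u"
    and metric_linear:
      "u \<in> tangent_space A x \<Longrightarrow> v \<in> tangent_space A x \<Longrightarrow> w \<in> tangent_space A x \<Longrightarrow>
        g x (\<lambda>c. a *\<^sub>R u c + v c) w = a * g x u w + g x v w"
    and metric_pos:
      "u \<in> tangent_space A x \<Longrightarrow> u \<noteq> (\<lambda>c. 0) \<Longrightarrow> g x u u > 0"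
    and metric_smooth:
      "c \<in> A \<Longrightarrow> smooth_on (\<lambda>p. g (chart_inv c p) (vec_of A c (chart_inv c p) \<xi>)
         (vec_of A c (chart_inv c p) \<eta>)) (snd c ` fst c)"
begin

definition metric_coord :: "('m, 'e) chart \<Rightarrow> 'e \<Rightarrow> 'e \<Rightarrow> 'e \<Rightarrow> real" where
  "metric_coord c p \<xi> \<eta> =
     g (chart_inv c p) (vec_of A c (chart_inv c p) \<xi>) (vec_of A c (chart_inv c p) \<eta>)"

text \<open>The Christoffel symbols of the Levi-Civita connection, as the bilinear map
  \<open>\<Gamma>\<^sub>p(\<xi>,\<eta>) = (\<Sum>\<^sub>i\<^sub>j \<Gamma>\<^sup>k\<^sub>i\<^sub>j \<xi>\<^sup>i \<eta>\<^sup>j)\<^sub>k\<close>, determined by Koszul's formula for constant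
  coordinate fields.\<close>

definition christoffel :: "('m, 'e) chart \<Rightarrow> 'e \<Rightarrow> 'e \<Rightarrow> 'e \<Rightarrow> 'e" where
  "christoffel c p \<xi> \<eta> = (THE z. \<forall>\<zeta>. metric_coord c p z \<zeta> =
     (frechet_derivative (\<lambda>q. metric_coord c q \<eta> \<zeta>) (at p) \<xi>
      + frechet_derivative (\<lambda>q. metric_coord c q \<xi> \<zeta>) (at p) \<eta>
      - frechet_derivative (\<lambda>q. metric_coord c q \<xi> \<eta>) (at p) \<zeta>) / 2)"

text \<open>The geodesic vector field on \<open>TM\<close>; in the coordinates \<open>(p, \<xi>)\<close> induced by a chart it reads
  \<open>(\<xi>, - \<Gamma>\<^sub>p(\<xi>,\<xi>))\<close>.\<close>

definition geodesic_field ::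
    "'m \<times> ('m, 'e) tvec \<Rightarrow> ('m \<times> ('m, 'e) tvec, 'e \<times> 'e) tvec" where
  "geodesic_field y = (let c = chart_at A (fst y); (p, \<xi>) = snd (tangent_chart A c) y
     in vec_of (tangent_atlas A) (tangent_chart A c) y (\<xi>, - christoffel c p \<xi> \<xi>))"

definition geodesic_orbit :: "(real \<Rightarrow> 'm \<times> ('m, 'e) tvec) \<Rightarrow> bool" where
  "geodesic_orbit \<sigma> \<longleftrightarrow>
     (\<forall>t. \<sigma> t \<in> tangent_bundle A) \<and> continuous_on UNIV (fst \<circ> \<sigma>) \<and>
     (\<forall>t. \<forall>C\<in>tangent_atlas A. \<sigma> t \<in> fst C \<longrightarrow>
        ((\<lambda>s. snd C (\<sigma> s)) has_vector_derivative geodesic_field (\<sigma> t) C) (at t))"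

text \<open>As \<open>M\<close> is compact, there is exactly one orbit through each point of \<open>TM\<close>, defined for all
  times. The flow preserves \<open>SM\<close>; it is defined on all of \<open>TM\<close>, so that its differential
  on \<open>T(SM)\<close> is a restriction of its differential on \<open>T(TM)\<close>.\<close>

definition geodesic_flow :: "real \<Rightarrow> 'm \<times> ('m, 'e) tvec \<Rightarrow> 'm \<times> ('m, 'e) tvec" where
  "geodesic_flow t y = (THE \<sigma>. geodesic_orbit \<sigma> \<and> \<sigma> 0 = y) t"

definition unit_tangent_bundle :: "('m \<times> ('m, 'e) tvec) set" where
  "unit_tangent_bundle = {(x, v) \<in> tangent_bundle A. g x v v = 1}"

text \<open>\<open>T(SM)\<close> as a subbundle of \<open>T(TM)\<close>: \<open>SM\<close> is a regular level set of \<open>(x, v) \<mapsto> g\<^sub>x(v,v)\<close>.\<close>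

definition unit_tangent_space ::
    "'m \<times> ('m, 'e) tvec \<Rightarrow> ('m \<times> ('m, 'e) tvec, 'e \<times> 'e) tvec set" where
  "unit_tangent_space y = {w \<in> tangent_space (tangent_atlas A) y.
     deriv_along (tangent_atlas A) (\<lambda>(x, v). g x v v) y w = 0}"

text \<open>The norm of the Sasaki metric. If \<open>(a, b)\<close> are the coordinates of a vector tangent to \<open>TM\<close>
  at the point with coordinates \<open>(p, \<xi>)\<close>, its horizontal part is \<open>a\<close> and its vertical part is
  \<open>b + \<Gamma>\<^sub>p(a,\<xi>)\<close>. As \<open>SM\<close> is compact, the Anosov property does not depend on the choice of the
  continuous norm on \<open>T(SM)\<close>.\<close>

definition sasaki_norm ::
    "'m \<times> ('m, 'e) tvec \<Rightarrow> ('m \<times> ('m, 'e) tvec, 'e \<times> 'e) tvec \<Rightarrow> real" where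
  "sasaki_norm y w = (let c = chart_at A (fst y); (p, \<xi>) = snd (tangent_chart A c) y;
       (a, b) = w (tangent_chart A c); b' = b + christoffel c p a \<xi>
     in sqrt (metric_coord c p a a + metric_coord c p b' b'))"

text \<open>A continuous subbundle of \<open>T(SM)\<close>: in the coordinates given by any chart it has, locally, a
  continuous frame.\<close>

definition continuous_distribution ::
    "('m \<times> ('m, 'e) tvec \<Rightarrow> ('m \<times> ('m, 'e) tvec, 'e \<times> 'e) tvec set) \<Rightarrow> bool" where
  "continuous_distribution F \<longleftrightarrow>
     (\<forall>y\<in>unit_tangent_bundle. F y \<subseteq> unit_tangent_space y) \<and>
     (\<forall>C\<in>tangent_atlas A. \<forall>y\<in>unit_tangent_bundle \<inter> fst C.
        \<exists>W (n::nat) (b :: nat \<Rightarrow> 'e \<times> 'e \<Rightarrow> 'e \<times> 'e). open W \<and> snd C y \<in> W \<and>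
          (\<forall>i<n. continuous_on (W \<inter> snd C ` (unit_tangent_bundle \<inter> fst C)) (b i)) \<and>
          (\<forall>z\<in>unit_tangent_bundle \<inter> fst C. snd C z \<in> W \<longrightarrow>
             inj_on (\<lambda>i. b i (snd C z)) {..<n} \<and>
             independent ((\<lambda>i. b i (snd C z)) ` {..<n}) \<and>
             (\<lambda>w. w C) ` F z = span ((\<lambda>i. b i (snd C z)) ` {..<n})))"

abbreviation geodesic_differential ::
    "real \<Rightarrow> 'm \<times> ('m, 'e) tvec \<Rightarrow> ('m \<times> ('m, 'e) tvec, 'e \<times> 'e) tvec
      \<Rightarrow> ('m \<times> ('m, 'e) tvec, 'e \<times> 'e) tvec" where
  "geodesic_differential t \<equiv> differential (tangent_atlas A) (tangent_atlas A) (geodesic_flow t)"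

definition anosov :: bool where
  "anosov \<longleftrightarrow> (\<exists>Es Eu.
     continuous_distribution Es \<and> continuous_distribution Eu \<and>
     (\<forall>y\<in>unit_tangent_bundle. \<forall>w\<in>unit_tangent_space y.
        \<exists>!(a, ws, wu). ws \<in> Es y \<and> wu \<in> Eu y \<and>
          w = (\<lambda>C. a *\<^sub>R geodesic_field y C + ws C + wu C)) \<and>
     (\<forall>y\<in>unit_tangent_bundle. \<forall>t.
        geodesic_differential t y ` Es y = Es (geodesic_flow t y) \<and>
        geodesic_differential t y ` Eu y = Eu (geodesic_flow t y)) \<and>
     (\<exists>C>0. \<exists>\<mu>>0. \<forall>y\<in>unit_tangent_bundle.
        (\<forall>t\<ge>0. \<forall>w\<in>Es y. sasaki_norm (geodesic_flow t y) (geodesic_differential t y w)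
            \<le> C * exp (- \<mu> * t) * sasaki_norm y w) \<and>
        (\<forall>t\<le>0. \<forall>w\<in>Eu y. sasaki_norm (geodesic_flow t y) (geodesic_differential t y w)
            \<le> C * exp (- \<mu> * \<bar>t\<bar>) * sasaki_norm y w)))"

end


section \<open>Hermitian vector bundles\<close>

text \<open>A complex vector bundle is given by its fibres \<open>E x\<close> and a set \<open>T\<close> of local trivialisations
  \<open>(U, \<Phi>)\<close>, where \<open>\<Phi> x\<close> maps \<open>E x\<close> bijectively onto \<open>\<complex>\<^sup>r\<close> for \<open>x \<in> U\<close>, with smooth
  transition functions into \<open>GL\<^sub>r(\<complex>)\<close>. The total space is the disjoint union of the fibres; the
  sets \<open>E x\<close> themselves need not be disjoint. The vector space structure of the fibres is the one
  transported by the trivialisations.\<close>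

type_synonym ('m, 'v, 'r) triv = "'m set \<times> ('m \<Rightarrow> 'v \<Rightarrow> complex ^ 'r)"

locale vector_bundle = closed_riemannian_manifold A g
  for A :: "('m::t2_space, 'e::euclidean_space) chart set"
    and g :: "'m \<Rightarrow> ('m, 'e) tvec \<Rightarrow> ('m, 'e) tvec \<Rightarrow> real" +
  fixes E :: "'m \<Rightarrow> 'v set"
    and T :: "('m, 'v, 'r::finite) triv set"
  assumes triv_open: "(U, \<Phi>) \<in> T \<Longrightarrow> open U"
    and triv_cover: "\<Union> (fst ` T) = UNIV"
    and triv_bij: "(U, \<Phi>) \<in> T \<Longrightarrow> x \<in> U \<Longrightarrow> bij_betw (\<Phi> x) (E x) UNIV"
    and triv_transition: "(U, \<Phi>) \<in> T \<Longrightarrow> (V, \<Psi>) \<in> T \<Longrightarrow>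
      \<exists>G :: 'm \<Rightarrow> complex ^ 'r ^ 'r. smooth_fun (U \<inter> V) G \<and>
        (\<forall>x\<in>U \<inter> V. \<forall>e\<in>E x. \<Psi> x e = G x *v \<Phi> x e)"
begin

definition triv_at :: "'m \<Rightarrow> 'v \<Rightarrow> complex ^ 'r" where
  "triv_at x = snd (SOME \<tau>. \<tau> \<in> T \<and> x \<in> fst \<tau>) x"

definition fib_zero :: "'m \<Rightarrow> 'v" where
  "fib_zero x = inv_into (E x) (triv_at x) 0"

definition fib_add :: "'m \<Rightarrow> 'v \<Rightarrow> 'v \<Rightarrow> 'v" where
  "fib_add x e f = inv_into (E x) (triv_at x) (triv_at x e + triv_at x f)"

definition fib_scale :: "'m \<Rightarrow> complex \<Rightarrow> 'v \<Rightarrow> 'v" where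
  "fib_scale x a e = inv_into (E x) (triv_at x) (a *s triv_at x e)"

definition smooth_sections :: "('m \<Rightarrow> 'v) set" where
  "smooth_sections = {s. (\<forall>x. s x \<in> E x) \<and> (\<forall>(U, \<Phi>)\<in>T. smooth_fun U (\<lambda>x. \<Phi> x (s x)))}"

text \<open>Smooth complex subbundles are described by local smooth frames.\<close>

definition smooth_subbundle :: "('m \<Rightarrow> 'v set) \<Rightarrow> bool" where
  "smooth_subbundle F \<longleftrightarrow> (\<forall>x. F x \<subseteq> E x) \<and>
     (\<forall>(U, \<Phi>)\<in>T. \<forall>x\<in>U. \<exists>W (n::nat) (b :: nat \<Rightarrow> 'm \<Rightarrow> complex ^ 'r).
        open W \<and> x \<in> W \<and> W \<subseteq> U \<and> (\<forall>i<n. smooth_fun W (b i)) \<and>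
        (\<forall>y\<in>W. inj_on (\<lambda>i. b i y) {..<n} \<and> vec.independent ((\<lambda>i. b i y) ` {..<n}) \<and>
           \<Phi> y ` F y = vec.span ((\<lambda>i. b i y) ` {..<n})))"

end

locale hermitian_vector_bundle = vector_bundle A g E T
  for A :: "('m::t2_space, 'e::euclidean_space) chart set"
    and g :: "'m \<Rightarrow> ('m, 'e) tvec \<Rightarrow> ('m, 'e) tvec \<Rightarrow> real"
    and E :: "'m \<Rightarrow> 'v set"
    and T :: "('m, 'v, 'r::finite) triv set" +
  fixes h :: "'m \<Rightarrow> 'v \<Rightarrow> 'v \<Rightarrow> complex"
  assumes herm_sym: "e \<in> E x \<Longrightarrow> f \<in> E x \<Longrightarrow> h x f e = cnj (h x e f)"
    and herm_linear: "e \<in> E x \<Longrightarrow> e' \<in> E x \<Longrightarrow> f \<in> E x \<Longrightarrow>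
      h x (fib_add x (fib_scale x a e) e') f = a * h x e f + h x e' f"
    and herm_pos: "e \<in> E x \<Longrightarrow> e \<noteq> fib_zero x \<Longrightarrow> Re (h x e e) > 0"
    and herm_smooth: "(U, \<Phi>) \<in> T \<Longrightarrow>
      smooth_fun U (\<lambda>x. h x (inv_into (E x) (\<Phi> x) \<xi>) (inv_into (E x) (\<Phi> x) \<eta>))"
begin

section \<open>Unitary connections of class \<open>C\<^sup>k\<close>\<close>

text \<open>A connection is a covariant derivative \<open>\<nabla>\<^sub>w s \<in> E x\<close>, written \<open>D s x w\<close>, for smooth sections
  \<open>s\<close> and tangent vectors \<open>w\<close> at \<open>x\<close>; it is of class \<open>C\<^sup>k\<close> if \<open>\<nabla>s\<close> is of class \<open>C\<^sup>k\<close> for each smooth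
  section \<open>s\<close>. Fixing the value of \<open>D\<close> on irrelevant arguments makes equality of connections the
  equality of functions.\<close>

definition unitary_connections :: "nat \<Rightarrow> (('m \<Rightarrow> 'v) \<Rightarrow> 'm \<Rightarrow> ('m, 'e) tvec \<Rightarrow> 'v) set" where
  "unitary_connections k = {D.
     (\<forall>s x w. \<not> (s \<in> smooth_sections \<and> w \<in> tangent_space A x) \<longrightarrow> D s x w = undefined) \<and>
     (\<forall>s\<in>smooth_sections. \<forall>x. \<forall>w\<in>tangent_space A x. D s x w \<in> E x) \<and>
     (\<forall>s\<in>smooth_sections. \<forall>x. \<forall>w\<in>tangent_space A x. \<forall>w'\<in>tangent_space A x. \<forall>a::real.
        D s x (\<lambda>c. a *\<^sub>R w c + w' c) = fib_add x (fib_scale x (of_real a) (D s x w)) (D s x w')) \<and>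
     (\<forall>s\<in>smooth_sections. \<forall>s'\<in>smooth_sections. \<forall>x. \<forall>w\<in>tangent_space A x.
        D (\<lambda>y. fib_add y (s y) (s' y)) x w = fib_add x (D s x w) (D s' x w)) \<and>
     (\<forall>s\<in>smooth_sections. \<forall>f. smooth_fun UNIV f \<longrightarrow> (\<forall>x. \<forall>w\<in>tangent_space A x.
        D (\<lambda>y. fib_scale y (f y) (s y)) x w =
          fib_add x (fib_scale x (deriv_along A f x w) (s x)) (fib_scale x (f x) (D s x w)))) \<and>
     (\<forall>s\<in>smooth_sections. \<forall>s'\<in>smooth_sections. \<forall>x. \<forall>w\<in>tangent_space A x.
        deriv_along A (\<lambda>y. h y (s y) (s' y)) x w = h x (D s x w) (s' x) + h x (s x) (D s' x w)) \<and>
     (\<forall>s\<in>smooth_sections. \<forall>c\<in>A. \<forall>(U, \<Phi>)\<in>T. \<forall>\<xi>.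
        Ck_on k (\<lambda>p. \<Phi> (chart_inv c p) (D s (chart_inv c p) (vec_of A c (chart_inv c p) \<xi>)))
          (snd c ` (fst c \<inter> U)))}"

text \<open>The connection form in a local trivialisation: the matrix \<open>\<omega>(w)\<close> such that \<open>\<nabla>\<^sub>w\<close> acts as
  \<open>d + \<omega>(w)\<close>.\<close>

definition connection_form ::
    "(('m \<Rightarrow> 'v) \<Rightarrow> 'm \<Rightarrow> ('m, 'e) tvec \<Rightarrow> 'v) \<Rightarrow> ('m \<Rightarrow> 'v \<Rightarrow> complex ^ 'r)
      \<Rightarrow> 'm \<Rightarrow> ('m, 'e) tvec \<Rightarrow> complex ^ 'r ^ 'r" where
  "connection_form D \<Phi> x w = (THE \<omega>. \<forall>s\<in>smooth_sections.
     \<Phi> x (D s x w) = deriv_along A (\<lambda>y. \<Phi> y (s y)) x w + \<omega> *v \<Phi> x (s x))"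

definition connection_form_coord ::
    "(('m \<Rightarrow> 'v) \<Rightarrow> 'm \<Rightarrow> ('m, 'e) tvec \<Rightarrow> 'v) \<Rightarrow> ('m, 'e) chart \<Rightarrow> ('m \<Rightarrow> 'v \<Rightarrow> complex ^ 'r)
      \<Rightarrow> 'e \<Rightarrow> 'e \<Rightarrow> complex ^ 'r ^ 'r" where
  "connection_form_coord D c \<Phi> \<xi> p =
     connection_form D \<Phi> (chart_inv c p) (vec_of A c (chart_inv c p) \<xi>)"

text \<open>The \<open>C\<^sup>k\<close> topology is generated by the balls of the \<open>C\<^sup>k\<close> seminorms, over compact sets contained
  in the domain of a chart and of a trivialisation, of the difference \<open>D' - D\<close>, a section of
  \<open>T\<^sup>*M \<otimes> End\<^sub>s\<^sub>k(\<E>)\<close>. As the sets \<open>K\<close> are compact and the derivatives are continuous, the pointwise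
  strict bounds amount to a strict bound on the supremum.\<close>

definition Ck_ball ::
    "nat \<Rightarrow> (('m \<Rightarrow> 'v) \<Rightarrow> 'm \<Rightarrow> ('m, 'e) tvec \<Rightarrow> 'v) \<Rightarrow> ('m, 'e) chart \<Rightarrow> ('m \<Rightarrow> 'v \<Rightarrow> complex ^ 'r)
      \<Rightarrow> 'm set \<Rightarrow> real \<Rightarrow> (('m \<Rightarrow> 'v) \<Rightarrow> 'm \<Rightarrow> ('m, 'e) tvec \<Rightarrow> 'v) set" where
  "Ck_ball k D c \<Phi> K \<epsilon> = {D' \<in> unitary_connections k.
     \<forall>\<xi>\<in>Basis. \<forall>vs. set vs \<subseteq> Basis \<longrightarrow> length vs \<le> k \<longrightarrow> (\<forall>p\<in>snd c ` K.
       norm (iter_deriv vs (\<lambda>q. connection_form_coord D' c \<Phi> \<xi> q - connection_form_coord D c \<Phi> \<xi> q) p)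
         < \<epsilon>)}"

definition Ck_topology :: "nat \<Rightarrow> (('m \<Rightarrow> 'v) \<Rightarrow> 'm \<Rightarrow> ('m, 'e) tvec \<Rightarrow> 'v) topology" where
  "Ck_topology k = topology_generated_by {Ck_ball k D c \<Phi> K \<epsilon> | D c U \<Phi> K \<epsilon>.
     D \<in> unitary_connections k \<and> c \<in> A \<and> (U, \<Phi>) \<in> T \<and> compact K \<and> K \<subseteq> fst c \<inter> U \<and> \<epsilon> > 0}"

lemma topspace_Ck_topology: "topspace (Ck_topology k) = unitary_connections k"
proof -
  obtain c where c: "c \<in> A" using cover by auto
  obtain U \<Phi> where T: "(U, \<Phi>) \<in> T" using triv_cover by force
  have "D \<in> topspace (Ck_topology k)" if "D \<in> unitary_connections k" for D
    unfolding Ck_topology_def topology_generated_by_topspace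
  proof (rule UnionI)
    show "D \<in> Ck_ball k D c \<Phi> {} 1" using that by (simp add: Ck_ball_def)
    show "Ck_ball k D c \<Phi> {} 1 \<in> {Ck_ball k D c \<Phi> K \<epsilon> | D c U \<Phi> K \<epsilon>.
      D \<in> unitary_connections k \<and> c \<in> A \<and> (U, \<Phi>) \<in> T \<and> compact K \<and> K \<subseteq> fst c \<inter> U \<and> \<epsilon> > 0}"
      using that c T by (intro CollectI exI[of _ D] exI[of _ c] exI[of _ U] exI[of _ \<Phi>]
          exI[of _ "{}"] exI[of _ "1::real"]) auto
  qed
  then show ?thesis
    unfolding Ck_topology_def topology_generated_by_topspace by (auto simp: Ck_ball_def)
qed


section \<open>Parallel transport and opaque connections\<close>

text \<open>\<open>\<sigma>\<close> is an orbit of the geodesic flow, so \<open>snd (\<sigma> t)\<close> is the velocity of the geodesic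
  \<open>fst \<circ> \<sigma>\<close> at time \<open>t\<close>.\<close>

definition parallel_along ::
    "(('m \<Rightarrow> 'v) \<Rightarrow> 'm \<Rightarrow> ('m, 'e) tvec \<Rightarrow> 'v) \<Rightarrow> (real \<Rightarrow> 'm \<times> ('m, 'e) tvec) \<Rightarrow> (real \<Rightarrow> 'v) \<Rightarrow> bool"
where
  "parallel_along D \<sigma> e \<longleftrightarrow> (\<forall>t. e t \<in> E (fst (\<sigma> t))) \<and>
     (\<forall>t. \<forall>(U, \<Phi>)\<in>T. fst (\<sigma> t) \<in> U \<longrightarrow>
        ((\<lambda>s. \<Phi> (fst (\<sigma> s)) (e s)) has_vector_derivative
          - (connection_form D \<Phi> (fst (\<sigma> t)) (snd (\<sigma> t)) *v \<Phi> (fst (\<sigma> t)) (e t))) (at t))"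

definition parallel_transport ::
    "(('m \<Rightarrow> 'v) \<Rightarrow> 'm \<Rightarrow> ('m, 'e) tvec \<Rightarrow> 'v) \<Rightarrow> 'm \<times> ('m, 'e) tvec \<Rightarrow> real \<Rightarrow> 'v \<Rightarrow> 'v" where
  "parallel_transport D y t f =
     (THE e. parallel_along D (\<lambda>s. geodesic_flow s y) e \<and> e 0 = f) t"

definition invariant_subbundle ::
    "(('m \<Rightarrow> 'v) \<Rightarrow> 'm \<Rightarrow> ('m, 'e) tvec \<Rightarrow> 'v) \<Rightarrow> ('m \<Rightarrow> 'v set) \<Rightarrow> bool" where
  "invariant_subbundle D F \<longleftrightarrow> smooth_subbundle F \<and>
     (\<forall>y\<in>unit_tangent_bundle. \<forall>f\<in>F (fst y). \<forall>t.
        parallel_transport D y t f \<in> F (fst (geodesic_flow t y)))"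

definition opaque :: "(('m \<Rightarrow> 'v) \<Rightarrow> 'm \<Rightarrow> ('m, 'e) tvec \<Rightarrow> 'v) \<Rightarrow> bool" where
  "opaque D \<longleftrightarrow> (\<forall>F. invariant_subbundle D F \<longrightarrow> F = E \<or> F = (\<lambda>x. {fib_zero x}))"

end

end

theory Submission
  imports Defs
begin

text \<open>An invariant subbundle \<open>F\<close> lives on \<open>M\<close>, and through every point of \<open>M\<close> there is a geodesic in
  every direction. Hence, for a differentiable section \<open>b\<close> of \<open>F\<close>, the derivative \<open>\<nabla>\<^sub>v b\<close> is again a section of \<open>F\<close>
  for all \<open>v\<close>, and the fibre of \<open>F\<close> at a point \<open>x\<close> is stable under the curvature \<open>\<Omega>(v,w)\<close> and under \<open>(\<nabla>\<^sub>v\<Omega>)(v,w)\<close>.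
  If the words in these two endomorphisms span \<open>End(\<E>\<^sub>x)\<close>, the fibre is \<open>0\<close> or \<open>\<E>\<^sub>x\<close>, and so is \<open>F\<close>
  everywhere, as its rank is locally constant. The spanning condition is the nonvanishing of a
  determinant depending continuously on the 2-jet of the connection form at \<open>x\<close>, hence open in the
  \<open>C\<^sup>k\<close> topology for \<open>k \<ge> 2\<close>. It is dense: adding \<open>\<psi> (l K\<^sub>1 + l\<^sup>2 K\<^sub>2 / 2) dw\<close>, with skew-Hermitian \<open>K\<^sub>1\<close>, \<open>K\<^sub>2\<close>, a
  cut-off function \<open>\<psi>\<close> and the coordinate \<open>l\<close> along \<open>v\<close>, moves the two endomorphisms affinely. The determinant is
  a polynomial in the perturbation which, after complexification, does not vanish identically, so it
  is nonzero for arbitrarily small skew-Hermitian perturbations. The geodesics and the parallel transport along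
  them exist for all times by compactness and conservation of speed.\<close>

section \<open>Calculus on Euclidean spaces, cut-off functions and differential equations\<close>

section \<open>Functions of class \<open>C\<^sup>k\<close>\<close>

text \<open>Over a surface the curvature at a point is, up to scale, a single endomorphism, and a
  single endomorphism of a space of dimension at least two always has an invariant line. A second
  endomorphism is therefore taken one derivative higher, which explains the 2-jet and the bound
  \<open>k \<ge> 2\<close>. Only the words \<open>M^a N M^b\<close> with exponents below the rank
  enter: there are exactly as many of them as matrix entries, so spanning becomes the nonvanishing
  of one square determinant. One pair with nonzero determinant is enough for density, because
  complex combinations of skew-Hermitian matrices reach every matrix and a polynomial vanishing on
  the skew-Hermitian perturbations would vanish on all of them. The delicate analytic point is that
  \<open>\<nabla> b\<close> stays in \<open>F\<close>. The difference quotients that converge to it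
  lie in fibres over moving points of a geodesic, so a limit of vectors in a continuous family of
  subspaces must be shown to lie in the limit subspace.\<close>

lemma frechet_derivative_eqI: "(f has_derivative f') (at x) \<Longrightarrow> frechet_derivative f (at x) = f'"
  by (rule frechet_derivative_at[symmetric])

lemma frechet_derivative_cong_open:
  assumes "open S" "x \<in> S" "\<And>y. y \<in> S \<Longrightarrow> f y = g y"
  shows "frechet_derivative f (at x) = frechet_derivative g (at x)"
proof -
  have "(f has_derivative f') (at x) \<longleftrightarrow> (g has_derivative f') (at x)" for f'
    using has_derivative_transform_within_open[of f f' x UNIV S g]
      has_derivative_transform_within_open[of g f' x UNIV S f] assms by auto
  then show ?thesis by (simp add: frechet_derivative_def)
qed

lemma differentiable_cong_open:
  assumes "open S" "x \<in> S" "\<And>y. y \<in> S \<Longrightarrow> f y = g y" "f differentiable (at x)"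
  shows "g differentiable (at x)"
  using assms has_derivative_transform_within_open[of f _ x UNIV S g]
  unfolding differentiable_def by blast

lemma Ck_on_cong:
  assumes "open S" "\<And>y. y \<in> S \<Longrightarrow> f y = g y" "Ck_on k f S"
  shows "Ck_on k g S"
  using assms(2,3)
proof (induction k arbitrary: f g)
  case 0
  then show ?case by (simp cong: continuous_on_cong)
next
  case (Suc k)
  have d: "frechet_derivative f (at x) = frechet_derivative g (at x)" if "x \<in> S" for x
    using frechet_derivative_cong_open[OF assms(1) that] Suc.prems by blast
  have "\<forall>x\<in>S. g differentiable (at x)"
    using Suc.prems differentiable_cong_open[OF assms(1)] by (metis Ck_on.simps(2))
  moreover have "Ck_on k (\<lambda>x. frechet_derivative g (at x) v) S" for v
    by (rule Suc.IH[of "\<lambda>x. frechet_derivative f (at x) v"]) (use d Suc.prems in auto)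
  ultimately show ?case by simp
qed

lemma Ck_on_subset: "Ck_on k f S \<Longrightarrow> T \<subseteq> S \<Longrightarrow> Ck_on k f T"
  by (induction k arbitrary: f) (auto intro: continuous_on_subset)

lemma Ck_on_Suc_imp: "Ck_on (Suc k) f S \<Longrightarrow> Ck_on k f S"
proof (induction k arbitrary: f)
  case 0
  then show ?case
    by (auto intro!: continuous_at_imp_continuous_on differentiable_imp_continuous_within)
next
  case (Suc k)
  then show ?case by auto
qed

lemma Ck_on_le: "Ck_on m f S \<Longrightarrow> k \<le> m \<Longrightarrow> Ck_on k f S"
  by (induction m) (auto simp: le_Suc_eq dest: Ck_on_Suc_imp simp del: Ck_on.simps(2))

lemma Ck_on_continuous: "Ck_on k f S \<Longrightarrow> continuous_on S f"
  using Ck_on_le[of k f S 0] by simp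

lemma Ck_on_differentiable: "Ck_on k f S \<Longrightarrow> 0 < k \<Longrightarrow> x \<in> S \<Longrightarrow> f differentiable (at x)"
  by (cases k) auto

lemma Ck_on_has_derivative:
  "Ck_on k f S \<Longrightarrow> 0 < k \<Longrightarrow> x \<in> S \<Longrightarrow> (f has_derivative frechet_derivative f (at x)) (at x)"
  using Ck_on_differentiable frechet_derivative_works by blast

lemma Ck_on_local:
  assumes "\<And>x. x \<in> S \<Longrightarrow> \<exists>U. open U \<and> x \<in> U \<and> Ck_on k f (U \<inter> S)"
    and "open S"
  shows "Ck_on k f S"
  using assms(1)
proof (induction k arbitrary: f)
  case 0
  have "isCont f x" if x: "x \<in> S" for x
  proof -
    obtain U where "open U" "x \<in> U" "continuous_on (U \<inter> S) f" using 0[OF x] by auto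
    then show ?thesis using x \<open>open S\<close> continuous_on_eq_continuous_at[of "U \<inter> S" f] by auto
  qed
  then show ?case by (simp add: continuous_at_imp_continuous_on)
next
  case (Suc k)
  have "f differentiable (at x)" if "x \<in> S" for x
    using Suc.prems[OF that] that by auto
  moreover have "Ck_on k (\<lambda>x. frechet_derivative f (at x) v) S" for v
    by (rule Suc.IH) (use Suc.prems in fastforce)
  ultimately show ?case by simp
qed

lemma Ck_on_const: "Ck_on k (\<lambda>x. c) S"
  by (induction k arbitrary: c) (auto simp: frechet_derivative_const)

lemma Ck_on_bounded_linear:
  assumes "bounded_linear f" shows "Ck_on k f S"
proof (cases k)
  case 0
  then show ?thesis using assms by (simp add: linear_continuous_on)
next
  case (Suc m)
  have "(f has_derivative f) (at x)" for x using assms by (rule bounded_linear_imp_has_derivative)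
  then have "frechet_derivative f (at x) = f" "f differentiable (at x)" for x
    by (auto simp: frechet_derivative_eqI differentiable_def)
  then show ?thesis using Suc by (simp add: Ck_on_const)
qed

lemma Ck_on_id: "Ck_on k (\<lambda>x. x) S"
  by (rule Ck_on_bounded_linear) simp

lemma Ck_on_linear_compose:
  assumes "bounded_linear L" "open S" "Ck_on k f S"
  shows "Ck_on k (\<lambda>x. L (f x)) S"
  using assms(3)
proof (induction k arbitrary: f)
  case 0
  then show ?case
    by (auto intro: bounded_linear.continuous_on[OF assms(1)])
next
  case (Suc k)
  have d: "((\<lambda>x. L (f x)) has_derivative (\<lambda>v. L (frechet_derivative f (at x) v))) (at x)"
    if "x \<in> S" for x
    using Suc.prems that by (intro bounded_linear.has_derivative[OF assms(1)])
      (auto intro: Ck_on_has_derivative simp flip: frechet_derivative_works)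
  have "Ck_on k (\<lambda>x. frechet_derivative (\<lambda>x. L (f x)) (at x) v) S" for v
    by (rule Ck_on_cong[OF assms(2), of "\<lambda>x. L (frechet_derivative f (at x) v)"])
      (use Suc in \<open>auto simp: frechet_derivative_eqI[OF d]\<close>)
  then show ?case using d by (auto simp: differentiable_def)
qed

lemma Ck_on_add:
  assumes "open S" "Ck_on k f S" "Ck_on k g S"
  shows "Ck_on k (\<lambda>x. f x + g x) S"
  using assms(2,3)
proof (induction k arbitrary: f g)
  case 0
  then show ?case by (auto intro: continuous_intros)
next
  case (Suc k)
  have d: "((\<lambda>x. f x + g x) has_derivative
      (\<lambda>v. frechet_derivative f (at x) v + frechet_derivative g (at x) v)) (at x)"
    if "x \<in> S" for x
    using Suc.prems that by (intro has_derivative_add) (auto simp flip: frechet_derivative_works)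
  have "Ck_on k (\<lambda>x. frechet_derivative (\<lambda>x. f x + g x) (at x) v) S" for v
    by (rule Ck_on_cong[OF assms(1),
          of "\<lambda>x. frechet_derivative f (at x) v + frechet_derivative g (at x) v"])
      (use Suc in \<open>auto simp: frechet_derivative_eqI[OF d]\<close>)
  then show ?case using d by (auto simp: differentiable_def)
qed

text \<open>Each term of the Leibniz rule pairs one differentiated factor with one undifferentiated
  factor, and both are of the lower class; hence the induction runs over arbitrary pairs of
  functions.\<close>

lemma Ck_on_bilinear:
  assumes B: "bounded_bilinear B" and S: "open S" and "Ck_on k f S" "Ck_on k g S"
  shows "Ck_on k (\<lambda>x. B (f x) (g x)) S"
  using assms(3,4)
proof (induction k arbitrary: f g)
  case 0
  then show ?case by (auto intro: bounded_bilinear.continuous_on[OF B])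
next
  case (Suc k)
  have d: "((\<lambda>x. B (f x) (g x)) has_derivative
      (\<lambda>v. B (f x) (frechet_derivative g (at x) v) + B (frechet_derivative f (at x) v) (g x))) (at x)"
    if "x \<in> S" for x
    using Suc.prems that
    by (intro bounded_bilinear.FDERIV[OF B]) (auto simp flip: frechet_derivative_works)
  have fg: "Ck_on k f S" "Ck_on k g S" using Suc.prems Ck_on_Suc_imp by blast+
  have "Ck_on k (\<lambda>x. B (f x) (frechet_derivative g (at x) v)
      + B (frechet_derivative f (at x) v) (g x)) S" for v
    by (intro Ck_on_add S Suc.IH fg) (use Suc.prems in auto)
  then have "Ck_on k (\<lambda>x. frechet_derivative (\<lambda>x. B (f x) (g x)) (at x) v) S" for v
    by (rule Ck_on_cong[OF S, rotated]) (auto simp: frechet_derivative_eqI[OF d])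
  then show ?case using d by (auto simp: differentiable_def)
qed

lemmas Ck_on_scaleR = Ck_on_bilinear[OF bounded_bilinear_scaleR]
lemmas Ck_on_mult = Ck_on_bilinear[OF bounded_bilinear_mult]
lemmas Ck_on_minus = Ck_on_linear_compose[OF bounded_linear_minus[OF bounded_linear_ident]]

lemma Ck_on_diff: "open S \<Longrightarrow> Ck_on k f S \<Longrightarrow> Ck_on k g S \<Longrightarrow> Ck_on k (\<lambda>x. f x - g x) S"
  using Ck_on_add[of S k f "\<lambda>x. - g x"] Ck_on_minus[of S k g] by simp

lemma Ck_on_sum:
  "open S \<Longrightarrow> (\<And>i. i \<in> I \<Longrightarrow> Ck_on k (f i) S) \<Longrightarrow> Ck_on k (\<lambda>x. \<Sum>i\<in>I. f i x) S"
proof (induction I rule: infinite_finite_induct)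
  case (insert i I)
  then have "Ck_on k (\<lambda>x. f i x + (\<Sum>i\<in>I. f i x)) S"
    by (intro Ck_on_add) auto
  then show ?case using insert by simp
qed (simp_all add: Ck_on_const)

text \<open>\<open>Ck_on\<close> controls derivatives one fixed direction at a time, whereas the
  chain rule evaluates \<open>f'\<close> in the moving direction \<open>g' v\<close>. Expanding that
  direction in the basis of the middle space reduces it to finitely many fixed ones.\<close>

lemma Ck_on_compose:
  fixes f :: "'b::euclidean_space \<Rightarrow> 'c::real_normed_vector"
    and g :: "'a::real_normed_vector \<Rightarrow> 'b"
  assumes "open S" "Ck_on k f T" "Ck_on k g S" "g ` S \<subseteq> T"
  shows "Ck_on k (\<lambda>x. f (g x)) S"
  using assms(2,3)
proof (induction k arbitrary: f)
  case 0
  then show ?case using assms(4) by (auto intro: continuous_on_compose2)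
next
  case (Suc k)
  let ?f' = "\<lambda>y. frechet_derivative f (at y)" and ?g' = "\<lambda>x. frechet_derivative g (at x)"
  have d: "((\<lambda>x. f (g x)) has_derivative (\<lambda>v. \<Sum>b\<in>Basis. (?g' x v \<bullet> b) *\<^sub>R ?f' (g x) b)) (at x)"
    if x: "x \<in> S" for x
  proof -
    have "f differentiable (at (g x))" using Suc.prems(1) x assms(4) by auto
    then have f': "(f has_derivative ?f' (g x)) (at (g x))" by (simp add: frechet_derivative_works)
    have g': "(g has_derivative ?g' x) (at x)"
      using Suc.prems(2) x by (simp flip: frechet_derivative_works)
    have "((\<lambda>x. f (g x)) has_derivative (\<lambda>v. ?f' (g x) (?g' x v))) (at x)"
      by (rule has_derivative_compose[OF g' f'])
    moreover
    have "?f' (g x) w = (\<Sum>b\<in>Basis. (w \<bullet> b) *\<^sub>R ?f' (g x) b)" for w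
    proof -
      have l: "linear (?f' (g x))" using f' has_derivative_linear by blast
      have "?f' (g x) (\<Sum>b\<in>Basis. (w \<bullet> b) *\<^sub>R b) = (\<Sum>b\<in>Basis. (w \<bullet> b) *\<^sub>R ?f' (g x) b)"
        by (simp add: linear_sum[OF l] linear_cmul[OF l])
      then show ?thesis by (simp add: euclidean_representation)
    qed
    then have "(\<lambda>v. ?f' (g x) (?g' x v)) = (\<lambda>v. \<Sum>b\<in>Basis. (?g' x v \<bullet> b) *\<^sub>R ?f' (g x) b)" by blast
    ultimately show ?thesis by (rule has_derivative_eq_rhs)
  qed
  have g: "Ck_on k g S" using Suc.prems Ck_on_Suc_imp by blast
  have 1: "Ck_on k (\<lambda>x. ?f' (g x) b) S" for b
    by (rule Suc.IH) (use Suc.prems g in auto)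
  have 2: "Ck_on k (\<lambda>x. ?g' x v \<bullet> b) S" for b v
    by (rule Ck_on_linear_compose[OF bounded_linear_inner_left assms(1)]) (use Suc.prems in auto)
  have "Ck_on k (\<lambda>x. \<Sum>b\<in>Basis. (?g' x v \<bullet> b) *\<^sub>R ?f' (g x) b) S" for v
    by (rule Ck_on_sum[OF assms(1)], rule Ck_on_scaleR[OF assms(1) 2 1])
  then have "Ck_on k (\<lambda>x. frechet_derivative (\<lambda>x. f (g x)) (at x) v) S" for v
    by (rule Ck_on_cong[OF assms(1), rotated]) (auto simp: frechet_derivative_eqI[OF d])
  then show ?case using d by (auto simp: differentiable_def)
qed

lemma smooth_on_subset: "smooth_on f S \<Longrightarrow> T \<subseteq> S \<Longrightarrow> smooth_on f T"
  using Ck_on_subset unfolding smooth_on_def by blast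

lemma smooth_on_cong: "open S \<Longrightarrow> (\<And>y. y \<in> S \<Longrightarrow> f y = g y) \<Longrightarrow> smooth_on f S \<Longrightarrow> smooth_on g S"
  using Ck_on_cong unfolding smooth_on_def by blast

lemma smooth_on_local:
  assumes "\<And>x. x \<in> S \<Longrightarrow> \<exists>U. open U \<and> x \<in> U \<and> smooth_on f (U \<inter> S)" "open S"
  shows "smooth_on f S"
proof -
  have "Ck_on k f S" for k
    by (rule Ck_on_local[OF _ assms(2)]) (metis assms(1) smooth_on_def)
  then show ?thesis by (simp add: smooth_on_def)
qed

lemma smooth_on_compose:
  fixes f :: "'b::euclidean_space \<Rightarrow> 'c::real_normed_vector"
  shows "open S \<Longrightarrow> smooth_on f T \<Longrightarrow> smooth_on g S \<Longrightarrow> g ` S \<subseteq> T \<Longrightarrow> smooth_on (\<lambda>x. f (g x)) S"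
  using Ck_on_compose unfolding smooth_on_def by blast

lemma smooth_on_bilinear:
  "bounded_bilinear B \<Longrightarrow> open S \<Longrightarrow> smooth_on f S \<Longrightarrow> smooth_on g S
    \<Longrightarrow> smooth_on (\<lambda>x. B (f x) (g x)) S"
  using Ck_on_bilinear unfolding smooth_on_def by blast

lemma smooth_on_linear_compose:
  "bounded_linear L \<Longrightarrow> open S \<Longrightarrow> smooth_on f S \<Longrightarrow> smooth_on (\<lambda>x. L (f x)) S"
  using Ck_on_linear_compose unfolding smooth_on_def by blast

lemma smooth_on_add:
  "open S \<Longrightarrow> smooth_on f S \<Longrightarrow> smooth_on g S \<Longrightarrow> smooth_on (\<lambda>x. f x + g x) S"
  using Ck_on_add unfolding smooth_on_def by blast

lemma smooth_on_sum:
  "open S \<Longrightarrow> (\<And>i. i \<in> I \<Longrightarrow> smooth_on (f i) S) \<Longrightarrow> smooth_on (\<lambda>x. \<Sum>i\<in>I. f i x) S"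
  by (simp add: smooth_on_def Ck_on_sum)

lemma smooth_on_const: "smooth_on (\<lambda>x. c) S"
  using Ck_on_const unfolding smooth_on_def by blast

lemma smooth_on_bounded_linear: "bounded_linear f \<Longrightarrow> smooth_on f S"
  using Ck_on_bounded_linear unfolding smooth_on_def by blast

lemma smooth_on_imp_Ck: "smooth_on f S \<Longrightarrow> Ck_on k f S"
  unfolding smooth_on_def by blast

lemma smooth_on_continuous: "smooth_on f S \<Longrightarrow> continuous_on S f"
  using smooth_on_imp_Ck[of f S 0] by simp

lemma smooth_on_has_derivative:
  "smooth_on f S \<Longrightarrow> x \<in> S \<Longrightarrow> (f has_derivative frechet_derivative f (at x)) (at x)"
  by (rule Ck_on_has_derivative[OF smooth_on_imp_Ck[of f S 1]]) simp_all

lemma smooth_on_differentiable: "smooth_on f S \<Longrightarrow> x \<in> S \<Longrightarrow> f differentiable (at x)"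
  by (rule Ck_on_differentiable[OF smooth_on_imp_Ck[of f S 1]]) simp_all

lemma smooth_on_deriv: "smooth_on f S \<Longrightarrow> smooth_on (\<lambda>x. frechet_derivative f (at x) v) S"
  unfolding smooth_on_def by (metis Ck_on.simps(2))

lemma Ck_on_iter_deriv:
  "Ck_on k f S \<Longrightarrow> length vs \<le> k \<Longrightarrow> Ck_on (k - length vs) (iter_deriv vs f) S"
proof (induction vs arbitrary: f k)
  case (Cons v vs)
  then obtain k' where "k = Suc k'" by (cases k) auto
  then show ?case using Cons by auto
qed simp

section \<open>Symmetry of second derivatives\<close>

lemma Ck_on_2D:
  assumes "Ck_on 2 f S"
  shows "Ck_on 1 f S" "Ck_on 1 (\<lambda>y. frechet_derivative f (at y) v) S"
  using Ck_on_le[OF assms, of 1] assms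
  by (simp_all only: numeral_2_eq_2 Ck_on.simps(2) One_nat_def) simp_all

lemma linear_path_deriv:
  fixes f :: "'a::real_normed_vector \<Rightarrow> real"
  assumes "f differentiable (at (a + s *\<^sub>R v))"
  shows "((\<lambda>s. f (a + s *\<^sub>R v)) has_real_derivative frechet_derivative f (at (a + s *\<^sub>R v)) v) (at s)"
proof -
  let ?f' = "frechet_derivative f (at (a + s *\<^sub>R v))"
  have f': "(f has_derivative ?f') (at (a + s *\<^sub>R v))" using assms frechet_derivative_works by blast
  have "((\<lambda>s. a + s *\<^sub>R v) has_derivative (\<lambda>t. t *\<^sub>R v)) (at s)"
    by (auto intro!: derivative_eq_intros)
  from has_derivative_compose[OF this f']
  have "((\<lambda>s. f (a + s *\<^sub>R v)) has_derivative (\<lambda>t. ?f' (t *\<^sub>R v))) (at s)" .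
  moreover have "?f' (t *\<^sub>R v) = t * ?f' v" for t
    using linear_cmul[OF has_derivative_linear[OF f']] by simp
  ultimately show ?thesis
    by (simp add: has_field_derivative_def mult_commute_abs)
qed

text \<open>The mean value theorem is used twice: along \<open>v\<close> for the increment of
  \<open>f\<close> over the step \<open>h w\<close>, then along \<open>w\<close> for the derivative
  in direction \<open>v\<close>. The left-hand side is symmetric in \<open>v\<close> and
  \<open>w\<close>.\<close>

lemma second_difference_mean_value:
  fixes f :: "'a::real_normed_vector \<Rightarrow> real"
  assumes S: "\<And>s t. s \<in> {0..h} \<Longrightarrow> t \<in> {0..h} \<Longrightarrow> x + s *\<^sub>R v + t *\<^sub>R w \<in> S"
    and f: "Ck_on 2 f S" and h: "0 < h"
  obtains s t where "s \<in> {0..h}" "t \<in> {0..h}"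
    "f (x + h *\<^sub>R v + h *\<^sub>R w) - f (x + h *\<^sub>R v) - f (x + h *\<^sub>R w) + f x =
      h * h * frechet_derivative (\<lambda>y. frechet_derivative f (at y) v) (at (x + s *\<^sub>R v + t *\<^sub>R w)) w"
proof -
  let ?fv = "\<lambda>y. frechet_derivative f (at y) v"
  have fv: "Ck_on 1 ?fv S" and f1: "Ck_on 1 f S" using Ck_on_2D[OF f] by blast+
  have fd: "f differentiable (at (x + s *\<^sub>R v + t *\<^sub>R w))" "?fv differentiable (at (x + s *\<^sub>R v + t *\<^sub>R w))"
    if "s \<in> {0..h}" "t \<in> {0..h}" for s t
    by (rule Ck_on_differentiable[OF f1 _ S[OF that]], simp)
      (rule Ck_on_differentiable[OF fv _ S[OF that]], simp)
  have swap: "x + s *\<^sub>R v + t *\<^sub>R w = (x + t *\<^sub>R w) + s *\<^sub>R v" for s t by simp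
  have "((\<lambda>s. f ((x + h *\<^sub>R w) + s *\<^sub>R v) - f (x + s *\<^sub>R v)) has_real_derivative
      (?fv ((x + h *\<^sub>R w) + s *\<^sub>R v) - ?fv (x + s *\<^sub>R v))) (at s)" if "0 \<le> s" "s \<le> h" for s
    using fd(1)[of s h] fd(1)[of s 0] that h
    by (intro DERIV_diff linear_path_deriv) (auto simp: swap)
  from MVT2[OF h this] obtain s where s: "0 < s" "s < h" and
    eq1: "f (x + h *\<^sub>R w + h *\<^sub>R v) - f (x + h *\<^sub>R v) - (f (x + h *\<^sub>R w) - f x)
      = h * (?fv (x + h *\<^sub>R w + s *\<^sub>R v) - ?fv (x + s *\<^sub>R v))" by auto
  have "((\<lambda>t. ?fv ((x + s *\<^sub>R v) + t *\<^sub>R w)) has_real_derivative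
      frechet_derivative ?fv (at ((x + s *\<^sub>R v) + t *\<^sub>R w)) w) (at t)" if "0 \<le> t" "t \<le> h" for t
    using fd(2)[of s t] that s by (intro linear_path_deriv) auto
  from MVT2[OF h this] obtain t where t: "0 < t" "t < h" and
    eq2: "?fv (x + s *\<^sub>R v + h *\<^sub>R w) - ?fv (x + s *\<^sub>R v)
      = h * frechet_derivative ?fv (at (x + s *\<^sub>R v + t *\<^sub>R w)) w" by auto
  show ?thesis
    by (rule that[of s t]) (use s t eq1 eq2 in \<open>auto simp: algebra_simps\<close>)
qed

text \<open>Both mixed derivatives, at intermediate points converging to \<open>x\<close>, equal the
  same second difference quotient; continuity does the rest.\<close>

lemma symmetric_second_derivative_real:
  fixes f :: "'a::real_normed_vector \<Rightarrow> real"
  assumes S: "open S" "x \<in> S" and f: "Ck_on 2 f S"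
  shows "frechet_derivative (\<lambda>y. frechet_derivative f (at y) v) (at x) w
       = frechet_derivative (\<lambda>y. frechet_derivative f (at y) w) (at x) v"
proof -
  let ?F = "\<lambda>v w y. frechet_derivative (\<lambda>y. frechet_derivative f (at y) v) (at y) w"
  have cont: "isCont (?F v w) x" for v w
    using Ck_on_2D(2)[OF f, of v] S by (auto simp: continuous_on_eq_continuous_at)
  obtain \<delta> where \<delta>: "\<delta> > 0" "ball x \<delta> \<subseteq> S" using S openE by blast
  \<comment> \<open>All intermediate points then lie within \<open>\<delta> / (n + 2)\<close> of
    \<open>x\<close>, which is strictly below \<open>\<delta>\<close> already for
    \<open>n = 0\<close>.\<close>
  define h where "h n = \<delta> / (norm v + norm w + 1) / real (n + 2)" for n :: nat
  have vw: "norm v + norm w + 1 > 0" by (simp add: add_nonneg_pos)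
  have h0: "h n > 0" for n using \<delta> vw by (simp add: h_def)
  have near: "norm (s *\<^sub>R v + t *\<^sub>R w) \<le> \<delta> / real (n + 2)"
    if "s \<in> {0..h n}" "t \<in> {0..h n}" for s t n
  proof -
    have "norm (s *\<^sub>R v + t *\<^sub>R w) \<le> s * norm v + t * norm w"
      using norm_triangle_ineq[of "s *\<^sub>R v" "t *\<^sub>R w"] that by simp
    also have "\<dots> \<le> h n * norm v + h n * norm w"
      using that by (intro add_mono mult_right_mono) auto
    also have "\<dots> \<le> h n * (norm v + norm w + 1)" using h0[of n] by (simp add: algebra_simps)
    also have "\<dots> = \<delta> / real (n + 2)" using vw by (simp add: h_def)
    finally show ?thesis .
  qed
  have inS: "x + s *\<^sub>R v + t *\<^sub>R w \<in> S" if "s \<in> {0..h n}" "t \<in> {0..h n}" for s t n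
  proof -
    have dist_x: "dist x (x + d) = norm d" for d by (simp add: dist_norm)
    have "\<delta> / real (n + 2) < \<delta> / 1"
      by (rule divide_strict_left_mono) (use \<delta>(1) in auto)
    then have "norm (s *\<^sub>R v + t *\<^sub>R w) < \<delta>" using near[OF that] by linarith
    then have "x + (s *\<^sub>R v + t *\<^sub>R w) \<in> ball x \<delta>" by (simp only: mem_ball dist_x)
    then show ?thesis using \<delta>(2) by (simp only: add.assoc subset_iff)
  qed
  have "\<exists>s t. s \<in> {0..h n} \<and> t \<in> {0..h n} \<and>
      f (x + h n *\<^sub>R v + h n *\<^sub>R w) - f (x + h n *\<^sub>R v) - f (x + h n *\<^sub>R w) + f x
        = h n * h n * ?F v w (x + s *\<^sub>R v + t *\<^sub>R w)" for n
    by (rule second_difference_mean_value[OF inS f h0, of n]) blast+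
  then obtain s t where st: "\<And>n. s n \<in> {0..h n}" "\<And>n. t n \<in> {0..h n}"
    and eq1: "\<And>n. f (x + h n *\<^sub>R v + h n *\<^sub>R w) - f (x + h n *\<^sub>R v) - f (x + h n *\<^sub>R w) + f x
        = h n * h n * ?F v w (x + s n *\<^sub>R v + t n *\<^sub>R w)" by metis
  have inS': "x + s *\<^sub>R w + t *\<^sub>R v \<in> S" if "s \<in> {0..h n}" "t \<in> {0..h n}" for s t n
    using inS[OF that(2,1)] by (simp only: add.assoc add.commute[of "s *\<^sub>R w"])
  have "\<exists>s t. s \<in> {0..h n} \<and> t \<in> {0..h n} \<and>
      f (x + h n *\<^sub>R w + h n *\<^sub>R v) - f (x + h n *\<^sub>R w) - f (x + h n *\<^sub>R v) + f x
        = h n * h n * ?F w v (x + s *\<^sub>R w + t *\<^sub>R v)" for n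
    by (rule second_difference_mean_value[OF inS' f h0, of n]) blast+
  then obtain s' t' where st': "\<And>n. s' n \<in> {0..h n}" "\<And>n. t' n \<in> {0..h n}"
    and eq2: "\<And>n. f (x + h n *\<^sub>R w + h n *\<^sub>R v) - f (x + h n *\<^sub>R w) - f (x + h n *\<^sub>R v) + f x
        = h n * h n * ?F w v (x + s' n *\<^sub>R w + t' n *\<^sub>R v)" by metis
  have eq: "?F v w (x + s n *\<^sub>R v + t n *\<^sub>R w) = ?F w v (x + s' n *\<^sub>R w + t' n *\<^sub>R v)" for n
  proof -
    have "f (x + h n *\<^sub>R w + h n *\<^sub>R v) = f (x + h n *\<^sub>R v + h n *\<^sub>R w)"
      by (simp only: add.assoc add.commute[of "h n *\<^sub>R v"])
    then have "h n * h n * ?F v w (x + s n *\<^sub>R v + t n *\<^sub>R w)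
        = h n * h n * ?F w v (x + s' n *\<^sub>R w + t' n *\<^sub>R v)"
      using eq1[of n] eq2[of n] by linarith
    moreover have "h n * h n \<noteq> 0" using h0[of n] by simp
    ultimately show ?thesis by (simp only: mult_cancel_left) blast
  qed
  have null: "(\<lambda>n. \<delta> / real (n + 2)) \<longlonglongrightarrow> 0"
    using LIMSEQ_ignore_initial_segment[OF lim_const_over_n, of \<delta> 2] by simp
  have l1: "(\<lambda>n. x + s n *\<^sub>R v + t n *\<^sub>R w) \<longlonglongrightarrow> x"
  proof -
    have "(\<lambda>n. s n *\<^sub>R v + t n *\<^sub>R w) \<longlonglongrightarrow> 0"
      by (rule Lim_null_comparison[OF _ null]) (use near st in auto)
    from tendsto_add[OF tendsto_const[of x] this] show ?thesis by (simp add: add.assoc)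
  qed
  have l2: "(\<lambda>n. x + s' n *\<^sub>R w + t' n *\<^sub>R v) \<longlonglongrightarrow> x"
  proof -
    have "(\<lambda>n. t' n *\<^sub>R v + s' n *\<^sub>R w) \<longlonglongrightarrow> 0"
      by (rule Lim_null_comparison[OF _ null]) (use near st' in auto)
    from tendsto_add[OF tendsto_const[of x] this] show ?thesis by (simp add: add_ac)
  qed
  have "(\<lambda>n. ?F v w (x + s n *\<^sub>R v + t n *\<^sub>R w)) \<longlonglongrightarrow> ?F v w x"
    by (rule isCont_tendsto_compose[OF cont l1])
  moreover have "(\<lambda>n. ?F w v (x + s' n *\<^sub>R w + t' n *\<^sub>R v)) \<longlonglongrightarrow> ?F w v x"
    by (rule isCont_tendsto_compose[OF cont l2])
  ultimately show ?thesis using LIMSEQ_unique eq by simp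
qed

lemma frechet_derivative_linear_compose:
  assumes "bounded_linear L" "f differentiable (at x)"
  shows "frechet_derivative (\<lambda>x. L (f x)) (at x) v = L (frechet_derivative f (at x) v)"
  using frechet_derivative_eqI[OF bounded_linear.has_derivative[OF assms(1)
        assms(2)[unfolded frechet_derivative_works]]] by simp

text \<open>Reduction to components, since the mean value theorem with equality is available only
  for real values.\<close>

lemma symmetric_second_derivative:
  fixes f :: "'a::real_normed_vector \<Rightarrow> 'b::euclidean_space"
  assumes S: "open S" "x \<in> S" and f: "Ck_on 2 f S"
  shows "frechet_derivative (\<lambda>y. frechet_derivative f (at y) v) (at x) w
       = frechet_derivative (\<lambda>y. frechet_derivative f (at y) w) (at x) v"
proof (rule euclidean_eqI)
  fix b :: 'b
  have d1: "f differentiable (at y)" "(\<lambda>y. frechet_derivative f (at y) v) differentiable (at y)"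
    if "y \<in> S" for y v using Ck_on_2D(1)[OF f] Ck_on_2D(2)[OF f, of v] that by auto
  have 1: "frechet_derivative (\<lambda>y. f y \<bullet> b) (at y) v = frechet_derivative f (at y) v \<bullet> b"
    if "y \<in> S" for y v
    by (rule frechet_derivative_linear_compose[OF bounded_linear_inner_left d1(1)[OF that]])
  have 2: "frechet_derivative (\<lambda>y. frechet_derivative (\<lambda>y. f y \<bullet> b) (at y) v) (at x) w
      = frechet_derivative (\<lambda>y. frechet_derivative f (at y) v) (at x) w \<bullet> b" for v w
  proof -
    have "frechet_derivative (\<lambda>y. frechet_derivative (\<lambda>y. f y \<bullet> b) (at y) v) (at x)
      = frechet_derivative (\<lambda>y. frechet_derivative f (at y) v \<bullet> b) (at x)"
      by (rule frechet_derivative_cong_open[OF S]) (rule 1)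
    then show ?thesis
      using frechet_derivative_linear_compose[OF bounded_linear_inner_left d1(2)[OF S(2)]] by simp
  qed
  have "Ck_on 2 (\<lambda>y. f y \<bullet> b) S"
    by (rule Ck_on_linear_compose[OF bounded_linear_inner_left S(1) f])
  from symmetric_second_derivative_real[OF S this, of v w]
  show "frechet_derivative (\<lambda>y. frechet_derivative f (at y) v) (at x) w \<bullet> b
    = frechet_derivative (\<lambda>y. frechet_derivative f (at y) w) (at x) v \<bullet> b" by (simp add: 2)
qed

section \<open>Lipschitz estimates and cut-off functions\<close>

lemma linear_Basis_sum:
  fixes f :: "'a::euclidean_space \<Rightarrow> 'b::real_vector"
  assumes "linear f"
  shows "f v = (\<Sum>b\<in>Basis. (v \<bullet> b) *\<^sub>R f b)"
proof -
  have "f (\<Sum>b\<in>Basis. (v \<bullet> b) *\<^sub>R b) = (\<Sum>b\<in>Basis. (v \<bullet> b) *\<^sub>R f b)"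
    by (simp add: linear_sum[OF assms] linear_cmul[OF assms])
  then show ?thesis by (simp only: euclidean_representation)
qed

text \<open>Compactness bounds the finitely many partial derivatives, hence the operator norm of the
  derivative; convexity makes the mean value inequality applicable.\<close>

lemma C1_lipschitz:
  fixes f :: "'a::euclidean_space \<Rightarrow> 'b::real_normed_vector"
  assumes f: "Ck_on 1 f S" and K: "compact K" "convex K" "K \<subseteq> S"
  obtains L where "L \<ge> 0" "\<And>x y. x \<in> K \<Longrightarrow> y \<in> K \<Longrightarrow> norm (f x - f y) \<le> L * norm (x - y)"
proof -
  have "\<exists>C. \<forall>x\<in>K. norm (frechet_derivative f (at x) b) \<le> C" for b
  proof -
    have "continuous_on S (\<lambda>x. frechet_derivative f (at x) b)" using f by simp
    then have "continuous_on K (\<lambda>x. frechet_derivative f (at x) b)"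
      using K(3) by (rule continuous_on_subset)
    from compact_imp_bounded[OF compact_continuous_image[OF this K(1)]]
    show ?thesis by (auto simp: bounded_iff)
  qed
  then obtain C where C: "\<And>b x. x \<in> K \<Longrightarrow> norm (frechet_derivative f (at x) b) \<le> C b" by metis
  define L where "L = (\<Sum>b\<in>Basis. \<bar>C b\<bar>)"
  have L: "onorm (frechet_derivative f (at x)) \<le> L" if x: "x \<in> K" for x
  proof (rule onorm_bound)
    fix v
    have "linear (frechet_derivative f (at x))"
      using Ck_on_has_derivative[OF f zero_less_one] x K(3) by (auto intro: has_derivative_linear)
    then have "frechet_derivative f (at x) v
        = (\<Sum>b\<in>Basis. (v \<bullet> b) *\<^sub>R frechet_derivative f (at x) b)"
      by (rule linear_Basis_sum)
    also have "norm \<dots> \<le> (\<Sum>b\<in>Basis. norm v * \<bar>C b\<bar>)"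
      by (rule sum_norm_le) (auto intro!: mult_mono Basis_le_norm order.trans[OF C[OF x]])
    finally show "norm (frechet_derivative f (at x) v) \<le> L * norm v"
      by (simp add: L_def sum_distrib_left mult.commute)
  qed (simp add: L_def sum_nonneg)
  have "norm (f x - f y) \<le> L * norm (x - y)" if "x \<in> K" "y \<in> K" for x y
    by (rule differentiable_bound[OF K(2) _ L that])
      (use f K Ck_on_has_derivative[of 1 f S] in \<open>auto intro: has_derivative_at_withinI\<close>)
  then show ?thesis using that[of L] by (simp add: L_def sum_nonneg)
qed

text \<open>The derivative of \<open>inverse\<close> is a quadratic expression in
  \<open>inverse\<close> itself, so the induction closes.\<close>

lemma smooth_on_inverse: "smooth_on (inverse :: real \<Rightarrow> real) (- {0})"
proof -
  have "Ck_on k (inverse :: real \<Rightarrow> real) (- {0})" for k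
  proof (induction k)
    case 0
    then show ?case by (auto intro: continuous_intros)
  next
    case (Suc k)
    have d: "((inverse::real\<Rightarrow>real) has_derivative (\<lambda>v. - (inverse x * v * inverse x))) (at x)" if "x \<noteq> 0" for x
      using that by (auto intro!: derivative_eq_intros)
    have o: "open (- {0::real})" by auto
    have "Ck_on k (\<lambda>x. - (inverse x * v * inverse x)) (- {0})" for v :: real
      by (intro Ck_on_minus Ck_on_mult o Ck_on_const Suc)
    then have "Ck_on k (\<lambda>x. frechet_derivative (inverse :: real \<Rightarrow> real) (at x) v) (- {0})" for v
      by (rule Ck_on_cong[OF o, rotated]) (auto simp: frechet_derivative_eqI[OF d])
    then show ?case using d by (auto simp: differentiable_def)
  qed
  then show ?thesis by (simp add: smooth_on_def)
qed

text \<open>The derivative of \<open>p(1/t) e\<^sup>-\<^sup>1\<^sup>/\<^sup>t\<close> has again this form.\<close>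

definition flat_fun :: "real poly \<Rightarrow> real \<Rightarrow> real" where
  "flat_fun p t = (if t \<le> 0 then 0 else poly p (inverse t) * exp (- inverse t))"

text \<open>Substituting \<open>x = 1/t\<close> turns the claim into the decay of polynomials
  against the exponential at infinity.\<close>

lemma flat_fun_tendsto_0: "((\<lambda>t. poly p (inverse t) * exp (- inverse t)) \<longlongrightarrow> 0) (at_right (0::real))"
proof -
  have "((\<lambda>x. poly p x * exp (- x)) \<longlongrightarrow> 0) (at_top :: real filter)"
  proof -
    have "((\<lambda>x. coeff p i * x ^ i * exp (- x)) \<longlongrightarrow> 0) (at_top :: real filter)" for i
    proof -
      have "((\<lambda>x. coeff p i * (x ^ i / exp x)) \<longlongrightarrow> coeff p i * 0) (at_top :: real filter)"
        by (intro tendsto_intros tendsto_power_div_exp_0)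
      then show ?thesis by (simp add: exp_minus field_simps)
    qed
    then have "((\<lambda>x. \<Sum>i\<le>degree p. coeff p i * x ^ i * exp (- x)) \<longlongrightarrow> 0) (at_top :: real filter)"
      by (rule tendsto_null_sum)
    then show ?thesis by (simp add: poly_altdef sum_distrib_right)
  qed
  then show ?thesis
    by (rule filterlim_compose) (rule filterlim_inverse_at_top_right)
qed

text \<open>Since \<open>d/dt (1/t) = -(1/t)^2\<close>, differentiating the product gives
  \<open>(1/t)^2 (p - p')(1/t) exp(-1/t)\<close>; the polynomial factor \<open>[:0, 0, 1:]\<close>
  is the square.\<close>

lemma flat_fun_deriv:
  "(flat_fun p has_real_derivative flat_fun ([:0, 0, 1:] * (p - pderiv p)) t) (at t)"
proof -
  consider "t < 0" | "t = 0" | "t > 0" by linarith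
  then show ?thesis
  proof cases
    case 1
    have "((\<lambda>t. 0) has_real_derivative 0) (at t)" by simp
    then have "(flat_fun p has_real_derivative 0) (at t)"
      by (rule has_field_derivative_transform_within_open[of _ _ _ "{..<0}"])
        (use 1 in \<open>auto simp: flat_fun_def\<close>)
    then show ?thesis using 1 by (simp add: flat_fun_def)
  next
    case 3
    have "((\<lambda>t. poly p (inverse t) * exp (- inverse t)) has_real_derivative
        poly ([:0, 0, 1:] * (p - pderiv p)) (inverse t) * exp (- inverse t)) (at t)"
      using 3 by (auto intro!: derivative_eq_intros poly_DERIV[THEN DERIV_chain2]
          simp: algebra_simps power2_eq_square)
    then have "(flat_fun p has_real_derivative
        poly ([:0, 0, 1:] * (p - pderiv p)) (inverse t) * exp (- inverse t)) (at t)"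
      by (rule has_field_derivative_transform_within_open[of _ _ _ "{0<..}"])
        (use 3 in \<open>auto simp: flat_fun_def\<close>)
    then show ?thesis using 3 by (simp add: flat_fun_def)
  next
    case 2
    \<comment> \<open>Dividing by \<open>h\<close> multiplies the polynomial in \<open>1/h\<close>
      by its variable, which is \<open>pCons 0 p\<close>.\<close>
    have r: "((\<lambda>h. flat_fun p h / h) \<longlongrightarrow> 0) (at_right 0)"
    proof (rule Lim_transform_eventually[OF flat_fun_tendsto_0[of "pCons 0 p"]])
      show "\<forall>\<^sub>F t in at_right 0. poly (pCons 0 p) (inverse t) * exp (- inverse t) = flat_fun p t / t"
        by (auto simp: eventually_at_filter flat_fun_def field_simps)
    qed
    have l: "((\<lambda>h. flat_fun p h / h) \<longlongrightarrow> 0) (at_left 0)"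
      by (rule Lim_transform_eventually[OF tendsto_const[of 0]])
        (auto simp: eventually_at_filter flat_fun_def)
    show ?thesis using 2 l r by (simp add: DERIV_def filterlim_at_split) (simp add: flat_fun_def)
  qed
qed

lemma smooth_flat_fun: "smooth_on (flat_fun p) S"
proof -
  have "Ck_on k (flat_fun p) UNIV" for k
  proof (induction k arbitrary: p)
    case 0
    then show ?case
      using DERIV_isCont[OF flat_fun_deriv] by (simp add: continuous_at_imp_continuous_on)
  next
    case (Suc k)
    let ?q = "[:0, 0, 1:] * (p - pderiv p)"
    have d: "(flat_fun p has_derivative (\<lambda>v. flat_fun ?q t * v)) (at t)" for t
      using flat_fun_deriv[of p t] by (simp only: has_field_derivative_def)
    have "Ck_on k (\<lambda>t. flat_fun ?q t * v) UNIV" for v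
      by (intro Ck_on_mult Suc Ck_on_const) simp
    then show ?case using d by (auto simp: differentiable_def frechet_derivative_eqI[OF d])
  qed
  then show ?thesis using Ck_on_subset unfolding smooth_on_def by blast
qed

lemma flat_fun_1: "flat_fun 1 t \<ge> 0" "flat_fun 1 t > 0 \<longleftrightarrow> t > 0" "t \<le> 0 \<Longrightarrow> flat_fun 1 t = 0"
  by (auto simp: flat_fun_def)

text \<open>In the quotient \<open>a / (a + b)\<close> the function \<open>a\<close> is positive
  exactly inside the large ball and \<open>b\<close> exactly outside the small closed one; as the
  radii differ, the denominator never vanishes. Squared distances keep everything smooth at the
  centre.\<close>

lemma cutoff_function:
  fixes p :: "'a::euclidean_space"
  assumes "0 < \<rho>" "\<rho> < \<rho>'"
  obtains \<psi> :: "'a \<Rightarrow> real" where "smooth_on \<psi> UNIV" "\<And>x. x \<in> cball p \<rho> \<Longrightarrow> \<psi> x = 1"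
    "\<And>x. x \<notin> ball p \<rho>' \<Longrightarrow> \<psi> x = 0"
proof -
  define N where "N x = (x - p) \<bullet> (x - p)" for x :: 'a
  define a where "a x = flat_fun 1 (\<rho>'\<^sup>2 - N x)" for x
  define b where "b x = flat_fun 1 (N x - \<rho>\<^sup>2)" for x
  have N: "smooth_on N UNIV" unfolding N_def smooth_on_def
    by (intro allI Ck_on_bilinear[OF bounded_bilinear_inner] Ck_on_diff[OF _ Ck_on_id Ck_on_const]) auto
  have N': "smooth_on (\<lambda>x. \<rho>'\<^sup>2 - N x) UNIV" "smooth_on (\<lambda>x. N x - \<rho>\<^sup>2) UNIV"
    using N Ck_on_diff[OF open_UNIV] Ck_on_const unfolding smooth_on_def by blast+
  have a: "smooth_on a UNIV" unfolding a_def
    by (rule smooth_on_compose[OF open_UNIV smooth_flat_fun N'(1)]) (rule subset_UNIV)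
  have b: "smooth_on b UNIV" unfolding b_def
    by (rule smooth_on_compose[OF open_UNIV smooth_flat_fun N'(2)]) (rule subset_UNIV)
  have sq: "\<rho>\<^sup>2 < \<rho>'\<^sup>2" using assms by (simp add: power_strict_mono)
  have pos: "a x + b x > 0" for x
  proof (cases "N x < \<rho>'\<^sup>2")
    case True
    then show ?thesis using flat_fun_1 by (simp add: a_def b_def add_pos_nonneg)
  next
    case False
    then have "N x - \<rho>\<^sup>2 > 0" using sq by simp
    then show ?thesis using flat_fun_1 by (simp add: a_def b_def add_nonneg_pos)
  qed
  have "smooth_on (\<lambda>x. a x * inverse (a x + b x)) UNIV"
  proof (rule smooth_on_bilinear[OF bounded_bilinear_mult open_UNIV a])
    show "smooth_on (\<lambda>x. inverse (a x + b x)) UNIV"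
      by (rule smooth_on_compose[OF open_UNIV smooth_on_inverse smooth_on_add[OF open_UNIV a b]])
        (use pos in \<open>auto simp: less_le\<close>)
  qed
  moreover have "a x * inverse (a x + b x) = 1" if "x \<in> cball p \<rho>" for x
  proof -
    have "N x \<le> \<rho>\<^sup>2" using that assms
      by (simp add: N_def dist_norm norm_minus_commute power_mono flip: power2_norm_eq_inner)
    then have "b x = 0" using flat_fun_1 by (simp add: b_def)
    then show ?thesis using pos[of x] by simp
  qed
  moreover have "a x * inverse (a x + b x) = 0" if "x \<notin> ball p \<rho>'" for x
  proof -
    have "\<rho>'\<^sup>2 \<le> N x" using that assms
      by (simp add: N_def dist_norm norm_minus_commute power_mono flip: power2_norm_eq_inner)
    then show ?thesis using flat_fun_1 by (simp add: a_def)
  qed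
  ultimately show ?thesis using that by blast
qed

section \<open>Ordinary differential equations\<close>

text \<open>A contraction on bounded continuous functions of the whole line. The Lipschitz bound is
  global in the state, so no ball has to be preserved; callers arrange this by modifying the
  right-hand side. The factor 8 yields the contraction constant 1/2, since two integrals over
  intervals of length at most \<open>2 * \<epsilon>\<close> are estimated.\<close>

lemma picard_local:
  fixes f :: "real \<Rightarrow> 'a::euclidean_space \<Rightarrow> 'a"
  assumes cont: "\<And>u. continuous_on {t0-\<epsilon>..t0+\<epsilon>} u \<Longrightarrow> continuous_on {t0-\<epsilon>..t0+\<epsilon>} (\<lambda>t. f t (u t))"
    and lip: "\<And>t x y. t \<in> {t0-\<epsilon>..t0+\<epsilon>} \<Longrightarrow> norm (f t x - f t y) \<le> L * norm (x - y)"
    and \<epsilon>: "0 < \<epsilon>" "8 * \<epsilon> * L \<le> 1" and L: "0 \<le> L"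
  obtains u where "u t0 = x0"
    "\<And>t. t \<in> {t0-\<epsilon><..<t0+\<epsilon>} \<Longrightarrow> (u has_vector_derivative f t (u t)) (at t)"
proof -
  define a b where "a = t0 - \<epsilon>" and "b = t0 + \<epsilon>"
  have ab: "a < b" "t0 \<in> {a..b}" using \<epsilon> by (auto simp: a_def b_def)
  \<comment> \<open>Truncating the time to \<open>[a, b]\<close> makes the images of the fixed point
    operator bounded on the whole line.\<close>
  define c where "c t = max a (min b t)" for t
  have c: "c t \<in> {a..b}" for t using ab by (auto simp: c_def)
  have c_id: "c t = t" if "t \<in> {a..b}" for t using that by (auto simp: c_def)
  have c_cont: "continuous_on UNIV c" unfolding c_def by (intro continuous_intros)
  \<comment> \<open>Integrating from the left end point and subtracting the value at
    \<open>t0\<close> later gives the integral from \<open>t0\<close> without distinguishing the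
    order of the limits.\<close>
  define I where "I u t = integral {a..t} (\<lambda>s. f s (u s))" for u :: "real \<Rightarrow> 'a" and t
  have fcont: "continuous_on {a..b} (\<lambda>t. f t (u t))" if "continuous_on {a..b} u" for u
    using cont[of u] that unfolding a_def b_def by blast
  have Icont: "continuous_on {a..b} (I u)" if "continuous_on {a..b} u" for u
    unfolding I_def by (intro indefinite_integral_continuous_1 integrable_continuous_real fcont that)
  define P where "P u = (\<lambda>t. x0 + I u (c t) - I u t0)" for u
  have P: "P (apply_bcontfun u) \<in> bcontfun" for u :: "real \<Rightarrow>\<^sub>C 'a"
  proof -
    have "continuous_on UNIV (\<lambda>t. I (apply_bcontfun u) (c t))"
      by (rule continuous_on_compose2[OF Icont c_cont]) (use c in auto)
    then have 1: "continuous_on UNIV (P (apply_bcontfun u))"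
      unfolding P_def by (intro continuous_intros)
    have "continuous_on {a..b} (P (apply_bcontfun u))" by (rule continuous_on_subset[OF 1]) simp
    from compact_continuous_image[OF this compact_Icc]
    have 2: "bounded (P (apply_bcontfun u) ` {a..b})" by (rule compact_imp_bounded)
    have "range (P (apply_bcontfun u)) \<subseteq> P (apply_bcontfun u) ` {a..b}"
    proof
      fix y assume "y \<in> range (P (apply_bcontfun u))"
      then obtain t where "y = P (apply_bcontfun u) t" by blast
      then have "y = P (apply_bcontfun u) (c t)" using c_id[OF c[of t]] by (simp add: P_def)
      then show "y \<in> P (apply_bcontfun u) ` {a..b}" using c by blast
    qed
    with 1 2 show ?thesis unfolding bcontfun_def using bounded_subset by blast
  qed
  define Q where "Q u = Bcontfun (P (apply_bcontfun u))" for u :: "real \<Rightarrow>\<^sub>C 'a"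
  have Q: "apply_bcontfun (Q u) = P (apply_bcontfun u)" for u
    unfolding Q_def by (rule Bcontfun_inverse[OF P])
  have contr: "dist (Q u) (Q v) \<le> 1/2 * dist u v" for u v
  proof (rule dist_bound)
    fix t
    let ?u = "apply_bcontfun u" and ?v = "apply_bcontfun v"
    have bd: "norm (I ?u s - I ?v s) \<le> L * dist u v * (2 * \<epsilon>)" if s: "s \<in> {a..b}" for s
    proof -
      have sub: "{a..s} \<subseteq> {a..b}" using s by auto
      have cu: "continuous_on {a..s} (\<lambda>t. f t (?u t))" "continuous_on {a..s} (\<lambda>t. f t (?v t))"
        by (rule continuous_on_subset[OF fcont sub], simp)+
      have "I ?u s - I ?v s = integral {a..s} (\<lambda>t. f t (?u t) - f t (?v t))"
        unfolding I_def by (rule integral_diff[symmetric]) (use cu integrable_continuous_real in blast)+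
      moreover have "norm (integral {a..s} (\<lambda>t. f t (?u t) - f t (?v t))) \<le> L * dist u v * (s - a)"
      proof (rule integral_bound)
        show "a \<le> s" using s by simp
        show "continuous_on {a..s} (\<lambda>t. f t (?u t) - f t (?v t))"
          by (rule continuous_on_diff[OF cu])
        fix r assume "r \<in> {a..s}"
        then have "norm (f r (?u r) - f r (?v r)) \<le> L * norm (?u r - ?v r)"
          using lip[of r] sub unfolding a_def b_def by blast
        also have "\<dots> \<le> L * dist u v"
          using dist_bounded[of u r v] L by (intro mult_left_mono) (auto simp: dist_norm)
        finally show "norm (f r (?u r) - f r (?v r)) \<le> L * dist u v" .
      qed
      moreover have "L * dist u v * (s - a) \<le> L * dist u v * (2 * \<epsilon>)"
        using s L by (intro mult_left_mono) (auto simp: a_def b_def)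
      ultimately show ?thesis by simp
    qed
    have "norm (P ?u t - P ?v t) = norm ((I ?u (c t) - I ?v (c t)) - (I ?u t0 - I ?v t0))"
      by (simp add: P_def algebra_simps)
    also have "\<dots> \<le> norm (I ?u (c t) - I ?v (c t)) + norm (I ?u t0 - I ?v t0)"
      by (rule norm_triangle_ineq4)
    also have "\<dots> \<le> L * dist u v * (2 * \<epsilon>) + L * dist u v * (2 * \<epsilon>)"
      by (intro add_mono bd c ab)
    also have "\<dots> = 1/2 * (8 * \<epsilon> * L) * dist u v" by simp
    also have "\<dots> \<le> 1/2 * 1 * dist u v" using \<epsilon>(2) by (intro mult_right_mono mult_left_mono) auto
    finally show "dist (apply_bcontfun (Q u) t) (apply_bcontfun (Q v) t) \<le> 1/2 * dist u v"
      by (simp add: Q dist_norm)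
  qed
  have "\<exists>!u. Q u = u"
    by (rule banach_fix_type[of "1/2"]) (simp, simp, use contr in blast)
  then obtain u where Qu: "Q u = u" by blast
  have u: "apply_bcontfun u t = x0 + I (apply_bcontfun u) (c t) - I (apply_bcontfun u) t0" for t
    using fun_cong[OF Q[of u], of t] unfolding Qu P_def .
  show ?thesis
  proof (rule that[of "apply_bcontfun u"])
    show "apply_bcontfun u t0 = x0" using u[of t0] c_id[OF ab(2)] by simp
    fix t assume "t \<in> {t0-\<epsilon><..<t0+\<epsilon>}"
    then have t: "a < t" "t < b" by (auto simp: a_def b_def)
    have "(I (apply_bcontfun u) has_vector_derivative f t (apply_bcontfun u t)) (at t within {a..b})"
      unfolding I_def by (rule integral_has_vector_derivative[OF fcont]) (use t in auto)
    then have "(I (apply_bcontfun u) has_vector_derivative f t (apply_bcontfun u t)) (at t)"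
      using t by (simp add: at_within_Icc_at)
    then have d: "((\<lambda>s. x0 + I (apply_bcontfun u) s - I (apply_bcontfun u) t0) has_vector_derivative
        f t (apply_bcontfun u t)) (at t)"
      by (auto intro!: derivative_eq_intros)
    show "(apply_bcontfun u has_vector_derivative f t (apply_bcontfun u t)) (at t)"
      by (rule has_vector_derivative_transform_within_open[OF d, of "{a<..<b}"])
        (use t u c_id in auto)
  qed
qed

text \<open>Gronwall for the squared distance \<open>w\<close>, whose derivative is at most
  \<open>2 * L * w\<close> in absolute value: multiplied by a suitable exponential, \<open>w\<close>
  is monotone on either side of \<open>t0\<close>. The Lipschitz bound is asked only along the two
  curves, which suits solutions confined to a chart.\<close>

lemma ode_unique:
  fixes u v :: "real \<Rightarrow> 'a::real_inner"
  assumes u: "\<And>t. t \<in> {a<..<b} \<Longrightarrow> (u has_vector_derivative u' t) (at t)"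
    and v: "\<And>t. t \<in> {a<..<b} \<Longrightarrow> (v has_vector_derivative v' t) (at t)"
    and L: "\<And>t. t \<in> {a<..<b} \<Longrightarrow> norm (u' t - v' t) \<le> L * norm (u t - v t)"
    and t0: "t0 \<in> {a<..<b}" "u t0 = v t0" and t: "t \<in> {a<..<b}"
  shows "u t = v t"
proof -
  define w where "w = (\<lambda>t. (u t - v t) \<bullet> (u t - v t))"
  define w' where "w' t = 2 * ((u t - v t) \<bullet> (u' t - v' t))" for t
  have w: "(w has_real_derivative w' t) (at t)" if "t \<in> {a<..<b}" for t
  proof -
    have "((\<lambda>t. u t - v t) has_derivative (\<lambda>h. h *\<^sub>R (u' t - v' t))) (at t)"
      using has_vector_derivative_diff[OF u[OF that] v[OF that]]
      by (simp add: has_vector_derivative_def)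
    from has_derivative_inner[OF this this]
    have "(w has_derivative (\<lambda>h. (u t - v t) \<bullet> (h *\<^sub>R (u' t - v' t)) + (h *\<^sub>R (u' t - v' t)) \<bullet> (u t - v t))) (at t)"
      unfolding w_def .
    then show ?thesis unfolding has_field_derivative_def
      by (rule has_derivative_eq_rhs) (auto simp: w'_def inner_commute fun_eq_iff)
  qed
  have w'_le: "\<bar>w' t\<bar> \<le> 2 * L * w t" if "t \<in> {a<..<b}" for t
  proof -
    have "\<bar>(u t - v t) \<bullet> (u' t - v' t)\<bar> \<le> norm (u t - v t) * norm (u' t - v' t)"
      by (rule Cauchy_Schwarz_ineq2)
    also have "\<dots> \<le> norm (u t - v t) * (L * norm (u t - v t))"
      by (intro mult_left_mono L that) simp
    finally show ?thesis
      by (simp add: w'_def w_def dot_square_norm power2_eq_square algebra_simps)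
  qed
  have w0: "w t0 = 0" using t0 by (simp add: w_def)
  have "w t \<le> 0"
  proof (cases "t0 \<le> t")
    case True
    have "exp (- (2 * L) * t) * w t \<le> exp (- (2 * L) * t0) * w t0"
    proof (rule DERIV_nonpos_imp_nonincreasing[OF True])
      fix s assume "t0 \<le> s" "s \<le> t"
      then have s: "s \<in> {a<..<b}" using t t0 by auto
      have "((\<lambda>s. exp (- (2 * L) * s) * w s) has_real_derivative
          exp (- (2 * L) * s) * (w' s - 2 * L * w s)) (at s)"
        by (auto intro!: derivative_eq_intros w[OF s] simp: algebra_simps)
      moreover have "exp (- (2 * L) * s) * (w' s - 2 * L * w s) \<le> 0"
        using w'_le[OF s] by (intro mult_nonneg_nonpos) auto
      ultimately show "\<exists>y. ((\<lambda>s. exp (- (2 * L) * s) * w s) has_real_derivative y) (at s) \<and> y \<le> 0"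
        by blast
    qed
    then show ?thesis using w0 by (simp add: mult_le_0_iff)
  next
    case False
    then have "t \<le> t0" by simp
    then have "exp (2 * L * t) * w t \<le> exp (2 * L * t0) * w t0"
    proof (rule DERIV_nonneg_imp_nondecreasing)
      fix s assume "t \<le> s" "s \<le> t0"
      then have s: "s \<in> {a<..<b}" using t t0 by auto
      have "((\<lambda>s. exp (2 * L * s) * w s) has_real_derivative
          exp (2 * L * s) * (w' s + 2 * L * w s)) (at s)"
        by (auto intro!: derivative_eq_intros w[OF s] simp: algebra_simps)
      moreover have "exp (2 * L * s) * (w' s + 2 * L * w s) \<ge> 0"
        using w'_le[OF s] by (intro mult_nonneg_nonneg) auto
      ultimately show "\<exists>y. ((\<lambda>s. exp (2 * L * s) * w s) has_real_derivative y) (at s) \<and> 0 \<le> y"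
        by blast
    qed
    then show ?thesis using w0 by (simp add: mult_le_0_iff)
  qed
  then have "norm (u t - v t) ^ 2 \<le> 0" by (simp add: w_def power2_norm_eq_inner)
  then show ?thesis by simp
qed

text \<open>Agreement and disagreement are both open conditions, and an interval is connected.
  Openness of disagreement replaces closedness of agreement, because no topology is given on the
  state space.\<close>

lemma agree_on_interval:
  fixes \<sigma> \<sigma>' :: "real \<Rightarrow> 's"
  assumes t0: "t0 \<in> {a<..<b}" "\<sigma> t0 = \<sigma>' t0"
    and eq: "\<And>t. t \<in> {a<..<b} \<Longrightarrow> \<sigma> t = \<sigma>' t \<Longrightarrow> \<forall>\<^sub>F s in nhds t. \<sigma> s = \<sigma>' s"
    and neq: "\<And>t. t \<in> {a<..<b} \<Longrightarrow> \<sigma> t \<noteq> \<sigma>' t \<Longrightarrow> \<forall>\<^sub>F s in nhds t. \<sigma> s \<noteq> \<sigma>' s"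
    and t: "t \<in> {a<..<b}"
  shows "\<sigma> t = \<sigma>' t"
proof (rule ccontr)
  assume ne: "\<sigma> t \<noteq> \<sigma>' t"
  let ?A = "{t \<in> {a<..<b}. \<sigma> t = \<sigma>' t}" and ?B = "{t \<in> {a<..<b}. \<sigma> t \<noteq> \<sigma>' t}"
  have o: "\<forall>\<^sub>F s in nhds x. s \<in> {a<..<b}" if "x \<in> {a<..<b}" for x
    by (rule eventually_nhds_in_open) (use that in auto)
  have "open ?A"
  proof (subst open_subopen, rule ballI)
    fix x assume "x \<in> ?A"
    then have "\<forall>\<^sub>F s in nhds x. s \<in> ?A" using eventually_conj[OF o[of x] eq[of x]] by simp
    then show "\<exists>T. open T \<and> x \<in> T \<and> T \<subseteq> ?A" by (auto simp: eventually_nhds)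
  qed
  moreover have "open ?B"
  proof (subst open_subopen, rule ballI)
    fix x assume "x \<in> ?B"
    then have "\<forall>\<^sub>F s in nhds x. s \<in> ?B" using eventually_conj[OF o[of x] neq[of x]] by simp
    then show "\<exists>T. open T \<and> x \<in> T \<and> T \<subseteq> ?B" by (auto simp: eventually_nhds)
  qed
  moreover have "?A \<inter> ?B \<inter> {a<..<b} = {}" "{a<..<b} \<subseteq> ?A \<union> ?B" by auto
  ultimately have "?A \<inter> {a<..<b} = {} \<or> ?B \<inter> {a<..<b} = {}"
    using connectedD[OF connected_Ioo[of a b]] by meson
  then show False using t t0 ne by blast
qed

text \<open>The predicate \<open>sol \<sigma> t\<close> stands for \<open>\<sigma>\<close> satisfying a differential equation at time \<open>t\<close>, and
  \<open>adm t\<close> for a set of states in which solutions stay and which makes the time of existence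
  locally uniform.\<close>

lemma global_solution:
  fixes sol :: "(real \<Rightarrow> 's) \<Rightarrow> real \<Rightarrow> bool" and adm :: "real \<Rightarrow> 's \<Rightarrow> bool"
  assumes germ: "\<And>\<sigma> \<sigma>' t. sol \<sigma> t \<Longrightarrow> \<forall>\<^sub>F s in nhds t. \<sigma> s = \<sigma>' s \<Longrightarrow> sol \<sigma>' t"
    and uniq: "\<And>\<sigma> \<sigma>' a b t0 t. (\<And>t. t \<in> {a<..<b} \<Longrightarrow> sol \<sigma> t \<and> sol \<sigma>' t) \<Longrightarrow> t0 \<in> {a<..<b} \<Longrightarrow>
        \<sigma> t0 = \<sigma>' t0 \<Longrightarrow> t \<in> {a<..<b} \<Longrightarrow> \<sigma> t = \<sigma>' t"
    and loc: "\<And>t0. \<exists>\<epsilon>>0. \<forall>t1\<in>{t0-\<epsilon><..<t0+\<epsilon>}. \<forall>s. adm t1 s \<longrightarrow>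
        (\<exists>\<sigma>. \<sigma> t1 = s \<and> (\<forall>t\<in>{t0-\<epsilon><..<t0+\<epsilon>}. sol \<sigma> t))"
    and adm: "\<And>\<sigma> a b t1 t. (\<And>t. t \<in> {a<..<b} \<Longrightarrow> sol \<sigma> t) \<Longrightarrow> t1 \<in> {a<..<b} \<Longrightarrow> adm t1 (\<sigma> t1) \<Longrightarrow>
        t \<in> {a<..<b} \<Longrightarrow> adm t (\<sigma> t)"
    and s0: "adm t0 s0"
  shows "\<exists>\<sigma>. \<sigma> t0 = s0 \<and> (\<forall>t. sol \<sigma> t)"
proof -
  define J where "J T = {t0-T<..<t0+T}" for T
  \<comment> \<open>The half-lengths of symmetric intervals around \<open>t0\<close> on which a
    solution exists; the aim is that every positive number belongs to \<open>R\<close>.\<close>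
  define R where "R = {T. 0 < T \<and> (\<exists>\<sigma>. \<sigma> t0 = s0 \<and> (\<forall>t\<in>J T. sol \<sigma> t))}"
  define S where "S T = (SOME \<sigma>. \<sigma> t0 = s0 \<and> (\<forall>t\<in>J T. sol \<sigma> t))" for T
  have S: "S T t0 = s0" "\<And>t. t \<in> J T \<Longrightarrow> sol (S T) t" if "T \<in> R" for T
  proof -
    have "\<exists>\<sigma>. \<sigma> t0 = s0 \<and> (\<forall>t\<in>J T. sol \<sigma> t)" using that by (auto simp: R_def)
    from someI_ex[OF this] show "S T t0 = s0" "\<And>t. t \<in> J T \<Longrightarrow> sol (S T) t"
      by (auto simp: S_def)
  qed
  have S_eq: "S T t = S T' t" if "T \<in> R" "T' \<in> R" "T \<le> T'" "t \<in> J T" for T T' t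
  proof (rule uniq[of "t0 - T" "t0 + T" _ _ t0])
    show "sol (S T) t \<and> sol (S T') t" if "t \<in> {t0-T<..<t0+T}" for t
      using S(2)[of T t] S(2)[of T' t] \<open>T \<in> R\<close> \<open>T' \<in> R\<close> \<open>T \<le> T'\<close> that by (auto simp: J_def)
    show "t0 \<in> {t0-T<..<t0+T}" using that by (auto simp: R_def)
    show "S T t0 = S T' t0" using S(1) that by simp
  qed (use that in \<open>simp add: J_def\<close>)
  have S_eq': "S T t = S T' t" if "T \<in> R" "T' \<in> R" "t \<in> J T" "t \<in> J T'" for T T' t
    using S_eq[of T T' t] S_eq[of T' T t] that by (metis linear)
  \<comment> \<open>Uniqueness makes the chosen solutions agree where they are both defined, so they
    glue; being a solution depends only on the germ.\<close>
  have union: "\<exists>\<sigma>. \<sigma> t0 = s0 \<and> (\<forall>T\<in>Q. \<forall>t\<in>J T. sol \<sigma> t)" if Q: "Q \<subseteq> R" "Q \<noteq> {}" for Q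
  proof -
    define \<sigma> where "\<sigma> t = S (SOME T. T \<in> Q \<and> t \<in> J T) t" for t
    have \<sigma>: "\<sigma> t = S T t" if "T \<in> Q" "t \<in> J T" for T t
    proof -
      have "\<exists>T. T \<in> Q \<and> t \<in> J T" using that by blast
      from someI_ex[OF this] show ?thesis unfolding \<sigma>_def using S_eq' Q that by blast
    qed
    obtain T0 where T0: "T0 \<in> Q" using Q by blast
    then have "t0 \<in> J T0" using Q by (auto simp: J_def R_def)
    then have "\<sigma> t0 = s0" using \<sigma>[OF T0] S(1) T0 Q by auto
    moreover have "sol \<sigma> t" if "T \<in> Q" "t \<in> J T" for T t
    proof (rule germ)
      show "sol (S T) t" using S(2) that Q by blast
      have "\<forall>\<^sub>F s in nhds t. s \<in> J T"
        by (rule eventually_nhds_in_open) (use that in \<open>auto simp: J_def\<close>)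
      then show "\<forall>\<^sub>F s in nhds t. S T s = \<sigma> s"
        by (rule eventually_mono) (use \<sigma> that in simp)
    qed
    ultimately show ?thesis by blast
  qed
  have down: "T' \<in> R" if "T \<in> R" "0 < T'" "T' \<le> T" for T T'
    using that unfolding R_def J_def by fastforce
  obtain T0 where T0: "T0 \<in> R"
  proof -
    obtain \<epsilon> where \<epsilon>: "\<epsilon> > 0" "\<forall>t1\<in>{t0-\<epsilon><..<t0+\<epsilon>}. \<forall>s. adm t1 s \<longrightarrow>
        (\<exists>\<sigma>. \<sigma> t1 = s \<and> (\<forall>t\<in>{t0-\<epsilon><..<t0+\<epsilon>}. sol \<sigma> t))" using loc by blast
    then have "\<exists>\<sigma>. \<sigma> t0 = s0 \<and> (\<forall>t\<in>{t0-\<epsilon><..<t0+\<epsilon>}. sol \<sigma> t)" using s0 by simp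
    then show ?thesis using that[of \<epsilon>] \<epsilon> by (simp add: R_def J_def)
  qed
  have all: "T \<in> R" if T: "T > 0" for T
  proof (rule ccontr)
    assume nT: "T \<notin> R"
    then have bdd: "T' < T" if "T' \<in> R" for T' using down[OF that T] by force
    define M where "M = Sup R"
    have bddR: "bdd_above R" using bdd by (meson bdd_aboveI less_imp_le)
    have M0: "M > 0" using cSup_upper[OF T0 bddR] T0 by (auto simp: M_def R_def)
    have lessM: "T' \<in> R" if "0 < T'" "T' < M" for T'
    proof -
      have "T' < Sup R" "R \<noteq> {}" using that T0 by (auto simp: M_def)
      then obtain T'' where "T'' \<in> R" "T' < T''" by (rule less_cSupE)
      then show ?thesis using down that by simp
    qed
    obtain \<sigma> where \<sigma>: "\<sigma> t0 = s0" "\<And>t. t \<in> J M \<Longrightarrow> sol \<sigma> t"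
    proof -
      have "{0<..<M} \<subseteq> R" "{0<..<M} \<noteq> {}" using lessM M0 by auto
      then obtain \<sigma> where s: "\<sigma> t0 = s0" "\<forall>T\<in>{0<..<M}. \<forall>t\<in>J T. sol \<sigma> t" using union by blast
      have "sol \<sigma> t" if "t \<in> J M" for t
      proof -
        have "\<bar>t - t0\<bar> < M" using that by (auto simp: J_def abs_less_iff)
        then obtain T' where "\<bar>t - t0\<bar> < T'" "T' < M" using dense by blast
        then have "T' \<in> {0<..<M}" "t \<in> J T'" by (auto simp: J_def abs_less_iff)
        then show ?thesis using s(2) by blast
      qed
      then show ?thesis using that s by blast
    qed
    have admM: "adm t (\<sigma> t)" if "t \<in> J M" for t
      using adm[of "t0-M" "t0+M" \<sigma> t0 t] \<sigma> s0 M0 that by (auto simp: J_def)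
    \<comment> \<open>At an end point \<open>z\<close> of the maximal interval the local existence
      time is uniform near \<open>z\<close>, so a solution started at a time \<open>t1\<close>
      inside the interval, from the state reached there, extends beyond \<open>z\<close>.\<close>
    have ext: "\<exists>e>0. \<exists>\<sigma>'. (\<forall>t\<in>{z-e<..<z+e}. sol \<sigma>' t) \<and> e < M \<and>
        (\<forall>t\<in>{z-e<..<z+e} \<inter> J M. \<sigma>' t = \<sigma> t)" if z: "z = t0 - M \<or> z = t0 + M" for z
    proof -
      obtain \<epsilon>0 where \<epsilon>0: "\<epsilon>0 > 0" "\<forall>t1\<in>{z-\<epsilon>0<..<z+\<epsilon>0}. \<forall>s. adm t1 s \<longrightarrow>
        (\<exists>\<sigma>. \<sigma> t1 = s \<and> (\<forall>t\<in>{z-\<epsilon>0<..<z+\<epsilon>0}. sol \<sigma> t))" using loc by blast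
      \<comment> \<open>Staying below \<open>M\<close> guarantees that \<open>t1\<close>, at
        distance \<open>e/2\<close> from \<open>z\<close>, still lies in \<open>J M\<close>.\<close>
      define e where "e = min \<epsilon>0 (M/2)"
      define t1 where "t1 = (if z = t0 + M then z - e/2 else z + e/2)"
      have e: "e > 0" "e < M" "e \<le> \<epsilon>0" using \<epsilon>0 M0 by (auto simp: e_def)
      have t1: "t1 \<in> {z-e<..<z+e}" "t1 \<in> J M" using z e M0 by (auto simp: t1_def J_def)
      then have "t1 \<in> {z-\<epsilon>0<..<z+\<epsilon>0}" using e by auto
      then obtain \<sigma>' where s': "\<sigma>' t1 = \<sigma> t1" "\<forall>t\<in>{z-\<epsilon>0<..<z+\<epsilon>0}. sol \<sigma>' t"
        using \<epsilon>0(2) admM[OF t1(2)] by blast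
      have "\<sigma>' t = \<sigma> t" if t: "t \<in> {z-e<..<z+e} \<inter> J M" for t
      proof (rule uniq)
        show "t1 \<in> {max (z-e) (t0-M)<..<min (z+e) (t0+M)}" using t1 by (auto simp: J_def)
        show "t \<in> {max (z-e) (t0-M)<..<min (z+e) (t0+M)}" using t by (auto simp: J_def)
        fix s assume s: "s \<in> {max (z-e) (t0-M)<..<min (z+e) (t0+M)}"
        then have "s \<in> {z-\<epsilon>0<..<z+\<epsilon>0}" "s \<in> J M" using e by (auto simp: J_def)
        then show "sol \<sigma>' s \<and> sol \<sigma> s" using s'(2) \<sigma>(2) by blast
      qed (fact s'(1))
      moreover have "\<forall>t\<in>{z-e<..<z+e}. sol \<sigma>' t" using s'(2) e by auto
      ultimately show ?thesis using e by blast
    qed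
    obtain e1 \<sigma>1 where e1: "e1 > 0" "e1 < M" "\<forall>t\<in>{t0-M-e1<..<t0-M+e1}. sol \<sigma>1 t"
      "\<forall>t\<in>{t0-M-e1<..<t0-M+e1} \<inter> J M. \<sigma>1 t = \<sigma> t" using ext[of "t0-M"] by blast
    obtain e2 \<sigma>2 where e2: "e2 > 0" "e2 < M" "\<forall>t\<in>{t0+M-e2<..<t0+M+e2}. sol \<sigma>2 t"
      "\<forall>t\<in>{t0+M-e2<..<t0+M+e2} \<inter> J M. \<sigma>2 t = \<sigma> t" using ext[of "t0+M"] by blast
    \<comment> \<open>The two extensions agree with \<open>\<sigma>\<close> on the overlaps, so near
      each time \<open>\<tau>\<close> coincides with a single solution; it lives on
      \<open>J (M + e)\<close>, contradicting the choice of \<open>M\<close>.\<close>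
    define \<tau> where "\<tau> t = (if t \<le> t0 - M then \<sigma>1 t else if t0 + M \<le> t then \<sigma>2 t else \<sigma> t)" for t
    have "\<tau> t = \<sigma>1 t" if "t \<in> {t0-M-e1<..<t0-M+e1}" for t
      using e1 that M0 by (auto simp: \<tau>_def J_def)
    note \<tau>1 = this
    have "\<tau> t = \<sigma>2 t" if "t \<in> {t0+M-e2<..<t0+M+e2}" for t
      using e2 that M0 by (auto simp: \<tau>_def J_def)
    note \<tau>2 = this
    have \<tau>3: "\<tau> t = \<sigma> t" if "t \<in> J M" for t using that by (auto simp: \<tau>_def J_def)
    define e where "e = min e1 e2"
    have tr: "sol \<tau> t" if "open U" "t \<in> U" "sol \<rho> t" "\<And>s. s \<in> U \<Longrightarrow> \<tau> s = \<rho> s" for U t \<rho>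
      by (rule germ[OF that(3)], rule eventually_mono[OF eventually_nhds_in_open[OF that(1,2)]])
        (simp add: that(4))
    have "sol \<tau> t" if "t \<in> J (M + e)" for t
    proof -
      have "t0 - (M + e) < t" "t < t0 + (M + e)" "e \<le> e1" "e \<le> e2"
        using that by (auto simp: J_def e_def)
      then have "t \<in> {t0-M-e1<..<t0-M+e1} \<or> t \<in> J M \<or> t \<in> {t0+M-e2<..<t0+M+e2}"
        using e1(1) e2(1) unfolding J_def greaterThanLessThan_iff by linarith
      then show ?thesis
      proof (elim disjE)
        assume 1: "t \<in> {t0-M-e1<..<t0-M+e1}"
        show ?thesis by (rule tr[OF open_greaterThanLessThan 1 _ \<tau>1]) (use 1 e1(3) in blast)+
      next
        assume 1: "t \<in> J M"
        show ?thesis by (rule tr[OF _ 1 _ \<tau>3]) (use 1 \<sigma>(2) in \<open>simp_all add: J_def\<close>)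
      next
        assume 1: "t \<in> {t0+M-e2<..<t0+M+e2}"
        show ?thesis by (rule tr[OF open_greaterThanLessThan 1 _ \<tau>2]) (use 1 e2(3) in blast)+
      qed
    qed
    moreover have "\<tau> t0 = s0" using \<sigma> M0 by (simp add: \<tau>_def)
    ultimately have "M + e \<in> R" using M0 e1 e2 by (auto simp: R_def e_def)
    then have "M + e \<le> M" unfolding M_def by (rule cSup_upper[OF _ bddR])
    then show False using e1 e2 by (simp add: e_def)
  qed
  have "{0<..} \<subseteq> R" using all by auto
  then obtain \<sigma> where \<sigma>: "\<sigma> t0 = s0" "\<forall>T\<in>{0<..}. \<forall>t\<in>J T. sol \<sigma> t"
    using union[of "{0<..}"] by auto
  have "sol \<sigma> t" for t
  proof -
    have "t \<in> J (\<bar>t - t0\<bar> + 1)" by (auto simp: J_def abs_if)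
    then show ?thesis using \<sigma>(2) by (meson abs_ge_zero add_nonneg_pos greaterThan_iff zero_less_one)
  qed
  then show ?thesis using \<sigma>(1) by blast
qed

section \<open>Differential geometry of the base: tangent vectors, the geodesic field and its
  complete flow\<close>

section \<open>Charts, tangent vectors and smooth functions\<close>

context closed_manifold
begin

lemma chart_open: "c \<in> A \<Longrightarrow> open (fst c)"
  and chart_image_open: "c \<in> A \<Longrightarrow> open (snd c ` fst c)"
  and chart_inv_left: "c \<in> A \<Longrightarrow> x \<in> fst c \<Longrightarrow> chart_inv c (snd c x) = x"
  and chart_inv_right: "c \<in> A \<Longrightarrow> p \<in> snd c ` fst c \<Longrightarrow> snd c (chart_inv c p) = p"
  and chart_inv_in: "c \<in> A \<Longrightarrow> p \<in> snd c ` fst c \<Longrightarrow> chart_inv c p \<in> fst c"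
  and chart_continuous: "c \<in> A \<Longrightarrow> continuous_on (fst c) (snd c)"
  and chart_inv_continuous: "c \<in> A \<Longrightarrow> continuous_on (snd c ` fst c) (chart_inv c)"
  using chart[of c] unfolding homeomorphism_def by auto

lemma open_chart_image:
  assumes c: "c \<in> A" and U: "open U"
  shows "open (snd c ` (U \<inter> fst c))"
proof -
  have "snd c ` (U \<inter> fst c) = snd c ` fst c \<inter> chart_inv c -` U"
    using chart_inv_left[OF c] by force
  then show ?thesis
    using continuous_open_preimage[OF chart_inv_continuous[OF c] chart_image_open[OF c] U] by simp
qed

lemma open_chart_image2: "c \<in> A \<Longrightarrow> d \<in> A \<Longrightarrow> open (snd c ` (fst c \<inter> fst d))"
  using open_chart_image[of c "fst d"] chart_open by (simp add: Int_commute)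

lemma open_chart_preimage:
  assumes "c \<in> A" "open W" shows "open {x \<in> fst c. snd c x \<in> W}"
proof -
  have "{x \<in> fst c. snd c x \<in> W} = fst c \<inter> snd c -` W" by blast
  then show ?thesis
    using continuous_open_preimage[OF chart_continuous[OF assms(1)] chart_open[OF assms(1)] assms(2)]
    by (simp only:)
qed

lemma chart_image_cases:
  assumes "c \<in> A" "p \<in> snd c ` (U \<inter> fst c)"
  shows "chart_inv c p \<in> U" "chart_inv c p \<in> fst c" "snd c (chart_inv c p) = p"
  using assms chart_inv_left[OF assms(1)] by auto

lemma chart_at: "chart_at A x \<in> A" "x \<in> fst (chart_at A x)"
proof -
  have "x \<in> \<Union> (fst ` A)" using cover by simp
  then have "\<exists>c. c \<in> A \<and> x \<in> fst c" by blast
  from someI_ex[OF this] show "chart_at A x \<in> A" "x \<in> fst (chart_at A x)" by (auto simp: chart_at_def)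
qed

definition dtrans :: "('m, 'e) chart \<Rightarrow> ('m, 'e) chart \<Rightarrow> 'e \<Rightarrow> 'e \<Rightarrow> 'e" where
  "dtrans c d p = frechet_derivative (snd d \<circ> chart_inv c) (at p)"

lemma trans_has_derivative:
  assumes "c \<in> A" "d \<in> A" "x \<in> fst c" "x \<in> fst d"
  shows "((snd d \<circ> chart_inv c) has_derivative dtrans c d (snd c x)) (at (snd c x))"
  unfolding dtrans_def
  by (rule smooth_on_has_derivative[OF transition[OF assms(1,2)]]) (use assms in blast)

lemma dtrans_linear:
  assumes "c \<in> A" "d \<in> A" "x \<in> fst c" "x \<in> fst d"
  shows "linear (dtrans c d (snd c x))"
  using trans_has_derivative[OF assms] by (rule has_derivative_linear)

text \<open>The cocycle identity of the coordinate changes. It is what makes the family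
  \<open>vec_of\<close> satisfy the compatibility required of a tangent vector.\<close>

lemma dtrans_chain:
  assumes "c \<in> A" "d \<in> A" "e \<in> A" "x \<in> fst c" "x \<in> fst d" "x \<in> fst e"
  shows "dtrans d e (snd d x) (dtrans c d (snd c x) \<xi>) = dtrans c e (snd c x) \<xi>"
proof -
  have 1: "((snd e \<circ> chart_inv d) has_derivative dtrans d e (snd d x)) (at ((snd d \<circ> chart_inv c) (snd c x)))"
    using trans_has_derivative[OF assms(2,3,5,6)] chart_inv_left assms by simp
  have 2: "((\<lambda>p. (snd e \<circ> chart_inv d) ((snd d \<circ> chart_inv c) p)) has_derivative
      (\<lambda>\<xi>. dtrans d e (snd d x) (dtrans c d (snd c x) \<xi>))) (at (snd c x))"
    by (rule has_derivative_compose[OF trans_has_derivative[OF assms(1,2,4,5)] 1])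
  have "((snd e \<circ> chart_inv c) has_derivative
      (\<lambda>\<xi>. dtrans d e (snd d x) (dtrans c d (snd c x) \<xi>))) (at (snd c x))"
    by (rule has_derivative_transform_within_open[OF 2 open_chart_image2[OF assms(1,2)]])
      (use assms chart_inv_left[OF assms(1)] chart_inv_left[OF assms(2)] in auto)
  from frechet_derivative_eqI[OF this] show ?thesis by (simp add: dtrans_def fun_eq_iff)
qed

lemma dtrans_self:
  assumes "c \<in> A" "x \<in> fst c" shows "dtrans c c (snd c x) \<xi> = \<xi>"
proof -
  have "((snd c \<circ> chart_inv c) has_derivative (\<lambda>\<xi>. \<xi>)) (at (snd c x))"
    by (rule has_derivative_transform_within_open[OF has_derivative_ident chart_image_open[OF assms(1)]])
      (use assms chart_inv_right in auto)
  from frechet_derivative_eqI[OF this] show ?thesis by (simp add: dtrans_def fun_eq_iff)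
qed

lemma vec_of_eq: "vec_of A c x \<xi> d = (if d \<in> A \<and> x \<in> fst d then dtrans c d (snd c x) \<xi> else 0)"
  by (simp add: vec_of_def dtrans_def)

lemma vec_of_self: "c \<in> A \<Longrightarrow> x \<in> fst c \<Longrightarrow> vec_of A c x \<xi> c = \<xi>"
  by (simp add: vec_of_eq dtrans_self)

lemma tangent_spaceD:
  "w \<in> tangent_space A x \<Longrightarrow> c \<in> A \<Longrightarrow> d \<in> A \<Longrightarrow> x \<in> fst c \<Longrightarrow> x \<in> fst d \<Longrightarrow>
    w d = dtrans c d (snd c x) (w c)"
  "w \<in> tangent_space A x \<Longrightarrow> \<not> (c \<in> A \<and> x \<in> fst c) \<Longrightarrow> w c = 0"
  unfolding tangent_space_def dtrans_def by blast+

lemma vec_of_in: "c \<in> A \<Longrightarrow> x \<in> fst c \<Longrightarrow> vec_of A c x \<xi> \<in> tangent_space A x"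
  unfolding tangent_space_def
  by (auto simp: vec_of_eq dtrans_chain simp flip: dtrans_def)

lemma vec_of_coord:
  assumes "w \<in> tangent_space A x" "c \<in> A" "x \<in> fst c"
  shows "vec_of A c x (w c) = w"
proof
  fix d
  show "vec_of A c x (w c) d = w d"
  proof (cases "d \<in> A \<and> x \<in> fst d")
    case True
    then show ?thesis using tangent_spaceD(1)[OF assms(1,2) _ assms(3), of d] by (simp add: vec_of_eq)
  next
    case False
    then show ?thesis using tangent_spaceD(2)[OF assms(1) False] by (auto simp: vec_of_eq)
  qed
qed

lemma tangent_space_lincomb:
  assumes "w \<in> tangent_space A x" "w' \<in> tangent_space A x"
  shows "(\<lambda>c. a *\<^sub>R w c + w' c) \<in> tangent_space A x"
proof -
  have "a *\<^sub>R w d + w' d = dtrans c d (snd c x) (a *\<^sub>R w c + w' c)"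
    if "c \<in> A" "d \<in> A" "x \<in> fst c" "x \<in> fst d" for c d
    using tangent_spaceD(1)[OF assms(1) that] tangent_spaceD(1)[OF assms(2) that] dtrans_linear[OF that]
    by (simp add: linear_add linear_cmul)
  moreover have "a *\<^sub>R w c + w' c = 0" if "\<not> (c \<in> A \<and> x \<in> fst c)" for c
    using tangent_spaceD(2)[OF assms(1) that] tangent_spaceD(2)[OF assms(2) that] by simp
  ultimately show ?thesis unfolding tangent_space_def dtrans_def[symmetric] mem_Collect_eq by blast
qed

lemma vec_of_lincomb:
  assumes "c \<in> A" "x \<in> fst c"
  shows "vec_of A c x (a *\<^sub>R \<xi> + \<eta>) = (\<lambda>d. a *\<^sub>R vec_of A c x \<xi> d + vec_of A c x \<eta> d)"
proof
  fix d
  show "vec_of A c x (a *\<^sub>R \<xi> + \<eta>) d = a *\<^sub>R vec_of A c x \<xi> d + vec_of A c x \<eta> d"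
    using dtrans_linear[OF assms(1) _ assms(2), of d] by (simp add: vec_of_eq linear_add linear_cmul)
qed

lemma tangent_space_eqI:
  assumes "w \<in> tangent_space A x" "w' \<in> tangent_space A x" "c \<in> A" "x \<in> fst c" "w c = w' c"
  shows "w = w'"
  using vec_of_coord[OF assms(1,3,4)] vec_of_coord[OF assms(2,3,4)] assms(5) by metis

lemma vec_of_trans:
  assumes "c \<in> A" "d \<in> A" "x \<in> fst c" "x \<in> fst d"
  shows "vec_of A d x (dtrans c d (snd c x) \<xi>) = vec_of A c x \<xi>"
  by (rule tangent_space_eqI[OF vec_of_in vec_of_in, of _ _ _ d]) (use assms in \<open>auto simp: vec_of_eq dtrans_self\<close>)

lemma smooth_funD: "smooth_fun U f \<Longrightarrow> c \<in> A \<Longrightarrow> smooth_on (f \<circ> chart_inv c) (snd c ` (U \<inter> fst c))"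
  by (simp add: smooth_fun_def)

lemma smooth_fun_has_derivative:
  assumes "smooth_fun U f" "c \<in> A" "x \<in> U" "x \<in> fst c"
  shows "((f \<circ> chart_inv c) has_derivative frechet_derivative (f \<circ> chart_inv c) (at (snd c x))) (at (snd c x))"
  by (rule smooth_on_has_derivative[OF smooth_funD[OF assms(1,2)]]) (use assms in blast)

text \<open>\<open>deriv_along\<close> is defined through one chosen chart; the chain rule for the
  coordinate change transfers the derivative to any other chart.\<close>

lemma deriv_along_has_derivative:
  assumes f: "((f \<circ> chart_inv c) has_derivative f') (at (snd c x))"
    and c: "c \<in> A" "x \<in> fst c" and w: "w \<in> tangent_space A x"
  shows "deriv_along A f x w = f' (w c)"
proof -
  define d where "d = chart_at A x"
  have d: "d \<in> A" "x \<in> fst d" using chart_at by (auto simp: d_def)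
  have 1: "((f \<circ> chart_inv c) has_derivative f') (at ((snd c \<circ> chart_inv d) (snd d x)))"
    using f chart_inv_left d by simp
  have 2: "((\<lambda>p. (f \<circ> chart_inv c) ((snd c \<circ> chart_inv d) p)) has_derivative
      (\<lambda>\<xi>. f' (dtrans d c (snd d x) \<xi>))) (at (snd d x))"
    by (rule has_derivative_compose[OF trans_has_derivative[OF d(1) c(1) d(2) c(2)] 1])
  have "((f \<circ> chart_inv d) has_derivative (\<lambda>\<xi>. f' (dtrans d c (snd d x) \<xi>))) (at (snd d x))"
    by (rule has_derivative_transform_within_open[OF 2 open_chart_image2[OF d(1) c(1)]])
      (use c d chart_inv_left[OF d(1)] chart_inv_left[OF c(1)] in auto)
  from frechet_derivative_eqI[OF this] show ?thesis
    using tangent_spaceD(1)[OF w d(1) c(1) d(2) c(2)] by (simp add: deriv_along_def Let_def flip: d_def)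
qed

lemma deriv_along_chart:
  assumes "smooth_fun U f" "x \<in> U" "c \<in> A" "x \<in> fst c" "w \<in> tangent_space A x"
  shows "deriv_along A f x w = frechet_derivative (f \<circ> chart_inv c) (at (snd c x)) (w c)"
  by (rule deriv_along_has_derivative[OF smooth_fun_has_derivative[OF assms(1,3,2,4)] assms(3-5)])

lemma smooth_fun_subset: "smooth_fun U f \<Longrightarrow> V \<subseteq> U \<Longrightarrow> smooth_fun V f"
  unfolding smooth_fun_def by (auto intro: smooth_on_subset)

lemma smooth_fun_cong:
  assumes "open U" "\<And>y. y \<in> U \<Longrightarrow> f y = g y" "smooth_fun U f" shows "smooth_fun U g"
  unfolding smooth_fun_def
proof
  fix c assume c: "c \<in> A"
  show "smooth_on (g \<circ> chart_inv c) (snd c ` (U \<inter> fst c))"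
    by (rule smooth_on_cong[OF open_chart_image[OF c assms(1)] _ smooth_funD[OF assms(3) c]])
      (use assms(2) chart_image_cases[OF c] in auto)
qed

lemma smooth_fun_local:
  assumes "open U" "\<And>x. x \<in> U \<Longrightarrow> \<exists>W. open W \<and> x \<in> W \<and> smooth_fun W f"
  shows "smooth_fun U f"
  unfolding smooth_fun_def
proof
  fix c assume c: "c \<in> A"
  show "smooth_on (f \<circ> chart_inv c) (snd c ` (U \<inter> fst c))"
  proof (rule smooth_on_local[OF _ open_chart_image[OF c assms(1)]])
    fix p assume p: "p \<in> snd c ` (U \<inter> fst c)"
    then obtain W where W: "open W" "chart_inv c p \<in> W" "smooth_fun W f"
      using assms(2)[OF chart_image_cases(1)[OF c p]] by blast
    have "open (snd c ` (W \<inter> fst c))" by (rule open_chart_image[OF c W(1)])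
    moreover have "p \<in> snd c ` (W \<inter> fst c)"
      using W(2) chart_image_cases(2,3)[OF c p] by (intro image_eqI[of _ _ "chart_inv c p"]) auto
    moreover have "smooth_on (f \<circ> chart_inv c) (snd c ` (W \<inter> fst c) \<inter> snd c ` (U \<inter> fst c))"
      by (rule smooth_on_subset[OF smooth_funD[OF W(3) c]]) blast
    ultimately show "\<exists>W. open W \<and> p \<in> W \<and> smooth_on (f \<circ> chart_inv c) (W \<inter> snd c ` (U \<inter> fst c))"
      by blast
  qed
qed

lemma smooth_fun_chart:
  assumes c: "c \<in> A" and U: "open U" "U \<subseteq> fst c" and f: "smooth_on (f \<circ> chart_inv c) (snd c ` U)"
  shows "smooth_fun U f"
  unfolding smooth_fun_def
proof
  fix d assume d: "d \<in> A"
  have o: "open (snd d ` (U \<inter> fst d))" by (rule open_chart_image[OF d U(1)])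
  have "smooth_on (\<lambda>p. (f \<circ> chart_inv c) ((snd c \<circ> chart_inv d) p)) (snd d ` (U \<inter> fst d))"
  proof (rule smooth_on_compose[OF o f])
    show "smooth_on (snd c \<circ> chart_inv d) (snd d ` (U \<inter> fst d))"
      by (rule smooth_on_subset[OF transition[OF d c]]) (use U in blast)
    show "(snd c \<circ> chart_inv d) ` snd d ` (U \<inter> fst d) \<subseteq> snd c ` U"
      using chart_inv_left[OF d] by auto
  qed
  then show "smooth_on (f \<circ> chart_inv d) (snd d ` (U \<inter> fst d))"
    by (rule smooth_on_cong[OF o, rotated])
      (use U chart_inv_left[OF c] chart_inv_left[OF d] in auto)
qed

lemma smooth_fun_const: "smooth_fun U (\<lambda>x. a)"
  by (simp add: smooth_fun_def comp_def smooth_on_const)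

lemma smooth_fun_bilinear:
  "bounded_bilinear B \<Longrightarrow> open U \<Longrightarrow> smooth_fun U f \<Longrightarrow> smooth_fun U g \<Longrightarrow> smooth_fun U (\<lambda>x. B (f x) (g x))"
  unfolding smooth_fun_def comp_def
  by (intro ballI smooth_on_bilinear[of B _ "\<lambda>p. f (chart_inv _ p)" "\<lambda>p. g (chart_inv _ p)"] open_chart_image)
    (assumption | drule (1) bspec)+

lemma smooth_fun_linear:
  "bounded_linear L \<Longrightarrow> open U \<Longrightarrow> smooth_fun U f \<Longrightarrow> smooth_fun U (\<lambda>x. L (f x))"
  unfolding smooth_fun_def comp_def
  by (intro ballI smooth_on_linear_compose[of L _ "\<lambda>p. f (chart_inv _ p)"] open_chart_image)
    (assumption | drule (1) bspec)+

lemma smooth_fun_add: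
  "open U \<Longrightarrow> smooth_fun U f \<Longrightarrow> smooth_fun U g \<Longrightarrow> smooth_fun U (\<lambda>x. f x + g x)"
  unfolding smooth_fun_def comp_def
  by (intro ballI smooth_on_add[of _ "\<lambda>p. f (chart_inv _ p)" "\<lambda>p. g (chart_inv _ p)"] open_chart_image)
    (assumption | drule (1) bspec)+

lemma smooth_fun_sum:
  "open U \<Longrightarrow> (\<And>i. i \<in> I \<Longrightarrow> smooth_fun U (f i)) \<Longrightarrow> smooth_fun U (\<lambda>x. \<Sum>i\<in>I. f i x)"
  unfolding smooth_fun_def comp_def
  by (intro ballI smooth_on_sum[of _ I "\<lambda>i p. f i (chart_inv _ p)"] open_chart_image) blast+

lemma deriv_along_cong:
  assumes "open U" "x \<in> U" "\<And>y. y \<in> U \<Longrightarrow> f y = g y"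
  shows "deriv_along A f x w = deriv_along A g x w"
proof -
  let ?c = "chart_at A x"
  have "frechet_derivative (f \<circ> chart_inv ?c) (at (snd ?c x)) = frechet_derivative (g \<circ> chart_inv ?c) (at (snd ?c x))"
    by (rule frechet_derivative_cong_open[OF open_chart_image[OF chart_at(1) assms(1), of x]])
      (use assms chart_at[of x] chart_image_cases[OF chart_at(1)] in auto)
  then show ?thesis by (simp add: deriv_along_def Let_def)
qed

lemma deriv_along_const: "deriv_along A (\<lambda>y. a) x w = 0"
  by (simp add: deriv_along_def Let_def comp_def frechet_derivative_const)

lemma deriv_along_bilinear:
  assumes B: "bounded_bilinear B" and "smooth_fun U f" "smooth_fun U g" "x \<in> U" "w \<in> tangent_space A x"
  shows "deriv_along A (\<lambda>y. B (f y) (g y)) x w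
    = B (f x) (deriv_along A g x w) + B (deriv_along A f x w) (g x)"
proof -
  let ?c = "chart_at A x"
  note c = chart_at[of x]
  have "((\<lambda>y. B (f y) (g y)) \<circ> chart_inv ?c has_derivative
     (\<lambda>v. B (f x) (frechet_derivative (g \<circ> chart_inv ?c) (at (snd ?c x)) v)
        + B (frechet_derivative (f \<circ> chart_inv ?c) (at (snd ?c x)) v) (g x))) (at (snd ?c x))"
    using bounded_bilinear.FDERIV[OF B smooth_fun_has_derivative[OF assms(2) c(1) assms(4) c(2)]
        smooth_fun_has_derivative[OF assms(3) c(1) assms(4) c(2)]] chart_inv_left[OF c]
    by (simp add: comp_def)
  from deriv_along_has_derivative[OF this c assms(5)] show ?thesis
    using deriv_along_chart[OF assms(2,4) c assms(5)] deriv_along_chart[OF assms(3,4) c assms(5)] by simp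
qed

lemma deriv_along_linear_compose:
  assumes L: "bounded_linear L" and "smooth_fun U f" "x \<in> U" "w \<in> tangent_space A x"
  shows "deriv_along A (\<lambda>y. L (f y)) x w = L (deriv_along A f x w)"
proof -
  let ?c = "chart_at A x"
  note c = chart_at[of x]
  have "((\<lambda>y. L (f y)) \<circ> chart_inv ?c has_derivative
     (\<lambda>v. L (frechet_derivative (f \<circ> chart_inv ?c) (at (snd ?c x)) v))) (at (snd ?c x))"
    using bounded_linear.has_derivative[OF L smooth_fun_has_derivative[OF assms(2) c(1) assms(3) c(2)]]
    by (simp add: comp_def)
  from deriv_along_has_derivative[OF this c assms(4)] show ?thesis
    using deriv_along_chart[OF assms(2,3) c assms(4)] by simp
qed

lemma deriv_along_lincomb:
  assumes "smooth_fun U f" "x \<in> U" "w \<in> tangent_space A x" "w' \<in> tangent_space A x"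
  shows "deriv_along A f x (\<lambda>c. a *\<^sub>R w c + w' c) = a *\<^sub>R deriv_along A f x w + deriv_along A f x w'"
proof -
  let ?c = "chart_at A x"
  note c = chart_at[of x]
  have l: "linear (frechet_derivative (f \<circ> chart_inv ?c) (at (snd ?c x)))"
    using smooth_fun_has_derivative[OF assms(1) c(1) assms(2) c(2)] has_derivative_linear by blast
  show ?thesis
    unfolding deriv_along_def Let_def linear_add[OF l] linear_cmul[OF l] ..
qed

text \<open>A Euclidean cut-off transplanted by a chart. The preimage \<open>K\<close> of a closed
  ball is compact, hence closed because the manifold is Hausdorff, so the extension by zero is
  smooth across the boundary of the chart domain.\<close>

lemma bump_function:
  assumes "open W" "x \<in> W"
  obtains \<psi> :: "'m \<Rightarrow> real" and V K where "smooth_fun UNIV \<psi>" "open V" "x \<in> V" "\<And>y. y \<in> V \<Longrightarrow> \<psi> y = 1"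
    "closed K" "K \<subseteq> W" "V \<subseteq> K" "\<And>y. y \<notin> K \<Longrightarrow> \<psi> y = 0"
proof -
  define c where "c = chart_at A x"
  have c: "c \<in> A" "x \<in> fst c" using chart_at by (auto simp: c_def)
  have "open (snd c ` (W \<inter> fst c))" "snd c x \<in> snd c ` (W \<inter> fst c)"
    using open_chart_image[OF c(1) assms(1)] c assms by auto
  then obtain \<rho> where \<rho>: "\<rho> > 0" "cball (snd c x) \<rho> \<subseteq> snd c ` (W \<inter> fst c)"
    using open_contains_cball by blast
  obtain \<psi> :: "'e \<Rightarrow> real" where \<psi>: "smooth_on \<psi> UNIV" "\<And>y. y \<in> cball (snd c x) (\<rho>/2) \<Longrightarrow> \<psi> y = 1"
    "\<And>y. y \<notin> ball (snd c x) \<rho> \<Longrightarrow> \<psi> y = 0"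
    using cutoff_function[of "\<rho>/2" \<rho> "snd c x"] \<rho> by auto
  define \<phi> where "\<phi> y = (if y \<in> fst c then \<psi> (snd c y) else 0)" for y
  define K where "K = chart_inv c ` cball (snd c x) \<rho>"
  define V where "V = {y \<in> fst c. snd c y \<in> ball (snd c x) (\<rho>/2)}"
  have sub: "cball (snd c x) \<rho> \<subseteq> snd c ` fst c" using \<rho> by blast
  have "compact K" unfolding K_def
    by (rule compact_continuous_image[OF continuous_on_subset[OF chart_inv_continuous[OF c(1)] sub] compact_cball])
  then have K: "closed K" by (rule compact_imp_closed)
  have inK: "y \<in> K" if "y \<in> fst c" "snd c y \<in> cball (snd c x) \<rho>" for y
    using that chart_inv_left[OF c(1)] unfolding K_def by (metis imageI)
  have out: "\<phi> y = 0" if "y \<notin> K" for y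
  proof (cases "y \<in> fst c")
    case True
    then have "snd c y \<notin> ball (snd c x) \<rho>" using inK[OF True] that by auto
    then show ?thesis using \<psi>(3) True by (simp add: \<phi>_def)
  qed (simp add: \<phi>_def)
  have s1: "smooth_fun (fst c) \<phi>"
  proof (rule smooth_fun_chart[OF c(1) chart_open[OF c(1)] order_refl])
    show "smooth_on (\<phi> \<circ> chart_inv c) (snd c ` fst c)"
      by (rule smooth_on_cong[OF chart_image_open[OF c(1)] _ smooth_on_subset[OF \<psi>(1)]])
        (use chart_inv_left[OF c(1)] in \<open>auto simp: \<phi>_def\<close>)
  qed
  have s2: "smooth_fun (- K) \<phi>"
    by (rule smooth_fun_cong[OF _ _ smooth_fun_const[of _ 0]]) (use K out in auto)
  have "smooth_fun UNIV \<phi>"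
  proof (rule smooth_fun_local)
    fix y
    have "y \<in> fst c \<or> y \<in> - K" using sub chart_inv_in[OF c(1)] unfolding K_def by blast
    then show "\<exists>W. open W \<and> y \<in> W \<and> smooth_fun W \<phi>"
      using s1 s2 chart_open[OF c(1)] K by (metis open_Compl)
  qed simp
  moreover have "open V" unfolding V_def by (rule open_chart_preimage[OF c(1) open_ball])
  moreover have "x \<in> V" using c \<rho> by (simp add: V_def)
  moreover have "\<phi> y = 1" if "y \<in> V" for y using that \<psi>(2)[of "snd c y"] by (simp add: V_def \<phi>_def)
  moreover have "K \<subseteq> W" using \<rho>(2) chart_image_cases(1)[OF c(1)] unfolding K_def by blast
  moreover have "V \<subseteq> K" using inK \<rho>(1) by (auto simp: V_def)
  ultimately show ?thesis using that K out by blast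
qed

lemma smooth_fun_extend:
  assumes "open W" "smooth_fun W f" "smooth_fun UNIV \<psi>" "closed K" "K \<subseteq> W" "\<And>y. y \<notin> K \<Longrightarrow> \<psi> y = 0"
  shows "smooth_fun UNIV (\<lambda>y. if y \<in> W then \<psi> y *\<^sub>R f y else 0)"
proof (rule smooth_fun_local)
  fix y
  let ?f = "\<lambda>y. if y \<in> W then \<psi> y *\<^sub>R f y else 0"
  have "smooth_fun W (\<lambda>y. \<psi> y *\<^sub>R f y)"
    by (rule smooth_fun_bilinear[OF bounded_bilinear_scaleR assms(1) smooth_fun_subset[OF assms(3)] assms(2)]) simp
  then have 1: "smooth_fun W ?f" by (rule smooth_fun_cong[OF assms(1), rotated]) simp
  have 2: "smooth_fun (- K) ?f"
    by (rule smooth_fun_cong[OF _ _ smooth_fun_const[of _ 0]]) (use assms in auto)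
  have "y \<in> W \<or> y \<in> - K" using assms by blast
  then show "\<exists>W. open W \<and> y \<in> W \<and> smooth_fun W ?f"
    using 1 2 assms(1,4) by (metis open_Compl)
qed simp

end

section \<open>The geodesic field in a chart\<close>

context closed_riemannian_manifold
begin

definition metric_deriv :: "('m, 'e) chart \<Rightarrow> 'e \<Rightarrow> 'e \<Rightarrow> 'e \<Rightarrow> 'e \<Rightarrow> real" where
  "metric_deriv c p v \<xi> \<eta> = frechet_derivative (\<lambda>q. metric_coord c q \<xi> \<eta>) (at p) v"

lemma metric_coord_smooth: "c \<in> A \<Longrightarrow> smooth_on (\<lambda>p. metric_coord c p \<xi> \<eta>) (snd c ` fst c)"
  unfolding metric_coord_def by (rule metric_smooth)

lemma metric_coord_eq:
  assumes "c \<in> A" "x \<in> fst c" "w \<in> tangent_space A x" "w' \<in> tangent_space A x"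
  shows "g x w w' = metric_coord c (snd c x) (w c) (w' c)"
  using assms by (simp add: metric_coord_def chart_inv_left vec_of_coord)

lemma metric_coord_sym:
  assumes "c \<in> A" "p \<in> snd c ` fst c" shows "metric_coord c p \<xi> \<eta> = metric_coord c p \<eta> \<xi>"
  unfolding metric_coord_def
  by (rule metric_sym) (rule vec_of_in[OF assms(1) chart_inv_in[OF assms]])+

lemma metric_coord_lincomb:
  assumes "c \<in> A" "p \<in> snd c ` fst c"
  shows "metric_coord c p (a *\<^sub>R \<xi> + \<eta>) \<zeta> = a * metric_coord c p \<xi> \<zeta> + metric_coord c p \<eta> \<zeta>"
proof -
  have x: "chart_inv c p \<in> fst c" by (rule chart_inv_in[OF assms])
  show ?thesis unfolding metric_coord_def vec_of_lincomb[OF assms(1) x]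
    by (rule metric_linear) (rule vec_of_in[OF assms(1) x])+
qed

lemma metric_coord_0: "c \<in> A \<Longrightarrow> p \<in> snd c ` fst c \<Longrightarrow> metric_coord c p 0 \<zeta> = 0"
  using metric_coord_lincomb[of c p "-1" 0 0 \<zeta>] by simp

lemma metric_coord_linear1:
  assumes "c \<in> A" "p \<in> snd c ` fst c" shows "linear (\<lambda>\<xi>. metric_coord c p \<xi> \<zeta>)"
  using metric_coord_lincomb[OF assms, of 1] metric_coord_lincomb[OF assms, of _ _ 0] metric_coord_0[OF assms]
  by (intro linearI) simp_all

lemma metric_coord_linear2:
  assumes "c \<in> A" "p \<in> snd c ` fst c" shows "linear (metric_coord c p \<zeta>)"
proof -
  have "metric_coord c p \<zeta> = (\<lambda>\<xi>. metric_coord c p \<xi> \<zeta>)"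
    by (rule ext) (rule metric_coord_sym[OF assms])
  then show ?thesis using metric_coord_linear1[OF assms, of \<zeta>] by (simp only:)
qed

lemma metric_coord_pos:
  assumes "c \<in> A" "p \<in> snd c ` fst c" "\<xi> \<noteq> 0" shows "metric_coord c p \<xi> \<xi> > 0"
proof -
  have x: "chart_inv c p \<in> fst c" by (rule chart_inv_in[OF assms(1,2)])
  show ?thesis unfolding metric_coord_def
    by (rule metric_pos[OF vec_of_in[OF assms(1) x]])
      (use vec_of_self[OF assms(1) x, of \<xi>] assms(3) in auto)
qed

lemma metric_deriv_linear:
  assumes "c \<in> A" "p \<in> snd c ` fst c"
  shows "linear (\<lambda>v. metric_deriv c p v \<xi> \<eta>)"
  unfolding metric_deriv_def
  using has_derivative_linear[OF smooth_on_has_derivative[OF metric_coord_smooth[OF assms(1)] assms(2)]] .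

lemma metric_deriv_lincomb:
  assumes "c \<in> A" "p \<in> snd c ` fst c"
  shows "metric_deriv c p v (a *\<^sub>R \<xi> + \<eta>) \<zeta> = a * metric_deriv c p v \<xi> \<zeta> + metric_deriv c p v \<eta> \<zeta>"
proof -
  have 1: "((\<lambda>q. metric_coord c q \<xi> \<zeta>) has_derivative (\<lambda>v. metric_deriv c p v \<xi> \<zeta>)) (at p)" for \<xi>
    using smooth_on_has_derivative[OF metric_coord_smooth[OF assms(1)] assms(2)]
    by (simp add: metric_deriv_def)
  have 2: "((\<lambda>q. a * metric_coord c q \<xi> \<zeta> + metric_coord c q \<eta> \<zeta>) has_derivative
      (\<lambda>v. a * metric_deriv c p v \<xi> \<zeta> + metric_deriv c p v \<eta> \<zeta>)) (at p)"
    by (rule has_derivative_add[OF has_derivative_mult_right[OF 1] 1])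
  have "((\<lambda>q. metric_coord c q (a *\<^sub>R \<xi> + \<eta>) \<zeta>) has_derivative
      (\<lambda>v. a * metric_deriv c p v \<xi> \<zeta> + metric_deriv c p v \<eta> \<zeta>)) (at p)"
    by (rule has_derivative_transform_within_open[OF 2 chart_image_open[OF assms(1)] assms(2)])
      (simp add: metric_coord_lincomb[OF assms(1)])
  from frechet_derivative_eqI[OF this] show ?thesis by (simp add: metric_deriv_def)
qed

lemma metric_deriv_sym:
  assumes "c \<in> A" "p \<in> snd c ` fst c"
  shows "metric_deriv c p v \<xi> \<eta> = metric_deriv c p v \<eta> \<xi>"
  unfolding metric_deriv_def
  using frechet_derivative_cong_open[OF chart_image_open[OF assms(1)] assms(2),
      of "\<lambda>q. metric_coord c q \<xi> \<eta>" "\<lambda>q. metric_coord c q \<eta> \<xi>"] metric_coord_sym[OF assms(1)] by simp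

lemma metric_deriv_linear1:
  assumes "c \<in> A" "p \<in> snd c ` fst c" shows "linear (\<lambda>\<xi>. metric_deriv c p v \<xi> \<zeta>)"
proof -
  have "metric_deriv c p v 0 \<zeta> = 0" using metric_deriv_lincomb[OF assms, of v "-1" 0 0 \<zeta>] by simp
  then show ?thesis
    using metric_deriv_lincomb[OF assms, of v 1] metric_deriv_lincomb[OF assms, of v _ _ 0]
    by (intro linearI) simp_all
qed

lemma metric_deriv_linear2:
  assumes "c \<in> A" "p \<in> snd c ` fst c" shows "linear (\<lambda>\<zeta>. metric_deriv c p v \<xi> \<zeta>)"
proof -
  have "(\<lambda>\<zeta>. metric_deriv c p v \<xi> \<zeta>) = (\<lambda>\<zeta>. metric_deriv c p v \<zeta> \<xi>)"
    by (rule ext) (rule metric_deriv_sym[OF assms])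
  then show ?thesis using metric_deriv_linear1[OF assms, of v \<xi>] by (simp only:)
qed

lemma bilinear_Basis_sum:
  fixes B :: "'a::euclidean_space \<Rightarrow> 'a \<Rightarrow> real"
  assumes "\<And>y. linear (\<lambda>x. B x y)" "\<And>x. linear (B x)"
  shows "B u v = (\<Sum>i\<in>Basis. \<Sum>j\<in>Basis. (u \<bullet> i) * (v \<bullet> j) * B i j)"
proof -
  have Bv: "B i v = (\<Sum>j\<in>Basis. (v \<bullet> j) *\<^sub>R B i j)" for i by (rule linear_Basis_sum[OF assms(2)])
  have "B u v = (\<Sum>i\<in>Basis. (u \<bullet> i) *\<^sub>R B i v)" by (rule linear_Basis_sum[OF assms(1)])
  also have "\<dots> = (\<Sum>i\<in>Basis. (u \<bullet> i) *\<^sub>R (\<Sum>j\<in>Basis. (v \<bullet> j) *\<^sub>R B i j))"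
    by (simp only: Bv)
  finally show ?thesis by (simp add: sum_distrib_left mult.assoc)
qed

lemma metric_coord_expand:
  assumes "c \<in> A" "p \<in> snd c ` fst c"
  shows "metric_coord c p u v = (\<Sum>i\<in>Basis. \<Sum>j\<in>Basis. (u \<bullet> i) * (v \<bullet> j) * metric_coord c p i j)"
  by (rule bilinear_Basis_sum[OF metric_coord_linear1[OF assms] metric_coord_linear2[OF assms]])

text \<open>Smoothness of the metric is given only for fixed coordinate vectors. The product rule is
  therefore applied to the expansion in the basis, and the resulting sums are folded back.\<close>

lemma metric_coord_has_derivative:
  assumes c: "c \<in> A" "q t \<in> snd c ` fst c"
    and q: "(q has_derivative q') (at t)" and u: "(u has_derivative u') (at t)"
    and v: "(v has_derivative v') (at t)"
  shows "((\<lambda>s. metric_coord c (q s) (u s) (v s)) has_derivative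
    (\<lambda>h. metric_deriv c (q t) (q' h) (u t) (v t) + metric_coord c (q t) (u' h) (v t)
       + metric_coord c (q t) (u t) (v' h))) (at t)"
proof -
  let ?m = "\<lambda>i j p. metric_coord c p i j"
  have m: "((\<lambda>s. ?m i j (q s)) has_derivative (\<lambda>h. metric_deriv c (q t) (q' h) i j)) (at t)" for i j
    using has_derivative_compose[OF q smooth_on_has_derivative[OF metric_coord_smooth[OF c(1)] c(2), of i j]]
    by (simp add: metric_deriv_def)
  have "((\<lambda>s. (u s \<bullet> i) * (v s \<bullet> j) * ?m i j (q s)) has_derivative
      (\<lambda>h. (u t \<bullet> i) * (v t \<bullet> j) * metric_deriv c (q t) (q' h) i j
        + (u' h \<bullet> i) * (v t \<bullet> j) * ?m i j (q t) + (u t \<bullet> i) * (v' h \<bullet> j) * ?m i j (q t))) (at t)" for i j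
    using has_derivative_mult[OF has_derivative_mult[OF has_derivative_inner_left[OF u, of i]
          has_derivative_inner_left[OF v, of j]] m[of i j]]
    by (rule has_derivative_eq_rhs) (simp add: algebra_simps fun_eq_iff)
  then have 1: "((\<lambda>s. \<Sum>i\<in>Basis. \<Sum>j\<in>Basis. (u s \<bullet> i) * (v s \<bullet> j) * ?m i j (q s)) has_derivative
      (\<lambda>h. \<Sum>i\<in>Basis. \<Sum>j\<in>Basis. (u t \<bullet> i) * (v t \<bullet> j) * metric_deriv c (q t) (q' h) i j
        + (u' h \<bullet> i) * (v t \<bullet> j) * ?m i j (q t) + (u t \<bullet> i) * (v' h \<bullet> j) * ?m i j (q t))) (at t)"
    by (intro has_derivative_sum)
  have "\<forall>\<^sub>F s in at t. q s \<in> snd c ` fst c"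
    using has_derivative_continuous[OF q] chart_image_open[OF c(1)] c(2)
    by (auto simp: continuous_within intro: topological_tendstoD)
  then have ev: "\<forall>\<^sub>F s in at t. (\<Sum>i\<in>Basis. \<Sum>j\<in>Basis. (u s \<bullet> i) * (v s \<bullet> j) * ?m i j (q s))
      = metric_coord c (q s) (u s) (v s)"
    by (rule eventually_mono) (rule metric_coord_expand[OF c(1), symmetric])
  have 2: "((\<lambda>s. metric_coord c (q s) (u s) (v s)) has_derivative
      (\<lambda>h. \<Sum>i\<in>Basis. \<Sum>j\<in>Basis. (u t \<bullet> i) * (v t \<bullet> j) * metric_deriv c (q t) (q' h) i j
        + (u' h \<bullet> i) * (v t \<bullet> j) * ?m i j (q t) + (u t \<bullet> i) * (v' h \<bullet> j) * ?m i j (q t))) (at t)"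
    by (rule has_derivative_transform_eventually[OF 1 ev]) (simp_all add: metric_coord_expand[OF c, symmetric])
  show ?thesis
    by (rule has_derivative_eq_rhs[OF 2])
      (simp only: sum.distrib metric_coord_expand[OF c, symmetric]
        bilinear_Basis_sum[OF metric_deriv_linear1[OF c] metric_deriv_linear2[OF c], symmetric])
qed

text \<open>Positive definiteness makes the lowering of indices injective, hence surjective in
  finite dimension. This justifies the definite description in \<open>christoffel\<close>.\<close>

lemma metric_riesz:
  assumes c: "c \<in> A" "p \<in> snd c ` fst c" and R: "linear R"
  shows "\<exists>!z. \<forall>\<zeta>. metric_coord c p z \<zeta> = R \<zeta>"
proof -
  define F where "F z = (\<Sum>b\<in>Basis. metric_coord c p z b *\<^sub>R b)" for z :: 'e
  have F: "linear F" unfolding F_def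
    by (intro linearI)
      (simp_all add: linear_add[OF metric_coord_linear1[OF c]] linear_cmul[OF metric_coord_linear1[OF c]]
        scaleR_add_left sum.distrib scaleR_sum_right)
  have Fb: "F z \<bullet> b = metric_coord c p z b" if "b \<in> Basis" for z b
    using that by (simp add: F_def)
  have "inj F" unfolding linear_injective_0[OF F]
  proof (intro allI impI)
    fix z assume "F z = 0"
    then have "metric_coord c p z b = 0" if "b \<in> Basis" for b using Fb[OF that, of z] by simp
    then have "metric_coord c p z z = 0"
      using linear_Basis_sum[OF metric_coord_linear2[OF c], of z z] by simp
    then show "z = 0" using metric_coord_pos[OF c, of z] by (metis less_irrefl)
  qed
  then have "surj F" by (rule linear_inj_imp_surj[OF F])
  then obtain z where z: "F z = (\<Sum>b\<in>Basis. R b *\<^sub>R b)" by (metis surjD)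
  have zb: "metric_coord c p z b = R b" if "b \<in> Basis" for b
    using Fb[OF that, of z] that by (simp add: z)
  have ex: "metric_coord c p z \<zeta> = R \<zeta>" for \<zeta>
    using linear_Basis_sum[OF metric_coord_linear2[OF c], of z \<zeta>] linear_Basis_sum[OF R, of \<zeta>] zb by simp
  show ?thesis
  proof (rule ex1I[of _ z])
    fix y assume y: "\<forall>\<zeta>. metric_coord c p y \<zeta> = R \<zeta>"
    then have "metric_coord c p (y - z) \<zeta> = 0" for \<zeta>
      using linear_diff[OF metric_coord_linear1[OF c]] ex by simp
    then show "y = z" using metric_coord_pos[OF c, of "y - z"] by (metis less_irrefl right_minus_eq)
  qed (use ex in blast)
qed

lemma christoffel_eq:
  assumes c: "c \<in> A" "p \<in> snd c ` fst c"
  shows "metric_coord c p (christoffel c p \<xi> \<eta>) \<zeta> =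
    (metric_deriv c p \<xi> \<eta> \<zeta> + metric_deriv c p \<eta> \<xi> \<zeta> - metric_deriv c p \<zeta> \<xi> \<eta>) / 2"
proof -
  have "linear (\<lambda>\<zeta>. (metric_deriv c p \<xi> \<eta> \<zeta> + metric_deriv c p \<eta> \<xi> \<zeta> - metric_deriv c p \<zeta> \<xi> \<eta>) / 2)"
    by (intro linearI) (simp_all add: linear_add[OF metric_deriv_linear2[OF c]] linear_cmul[OF metric_deriv_linear2[OF c]]
        linear_add[OF metric_deriv_linear[OF c]] linear_cmul[OF metric_deriv_linear[OF c]] field_simps)
  from theI'[OF metric_riesz[OF c this]] show ?thesis
    unfolding christoffel_def metric_deriv_def by blast
qed

text \<open>The Hessian of the coordinate change, which enters the differential of the transition
  maps of the tangent bundle and the transformation law of the Christoffel symbols.\<close>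

definition dtrans2 :: "('m, 'e) chart \<Rightarrow> ('m, 'e) chart \<Rightarrow> 'e \<Rightarrow> 'e \<Rightarrow> 'e \<Rightarrow> 'e" where
  "dtrans2 c d p v \<xi> = frechet_derivative (\<lambda>q. dtrans c d q \<xi>) (at p) v"

lemma dtrans_has_derivative:
  assumes "c \<in> A" "d \<in> A" "x \<in> fst c" "x \<in> fst d"
  shows "((\<lambda>q. dtrans c d q \<xi>) has_derivative (\<lambda>v. dtrans2 c d (snd c x) v \<xi>)) (at (snd c x))"
proof -
  have "smooth_on (\<lambda>q. dtrans c d q \<xi>) (snd c ` (fst c \<inter> fst d))"
    unfolding dtrans_def by (rule smooth_on_deriv[OF transition[OF assms(1,2)]])
  from smooth_on_has_derivative[OF this] show ?thesis unfolding dtrans2_def using assms by blast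
qed

lemma dtrans2_sym:
  assumes "c \<in> A" "d \<in> A" "x \<in> fst c" "x \<in> fst d"
  shows "dtrans2 c d (snd c x) v \<xi> = dtrans2 c d (snd c x) \<xi> v"
  unfolding dtrans2_def dtrans_def
  by (rule symmetric_second_derivative[OF open_chart_image2[OF assms(1,2)] _
        smooth_on_imp_Ck[OF transition[OF assms(1,2)]]]) (use assms in blast)

lemma metric_coord_trans:
  assumes "c \<in> A" "d \<in> A" "x \<in> fst c" "x \<in> fst d"
  shows "metric_coord c (snd c x) \<xi> \<eta>
    = metric_coord d (snd d x) (dtrans c d (snd c x) \<xi>) (dtrans c d (snd c x) \<eta>)"
  unfolding metric_coord_def chart_inv_left[OF assms(1,3)] chart_inv_left[OF assms(2,4)]
    vec_of_trans[OF assms] ..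

lemma metric_deriv_trans:
  assumes "c \<in> A" "d \<in> A" "x \<in> fst c" "x \<in> fst d"
  defines "p \<equiv> snd c x" and "q \<equiv> snd d x" and "D \<equiv> dtrans c d (snd c x)" and "D2 \<equiv> dtrans2 c d (snd c x)"
  shows "metric_deriv c p v \<xi> \<eta> = metric_deriv d q (D v) (D \<xi>) (D \<eta>)
    + metric_coord d q (D2 v \<xi>) (D \<eta>) + metric_coord d q (D \<xi>) (D2 v \<eta>)"
proof -
  let ?\<tau> = "snd d \<circ> chart_inv c"
  have \<tau>p: "?\<tau> p = q" using chart_inv_left[OF assms(1,3)] by (simp add: p_def q_def)
  have D2: "((\<lambda>r. dtrans c d r \<xi>) has_derivative (\<lambda>v. D2 v \<xi>)) (at p)" for \<xi>
    unfolding p_def D2_def by (rule dtrans_has_derivative[OF assms(1-4)])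
  have 1: "((\<lambda>r. metric_coord d (?\<tau> r) (dtrans c d r \<xi>) (dtrans c d r \<eta>)) has_derivative
    (\<lambda>v. metric_deriv d (?\<tau> p) (D v) (dtrans c d p \<xi>) (dtrans c d p \<eta>)
      + metric_coord d (?\<tau> p) (D2 v \<xi>) (dtrans c d p \<eta>)
      + metric_coord d (?\<tau> p) (dtrans c d p \<xi>) (D2 v \<eta>))) (at p)"
  proof (rule metric_coord_has_derivative[OF assms(2)])
    show "?\<tau> p \<in> snd d ` fst d" using \<tau>p assms(4) by (simp add: q_def)
    show "(?\<tau> has_derivative D) (at p)" unfolding p_def D_def by (rule trans_has_derivative[OF assms(1-4)])
  qed (rule D2)+
  have "((\<lambda>r. metric_coord c r \<xi> \<eta>) has_derivative
    (\<lambda>v. metric_deriv d (?\<tau> p) (D v) (dtrans c d p \<xi>) (dtrans c d p \<eta>)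
      + metric_coord d (?\<tau> p) (D2 v \<xi>) (dtrans c d p \<eta>)
      + metric_coord d (?\<tau> p) (dtrans c d p \<xi>) (D2 v \<eta>))) (at p)"
  proof (rule has_derivative_transform_within_open[OF 1 open_chart_image2[OF assms(1,2)]])
    show "p \<in> snd c ` (fst c \<inter> fst d)" using assms by blast
    fix r assume "r \<in> snd c ` (fst c \<inter> fst d)"
    then obtain y where y: "y \<in> fst c" "y \<in> fst d" "r = snd c y" by blast
    show "metric_coord d (?\<tau> r) (dtrans c d r \<xi>) (dtrans c d r \<eta>) = metric_coord c r \<xi> \<eta>"
      using metric_coord_trans[OF assms(1,2) y(1,2), of \<xi> \<eta>] chart_inv_left[OF assms(1) y(1)] by (simp add: y(3))
  qed
  from frechet_derivative_eqI[OF this] show ?thesis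
    by (simp only: metric_deriv_def[of c] \<tau>p) (simp add: p_def D_def)
qed

text \<open>The classical inhomogeneous transformation law. In Koszul's formula the terms with
  \<open>D2 \<xi> \<zeta>\<close> cancel by symmetry of the Hessian and of the metric, leaving the
  pairing of \<open>D2 \<xi> \<xi>\<close> with \<open>D \<zeta>\<close>.\<close>

lemma christoffel_trans:
  assumes cd: "c \<in> A" "d \<in> A" "x \<in> fst c" "x \<in> fst d"
  defines "p \<equiv> snd c x" and "q \<equiv> snd d x" and "D \<equiv> dtrans c d (snd c x)" and "D2 \<equiv> dtrans2 c d (snd c x)"
  shows "D (christoffel c p \<xi> \<xi>) = christoffel d q (D \<xi>) (D \<xi>) + D2 \<xi> \<xi>"
proof -
  have p: "p \<in> snd c ` fst c" and q: "q \<in> snd d ` fst d" using cd by (auto simp: p_def q_def)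
  have md: "metric_deriv c p v \<xi> \<eta> = metric_deriv d q (D v) (D \<xi>) (D \<eta>)
    + metric_coord d q (D2 v \<xi>) (D \<eta>) + metric_coord d q (D \<xi>) (D2 v \<eta>)" for v \<xi> \<eta>
    unfolding p_def q_def D_def D2_def by (rule metric_deriv_trans[OF cd])
  have sym: "metric_coord d q a b = metric_coord d q b a" for a b by (rule metric_coord_sym[OF cd(2) q])
  have D2s: "D2 a b = D2 b a" for a b unfolding D2_def by (rule dtrans2_sym[OF cd])
  have eq: "metric_coord d q (D (christoffel c p \<xi> \<xi>)) (D \<zeta>)
      = metric_coord d q (christoffel d q (D \<xi>) (D \<xi>) + D2 \<xi> \<xi>) (D \<zeta>)" for \<zeta>
  proof -
    have "metric_coord d q (D (christoffel c p \<xi> \<xi>)) (D \<zeta>) = metric_coord c p (christoffel c p \<xi> \<xi>) \<zeta>"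
      unfolding p_def q_def D_def by (rule metric_coord_trans[OF cd, symmetric])
    also have "\<dots> = metric_coord d q (christoffel d q (D \<xi>) (D \<xi>)) (D \<zeta>) + metric_coord d q (D2 \<xi> \<xi>) (D \<zeta>)"
      unfolding christoffel_eq[OF cd(1) p] christoffel_eq[OF cd(2) q] md
      using sym[of "D \<xi>"] D2s[of \<zeta>] by (simp add: field_simps)
    finally show ?thesis by (simp add: linear_add[OF metric_coord_linear1[OF cd(2) q]])
  qed
  \<comment> \<open>The reverse transition inverts \<open>D\<close>, so testing against all
    \<open>D \<zeta>\<close> is testing against all vectors.\<close>
  have surj: "D (dtrans d c q \<zeta>) = \<zeta>" for \<zeta>
    unfolding D_def q_def dtrans_chain[OF cd(2,1,2,4,3,4)] by (rule dtrans_self[OF cd(2,4)])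
  have "metric_coord d q (D (christoffel c p \<xi> \<xi>) - (christoffel d q (D \<xi>) (D \<xi>) + D2 \<xi> \<xi>)) \<zeta> = 0" for \<zeta>
    using eq[of "dtrans d c q \<zeta>"] unfolding surj linear_diff[OF metric_coord_linear1[OF cd(2) q]] by simp
  then show ?thesis using metric_coord_pos[OF cd(2) q] by (metis less_irrefl right_minus_eq)
qed

lemma tangent_bundle_iff: "y \<in> tangent_bundle A \<longleftrightarrow> snd y \<in> tangent_space A (fst y)"
  using cover by (auto simp: tangent_bundle_def split: prod.splits)

lemma tangent_chart_mem: "y \<in> fst (tangent_chart A c) \<longleftrightarrow> snd y \<in> tangent_space A (fst y) \<and> fst y \<in> fst c"
  using tangent_bundle_iff[of y] by (auto simp: tangent_chart_def split: prod.splits)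

lemma tangent_chart_snd: "snd (tangent_chart A c) y = (snd c (fst y), snd y c)"
  by (simp add: tangent_chart_def split: prod.splits)

lemma tangent_chart_inv:
  assumes "c \<in> A" "p \<in> snd c ` fst c"
  shows "chart_inv (tangent_chart A c) (p, \<xi>) = (chart_inv c p, vec_of A c (chart_inv c p) \<xi>)"
proof -
  have x: "chart_inv c p \<in> fst c" "snd c (chart_inv c p) = p"
    using chart_inv_in[OF assms] chart_inv_right[OF assms] .
  have "inj_on (snd (tangent_chart A c)) (fst (tangent_chart A c))"
  proof (rule inj_onI)
    fix y z assume yz: "y \<in> fst (tangent_chart A c)" "z \<in> fst (tangent_chart A c)"
      "snd (tangent_chart A c) y = snd (tangent_chart A c) z"
    then have "snd c (fst y) = snd c (fst z)" "fst y \<in> fst c" "fst z \<in> fst c"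
      by (simp_all add: tangent_chart_snd tangent_chart_mem)
    then have 1: "fst y = fst z" using chart_inv_left[OF assms(1)] by metis
    have "snd y = snd z"
      by (rule tangent_space_eqI[of _ "fst y" _ c]) (use yz 1 assms(1) in \<open>auto simp: tangent_chart_snd tangent_chart_mem\<close>)
    with 1 show "y = z" by (simp add: prod_eq_iff)
  qed
  moreover have "(chart_inv c p, vec_of A c (chart_inv c p) \<xi>) \<in> fst (tangent_chart A c)"
    using vec_of_in[OF assms(1) x(1)] x by (simp add: tangent_chart_mem)
  moreover have "snd (tangent_chart A c) (chart_inv c p, vec_of A c (chart_inv c p) \<xi>) = (p, \<xi>)"
    using vec_of_self[OF assms(1) x(1)] x by (simp add: tangent_chart_snd)
  ultimately show ?thesis unfolding chart_inv_def by (metis inv_into_f_f)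
qed

text \<open>In coordinates the transition map sends a point and a vector to their images under the
  coordinate change and its differential. Since \<open>dtrans\<close> is differentiated with its
  vector argument fixed, that argument is first expanded in the basis.\<close>

lemma tangent_trans_has_derivative:
  assumes cd: "c \<in> A" "d \<in> A" "x \<in> fst c" "x \<in> fst d"
  shows "((snd (tangent_chart A d) \<circ> chart_inv (tangent_chart A c)) has_derivative
    (\<lambda>(a, b). (dtrans c d (snd c x) a, dtrans2 c d (snd c x) a \<xi> + dtrans c d (snd c x) b)))
    (at (snd c x, \<xi>))"
proof -
  let ?p = "snd c x"
  have l: "linear (dtrans c d (snd c x))" if "x \<in> fst c" "x \<in> fst d" for x
    by (rule dtrans_linear[OF cd(1,2) that])
  have fst': "(fst has_derivative fst) (at (?p, \<xi>))"
    by (rule has_derivative_fst[OF has_derivative_ident])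
  have f1: "((\<lambda>y. (snd d \<circ> chart_inv c) (fst y)) has_derivative (\<lambda>h. dtrans c d ?p (fst h))) (at (?p, \<xi>))"
    by (rule has_derivative_compose[OF fst']) (use trans_has_derivative[OF cd] in \<open>simp add: comp_def\<close>)
  have f2: "((\<lambda>y. dtrans c d (fst y) b) has_derivative (\<lambda>h. dtrans2 c d ?p (fst h) b)) (at (?p, \<xi>))" for b
    by (rule has_derivative_compose[OF fst']) (use dtrans_has_derivative[OF cd] in simp)
  have "((\<lambda>y. \<Sum>b\<in>Basis. (snd y \<bullet> b) *\<^sub>R dtrans c d (fst y) b) has_derivative
      (\<lambda>h. \<Sum>b\<in>Basis. (\<xi> \<bullet> b) *\<^sub>R dtrans2 c d ?p (fst h) b + (snd h \<bullet> b) *\<^sub>R dtrans c d ?p b)) (at (?p, \<xi>))"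
    by (rule has_derivative_sum, rule has_derivative_eq_rhs[OF has_derivative_scaleR[OF
          has_derivative_inner_left[OF has_derivative_snd[OF has_derivative_ident]] f2]]) simp
  moreover have "(\<Sum>b\<in>Basis. (\<xi> \<bullet> b) *\<^sub>R dtrans2 c d ?p (fst h) b + (snd h \<bullet> b) *\<^sub>R dtrans c d ?p b)
      = dtrans2 c d ?p (fst h) \<xi> + dtrans c d ?p (snd h)" for h
  proof -
    have "linear (dtrans2 c d ?p (fst h))"
      using has_derivative_linear[OF dtrans_has_derivative[OF cd, of "fst h"]]
      by (simp add: dtrans2_sym[OF cd, of _ "fst h"])
    from linear_Basis_sum[OF this, of \<xi>] linear_Basis_sum[OF l[OF cd(3,4)], of "snd h"]
    show ?thesis by (simp add: sum.distrib)
  qed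
  ultimately have f3: "((\<lambda>y. \<Sum>b\<in>Basis. (snd y \<bullet> b) *\<^sub>R dtrans c d (fst y) b) has_derivative
      (\<lambda>h. dtrans2 c d ?p (fst h) \<xi> + dtrans c d ?p (snd h))) (at (?p, \<xi>))" by simp
  have "open (snd c ` (fst c \<inter> fst d) \<times> (UNIV :: 'e set))"
    by (intro open_Times open_chart_image2 cd open_UNIV)
  then have "((snd (tangent_chart A d) \<circ> chart_inv (tangent_chart A c)) has_derivative
    (\<lambda>h. (dtrans c d ?p (fst h), dtrans2 c d ?p (fst h) \<xi> + dtrans c d ?p (snd h)))) (at (?p, \<xi>))"
  proof (rule has_derivative_transform_within_open[OF has_derivative_Pair[OF f1 f3]])
    show "(?p, \<xi>) \<in> snd c ` (fst c \<inter> fst d) \<times> UNIV" using cd by blast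
    fix y assume "y \<in> snd c ` (fst c \<inter> fst d) \<times> (UNIV :: 'e set)"
    then obtain z \<zeta> where y: "y = (snd c z, \<zeta>)" "z \<in> fst c" "z \<in> fst d" by auto
    have "(\<Sum>b\<in>Basis. (\<zeta> \<bullet> b) *\<^sub>R dtrans c d (snd c z) b) = dtrans c d (snd c z) \<zeta>"
      using linear_Basis_sum[OF l[OF y(2,3)], of \<zeta>] by simp
    then show "((snd d \<circ> chart_inv c) (fst y), \<Sum>b\<in>Basis. (snd y \<bullet> b) *\<^sub>R dtrans c d (fst y) b)
      = (snd (tangent_chart A d) \<circ> chart_inv (tangent_chart A c)) y"
      using cd y by (simp add: tangent_chart_inv tangent_chart_snd chart_inv_left vec_of_eq)
  qed
  then show ?thesis by (rule has_derivative_eq_rhs) auto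
qed

text \<open>The Hessian term in the differential of the transition map cancels the one in the law
  for the Christoffel symbols, so the expression does not depend on the chart chosen in
  \<open>geodesic_field\<close>.\<close>

lemma geodesic_field_chart:
  assumes y: "y \<in> tangent_bundle A" and c: "c \<in> A" "fst y \<in> fst c"
  shows "geodesic_field y (tangent_chart A c) =
    (snd y c, - christoffel c (snd c (fst y)) (snd y c) (snd y c))"
proof -
  let ?x = "fst y"
  define d where "d = chart_at A ?x"
  have d: "d \<in> A" "?x \<in> fst d" using chart_at by (auto simp: d_def)
  have w: "snd y \<in> tangent_space A ?x" using y by (simp add: tangent_bundle_iff)
  have mem: "tangent_chart A c \<in> tangent_atlas A" "y \<in> fst (tangent_chart A c)"
    using c w by (auto simp: tangent_atlas_def tangent_chart_mem)
  let ?p = "snd d ?x" and ?\<xi> = "snd y d"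
  have wc: "snd y c = dtrans d c ?p ?\<xi>" by (rule tangent_spaceD(1)[OF w d(1) c(1) d(2) c(2)])
  have "geodesic_field y (tangent_chart A c) =
    frechet_derivative (snd (tangent_chart A c) \<circ> chart_inv (tangent_chart A d)) (at (?p, ?\<xi>))
      (?\<xi>, - christoffel d ?p ?\<xi> ?\<xi>)"
    using mem by (simp add: geodesic_field_def vec_of_def tangent_chart_snd Let_def flip: d_def)
  also have "\<dots> = (dtrans d c ?p ?\<xi>, dtrans2 d c ?p ?\<xi> ?\<xi> + dtrans d c ?p (- christoffel d ?p ?\<xi> ?\<xi>))"
    using frechet_derivative_eqI[OF tangent_trans_has_derivative[OF d(1) c(1) d(2) c(2), of ?\<xi>]] by simp
  also have "\<dots> = (snd y c, - christoffel c (snd c ?x) (snd y c) (snd y c))"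
    using christoffel_trans[OF d(1) c(1) d(2) c(2), of ?\<xi>] linear_neg[OF dtrans_linear[OF d(1) c(1) d(2) c(2)]]
    by (simp add: wc)
  finally show ?thesis .
qed

end

section \<open>Existence and uniqueness of geodesics\<close>

lemma norm_components: "norm (fst z) \<le> norm z" "norm (snd z) \<le> norm z"
  using norm_fst_le[of "fst z" "snd z"] norm_snd_le[of "snd z" "fst z"] by simp_all

context closed_riemannian_manifold
begin

definition spray :: "('m, 'e) chart \<Rightarrow> 'e \<times> 'e \<Rightarrow> 'e \<times> 'e" where
  "spray c z = (snd z, - christoffel c (fst z) (snd z) (snd z))"

text \<open>The minimum on the compact set of unit vectors over \<open>K\<close>, extended by
  homogeneity. The constant serves both to estimate Christoffel symbols and to bound velocities of
  given energy.\<close>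

lemma metric_coord_lower_bound:
  assumes c: "c \<in> A" and K: "compact K" "K \<subseteq> snd c ` fst c"
  obtains m where "m > 0" "\<And>p \<xi>. p \<in> K \<Longrightarrow> m * (norm \<xi>)\<^sup>2 \<le> metric_coord c p \<xi> \<xi>"
proof (cases "K = {}")
  case True
  then show ?thesis using that[of 1] by simp
next
  case False
  let ?S = "K \<times> sphere (0::'e) 1"
  let ?f = "\<lambda>z. \<Sum>i\<in>Basis. \<Sum>j\<in>Basis. (snd z \<bullet> i) * (snd z \<bullet> j) * metric_coord c (fst z) i j"
  have f: "?f z = metric_coord c (fst z) (snd z) (snd z)" if "fst z \<in> K" for z
    using metric_coord_expand[OF c, of "fst z" "snd z" "snd z"] K(2) that by auto
  have m: "continuous_on ?S (\<lambda>z. metric_coord c (fst z) i j)" for i j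
    by (rule continuous_on_compose2[OF smooth_on_continuous[OF metric_coord_smooth[OF c]]])
      (use K(2) in \<open>auto intro!: continuous_intros\<close>)
  have cont: "continuous_on ?S ?f" by (intro continuous_intros m)
  have S: "compact ?S" by (intro compact_Times K compact_sphere)
  obtain b :: 'e where "b \<in> Basis" by (metis ex_in_conv nonempty_Basis)
  then have "b \<in> sphere 0 1" by simp
  then have ne: "?S \<noteq> {}" using False by blast
  obtain z where z: "z \<in> ?S" "\<And>y. y \<in> ?S \<Longrightarrow> ?f z \<le> ?f y"
    using continuous_attains_inf[OF S ne cont] by blast
  have z': "fst z \<in> K" "fst z \<in> snd c ` fst c" "snd z \<noteq> 0" using z(1) K(2) by auto
  show ?thesis
  proof (rule that[of "?f z"])
    show "?f z > 0" unfolding f[OF z'(1)] by (rule metric_coord_pos[OF c z'(2,3)])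
    fix p \<xi> assume p: "p \<in> K"
    then have pc: "p \<in> snd c ` fst c" using K(2) by blast
    show "?f z * (norm \<xi>)\<^sup>2 \<le> metric_coord c p \<xi> \<xi>"
    proof (cases "\<xi> = 0")
      case True
      then show ?thesis using metric_coord_0[OF c pc] by simp
    next
      case False
      define \<eta> where "\<eta> = (1 / norm \<xi>) *\<^sub>R \<xi>"
      have \<xi>: "\<xi> = norm \<xi> *\<^sub>R \<eta>" using False by (simp add: \<eta>_def)
      have "(p, \<eta>) \<in> ?S" using p False by (simp add: \<eta>_def)
      from z(2)[OF this] have le: "?f z \<le> metric_coord c p \<eta> \<eta>" using f[of "(p, \<eta>)"] p by simp
      have "metric_coord c p \<xi> \<xi> = metric_coord c p (norm \<xi> *\<^sub>R \<eta>) (norm \<xi> *\<^sub>R \<eta>)" using \<xi> by simp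
      also have "\<dots> = norm \<xi> * (norm \<xi> * metric_coord c p \<eta> \<eta>)"
        unfolding linear_cmul[OF metric_coord_linear1[OF c pc]] linear_cmul[OF metric_coord_linear2[OF c pc]]
        by (simp only: real_scaleR_def)
      finally have eq: "metric_coord c p \<xi> \<xi> = metric_coord c p \<eta> \<eta> * (norm \<xi>)\<^sup>2"
        by (simp add: power2_eq_square)
      show ?thesis unfolding eq by (rule mult_right_mono[OF le]) simp
    qed
  qed
qed

text \<open>The Christoffel symbols are defined only implicitly, as the solution of a linear system
  given by the metric. Instead of inverting the metric smoothly, the two systems at \<open>z\<close>
  and \<open>z'\<close> are subtracted and tested against the difference of the solutions;
  coercivity of the metric then bounds it.\<close>

lemma spray_lipschitz:
  assumes c: "c \<in> A" and \<rho>: "cball p0 \<rho> \<subseteq> snd c ` fst c"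
  obtains L where "L \<ge> 0" "\<And>z z'. z \<in> cball p0 \<rho> \<times> cball 0 r \<Longrightarrow> z' \<in> cball p0 \<rho> \<times> cball 0 r \<Longrightarrow>
    norm (spray c z - spray c z') \<le> L * norm (z - z')"
proof -
  let ?D = "snd c ` fst c"
  define X where "X = cball p0 \<rho> \<times> cball (0::'e) r"
  define DO where "DO = ?D \<times> (UNIV :: 'e set)"
  have X: "compact X" "convex X" "X \<subseteq> DO"
    using \<rho> by (auto simp: X_def DO_def intro!: compact_Times convex_Times)
  have DO: "open DO" unfolding DO_def by (intro open_Times chart_image_open c open_UNIV)
  have XD: "fst z \<in> ?D" if "z \<in> X" for z using that X(3) by (auto simp: DO_def)
  obtain m where m: "m > 0" "\<And>p \<xi>. p \<in> cball p0 \<rho> \<Longrightarrow> m * (norm \<xi>)\<^sup>2 \<le> metric_coord c p \<xi> \<xi>"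
    using metric_coord_lower_bound[OF c compact_cball \<rho>] by blast
  have lift: "Ck_on 1 (\<lambda>z. f (fst z)) DO" if "smooth_on f ?D" for f :: "'e \<Rightarrow> real"
    by (rule Ck_on_compose[OF DO smooth_on_imp_Ck[OF that] Ck_on_bounded_linear[OF bounded_linear_fst]])
      (auto simp: DO_def)
  have md: "smooth_on (\<lambda>p. metric_deriv c p v \<xi> \<eta>) ?D" for v \<xi> \<eta>
    unfolding metric_deriv_def by (rule smooth_on_deriv[OF metric_coord_smooth[OF c]])
  have "\<forall>i j. \<exists>L\<ge>0. \<forall>x\<in>X. \<forall>y\<in>X. norm (metric_coord c (fst x) i j - metric_coord c (fst y) i j) \<le> L * norm (x - y)"
    using C1_lipschitz[OF lift[OF metric_coord_smooth[OF c]] X] by metis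
  then obtain Lm where Lm: "\<And>i j. Lm i j \<ge> 0" "\<And>i j x y. x \<in> X \<Longrightarrow> y \<in> X \<Longrightarrow>
      \<bar>metric_coord c (fst x) i j - metric_coord c (fst y) i j\<bar> \<le> Lm i j * norm (x - y)"
    unfolding real_norm_def by metis
  \<comment> \<open>Koszul's right-hand side for two equal arguments \<open>snd z\<close>, tested
    against \<open>b\<close>: the first two terms coincide, so only the last keeps the factor
    1/2.\<close>
  define k where "k b z = (\<Sum>i\<in>Basis. \<Sum>j\<in>Basis. (snd z \<bullet> i) * (snd z \<bullet> j) *
    (metric_deriv c (fst z) i j b - metric_deriv c (fst z) b i j * (1/2)))" for b z
  have sndi: "Ck_on 1 (\<lambda>z::'e \<times> 'e. snd z \<bullet> i) DO" for i
    by (rule Ck_on_bounded_linear) (intro bounded_linear_intros bounded_linear_compose[OF bounded_linear_inner_left bounded_linear_snd])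
  have k: "Ck_on 1 (k b) DO" for b
    unfolding k_def
    by (intro Ck_on_sum[OF DO] Ck_on_mult[OF DO] Ck_on_diff[OF DO] sndi lift md Ck_on_const)
  have "\<forall>b. \<exists>L\<ge>0. \<forall>x\<in>X. \<forall>y\<in>X. norm (k b x - k b y) \<le> L * norm (x - y)"
    using C1_lipschitz[OF k X] by metis
  then obtain Lk where Lk: "\<And>b. Lk b \<ge> 0" "\<And>b x y. x \<in> X \<Longrightarrow> y \<in> X \<Longrightarrow> \<bar>k b x - k b y\<bar> \<le> Lk b * norm (x - y)"
    unfolding real_norm_def by metis
  have "\<exists>C\<ge>0. \<forall>x\<in>X. norm (k b x) \<le> C" for b
  proof -
    have "continuous_on X (k b)" by (rule continuous_on_subset[OF Ck_on_continuous[OF k] X(3)])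
    from compact_imp_bounded[OF compact_continuous_image[OF this X(1)]]
    show ?thesis unfolding bounded_pos by (auto intro: less_imp_le)
  qed
  then obtain Ck where Ck: "\<And>b. Ck b \<ge> 0" "\<And>b x. x \<in> X \<Longrightarrow> \<bar>k b x\<bar> \<le> Ck b"
    unfolding real_norm_def by metis
  define Z where "Z z = christoffel c (fst z) (snd z) (snd z)" for z
  have Z: "metric_coord c (fst z) (Z z) \<zeta> = (\<Sum>b\<in>Basis. (\<zeta> \<bullet> b) * k b z)" if "z \<in> X" for z \<zeta>
  proof -
    note p = XD[OF that]
    have "metric_coord c (fst z) (Z z) b = k b z" for b
    proof -
      have "metric_coord c (fst z) (Z z) b = metric_deriv c (fst z) (snd z) (snd z) b
        - metric_deriv c (fst z) b (snd z) (snd z) * (1/2)"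
        unfolding Z_def christoffel_eq[OF c p] by simp
      also have "metric_deriv c (fst z) (snd z) (snd z) b =
        (\<Sum>i\<in>Basis. \<Sum>j\<in>Basis. (snd z \<bullet> i) * (snd z \<bullet> j) * metric_deriv c (fst z) i j b)"
        by (rule bilinear_Basis_sum[OF metric_deriv_linear[OF c p] metric_deriv_linear1[OF c p]])
      also have "metric_deriv c (fst z) b (snd z) (snd z) =
        (\<Sum>i\<in>Basis. \<Sum>j\<in>Basis. (snd z \<bullet> i) * (snd z \<bullet> j) * metric_deriv c (fst z) b i j)"
        by (rule bilinear_Basis_sum[OF metric_deriv_linear1[OF c p] metric_deriv_linear2[OF c p]])
      finally show ?thesis
        unfolding k_def right_diff_distrib sum_subtractf sum_distrib_right mult.assoc .
    qed
    then show ?thesis using linear_Basis_sum[OF metric_coord_linear2[OF c p], of "Z z" \<zeta>] by simp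
  qed
  define LK where "LK = (\<Sum>b\<in>Basis. Lk b)"
  define CK where "CK = (\<Sum>b\<in>Basis. Ck b)"
  define LM where "LM = (\<Sum>i\<in>Basis. \<Sum>j\<in>Basis. Lm i j)"
  have nn: "LK \<ge> 0" "CK \<ge> 0" "LM \<ge> 0"
    unfolding LK_def CK_def LM_def by (intro sum_nonneg Lk Ck Lm)+
  have sumb: "\<bar>\<Sum>b\<in>Basis. (\<zeta> \<bullet> b) * h b\<bar> \<le> (\<Sum>b\<in>Basis. H b) * a * norm \<zeta>"
    if "\<And>b. \<bar>h b\<bar> \<le> H b * a" for \<zeta> :: 'e and h H :: "'e \<Rightarrow> real" and a
  proof -
    have "\<bar>\<Sum>b\<in>Basis. (\<zeta> \<bullet> b) * h b\<bar> \<le> (\<Sum>b\<in>Basis. norm \<zeta> * (H b * a))"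
      unfolding abs_mult
      by (rule order.trans[OF sum_abs sum_mono]) (auto simp: abs_mult intro!: mult_mono Basis_le_norm that)
    then show ?thesis by (simp add: sum_distrib_left sum_distrib_right mult_ac)
  qed
  \<comment> \<open>Coercivity applied to \<open>Z z\<close> itself gives an a priori bound, used
    below to control the change of the metric between the two base points.\<close>
  have Zb: "norm (Z z) \<le> CK / m" if z: "z \<in> X" for z
  proof -
    have "m * (norm (Z z))\<^sup>2 \<le> metric_coord c (fst z) (Z z) (Z z)" using m(2) z by (auto simp: X_def)
    also have "\<dots> \<le> CK * 1 * norm (Z z)"
      unfolding Z[OF z] CK_def by (rule order.trans[OF abs_ge_self sumb]) (use Ck(2)[OF z] in simp)
    finally have "norm (Z z) * (m * norm (Z z)) \<le> norm (Z z) * CK" by (simp add: power2_eq_square mult_ac)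
    then have "norm (Z z) = 0 \<or> m * norm (Z z) \<le> CK"
      by (metis mult_le_cancel_left_pos norm_ge_zero order_le_less)
    then show ?thesis using m(1) nn by (auto simp: field_simps)
  qed
  have Zl: "norm (Z z - Z z') \<le> (LK + LM * (CK / m)) / m * norm (z - z')" if z: "z \<in> X" "z' \<in> X" for z z'
  proof -
    define d where "d = Z z - Z z'"
    note p = XD[OF z(1)] and p' = XD[OF z(2)]
    have "\<bar>metric_coord c (fst z) u v - metric_coord c (fst z') u v\<bar> \<le> LM * norm (z - z') * norm u * norm v" for u v
    proof -
      have "metric_coord c (fst z) u v - metric_coord c (fst z') u v = (\<Sum>i\<in>Basis. \<Sum>j\<in>Basis.
          (u \<bullet> i) * (v \<bullet> j) * (metric_coord c (fst z) i j - metric_coord c (fst z') i j))"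
        unfolding metric_coord_expand[OF c p, of u v] metric_coord_expand[OF c p', of u v]
        by (simp add: right_diff_distrib sum_subtractf)
      also have "\<bar>\<dots>\<bar> \<le> (\<Sum>i\<in>Basis. \<Sum>j\<in>Basis. norm u * norm v * (Lm i j * norm (z - z')))"
        by (rule order.trans[OF sum_abs sum_mono], rule order.trans[OF sum_abs sum_mono])
          (auto simp: abs_mult intro!: mult_mono Basis_le_norm Lm z)
      also have "\<dots> = LM * norm (z - z') * norm u * norm v"
        by (simp add: LM_def sum_distrib_left sum_distrib_right mult_ac)
      finally show ?thesis .
    qed
    note ml = this[of "Z z'" d]
    \<comment> \<open>The metric is frozen at the first base point; moving it to the second in the
      term with \<open>Z z'\<close> costs the error estimated in \<open>ml\<close>.\<close>
    have "m * (norm d)\<^sup>2 \<le> metric_coord c (fst z) d d" using m(2) z by (auto simp: X_def)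
    also have "\<dots> = metric_coord c (fst z) (Z z) d - metric_coord c (fst z) (Z z') d"
      unfolding d_def linear_diff[OF metric_coord_linear1[OF c p]] ..
    also have "\<dots> = (\<Sum>b\<in>Basis. (d \<bullet> b) * (k b z - k b z'))
        - (metric_coord c (fst z) (Z z') d - metric_coord c (fst z') (Z z') d)"
      unfolding Z[OF z(1)] Z[OF z(2)] by (simp add: right_diff_distrib sum_subtractf)
    also have "\<dots> \<le> LK * norm (z - z') * norm d + LM * norm (z - z') * norm (Z z') * norm d"
      using sumb[of "\<lambda>b. k b z - k b z'" Lk "norm (z - z')" d, OF Lk(2)[OF z]] ml unfolding LK_def by linarith
    also have "LM * norm (z - z') * norm (Z z') * norm d \<le> LM * norm (z - z') * (CK / m) * norm d"
      by (intro mult_right_mono mult_left_mono Zb z) (use nn in auto)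
    finally have "norm d * (m * norm d) \<le> norm d * ((LK + LM * (CK / m)) * norm (z - z'))"
      by (simp add: power2_eq_square algebra_simps)
    then have "norm d = 0 \<or> m * norm d \<le> (LK + LM * (CK / m)) * norm (z - z')"
      by (metis mult_le_cancel_left_pos norm_ge_zero order_le_less)
    moreover have "0 \<le> (LK + LM * (CK / m)) / m * norm (z - z')" using nn m(1) by simp
    ultimately show ?thesis using m(1) by (auto simp: pos_le_divide_eq mult.commute simp flip: d_def)
  qed
  show ?thesis
  proof (rule that[of "1 + (LK + LM * (CK / m)) / m"])
    show "1 + (LK + LM * (CK / m)) / m \<ge> 0" using nn m(1) by simp
    fix z z' :: "'e \<times> 'e" assume "z \<in> cball p0 \<rho> \<times> cball 0 r" "z' \<in> cball p0 \<rho> \<times> cball 0 r"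
    then have z: "z \<in> X" "z' \<in> X" by (auto simp: X_def)
    have "norm (spray c z - spray c z') \<le> norm (snd (z - z')) + norm (Z z' - Z z)"
      by (rule order.trans[OF _ norm_Pair_le]) (simp add: spray_def Z_def)
    also have "\<dots> \<le> norm (z - z') + (LK + LM * (CK / m)) / m * norm (z - z')"
      using Zl[OF z] by (intro add_mono norm_components) (simp add: norm_minus_commute)
    finally show "norm (spray c z - spray c z') \<le> (1 + (LK + LM * (CK / m)) / m) * norm (z - z')"
      by (simp only: distrib_right mult_1)
  qed
qed

text \<open>Composing the spray with the nearest-point projection onto a compact convex box makes it
  globally Lipschitz and bounded. A solution starting in the box of half the size moves too slowly
  to leave the full box during time \<open>\<epsilon>\<close>, where the projection is the
  identity.\<close>

lemma spray_local_solution: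
  assumes c: "c \<in> A" and \<rho>: "cball p0 \<rho> \<subseteq> snd c ` fst c" "\<rho> > 0" and r: "r > 0"
  obtains \<epsilon> where "\<epsilon> > 0" "\<And>z t1. z \<in> cball p0 (\<rho>/2) \<times> cball 0 (r/2) \<Longrightarrow> \<exists>u. u t1 = z \<and>
     (\<forall>t\<in>{t1-\<epsilon><..<t1+\<epsilon>}. u t \<in> cball p0 \<rho> \<times> cball 0 r \<and>
        (u has_vector_derivative spray c (u t)) (at t))"
proof -
  define X where "X = cball p0 \<rho> \<times> cball (0::'e) r"
  have X: "closed X" "convex X" "X \<noteq> {}"
    using \<rho> r by (auto simp: X_def intro!: closed_Times convex_Times)
  obtain L where L: "L \<ge> 0" "\<And>z z'. z \<in> X \<Longrightarrow> z' \<in> X \<Longrightarrow> norm (spray c z - spray c z') \<le> L * norm (z - z')"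
    using spray_lipschitz[OF c \<rho>(1)] unfolding X_def by metis
  define f where "f z = spray c (closest_point X z)" for z
  have inX: "closest_point X z \<in> X" for z by (rule closest_point_in_set[OF X(1,3)])
  have fL: "norm (f z - f z') \<le> L * norm (z - z')" for z z'
  proof -
    have "norm (f z - f z') \<le> L * norm (closest_point X z - closest_point X z')"
      unfolding f_def by (rule L(2)[OF inX inX])
    also have "\<dots> \<le> L * norm (z - z')"
      using closest_point_lipschitz[OF X(2,1,3), of z z'] L(1) by (intro mult_left_mono) (simp_all add: dist_norm)
    finally show ?thesis .
  qed
  have fc: "continuous_on UNIV f"
    by (rule lipschitz_on_continuous_on[of L]) (use fL L(1) in \<open>auto intro!: lipschitz_onI simp: dist_norm\<close>)
  define B where "B = norm (spray c (p0, 0)) + L * (\<rho> + r)"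
  have B0: "B \<ge> 0" using L \<rho> r by (simp add: B_def)
  have B: "norm (f z) \<le> B" for z
  proof -
    have z: "closest_point X z \<in> X" "(p0, 0) \<in> X" using inX \<rho> r by (auto simp: X_def)
    have "norm (closest_point X z - (p0, 0)) \<le> norm (fst (closest_point X z) - p0) + norm (snd (closest_point X z) - 0)"
      by (rule order.trans[OF _ norm_Pair_le]) (simp add: minus_prod_def)
    also have "\<dots> \<le> \<rho> + r" using z(1) by (auto simp: X_def mem_Times_iff dist_norm norm_minus_commute)
    finally have "norm (closest_point X z - (p0, 0)) \<le> \<rho> + r" .
    then have "norm (f z - spray c (p0, 0)) \<le> L * (\<rho> + r)"
      using L(2)[OF z] L(1) unfolding f_def by (meson mult_left_mono order_trans)
    then show ?thesis using norm_triangle_ineq2[of "f z" "spray c (p0, 0)"] by (simp add: B_def)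
  qed
  \<comment> \<open>The first term makes the Picard operator contract; the second keeps the
    displacement below half the size of the box. Adding 1 avoids division by zero.\<close>
  define \<epsilon> where "\<epsilon> = min (1 / (8 * (L + 1))) (min \<rho> r / 2 / (B + 1))"
  have \<epsilon>: "\<epsilon> > 0" using L B0 \<rho> r by (simp add: \<epsilon>_def)
  have \<epsilon>L: "8 * \<epsilon> * L \<le> 1"
  proof -
    have "\<epsilon> * (8 * (L + 1)) \<le> 1 / (8 * (L + 1)) * (8 * (L + 1))"
      by (rule mult_right_mono) (use L in \<open>auto simp: \<epsilon>_def\<close>)
    then have "8 * \<epsilon> * L + 8 * \<epsilon> \<le> 1" using L(1) by (simp add: algebra_simps)
    then show ?thesis using \<epsilon> by simp
  qed
  have \<epsilon>B: "B * \<epsilon> \<le> min \<rho> r / 2"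
  proof -
    have "B * \<epsilon> \<le> (B + 1) * (min \<rho> r / 2 / (B + 1))"
      by (rule mult_mono) (use B0 \<epsilon> in \<open>auto simp: \<epsilon>_def\<close>)
    also have "(B + 1) * (min \<rho> r / 2 / (B + 1)) = min \<rho> r / 2"
      by (rule nonzero_mult_div_cancel_left[where a = "B + 1", unfolded times_divide_eq_right[symmetric]]) (use B0 in simp)
    finally show ?thesis .
  qed
  show ?thesis
  proof (rule that[OF \<epsilon>])
    fix z :: "'e \<times> 'e" and t1 :: real
    assume z: "z \<in> cball p0 (\<rho>/2) \<times> cball 0 (r/2)"
    obtain u where u: "u t1 = z" "\<And>t. t \<in> {t1-\<epsilon><..<t1+\<epsilon>} \<Longrightarrow> (u has_vector_derivative f (u t)) (at t)"
    proof (rule picard_local[of t1 \<epsilon> "\<lambda>t. f" L z])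
      show "continuous_on {t1-\<epsilon>..t1+\<epsilon>} (\<lambda>t. f (v t))" if "continuous_on {t1-\<epsilon>..t1+\<epsilon>} v" for v
        by (rule continuous_on_compose2[OF fc that]) simp
    qed (use fL \<epsilon> \<epsilon>L L in auto)
    have "u t \<in> X" if t: "t \<in> {t1-\<epsilon><..<t1+\<epsilon>}" for t
    proof -
      have "norm (u t - u t1) \<le> B * norm (t - t1)"
      proof (rule differentiable_bound[OF convex_real_interval(8)[of "t1-\<epsilon>" "t1+\<epsilon>"]])
        fix s assume s: "s \<in> {t1-\<epsilon><..<t1+\<epsilon>}"
        show "(u has_derivative (\<lambda>h. h *\<^sub>R f (u s))) (at s within {t1-\<epsilon><..<t1+\<epsilon>})"
          using u(2)[OF s] has_derivative_at_withinI unfolding has_vector_derivative_def by blast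
        show "onorm (\<lambda>h. h *\<^sub>R f (u s)) \<le> B"
          by (rule onorm_le) (use mult_left_mono[OF B[of "u s"] abs_ge_zero] in \<open>simp add: mult.commute\<close>)
      qed (use t \<epsilon> in auto)
      also have "\<dots> \<le> B * \<epsilon>" using t B0 by (intro mult_left_mono) auto
      finally have d: "norm (u t - z) \<le> min \<rho> r / 2" using \<epsilon>B u(1) by simp
      have "dist (fst z) (fst (u t)) \<le> \<rho>/2" "dist (snd z) (snd (u t)) \<le> r/2"
        using order.trans[OF norm_components(1) d] order.trans[OF norm_components(2) d]
        by (auto simp: dist_norm norm_minus_commute)
      moreover have "dist p0 (fst z) \<le> \<rho>/2" "dist 0 (snd z) \<le> r/2"
        using z by (auto simp: mem_Times_iff simp del: dist_0_norm)
      ultimately have "dist p0 (fst (u t)) \<le> \<rho>" "dist 0 (snd (u t)) \<le> r"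
        using dist_triangle[of p0 "fst (u t)" "fst z"] dist_triangle[of 0 "snd (u t)" "snd z"] by linarith+
      then show ?thesis by (simp add: X_def mem_Times_iff)
    qed
    then have "\<forall>t\<in>{t1-\<epsilon><..<t1+\<epsilon>}. u t \<in> X \<and> (u has_vector_derivative spray c (u t)) (at t)"
      using u(2) closest_point_self[of _ X] unfolding f_def by simp
    then show "\<exists>u. u t1 = z \<and> (\<forall>t\<in>{t1-\<epsilon><..<t1+\<epsilon>}. u t \<in> cball p0 \<rho> \<times> cball 0 r \<and>
        (u has_vector_derivative spray c (u t)) (at t))"
      using u(1) unfolding X_def by blast
  qed
qed

text \<open>The condition of \<open>geodesic_orbit\<close> at a single time, in the form that
  \<open>global_solution\<close> asks for.\<close>

definition geodesic_at :: "(real \<Rightarrow> 'm \<times> ('m, 'e) tvec) \<Rightarrow> real \<Rightarrow> bool" where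
  "geodesic_at \<sigma> t \<longleftrightarrow> \<sigma> t \<in> tangent_bundle A \<and> isCont (fst \<circ> \<sigma>) t \<and>
     (\<forall>C\<in>tangent_atlas A. \<sigma> t \<in> fst C \<longrightarrow>
        ((\<lambda>s. snd C (\<sigma> s)) has_vector_derivative geodesic_field (\<sigma> t) C) (at t))"

lemma geodesic_orbit_iff: "geodesic_orbit \<sigma> \<longleftrightarrow> (\<forall>t. geodesic_at \<sigma> t)"
  unfolding geodesic_orbit_def geodesic_at_def continuous_on_eq_continuous_at[OF open_UNIV] by blast

lemma geodesic_at_cong:
  assumes "geodesic_at \<sigma> t" and ev: "\<forall>\<^sub>F s in nhds t. \<sigma> s = \<sigma>' s"
  shows "geodesic_at \<sigma>' t"
proof -
  have t: "\<sigma> t = \<sigma>' t" using ev by (rule eventually_nhds_x_imp_x)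
  have "isCont (fst \<circ> \<sigma>) t = isCont (fst \<circ> \<sigma>') t"
    by (rule isCont_cong) (use ev in \<open>auto elim: eventually_mono\<close>)
  moreover have "((\<lambda>s. snd C (\<sigma> s)) has_vector_derivative v) (at t)
      = ((\<lambda>s. snd C (\<sigma>' s)) has_vector_derivative v) (at t)" for C :: "('m \<times> ('m, 'e) tvec, 'e \<times> 'e) chart" and v
    by (rule has_vector_derivative_cong_ev) (use ev t in \<open>auto elim: eventually_mono\<close>)
  ultimately show ?thesis using assms(1) unfolding geodesic_at_def t by auto
qed

abbreviation coords :: "('m, 'e) chart \<Rightarrow> 'm \<times> ('m, 'e) tvec \<Rightarrow> 'e \<times> 'e" where
  "coords c y \<equiv> (snd c (fst y), snd y c)"

lemma coords_eqI:
  assumes "c \<in> A" "y \<in> tangent_bundle A" "z \<in> tangent_bundle A" "fst y \<in> fst c" "fst z \<in> fst c"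
    "coords c y = coords c z"
  shows "y = z"
proof -
  have 1: "fst y = fst z"
    using assms(6) chart_inv_left[OF assms(1,4)] chart_inv_left[OF assms(1,5)] by (metis prod.inject)
  have "snd y = snd z"
    by (rule tangent_space_eqI[of _ "fst y" _ c]) (use assms 1 in \<open>auto simp: tangent_bundle_iff\<close>)
  with 1 show ?thesis by (simp add: prod_eq_iff)
qed

lemma geodesic_at_coords:
  assumes "geodesic_at \<sigma> t" "c \<in> A" "fst (\<sigma> t) \<in> fst c"
  shows "((\<lambda>s. coords c (\<sigma> s)) has_vector_derivative spray c (coords c (\<sigma> t))) (at t)"
proof -
  have y: "\<sigma> t \<in> tangent_bundle A" using assms(1) by (simp add: geodesic_at_def)
  then have "tangent_chart A c \<in> tangent_atlas A" "\<sigma> t \<in> fst (tangent_chart A c)"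
    using assms by (auto simp: tangent_atlas_def tangent_chart_mem tangent_bundle_iff)
  then have "((\<lambda>s. snd (tangent_chart A c) (\<sigma> s)) has_vector_derivative geodesic_field (\<sigma> t) (tangent_chart A c)) (at t)"
    using assms(1) unfolding geodesic_at_def by blast
  then show ?thesis
    unfolding geodesic_field_chart[OF y assms(2,3)] tangent_chart_snd spray_def by simp
qed

lemma geodesic_at_near:
  assumes "geodesic_at \<sigma> t" "open U" "fst (\<sigma> t) \<in> U"
  shows "\<forall>\<^sub>F s in nhds t. fst (\<sigma> s) \<in> U"
proof -
  have "isCont (fst \<circ> \<sigma>) t" using assms(1) by (simp add: geodesic_at_def)
  then have "((fst \<circ> \<sigma>) \<longlongrightarrow> (fst \<circ> \<sigma>) t) (nhds t)" by (simp add: continuous_at_imp_continuous_at_within isCont_def tendsto_nhds_iff)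
  from topological_tendstoD[OF this assms(2)] show ?thesis using assms(3) by simp
qed

text \<open>A solution in one chart satisfies the equation in every other chart: the differential of
  the transition map of the tangent bundle carries the spray to the spray, by
  \<open>christoffel_trans\<close>.\<close>

lemma geodesic_at_chart:
  assumes c: "c \<in> A" and u: "\<And>s. s \<in> {a<..<b} \<Longrightarrow> fst (u s) \<in> snd c ` fst c" and t: "t \<in> {a<..<b}"
    and d: "(u has_vector_derivative spray c (u t)) (at t)"
  shows "geodesic_at (\<lambda>s. chart_inv (tangent_chart A c) (u s)) t"
proof -
  let ?\<sigma> = "\<lambda>s. chart_inv (tangent_chart A c) (u s)"
  have \<sigma>: "?\<sigma> s = (chart_inv c (fst (u s)), vec_of A c (chart_inv c (fst (u s))) (snd (u s)))"
    if "s \<in> {a<..<b}" for s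
    using tangent_chart_inv[OF c u[OF that], of "snd (u s)"] by simp
  define x where "x = chart_inv c (fst (u t))"
  have x: "x \<in> fst c" "snd c x = fst (u t)"
    using chart_inv_in[OF c u[OF t]] chart_inv_right[OF c u[OF t]] by (auto simp: x_def)
  have \<sigma>t: "?\<sigma> t = (x, vec_of A c x (snd (u t)))" using \<sigma>[OF t] by (simp add: x_def)
  have y: "?\<sigma> t \<in> tangent_bundle A" unfolding \<sigma>t tangent_bundle_iff using vec_of_in[OF c x(1)] by simp
  have uc: "isCont u t" using d has_vector_derivative_continuous by blast
  have "isCont (chart_inv c) (fst (u t))"
    using chart_inv_continuous[OF c] u[OF t]
    unfolding continuous_on_eq_continuous_at[OF chart_image_open[OF c]] by blast
  then have "isCont (\<lambda>s. chart_inv c (fst (u s))) t"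
    using continuous_within_compose3 isCont_o2[OF continuous_fst[OF uc]] by blast
  moreover have "isCont (\<lambda>s. chart_inv c (fst (u s))) t = isCont (fst \<circ> ?\<sigma>) t"
    by (rule isCont_cong, rule eventually_mono[OF eventually_nhds_in_open[of "{a<..<b}"]]) (use t \<sigma> in auto)
  ultimately have cont: "isCont (fst \<circ> ?\<sigma>) t" by simp
  have "((\<lambda>s. snd (tangent_chart A e) (?\<sigma> s)) has_vector_derivative geodesic_field (?\<sigma> t) (tangent_chart A e)) (at t)"
    if e: "e \<in> A" "?\<sigma> t \<in> fst (tangent_chart A e)" for e
  proof -
    have xe: "x \<in> fst e" using e(2) \<sigma>t by (simp add: tangent_chart_mem)
    let ?D = "dtrans c e (snd c x)" and ?D2 = "dtrans2 c e (snd c x)"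
    have 1: "((snd (tangent_chart A e) \<circ> chart_inv (tangent_chart A c)) has_derivative
      (\<lambda>(a, b). (?D a, ?D2 a (snd (u t)) + ?D b))) (at (u t))"
      using tangent_trans_has_derivative[OF c e(1) x(1) xe, of "snd (u t)"] x(2) by simp
    have "((\<lambda>s. (snd (tangent_chart A e) \<circ> chart_inv (tangent_chart A c)) (u s)) has_derivative
      (\<lambda>h. (\<lambda>(a, b). (?D a, ?D2 a (snd (u t)) + ?D b)) (h *\<^sub>R spray c (u t)))) (at t)"
      by (rule has_derivative_compose[OF d[unfolded has_vector_derivative_def] 1])
    moreover have "(\<lambda>(a, b). (?D a, ?D2 a (snd (u t)) + ?D b)) (h *\<^sub>R z)
        = h *\<^sub>R (\<lambda>(a, b). (?D a, ?D2 a (snd (u t)) + ?D b)) z" for h z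
      using linear_cmul[OF has_derivative_linear[OF 1]] by blast
    ultimately have 2: "((\<lambda>s. snd (tangent_chart A e) (?\<sigma> s)) has_vector_derivative
      (\<lambda>(a, b). (?D a, ?D2 a (snd (u t)) + ?D b)) (spray c (u t))) (at t)"
      unfolding has_vector_derivative_def by (simp add: comp_def)
    have ve: "vec_of A c x (snd (u t)) e = ?D (snd (u t))" using e xe by (simp add: vec_of_eq)
    have "geodesic_field (?\<sigma> t) (tangent_chart A e) = (\<lambda>(a, b). (?D a, ?D2 a (snd (u t)) + ?D b)) (spray c (u t))"
      using geodesic_field_chart[OF y e(1)] xe christoffel_trans[OF c e(1) x(1) xe, of "snd (u t)"]
        linear_neg[OF dtrans_linear[OF c e(1) x(1) xe]]
      unfolding \<sigma>t by (simp add: ve spray_def x(2))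
    then show ?thesis using 2 by simp
  qed
  then show ?thesis using y cont unfolding geodesic_at_def tangent_atlas_def by blast
qed

text \<open>Along a geodesic the derivative of the metric coefficients contributes
  \<open>metric_deriv\<close> in the direction of the velocity, and the acceleration contributes
  minus twice the pairing with the Christoffel symbol; Koszul's formula makes the sum zero.\<close>

lemma geodesic_speed:
  assumes sol: "\<And>t. t \<in> {a<..<b} \<Longrightarrow> geodesic_at \<sigma> t" and t: "t1 \<in> {a<..<b}" "t \<in> {a<..<b}"
  shows "g (fst (\<sigma> t)) (snd (\<sigma> t)) (snd (\<sigma> t)) = g (fst (\<sigma> t1)) (snd (\<sigma> t1)) (snd (\<sigma> t1))"
proof -
  let ?E = "\<lambda>s. g (fst (\<sigma> s)) (snd (\<sigma> s)) (snd (\<sigma> s))"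
  have "(?E has_derivative (\<lambda>h. 0)) (at t within {a<..<b})" if t: "t \<in> {a<..<b}" for t
  proof -
    define c where "c = chart_at A (fst (\<sigma> t))"
    have c: "c \<in> A" "fst (\<sigma> t) \<in> fst c" using chart_at by (auto simp: c_def)
    define q where "q = (\<lambda>s. snd c (fst (\<sigma> s)))"
    define \<xi> where "\<xi> = (\<lambda>s. snd (\<sigma> s) c)"
    define Z where "Z = christoffel c (q t) (\<xi> t) (\<xi> t)"
    have "((\<lambda>s. (q s, \<xi> s)) has_vector_derivative (\<xi> t, - Z)) (at t)"
      using geodesic_at_coords[OF sol[OF t] c] by (simp add: q_def \<xi>_def Z_def spray_def)
    from has_derivative_fst[OF this[unfolded has_vector_derivative_def]]
      has_derivative_snd[OF this[unfolded has_vector_derivative_def]]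
    have q: "(q has_derivative (\<lambda>h. h *\<^sub>R \<xi> t)) (at t)" and \<xi>: "(\<xi> has_derivative (\<lambda>h. h *\<^sub>R (- Z))) (at t)"
      by simp_all
    have qt: "q t \<in> snd c ` fst c" using c by (simp add: q_def)
    have eq: "metric_coord c (q t) Z (\<xi> t) = metric_deriv c (q t) (\<xi> t) (\<xi> t) (\<xi> t) / 2"
      unfolding Z_def christoffel_eq[OF c(1) qt] by simp
    have "((\<lambda>s. metric_coord c (q s) (\<xi> s) (\<xi> s)) has_derivative (\<lambda>h. 0)) (at t)"
      by (rule has_derivative_eq_rhs[OF metric_coord_has_derivative[OF c(1) qt q \<xi> \<xi>]], rule ext)
        (simp add: linear_cmul[OF metric_deriv_linear[OF c(1) qt]] linear_cmul[OF metric_coord_linear1[OF c(1) qt]]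
          linear_neg[OF metric_coord_linear1[OF c(1) qt]] linear_neg[OF metric_coord_linear2[OF c(1) qt]]
          linear_cmul[OF metric_coord_linear2[OF c(1) qt]] metric_coord_sym[OF c(1) qt, of "\<xi> t" Z] eq)
    then have 1: "((\<lambda>s. metric_coord c (q s) (\<xi> s) (\<xi> s)) has_derivative (\<lambda>h. 0)) (at t within {a<..<b})"
      by (rule has_derivative_at_withinI)
    have E: "metric_coord c (q s) (\<xi> s) (\<xi> s) = ?E s" if "fst (\<sigma> s) \<in> fst c" "s \<in> {a<..<b}" for s
      using metric_coord_eq[OF c(1) that(1), of "snd (\<sigma> s)" "snd (\<sigma> s)"] sol[OF that(2)]
      by (simp add: geodesic_at_def tangent_bundle_iff q_def \<xi>_def)
    have "\<forall>\<^sub>F s in nhds t. fst (\<sigma> s) \<in> fst c" by (rule geodesic_at_near[OF sol[OF t] chart_open[OF c(1)] c(2)])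
    then have ev: "\<forall>\<^sub>F s in at t within {a<..<b}. metric_coord c (q s) (\<xi> s) (\<xi> s) = ?E s"
      unfolding eventually_at_filter by (rule eventually_mono) (use E in auto)
    show ?thesis by (rule has_derivative_transform_eventually[OF 1 ev E[OF c(2) t] t])
  qed
  from has_derivative_zero_constant[OF convex_real_interval(8) this]
  obtain k where "\<And>s. s \<in> {a<..<b} \<Longrightarrow> ?E s = k" by blast
  then show ?thesis using t by metis
qed

text \<open>Where two geodesics agree, uniqueness in a chart gives agreement nearby. Where they
  differ, either the base points are separated by disjoint open sets, or the base points coincide
  and the coordinates in one chart differ; both persist nearby.\<close>

lemma geodesic_unique:
  assumes sol: "\<And>t. t \<in> {a<..<b} \<Longrightarrow> geodesic_at \<sigma> t" "\<And>t. t \<in> {a<..<b} \<Longrightarrow> geodesic_at \<sigma>' t"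
    and t0: "t0 \<in> {a<..<b}" "\<sigma> t0 = \<sigma>' t0" and t: "t \<in> {a<..<b}"
  shows "\<sigma> t = \<sigma>' t"
proof (rule agree_on_interval[of t0 a b \<sigma> \<sigma>' t, OF t0 _ _ t])
  fix t assume t: "t \<in> {a<..<b}" and eq: "\<sigma> t = \<sigma>' t"
  define c where "c = chart_at A (fst (\<sigma> t))"
  have c: "c \<in> A" "fst (\<sigma> t) \<in> fst c" "fst (\<sigma>' t) \<in> fst c" using chart_at eq by (auto simp: c_def)
  have "snd c (fst (\<sigma> t)) \<in> snd c ` fst c" using c by blast
  then obtain \<rho> where \<rho>: "\<rho> > 0" "cball (snd c (fst (\<sigma> t))) \<rho> \<subseteq> snd c ` fst c"
    using chart_image_open[OF c(1)] open_contains_cball by meson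
  define r where "r = norm (snd (\<sigma> t) c) + 1"
  define X where "X = cball (snd c (fst (\<sigma> t))) \<rho> \<times> cball (0::'e) r"
  define Y where "Y = ball (snd c (fst (\<sigma> t))) \<rho> \<times> ball (0::'e) r"
  obtain L where L: "L \<ge> 0" "\<And>z z'. z \<in> X \<Longrightarrow> z' \<in> X \<Longrightarrow> norm (spray c z - spray c z') \<le> L * norm (z - z')"
    using spray_lipschitz[OF c(1) \<rho>(2)] unfolding X_def by metis
  have ev: "\<forall>\<^sub>F s in nhds t. s \<in> {a<..<b} \<and> fst (\<tau> s) \<in> fst c \<and> coords c (\<tau> s) \<in> X"
    if \<tau>: "geodesic_at \<tau> t" "\<tau> t = \<sigma> t" for \<tau>
  proof -
    have cc: "fst (\<tau> t) \<in> fst c" using \<tau>(2) c(2) by simp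
    have "isCont (\<lambda>s. coords c (\<tau> s)) t"
      using geodesic_at_coords[OF \<tau>(1) c(1) cc] has_vector_derivative_continuous by blast
    then have "((\<lambda>s. coords c (\<tau> s)) \<longlongrightarrow> coords c (\<tau> t)) (nhds t)"
      by (simp add: isCont_def tendsto_nhds_iff)
    moreover have "open Y" unfolding Y_def by (intro open_Times open_ball)
    moreover have "coords c (\<tau> t) \<in> Y" using \<rho> by (simp add: Y_def \<tau>(2) r_def)
    ultimately have 1: "\<forall>\<^sub>F s in nhds t. coords c (\<tau> s) \<in> Y" by (rule topological_tendstoD)
    have 2: "\<forall>\<^sub>F s in nhds t. s \<in> {a<..<b}" by (rule eventually_nhds_in_open) (use t in auto)
    have "Y \<subseteq> X" unfolding X_def Y_def by auto
    with geodesic_at_near[OF \<tau>(1) chart_open[OF c(1)] cc] 1 2 show ?thesis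
      unfolding eventually_conj_iff by (auto elim: eventually_mono)
  qed
  have "\<forall>\<^sub>F s in nhds t. (s \<in> {a<..<b} \<and> fst (\<sigma> s) \<in> fst c \<and> coords c (\<sigma> s) \<in> X) \<and>
      (s \<in> {a<..<b} \<and> fst (\<sigma>' s) \<in> fst c \<and> coords c (\<sigma>' s) \<in> X)"
    using ev[OF sol(1)[OF t] refl] ev[OF sol(2)[OF t] eq[symmetric]] by (rule eventually_conj)
  then obtain \<delta> where \<delta>: "\<delta> > 0" "\<And>s. dist s t < \<delta> \<Longrightarrow> (s \<in> {a<..<b} \<and> fst (\<sigma> s) \<in> fst c \<and> coords c (\<sigma> s) \<in> X) \<and>
      (s \<in> {a<..<b} \<and> fst (\<sigma>' s) \<in> fst c \<and> coords c (\<sigma>' s) \<in> X)"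
    unfolding eventually_nhds_metric by blast
  have near: "dist s t < \<delta>" if "s \<in> {t-\<delta><..<t+\<delta>}" for s using that by (auto simp: dist_real_def abs_less_iff)
  have ceq: "coords c (\<sigma> s) = coords c (\<sigma>' s)" if s: "s \<in> {t-\<delta><..<t+\<delta>}" for s
  proof (rule ode_unique[of "t-\<delta>" "t+\<delta>" "\<lambda>s. coords c (\<sigma> s)" "\<lambda>s. spray c (coords c (\<sigma> s))"
        "\<lambda>s. coords c (\<sigma>' s)" "\<lambda>s. spray c (coords c (\<sigma>' s))" L t])
    fix s assume "s \<in> {t-\<delta><..<t+\<delta>}"
    note s = \<delta>(2)[OF near[OF this]]
    show "((\<lambda>s. coords c (\<sigma> s)) has_vector_derivative spray c (coords c (\<sigma> s))) (at s)"
      using geodesic_at_coords[OF sol(1) c(1)] s by blast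
    show "((\<lambda>s. coords c (\<sigma>' s)) has_vector_derivative spray c (coords c (\<sigma>' s))) (at s)"
      using geodesic_at_coords[OF sol(2) c(1)] s by blast
    show "norm (spray c (coords c (\<sigma> s)) - spray c (coords c (\<sigma>' s))) \<le> L * norm (coords c (\<sigma> s) - coords c (\<sigma>' s))"
      using L(2) s by blast
  qed (use \<delta>(1) eq s in auto)
  have "\<sigma> s = \<sigma>' s" if "dist s t < \<delta>" for s
  proof (rule coords_eqI[OF c(1)])
    note s = \<delta>(2)[OF that]
    show "\<sigma> s \<in> tangent_bundle A" "\<sigma>' s \<in> tangent_bundle A"
      using sol s unfolding geodesic_at_def by blast+
    show "fst (\<sigma> s) \<in> fst c" "fst (\<sigma>' s) \<in> fst c" using s by blast+
    show "coords c (\<sigma> s) = coords c (\<sigma>' s)"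
      by (rule ceq) (use that in \<open>auto simp: dist_real_def abs_less_iff\<close>)
  qed
  then show "\<forall>\<^sub>F s in nhds t. \<sigma> s = \<sigma>' s" unfolding eventually_nhds_metric using \<delta>(1) by blast
next
  fix t assume t: "t \<in> {a<..<b}" and ne: "\<sigma> t \<noteq> \<sigma>' t"
  show "\<forall>\<^sub>F s in nhds t. \<sigma> s \<noteq> \<sigma>' s"
  proof (cases "fst (\<sigma> t) = fst (\<sigma>' t)")
    case False
    then obtain U V where UV: "open U" "open V" "fst (\<sigma> t) \<in> U" "fst (\<sigma>' t) \<in> V" "U \<inter> V = {}"
      using hausdorff by metis
    show ?thesis
      using geodesic_at_near[OF sol(1)[OF t] UV(1,3)] geodesic_at_near[OF sol(2)[OF t] UV(2,4)]
      by eventually_elim (use UV(5) in auto)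
  next
    case True
    define c where "c = chart_at A (fst (\<sigma> t))"
    have c: "c \<in> A" "fst (\<sigma> t) \<in> fst c" "fst (\<sigma>' t) \<in> fst c" using chart_at True by (auto simp: c_def)
    have tb: "\<sigma> t \<in> tangent_bundle A" "\<sigma>' t \<in> tangent_bundle A" using sol t unfolding geodesic_at_def by blast+
    define k where "k = (\<lambda>s. coords c (\<sigma> s) - coords c (\<sigma>' s))"
    have "coords c (\<sigma> t) \<noteq> coords c (\<sigma>' t)" using coords_eqI[OF c(1) tb c(2,3)] ne by blast
    then have k0: "k t \<noteq> 0" unfolding k_def right_minus_eq .
    have "isCont (\<lambda>s. coords c (\<sigma> s)) t" "isCont (\<lambda>s. coords c (\<sigma>' s)) t"
      using geodesic_at_coords[OF sol(1)[OF t] c(1,2)] geodesic_at_coords[OF sol(2)[OF t] c(1,3)]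
        has_vector_derivative_continuous by blast+
    then have "isCont k t" unfolding k_def by (rule continuous_diff)
    then have "(k \<longlongrightarrow> k t) (nhds t)" by (simp add: isCont_def tendsto_nhds_iff)
    from tendsto_imp_eventually_ne[OF this k0] show ?thesis
      by (rule eventually_mono) (auto simp: k_def zero_prod_def)
  qed
qed

text \<open>A fixed energy bounds the coordinate velocities over a neighbourhood of
  \<open>x0\<close>, so one existence time serves all directions and all starting times.\<close>

lemma geodesic_local_uniform:
  assumes x0: "x0 \<in> (UNIV :: 'm set)"
  shows "\<exists>N \<epsilon>. open N \<and> x0 \<in> N \<and> \<epsilon> > 0 \<and> (\<forall>y\<in>tangent_bundle A. fst y \<in> N \<longrightarrow>
    g (fst y) (snd y) (snd y) = R \<longrightarrow> (\<forall>t1. \<exists>\<sigma>. \<sigma> t1 = y \<and> (\<forall>t\<in>{t1-\<epsilon><..<t1+\<epsilon>}. geodesic_at \<sigma> t)))"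
proof -
  define c where "c = chart_at A x0"
  have c: "c \<in> A" "x0 \<in> fst c" using chart_at by (auto simp: c_def)
  have "snd c x0 \<in> snd c ` fst c" using c by blast
  then obtain \<rho> where \<rho>: "\<rho> > 0" "cball (snd c x0) \<rho> \<subseteq> snd c ` fst c"
    using chart_image_open[OF c(1)] open_contains_cball by meson
  obtain m where m: "m > 0" "\<And>p \<xi>. p \<in> cball (snd c x0) \<rho> \<Longrightarrow> m * (norm \<xi>)\<^sup>2 \<le> metric_coord c p \<xi> \<xi>"
    using metric_coord_lower_bound[OF c(1) compact_cball \<rho>(2)] by blast
  \<comment> \<open>Half of \<open>r\<close> exceeds the largest coordinate velocity allowed by the
    energy \<open>R\<close>; the summand 1 keeps \<open>r\<close> positive when
    \<open>R = 0\<close>.\<close>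
  define r where "r = 2 * sqrt (\<bar>R\<bar> / m) + 1"
  have r: "r > 0" using m(1) by (simp add: r_def add_nonneg_pos)
  obtain \<epsilon> where \<epsilon>: "\<epsilon> > 0" "\<And>z t1. z \<in> cball (snd c x0) (\<rho>/2) \<times> cball 0 (r/2) \<Longrightarrow> \<exists>u. u t1 = z \<and>
     (\<forall>t\<in>{t1-\<epsilon><..<t1+\<epsilon>}. u t \<in> cball (snd c x0) \<rho> \<times> cball 0 r \<and>
        (u has_vector_derivative spray c (u t)) (at t))"
    using spray_local_solution[OF c(1) \<rho>(2,1) r] by metis
  define N where "N = {x \<in> fst c. snd c x \<in> ball (snd c x0) (\<rho>/2)}"
  have "open N" unfolding N_def by (rule open_chart_preimage[OF c(1) open_ball])
  moreover have "x0 \<in> N" using c \<rho> by (simp add: N_def)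
  moreover have "\<exists>\<sigma>. \<sigma> t1 = y \<and> (\<forall>t\<in>{t1-\<epsilon><..<t1+\<epsilon>}. geodesic_at \<sigma> t)"
    if y: "y \<in> tangent_bundle A" "fst y \<in> N" "g (fst y) (snd y) (snd y) = R" for y t1
  proof -
    have yc: "fst y \<in> fst c" "snd c (fst y) \<in> cball (snd c x0) (\<rho>/2)" "snd c (fst y) \<in> cball (snd c x0) \<rho>"
      using y(2) \<rho>(1) by (auto simp: N_def)
    have ty: "snd y \<in> tangent_space A (fst y)" using y(1) by (simp add: tangent_bundle_iff)
    have "m * (norm (snd y c))\<^sup>2 \<le> R"
      using m(2)[OF yc(3), of "snd y c"] metric_coord_eq[OF c(1) yc(1) ty ty] y(3) by simp
    then have "(norm (snd y c))\<^sup>2 \<le> \<bar>R\<bar> / m" using m(1) by (simp add: pos_le_divide_eq mult.commute)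
    then have "norm (snd y c) \<le> sqrt (\<bar>R\<bar> / m)" by (rule real_le_rsqrt)
    then have "snd y c \<in> cball 0 (r/2)" by (simp add: r_def)
    then have "coords c y \<in> cball (snd c x0) (\<rho>/2) \<times> cball 0 (r/2)" using yc(2) by simp
    from \<epsilon>(2)[OF this, of t1] obtain u where u: "u t1 = coords c y"
      "\<And>t. t \<in> {t1-\<epsilon><..<t1+\<epsilon>} \<Longrightarrow> u t \<in> cball (snd c x0) \<rho> \<times> cball 0 r"
      "\<And>t. t \<in> {t1-\<epsilon><..<t1+\<epsilon>} \<Longrightarrow> (u has_vector_derivative spray c (u t)) (at t)" by blast
    have "geodesic_at (\<lambda>s. chart_inv (tangent_chart A c) (u s)) t" if t: "t \<in> {t1-\<epsilon><..<t1+\<epsilon>}" for t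
      by (rule geodesic_at_chart[OF c(1) _ t u(3)[OF t]]) (use u(2) \<rho>(2) in \<open>force simp: mem_Times_iff\<close>)
    moreover have "chart_inv (tangent_chart A c) (u t1) = y"
      by (simp only: u(1) tangent_chart_inv[OF c(1) imageI[OF yc(1)]] chart_inv_left[OF c(1) yc(1)]
          vec_of_coord[OF ty c(1) yc(1)] prod.collapse)
    ultimately show ?thesis
      by (intro exI[of _ "\<lambda>s. chart_inv (tangent_chart A c) (u s)"] conjI ballI)
  qed
  ultimately show ?thesis using \<epsilon>(1) by blast
qed

text \<open>A finite cover of the compact manifold turns the local existence times into a single
  one, and conservation of energy keeps the state in the set to which it applies.\<close>

lemma geodesic_exists:
  assumes y0: "y0 \<in> tangent_bundle A"
  shows "\<exists>\<sigma>. \<sigma> 0 = y0 \<and> (\<forall>t. geodesic_at \<sigma> t)"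
proof -
  define R where "R = g (fst y0) (snd y0) (snd y0)"
  define adm where "adm = (\<lambda>t::real. \<lambda>y. y \<in> tangent_bundle A \<and> g (fst y) (snd y) (snd y) = R)"
  define P where "P N \<epsilon> = (\<forall>y\<in>tangent_bundle A. fst y \<in> N \<longrightarrow> g (fst y) (snd y) (snd y) = R \<longrightarrow>
    (\<forall>t1. \<exists>\<sigma>. \<sigma> t1 = y \<and> (\<forall>t\<in>{t1-\<epsilon><..<t1+\<epsilon>}. geodesic_at \<sigma> t)))" for N \<epsilon>
  have "\<forall>x0. \<exists>N \<epsilon>. open N \<and> x0 \<in> N \<and> \<epsilon> > 0 \<and> P N \<epsilon>"
    using geodesic_local_uniform[OF UNIV_I] unfolding P_def by blast
  then obtain N \<epsilon> where N: "\<And>x. open (N x)" "\<And>x. x \<in> N x" "\<And>x. \<epsilon> x > 0" "\<And>x. P (N x) (\<epsilon> x)" by metis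
  obtain D where D: "finite D" "UNIV \<subseteq> (\<Union>x\<in>D. N x)"
    by (rule compactE_image[OF compact, of UNIV N]) (use N(1,2) in auto)
  have D0: "D \<noteq> {}" using D(2) by auto
  define e where "e = Min (\<epsilon> ` D)"
  have e: "e > 0" "\<And>x. x \<in> D \<Longrightarrow> e \<le> \<epsilon> x" unfolding e_def using D(1) D0 N(3) by auto
  have loc: "\<exists>\<sigma>. \<sigma> t1 = y \<and> (\<forall>t\<in>{t1-e<..<t1+e}. geodesic_at \<sigma> t)" if "adm t1 y" for t1 y
  proof -
    obtain x where x: "x \<in> D" "fst y \<in> N x" using D(2) by blast
    have y: "y \<in> tangent_bundle A" "g (fst y) (snd y) (snd y) = R" using that by (simp_all add: adm_def)
    obtain \<sigma> where s: "\<sigma> t1 = y" "\<forall>t\<in>{t1-\<epsilon> x<..<t1+\<epsilon> x}. geodesic_at \<sigma> t"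
      using N(4)[of x, unfolded P_def, THEN bspec, OF y(1), THEN mp, OF x(2), THEN mp, OF y(2)] by metis
    moreover have "{t1-e<..<t1+e} \<subseteq> {t1-\<epsilon> x<..<t1+\<epsilon> x}" using e(2)[OF x(1)] by auto
    ultimately show ?thesis by blast
  qed
  show ?thesis
  proof (rule global_solution[where sol = geodesic_at and adm = adm])
    show "geodesic_at \<sigma>' t" if "geodesic_at \<sigma> t" "\<forall>\<^sub>F s in nhds t. \<sigma> s = \<sigma>' s" for \<sigma> \<sigma>' t
      by (rule geodesic_at_cong[OF that])
    show "\<sigma> t = \<sigma>' t" if "\<And>t. t \<in> {a<..<b} \<Longrightarrow> geodesic_at \<sigma> t \<and> geodesic_at \<sigma>' t" "t0 \<in> {a<..<b}"
      "\<sigma> t0 = \<sigma>' t0" "t \<in> {a<..<b}" for \<sigma> \<sigma>' a b t0 t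
      by (rule geodesic_unique[of a b \<sigma> \<sigma>' t0 t, OF _ _ that(2-4)]) (use that(1) in blast)+
    show "\<exists>\<epsilon>>0. \<forall>t1\<in>{t0-\<epsilon><..<t0+\<epsilon>}. \<forall>s. adm t1 s \<longrightarrow>
      (\<exists>\<sigma>. \<sigma> t1 = s \<and> (\<forall>t\<in>{t0-\<epsilon><..<t0+\<epsilon>}. geodesic_at \<sigma> t))" for t0
    \<comment> \<open>Half of \<open>e\<close>, because the local solution is centred at
      \<open>t1\<close> and must cover the whole interval around \<open>t0\<close>.\<close>
    proof (intro exI[of _ "e/2"] conjI ballI allI impI)
      fix t1 s assume t1: "t1 \<in> {t0 - e/2<..<t0 + e/2}" and "adm t1 s"
      then obtain \<sigma> where s: "\<sigma> t1 = s" "\<forall>t\<in>{t1-e<..<t1+e}. geodesic_at \<sigma> t" using loc by blast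
      moreover have "{t0 - e/2<..<t0 + e/2} \<subseteq> {t1-e<..<t1+e}" using t1 by auto
      ultimately show "\<exists>\<sigma>. \<sigma> t1 = s \<and> (\<forall>t\<in>{t0 - e/2<..<t0 + e/2}. geodesic_at \<sigma> t)" by blast
    qed (use e in simp)
    show "adm t (\<sigma> t)" if "\<And>t. t \<in> {a<..<b} \<Longrightarrow> geodesic_at \<sigma> t" "t1 \<in> {a<..<b}" "adm t1 (\<sigma> t1)"
      "t \<in> {a<..<b}" for \<sigma> a b t1 t
      using geodesic_speed[OF that(1,2,4)] that(1)[OF that(4)] that(3) unfolding adm_def geodesic_at_def by simp
    show "adm 0 y0" using y0 by (simp add: adm_def R_def)
  qed
qed

lemma geodesic_flow_orbit:
  assumes "y \<in> tangent_bundle A"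
  shows "geodesic_orbit (\<lambda>t. geodesic_flow t y)" "geodesic_flow 0 y = y"
proof -
  obtain \<sigma> where \<sigma>: "\<sigma> 0 = y" "\<And>t. geodesic_at \<sigma> t" using geodesic_exists[OF assms] by blast
  have "\<exists>!\<sigma>. geodesic_orbit \<sigma> \<and> \<sigma> 0 = y"
  proof (rule ex1I[of _ \<sigma>])
    fix \<tau> assume \<tau>: "geodesic_orbit \<tau> \<and> \<tau> 0 = y"
    show "\<tau> = \<sigma>"
    proof
      fix t
      show "\<tau> t = \<sigma> t"
        by (rule geodesic_unique[of "- \<bar>t\<bar> - 1" "\<bar>t\<bar> + 1" _ _ 0])
          (use \<sigma> \<tau> in \<open>auto simp: geodesic_orbit_iff\<close>)
    qed
  qed (use \<sigma> in \<open>simp add: geodesic_orbit_iff\<close>)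
  from theI'[OF this] show "geodesic_orbit (\<lambda>t. geodesic_flow t y)" "geodesic_flow 0 y = y"
    unfolding geodesic_flow_def by simp_all
qed

end

section \<open>Hermitian bundles: fibres, connection forms and parallel transport\<close>

section \<open>Matrices and vectors over the complex numbers\<close>

lemma bounded_bilinear_smult: "bounded_bilinear ((*s) :: complex \<Rightarrow> complex ^ 'n::finite \<Rightarrow> complex ^ 'n)"
proof -
  have "bilinear ((*s) :: complex \<Rightarrow> complex ^ 'n \<Rightarrow> complex ^ 'n)"
    unfolding bilinear_def
    by (intro conjI allI linearI)
      (simp_all add: vec_eq_iff algebra_simps)
  then show ?thesis by (simp add: bilinear_conv_bounded_bilinear)
qed

lemma bounded_bilinear_mv:
  "bounded_bilinear ((*v) :: complex ^ 'n::finite ^ 'n \<Rightarrow> complex ^ 'n \<Rightarrow> complex ^ 'n)"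
proof -
  have "bilinear ((*v) :: complex ^ 'n ^ 'n \<Rightarrow> complex ^ 'n \<Rightarrow> complex ^ 'n)"
    unfolding bilinear_def
    by (intro conjI allI linearI)
      (simp_all add: vec_eq_iff matrix_vector_mult_def algebra_simps sum.distrib scaleR_sum_right)
  then show ?thesis by (simp add: bilinear_conv_bounded_bilinear)
qed

lemma bounded_bilinear_mm:
  "bounded_bilinear ((**) :: complex ^ 'n::finite ^ 'n \<Rightarrow> complex ^ 'n ^ 'n \<Rightarrow> complex ^ 'n ^ 'n)"
proof -
  have "bilinear ((**) :: complex ^ 'n ^ 'n \<Rightarrow> complex ^ 'n ^ 'n \<Rightarrow> complex ^ 'n ^ 'n)"
    unfolding bilinear_def
    by (intro conjI allI linearI)
      (simp_all add: vec_eq_iff matrix_matrix_mult_def algebra_simps sum.distrib scaleR_sum_right)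
  then show ?thesis by (simp add: bilinear_conv_bounded_bilinear)
qed

lemma scaleR_eq_smult: "a *\<^sub>R (v :: complex ^ 'n) = of_real a *s v"
  by (simp only: vec_eq_iff vector_scaleR_component vector_smult_component) (simp add: scaleR_conv_of_real)

text \<open>Assembles a matrix-valued function from its columns, so that its regularity follows from
  that of vector-valued functions.\<close>

definition col_matrix :: "'n \<Rightarrow> complex ^ 'n \<Rightarrow> complex ^ 'n ^ 'n" where
  "col_matrix j v = (\<chi> i l. if l = j then v $ i else 0)"

lemma bounded_linear_col_matrix: "bounded_linear (col_matrix j :: complex ^ 'n::finite \<Rightarrow> _)"
  unfolding linear_conv_bounded_linear[symmetric] by (intro linearI) (auto simp: vec_eq_iff col_matrix_def)

lemma sum_col_matrix: "(\<Sum>j\<in>UNIV. col_matrix j (A *v axis j 1)) = (A :: complex ^ 'n::finite ^ 'n)"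
  by (simp add: vec_eq_iff col_matrix_def matrix_vector_mult_def axis_def if_distrib cong: if_cong)

lemma sum_col_matrix_mult: "(\<Sum>j\<in>UNIV. col_matrix j (c j)) *v v = (\<Sum>j\<in>UNIV. (v $ j) *s (c j :: complex ^ 'n::finite))"
  by (simp add: vec_eq_iff matrix_vector_mult_def col_matrix_def mult.commute)

section \<open>Fibres and sections\<close>

context vector_bundle
begin

lemma triv_inv:
  assumes "(U, \<Phi>) \<in> T" "x \<in> U"
  shows "inv_into (E x) (\<Phi> x) v \<in> E x" "\<Phi> x (inv_into (E x) (\<Phi> x) v) = v"
    "e \<in> E x \<Longrightarrow> inv_into (E x) (\<Phi> x) (\<Phi> x e) = e"
  using triv_bij[OF assms] unfolding bij_betw_def
  by (metis UNIV_I inv_into_into, metis UNIV_I f_inv_into_f, metis inv_into_f_f)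

lemma triv_eqI:
  "(U, \<Phi>) \<in> T \<Longrightarrow> x \<in> U \<Longrightarrow> e \<in> E x \<Longrightarrow> f \<in> E x \<Longrightarrow> \<Phi> x e = \<Phi> x f \<Longrightarrow> e = f"
  by (metis triv_inv(3))

lemma triv_exists: obtains U \<Phi> where "(U, \<Phi>) \<in> T" "x \<in> U"
proof -
  have "x \<in> \<Union> (fst ` T)" using triv_cover by simp
  then show ?thesis using that by force
qed

lemma triv_at_cases:
  obtains U \<Phi> where "(U, \<Phi>) \<in> T" "x \<in> U" "triv_at x = \<Phi> x"
proof -
  have "\<exists>\<tau>. \<tau> \<in> T \<and> x \<in> fst \<tau>" by (rule triv_exists[of x]) force
  from someI_ex[OF this] show ?thesis
    using that[of "fst (SOME \<tau>. \<tau> \<in> T \<and> x \<in> fst \<tau>)" "snd (SOME \<tau>. \<tau> \<in> T \<and> x \<in> fst \<tau>)"]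
    by (simp add: triv_at_def)
qed

text \<open>The fibre operations are defined through one chosen trivialisation; linearity of the
  transition matrices makes every other trivialisation linear for them as well.\<close>

lemma fib_ops:
  assumes "(U, \<Phi>) \<in> T" "x \<in> U"
  shows "fib_zero x \<in> E x" "\<Phi> x (fib_zero x) = 0"
    "e \<in> E x \<Longrightarrow> f \<in> E x \<Longrightarrow> fib_add x e f \<in> E x"
    "e \<in> E x \<Longrightarrow> f \<in> E x \<Longrightarrow> \<Phi> x (fib_add x e f) = \<Phi> x e + \<Phi> x f"
    "e \<in> E x \<Longrightarrow> fib_scale x a e \<in> E x"
    "e \<in> E x \<Longrightarrow> \<Phi> x (fib_scale x a e) = a *s \<Phi> x e"
proof -
  obtain V \<Psi> where V: "(V, \<Psi>) \<in> T" "x \<in> V" "triv_at x = \<Psi> x" by (rule triv_at_cases)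
  obtain G where G: "\<And>e. e \<in> E x \<Longrightarrow> \<Phi> x e = G *v \<Psi> x e"
    using triv_transition[OF V(1) assms(1)] V(2) assms(2) by blast
  note inv = triv_inv[OF V(1,2)]
  show "fib_zero x \<in> E x" "\<Phi> x (fib_zero x) = 0"
    using G[OF inv(1)] inv by (simp_all add: fib_zero_def V(3))
  show "fib_add x e f \<in> E x" "fib_scale x a e \<in> E x" if "e \<in> E x" for f
    using inv(1) by (simp_all add: fib_add_def fib_scale_def V(3))
  show "\<Phi> x (fib_add x e f) = \<Phi> x e + \<Phi> x f" if "e \<in> E x" "f \<in> E x"
    using G[OF inv(1)] inv(2) G[OF that(1)] G[OF that(2)]
    by (simp add: fib_add_def V(3) matrix_vector_right_distrib)
  show "\<Phi> x (fib_scale x a e) = a *s \<Phi> x e" if "e \<in> E x"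
    using G[OF inv(1)] inv(2) G[OF that] by (simp add: fib_scale_def V(3) vector_scalar_commute)
qed

lemma fib_mem:
  "fib_zero x \<in> E x" "e \<in> E x \<Longrightarrow> f \<in> E x \<Longrightarrow> fib_add x e f \<in> E x" "e \<in> E x \<Longrightarrow> fib_scale x a e \<in> E x"
  by (rule triv_exists[of x], erule (1) fib_ops; assumption)+

lemma smooth_sectionsD:
  "s \<in> smooth_sections \<Longrightarrow> s x \<in> E x"
  "s \<in> smooth_sections \<Longrightarrow> (U, \<Phi>) \<in> T \<Longrightarrow> smooth_fun U (\<lambda>x. \<Phi> x (s x))"
  unfolding smooth_sections_def by blast+

lemma smooth_sectionsI:
  "(\<And>x. s x \<in> E x) \<Longrightarrow> (\<And>U \<Phi>. (U, \<Phi>) \<in> T \<Longrightarrow> smooth_fun U (\<lambda>x. \<Phi> x (s x))) \<Longrightarrow> s \<in> smooth_sections"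
  unfolding smooth_sections_def by blast

lemma smooth_sections_add:
  assumes "s \<in> smooth_sections" "s' \<in> smooth_sections"
  shows "(\<lambda>y. fib_add y (s y) (s' y)) \<in> smooth_sections"
proof (rule smooth_sectionsI)
  show "fib_add x (s x) (s' x) \<in> E x" for x using fib_mem assms smooth_sectionsD(1) by blast
  fix U \<Phi> assume U: "(U, \<Phi>) \<in> T"
  show "smooth_fun U (\<lambda>x. \<Phi> x (fib_add x (s x) (s' x)))"
    by (rule smooth_fun_cong[OF triv_open[OF U] _ smooth_fun_add[OF triv_open[OF U]
          smooth_sectionsD(2)[OF assms(1) U] smooth_sectionsD(2)[OF assms(2) U]]])
      (simp add: fib_ops(4)[OF U] smooth_sectionsD(1) assms)
qed

lemma smooth_sections_scale:
  assumes "s \<in> smooth_sections" "smooth_fun UNIV f"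
  shows "(\<lambda>y. fib_scale y (f y) (s y)) \<in> smooth_sections"
proof (rule smooth_sectionsI)
  show "fib_scale x (f x) (s x) \<in> E x" for x using fib_mem assms smooth_sectionsD(1) by blast
  fix U \<Phi> assume U: "(U, \<Phi>) \<in> T"
  show "smooth_fun U (\<lambda>x. \<Phi> x (fib_scale x (f x) (s x)))"
    by (rule smooth_fun_cong[OF triv_open[OF U] _ smooth_fun_bilinear[OF bounded_bilinear_smult triv_open[OF U]
          smooth_fun_subset[OF assms(2) subset_UNIV] smooth_sectionsD(2)[OF assms(1) U]]])
      (simp add: fib_ops(6)[OF U] smooth_sectionsD(1) assms)
qed

definition section_of :: "'m set \<Rightarrow> ('m \<Rightarrow> 'v \<Rightarrow> complex ^ 'r) \<Rightarrow> ('m \<Rightarrow> complex ^ 'r) \<Rightarrow> 'm \<Rightarrow> 'v" where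
  "section_of U \<Phi> v = (\<lambda>y. if y \<in> U then inv_into (E y) (\<Phi> y) (v y) else fib_zero y)"

lemma section_of_eq:
  assumes "(U, \<Phi>) \<in> T"
  shows "section_of U \<Phi> v y \<in> E y" "y \<in> U \<Longrightarrow> \<Phi> y (section_of U \<Phi> v y) = v y"
  using triv_inv[OF assms] fib_mem by (auto simp: section_of_def)

text \<open>In another trivialisation over \<open>V\<close> the section is \<open>G\<close> applied
  to \<open>v\<close> on the overlap and zero away from the closed set \<open>K\<close>; these two
  open sets cover \<open>V\<close>.\<close>

lemma section_of_smooth:
  assumes U: "(U, \<Phi>) \<in> T" and v: "smooth_fun U v" and K: "closed K" "K \<subseteq> U" "\<And>y. y \<notin> K \<Longrightarrow> v y = 0"
  shows "section_of U \<Phi> v \<in> smooth_sections"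
proof (rule smooth_sectionsI)
  show "section_of U \<Phi> v x \<in> E x" for x by (rule section_of_eq[OF U])
  fix V \<Psi> assume V: "(V, \<Psi>) \<in> T"
  obtain G where G: "smooth_fun (U \<inter> V) G" "\<forall>x\<in>U \<inter> V. \<forall>e\<in>E x. \<Psi> x e = G x *v \<Phi> x e"
    using triv_transition[OF U V] by blast
  have oUV: "open (U \<inter> V)" using triv_open[OF U] triv_open[OF V] by blast
  let ?f = "\<lambda>x. \<Psi> x (section_of U \<Phi> v x)"
  have 1: "smooth_fun (U \<inter> V) ?f"
    by (rule smooth_fun_cong[OF oUV _ smooth_fun_bilinear[OF bounded_bilinear_mv oUV G(1)
          smooth_fun_subset[OF v Int_lower1]]])
      (use G(2) section_of_eq[OF U] in auto)
  have z: "?f y = 0" if y: "y \<in> V" "y \<notin> K" for y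
  proof (cases "y \<in> U")
    case True
    have "?f y = G y *v \<Phi> y (section_of U \<Phi> v y)" using G(2) section_of_eq(1)[OF U] y True by blast
    then show ?thesis using section_of_eq(2)[OF U True, of v] K(3)[OF y(2)] by simp
  next
    case False
    then show ?thesis using fib_ops(2)[OF V y(1)] by (simp add: section_of_def)
  qed
  have oVK: "open (V - K)" using triv_open[OF V] K(1) by blast
  have 2: "smooth_fun (V - K) ?f"
    by (rule smooth_fun_cong[OF oVK _ smooth_fun_const[of _ 0]]) (use z in auto)
  show "smooth_fun V ?f"
  proof (rule smooth_fun_local[OF triv_open[OF V]])
    fix y assume "y \<in> V"
    then have "y \<in> U \<inter> V \<or> y \<in> V - K" using K(2) by blast
    then show "\<exists>W. open W \<and> y \<in> W \<and> smooth_fun W ?f" using 1 2 oUV oVK by blast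
  qed
qed

lemma bump_section:
  assumes U: "(U, \<Phi>) \<in> T" and \<psi>: "smooth_fun UNIV (\<psi> :: 'm \<Rightarrow> real)" and K: "closed K" "K \<subseteq> U" "\<And>y. y \<notin> K \<Longrightarrow> \<psi> y = 0"
  shows "section_of U \<Phi> (\<lambda>y. \<psi> y *\<^sub>R v) \<in> smooth_sections"
  by (rule section_of_smooth[OF U _ K(1,2)])
    (use K(3) in \<open>auto intro!: smooth_fun_bilinear[OF bounded_bilinear_scaleR triv_open[OF U] _ smooth_fun_const]
        smooth_fun_subset[OF \<psi>]\<close>)

lemma local_section:
  assumes U: "(U, \<Phi>) \<in> T" and x: "x \<in> U"
  obtains s V where "s \<in> smooth_sections" "open V" "x \<in> V" "V \<subseteq> U" "\<And>y. y \<in> V \<Longrightarrow> \<Phi> y (s y) = v"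
proof -
  obtain \<psi> :: "'m \<Rightarrow> real" and V K where b: "smooth_fun UNIV \<psi>" "open V" "x \<in> V" "\<And>y. y \<in> V \<Longrightarrow> \<psi> y = 1"
    "closed K" "K \<subseteq> U" "V \<subseteq> K" "\<And>y. y \<notin> K \<Longrightarrow> \<psi> y = 0"
    using bump_function[OF triv_open[OF U] x] by blast
  show ?thesis
    by (rule that[OF bump_section[OF U b(1,5,6,8)] b(2,3), of v])
      (use b section_of_eq(2)[OF U] in auto)
qed

end

section \<open>The connection form\<close>

context hermitian_vector_bundle
begin

lemma unitary_connectionsD:
  assumes "D \<in> unitary_connections k"
  shows "\<not> (s \<in> smooth_sections \<and> w \<in> tangent_space A x) \<Longrightarrow> D s x w = undefined"
    "s \<in> smooth_sections \<Longrightarrow> w \<in> tangent_space A x \<Longrightarrow> D s x w \<in> E x"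
    "s \<in> smooth_sections \<Longrightarrow> w \<in> tangent_space A x \<Longrightarrow> w' \<in> tangent_space A x \<Longrightarrow>
      D s x (\<lambda>c. a *\<^sub>R w c + w' c) = fib_add x (fib_scale x (of_real a) (D s x w)) (D s x w')"
    "s \<in> smooth_sections \<Longrightarrow> s' \<in> smooth_sections \<Longrightarrow> w \<in> tangent_space A x \<Longrightarrow>
      D (\<lambda>y. fib_add y (s y) (s' y)) x w = fib_add x (D s x w) (D s' x w)"
    "s \<in> smooth_sections \<Longrightarrow> smooth_fun UNIV f \<Longrightarrow> w \<in> tangent_space A x \<Longrightarrow>
      D (\<lambda>y. fib_scale y (f y) (s y)) x w =
          fib_add x (fib_scale x (deriv_along A f x w) (s x)) (fib_scale x (f x) (D s x w))"
    "s \<in> smooth_sections \<Longrightarrow> s' \<in> smooth_sections \<Longrightarrow> w \<in> tangent_space A x \<Longrightarrow>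
      deriv_along A (\<lambda>y. h y (s y) (s' y)) x w = h x (D s x w) (s' x) + h x (s x) (D s' x w)"
    "s \<in> smooth_sections \<Longrightarrow> c \<in> A \<Longrightarrow> (U, \<Phi>) \<in> T \<Longrightarrow>
      Ck_on k (\<lambda>p. \<Phi> (chart_inv c p) (D s (chart_inv c p) (vec_of A c (chart_inv c p) \<xi>))) (snd c ` (fst c \<inter> U))"
proof -
  note a = assms[unfolded unitary_connections_def mem_Collect_eq]
  note a2 = a[THEN conjunct2] note a3 = a2[THEN conjunct2] note a4 = a3[THEN conjunct2]
  note a5 = a4[THEN conjunct2] note a6 = a5[THEN conjunct2]
  show "\<not> (s \<in> smooth_sections \<and> w \<in> tangent_space A x) \<Longrightarrow> D s x w = undefined"
    by (rule a[THEN conjunct1, rule_format])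
  show "s \<in> smooth_sections \<Longrightarrow> w \<in> tangent_space A x \<Longrightarrow> D s x w \<in> E x"
    by (rule a2[THEN conjunct1, rule_format])
  show "s \<in> smooth_sections \<Longrightarrow> w \<in> tangent_space A x \<Longrightarrow> w' \<in> tangent_space A x \<Longrightarrow>
      D s x (\<lambda>c. a *\<^sub>R w c + w' c) = fib_add x (fib_scale x (of_real a) (D s x w)) (D s x w')"
    by (rule a3[THEN conjunct1, rule_format])
  show "s \<in> smooth_sections \<Longrightarrow> s' \<in> smooth_sections \<Longrightarrow> w \<in> tangent_space A x \<Longrightarrow>
      D (\<lambda>y. fib_add y (s y) (s' y)) x w = fib_add x (D s x w) (D s' x w)"
    by (rule a4[THEN conjunct1, rule_format])
  show "s \<in> smooth_sections \<Longrightarrow> smooth_fun UNIV f \<Longrightarrow> w \<in> tangent_space A x \<Longrightarrow>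
      D (\<lambda>y. fib_scale y (f y) (s y)) x w =
          fib_add x (fib_scale x (deriv_along A f x w) (s x)) (fib_scale x (f x) (D s x w))"
    by (rule a5[THEN conjunct1, rule_format])
  show "s \<in> smooth_sections \<Longrightarrow> s' \<in> smooth_sections \<Longrightarrow> w \<in> tangent_space A x \<Longrightarrow>
      deriv_along A (\<lambda>y. h y (s y) (s' y)) x w = h x (D s x w) (s' x) + h x (s x) (D s' x w)"
    by (rule a6[THEN conjunct1, rule_format])
  show "s \<in> smooth_sections \<Longrightarrow> c \<in> A \<Longrightarrow> (U, \<Phi>) \<in> T \<Longrightarrow>
      Ck_on k (\<lambda>p. \<Phi> (chart_inv c p) (D s (chart_inv c p) (vec_of A c (chart_inv c p) \<xi>))) (snd c ` (fst c \<inter> U))"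
    using a6[THEN conjunct2, rule_format, of s c "(U, \<Phi>)"] by simp
qed

text \<open>With a cut-off function \<open>\<psi>\<close> equal to \<open>1\<close> near \<open>x\<close>, the section \<open>\<psi>\<^sup>2 s\<close> is a combination of the
  global sections \<open>\<psi> e\<^sub>j\<close> with the global coefficients \<open>\<psi> s\<^sub>j\<close>, so that the Leibniz rule determines
  \<open>\<nabla>s\<close> at \<open>x\<close>.\<close>

lemma connection_frame:
  assumes D: "D \<in> unitary_connections k" and U: "(U, \<Phi>) \<in> T" and x: "x \<in> U" and w: "w \<in> tangent_space A x"
  shows "\<exists>\<omega>. \<forall>s\<in>smooth_sections. \<Phi> x (D s x w) = deriv_along A (\<lambda>y. \<Phi> y (s y)) x w + \<omega> *v \<Phi> x (s x)"
proof -
  note DD = unitary_connectionsD[OF D]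
  note ops = fib_ops[OF U x]
  obtain \<psi> :: "'m \<Rightarrow> real" and V K where b: "smooth_fun UNIV \<psi>" "open V" "x \<in> V" "\<And>y. y \<in> V \<Longrightarrow> \<psi> y = 1"
    "closed K" "K \<subseteq> U" "V \<subseteq> K" "\<And>y. y \<notin> K \<Longrightarrow> \<psi> y = 0"
    using bump_function[OF triv_open[OF U] x] by blast
  have VU: "V \<subseteq> U" using b by blast
  define e where "e j = section_of U \<Phi> (\<lambda>y. \<psi> y *\<^sub>R axis j 1)" for j
  have e: "e j \<in> smooth_sections" for j unfolding e_def by (rule bump_section[OF U b(1,5,6,8)])
  have e\<Phi>: "\<Phi> y (e j y) = \<psi> y *\<^sub>R axis j 1" if "y \<in> U" for y j
    unfolding e_def by (rule section_of_eq(2)[OF U that])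
  have eE: "e j y \<in> E y" for j y by (rule smooth_sectionsD(1)[OF e])
  \<comment> \<open>The columns of the connection form: near \<open>x\<close> the section
    \<open>e j\<close> has the constant coordinates \<open>axis j 1\<close>.\<close>
  define cj where "cj j = \<Phi> x (D (e j) x w)" for j
  have "\<Phi> x (D s x w) = deriv_along A (\<lambda>y. \<Phi> y (s y)) x w + (\<Sum>j\<in>UNIV. col_matrix j (cj j)) *v \<Phi> x (s x)"
    if s: "s \<in> smooth_sections" for s
  proof -
    have sE: "s y \<in> E y" for y by (rule smooth_sectionsD(1)[OF s])
    define f where "f j y = (if y \<in> U then \<psi> y *\<^sub>R (\<Phi> y (s y) $ j) else 0)" for j y
    have f: "smooth_fun UNIV (f j)" for j
      unfolding f_def
      by (rule smooth_fun_extend[OF triv_open[OF U] _ b(1,5,6,8)])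
        (rule smooth_fun_linear[OF bounded_linear_vec_nth triv_open[OF U] smooth_sectionsD(2)[OF s U]])
    have fz: "f j y = 0" if "y \<notin> U" for j y using that by (simp add: f_def)
    \<comment> \<open>The axioms of a connection treat a sum of two sections only, so the section
      with its derivative at \<open>x\<close> is built up one index at a time.\<close>
    have ind: "\<exists>S\<in>smooth_sections. (\<forall>y\<in>U. \<Phi> y (S y) = (\<Sum>j\<in>J. f j y *s (\<psi> y *\<^sub>R axis j 1))) \<and>
        (\<forall>y. y \<notin> U \<longrightarrow> S y = fib_zero y) \<and>
        \<Phi> x (D S x w) = (\<Sum>j\<in>J. deriv_along A (f j) x w *s axis j 1 + f j x *s cj j)" if "finite J" for J
      using that
    proof induction
      case empty
      \<comment> \<open>The zero section written as zero times \<open>s\<close>, so that the Leibniz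
        rule yields a vanishing derivative.\<close>
      let ?S = "\<lambda>y. fib_scale y ((\<lambda>_. 0) y) (s y)"
      have "?S \<in> smooth_sections" by (rule smooth_sections_scale[OF s smooth_fun_const])
      moreover have "\<Phi> y (?S y) = 0" if "y \<in> U" for y using fib_ops(6)[OF U that sE, of 0] by simp
      moreover have "?S y = fib_zero y" for y
      proof -
        obtain V \<Psi> where V: "(V, \<Psi>) \<in> T" "y \<in> V" by (rule triv_exists)
        show ?thesis
          by (rule triv_eqI[OF V fib_ops(5)[OF V sE] fib_ops(1)[OF V]]) (simp add: fib_ops[OF V] sE)
      qed
      moreover have "\<Phi> x (D ?S x w) = 0"
        unfolding DD(5)[OF s smooth_fun_const w] deriv_along_const
        by (simp add: ops sE DD(2)[OF s w])
      ultimately show ?case by (intro bexI[of _ ?S]) auto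
    next
      case (insert i J)
      then obtain S where S: "S \<in> smooth_sections"
        "\<forall>y\<in>U. \<Phi> y (S y) = (\<Sum>j\<in>J. f j y *s (\<psi> y *\<^sub>R axis j 1))" "\<forall>y. y \<notin> U \<longrightarrow> S y = fib_zero y"
        "\<Phi> x (D S x w) = (\<Sum>j\<in>J. deriv_along A (f j) x w *s axis j 1 + f j x *s cj j)" by blast
      let ?F = "\<lambda>y. fib_scale y (f i y) (e i y)"
      let ?S = "\<lambda>y. fib_add y (?F y) (S y)"
      have F: "?F \<in> smooth_sections" by (rule smooth_sections_scale[OF e f])
      have SE: "S y \<in> E y" for y by (rule smooth_sectionsD(1)[OF S(1)])
      have FE: "?F y \<in> E y" for y by (rule smooth_sectionsD(1)[OF F])
      have 1: "?S \<in> smooth_sections" by (rule smooth_sections_add[OF F S(1)])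
      have 2: "\<Phi> y (?S y) = (\<Sum>j\<in>insert i J. f j y *s (\<psi> y *\<^sub>R axis j 1))" if y: "y \<in> U" for y
        using S(2) y insert.hyps by (simp add: fib_ops(4,6)[OF U y] SE FE eE e\<Phi>)
      have 3: "?S y = fib_zero y" if "y \<notin> U" for y
      proof -
        obtain V \<Psi> where V: "(V, \<Psi>) \<in> T" "y \<in> V" by (rule triv_exists)
        show ?thesis
          by (rule triv_eqI[OF V fib_ops(3)[OF V FE SE] fib_ops(1)[OF V]])
            (use S(3) that in \<open>simp add: fib_ops[OF V] eE fz FE\<close>)
      qed
      have "\<Phi> x (D ?S x w) = \<Phi> x (D ?F x w) + \<Phi> x (D S x w)"
        unfolding DD(4)[OF F S(1) w] by (rule ops(4)[OF DD(2)[OF F w] DD(2)[OF S(1) w]])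
      also have "\<Phi> x (D ?F x w) = deriv_along A (f i) x w *s axis i 1 + f i x *s cj i"
        unfolding DD(5)[OF e f w]
        by (simp add: ops eE DD(2)[OF e w] e\<Phi>[OF x] b(4)[OF b(3)] cj_def)
      finally have 4: "\<Phi> x (D ?S x w) = (\<Sum>j\<in>insert i J. deriv_along A (f j) x w *s axis j 1 + f j x *s cj j)"
        using S(4) insert.hyps by simp
      show ?case using 1 2 3 4 by (intro bexI[of _ ?S]) blast+
    qed
    then obtain S where S: "S \<in> smooth_sections"
      "\<forall>y\<in>U. \<Phi> y (S y) = (\<Sum>j\<in>UNIV. f j y *s (\<psi> y *\<^sub>R axis j 1))" "\<forall>y. y \<notin> U \<longrightarrow> S y = fib_zero y"
      "\<Phi> x (D S x w) = (\<Sum>j\<in>UNIV. deriv_along A (f j) x w *s axis j 1 + f j x *s cj j)"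
      using ind[OF finite[of UNIV]] by blast
    \<comment> \<open>One factor \<open>\<psi>\<close> comes from the frame \<open>e j\<close>, the
      other from the coefficient \<open>f j\<close>. As \<open>q\<close> equals 1 near
      \<open>x\<close>, its derivative there vanishes and the factor disappears from the Leibniz
      rule.\<close>
    define q where "q y = complex_of_real (\<psi> y * \<psi> y)" for y
    have q: "smooth_fun UNIV q"
      unfolding q_def
      by (rule smooth_fun_linear[OF bounded_linear_of_real open_UNIV
            smooth_fun_bilinear[OF bounded_bilinear_mult open_UNIV b(1) b(1)]])
    have SE: "S y \<in> E y" for y by (rule smooth_sectionsD(1)[OF S(1)])
    have "S y = fib_scale y (q y) (s y)" for y
    proof (cases "y \<in> U")
      case True
      have "(\<Sum>j\<in>UNIV. f j y *s (\<psi> y *\<^sub>R axis j 1)) = q y *s (\<Sum>j\<in>UNIV. (\<Phi> y (s y) $ j) *s axis j 1)"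
        using True by (simp add: f_def q_def scaleR_eq_smult vec.scale_sum_right vector_smult_assoc scaleR_conv_of_real mult_ac)
      then have "\<Phi> y (S y) = \<Phi> y (fib_scale y (q y) (s y))"
        using S(2) True fib_ops(6)[OF U True sE] by (simp add: basis_expansion)
      then show ?thesis by (rule triv_eqI[OF U True SE fib_mem(3)[OF sE]])
    next
      case False
      then have "\<psi> y = 0" using b by blast
      obtain V \<Psi> where V: "(V, \<Psi>) \<in> T" "y \<in> V" by (rule triv_exists)
      show ?thesis
        by (rule triv_eqI[OF V SE fib_mem(3)[OF sE]])
          (use S(3) False \<open>\<psi> y = 0\<close> in \<open>simp add: fib_ops[OF V] sE q_def\<close>)
    qed
    then have Seq: "S = (\<lambda>y. fib_scale y (q y) (s y))" by blast
    have dq: "deriv_along A q x w = 0"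
      using deriv_along_cong[OF b(2,3), of q "\<lambda>y. 1" w] b(4) by (simp add: q_def deriv_along_const)
    have "\<Phi> x (D S x w) = \<Phi> x (D s x w)"
      unfolding Seq DD(5)[OF s q w] dq
      using b(4)[OF b(3)] by (simp add: ops sE DD(2)[OF s w] fib_mem q_def)
    then have "\<Phi> x (D s x w) = (\<Sum>j\<in>UNIV. deriv_along A (f j) x w *s axis j 1) + (\<Sum>j\<in>UNIV. f j x *s cj j)"
      using S(4) by (simp add: sum.distrib)
    also have "(\<Sum>j\<in>UNIV. deriv_along A (f j) x w *s axis j 1) = deriv_along A (\<lambda>y. \<Phi> y (s y)) x w"
    proof -
      have "deriv_along A (f j) x w = deriv_along A (\<lambda>y. \<Phi> y (s y)) x w $ j" for j
      proof -
        have "deriv_along A (f j) x w = deriv_along A (\<lambda>y. \<Phi> y (s y) $ j) x w"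
          by (rule deriv_along_cong[OF b(2,3)]) (use b(4) VU in \<open>auto simp: f_def\<close>)
        also have "\<dots> = deriv_along A (\<lambda>y. \<Phi> y (s y)) x w $ j"
          by (rule deriv_along_linear_compose[OF bounded_linear_vec_nth smooth_sectionsD(2)[OF s U] x w])
        finally show ?thesis .
      qed
      then show ?thesis by (simp add: basis_expansion)
    qed
    also have "(\<Sum>j\<in>UNIV. f j x *s cj j) = (\<Sum>j\<in>UNIV. col_matrix j (cj j)) *v \<Phi> x (s x)"
      using x b(4)[OF b(3)] by (simp add: sum_col_matrix_mult f_def)
    finally show ?thesis .
  qed
  then show ?thesis by blast
qed

lemma connection_form_eq:
  assumes D: "D \<in> unitary_connections k" and U: "(U, \<Phi>) \<in> T" and x: "x \<in> U" and w: "w \<in> tangent_space A x"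
    and s: "s \<in> smooth_sections"
  shows "\<Phi> x (D s x w) = deriv_along A (\<lambda>y. \<Phi> y (s y)) x w + connection_form D \<Phi> x w *v \<Phi> x (s x)"
proof -
  let ?P = "\<lambda>\<omega>. \<forall>s\<in>smooth_sections. \<Phi> x (D s x w) = deriv_along A (\<lambda>y. \<Phi> y (s y)) x w + \<omega> *v \<Phi> x (s x)"
  have "\<exists>!\<omega>. ?P \<omega>"
  proof (rule ex_ex1I[OF connection_frame[OF D U x w]])
    fix \<omega> \<omega>' assume w12: "?P \<omega>" "?P \<omega>'"
    show "\<omega> = \<omega>'" unfolding matrix_eq
    proof
      fix v
      obtain s V where s: "s \<in> smooth_sections" "x \<in> V" "\<And>y. y \<in> V \<Longrightarrow> \<Phi> y (s y) = v"
        using local_section[OF U x] by metis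
      show "\<omega> *v v = \<omega>' *v v" using w12 s(1) s(3)[OF s(2)] by (metis add_left_cancel)
    qed
  qed
  from theI'[OF this] show ?thesis using s unfolding connection_form_def by blast
qed

text \<open>For a section with constant coordinates the derivative term drops out, so the matrix can
  be read off from \<open>\<nabla>s\<close>, whose regularity is part of the definition of a
  connection.\<close>

lemma connection_form_const:
  assumes D: "D \<in> unitary_connections k" and U: "(U, \<Phi>) \<in> T" and V: "open V" "y \<in> V" "V \<subseteq> U"
    and s: "s \<in> smooth_sections" "\<And>y. y \<in> V \<Longrightarrow> \<Phi> y (s y) = v" and w: "w \<in> tangent_space A y"
  shows "connection_form D \<Phi> y w *v v = \<Phi> y (D s y w)"
proof -
  have "deriv_along A (\<lambda>y. \<Phi> y (s y)) y w = 0"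
    using deriv_along_cong[OF V(1,2), of "\<lambda>y. \<Phi> y (s y)" "\<lambda>y. v" w] s(2) by (simp add: deriv_along_const)
  then show ?thesis using connection_form_eq[OF D U _ w s(1)] V s(2)[OF V(2)] by auto
qed

lemma connection_form_unique:
  assumes D: "D \<in> unitary_connections k" and U: "(U, \<Phi>) \<in> T" and x: "x \<in> U" and w: "w \<in> tangent_space A x"
    and \<omega>: "\<And>s. s \<in> smooth_sections \<Longrightarrow>
      \<Phi> x (D s x w) = deriv_along A (\<lambda>y. \<Phi> y (s y)) x w + \<omega> *v \<Phi> x (s x)"
  shows "connection_form D \<Phi> x w = \<omega>"
  unfolding matrix_eq
proof
  fix v
  obtain s V where s: "s \<in> smooth_sections" "x \<in> V" "\<And>y. y \<in> V \<Longrightarrow> \<Phi> y (s y) = v"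
    using local_section[OF U x] by metis
  show "connection_form D \<Phi> x w *v v = \<omega> *v v"
    using connection_form_eq[OF D U x w s(1)] \<omega>[OF s(1)] s(3)[OF s(2)] by simp
qed

lemma connection_form_lincomb:
  assumes D: "D \<in> unitary_connections k" and U: "(U, \<Phi>) \<in> T" and x: "x \<in> U"
    and w: "w \<in> tangent_space A x" "w' \<in> tangent_space A x"
  shows "connection_form D \<Phi> x (\<lambda>c. a *\<^sub>R w c + w' c)
    = a *\<^sub>R connection_form D \<Phi> x w + connection_form D \<Phi> x w'"
proof (rule connection_form_unique[OF D U x tangent_space_lincomb[OF w]])
  fix s assume s: "s \<in> smooth_sections"
  note DE = unitary_connectionsD(2)[OF D s]
  have "\<Phi> x (D s x (\<lambda>c. a *\<^sub>R w c + w' c)) = a *\<^sub>R \<Phi> x (D s x w) + \<Phi> x (D s x w')"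
    unfolding unitary_connectionsD(3)[OF D s w]
    by (simp add: fib_ops[OF U x] fib_mem DE w scaleR_eq_smult)
  also have "\<dots> = deriv_along A (\<lambda>y. \<Phi> y (s y)) x (\<lambda>c. a *\<^sub>R w c + w' c)
      + (a *\<^sub>R connection_form D \<Phi> x w + connection_form D \<Phi> x w') *v \<Phi> x (s x)"
    unfolding deriv_along_lincomb[OF smooth_sectionsD(2)[OF s U] x w] connection_form_eq[OF D U x w(1) s]
      connection_form_eq[OF D U x w(2) s] bounded_bilinear.add_left[OF bounded_bilinear_mv]
      bounded_bilinear.scaleR_left[OF bounded_bilinear_mv]
    by (simp add: scaleR_add_right)
  finally show "\<Phi> x (D s x (\<lambda>c. a *\<^sub>R w c + w' c)) = deriv_along A (\<lambda>y. \<Phi> y (s y)) x (\<lambda>c. a *\<^sub>R w c + w' c)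
      + (a *\<^sub>R connection_form D \<Phi> x w + connection_form D \<Phi> x w') *v \<Phi> x (s x)" .
qed

lemma connection_form_vec_of:
  assumes D: "D \<in> unitary_connections k" and U: "(U, \<Phi>) \<in> T" and x: "x \<in> U" and c: "c \<in> A" "x \<in> fst c"
  shows "linear (\<lambda>\<xi>. connection_form D \<Phi> x (vec_of A c x \<xi>))"
proof -
  have lc: "connection_form D \<Phi> x (vec_of A c x (a *\<^sub>R \<xi> + \<eta>))
      = a *\<^sub>R connection_form D \<Phi> x (vec_of A c x \<xi>) + connection_form D \<Phi> x (vec_of A c x \<eta>)" for a \<xi> \<eta>
    unfolding vec_of_lincomb[OF c] by (rule connection_form_lincomb[OF D U x vec_of_in[OF c] vec_of_in[OF c]])
  have "connection_form D \<Phi> x (vec_of A c x 0) = 0" using lc[of "-1" 0 0] by simp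
  then show ?thesis using lc[of 1] lc[of _ _ 0] by (intro linearI) simp_all
qed

lemma connection_form_coord_linear:
  assumes "D \<in> unitary_connections k" "(U, \<Phi>) \<in> T" "c \<in> A" "p \<in> snd c ` (fst c \<inter> U)"
  shows "linear (\<lambda>\<xi>. connection_form_coord D c \<Phi> \<xi> p)"
  unfolding connection_form_coord_def
  by (rule connection_form_vec_of[OF assms(1,2) _ assms(3)])
    (use chart_image_cases[OF assms(3), of p U] assms(4) in \<open>auto simp: Int_commute\<close>)

lemma open_chart_triv: "c \<in> A \<Longrightarrow> (U, \<Phi>) \<in> T \<Longrightarrow> open (snd c ` (fst c \<inter> U))"
  using open_chart_image[of c U] triv_open by (simp add: Int_commute)

text \<open>Near each point the columns of the connection form are the derivatives of global
  sections with constant coordinates; finitely many of them share one neighbourhood.\<close>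

lemma connection_form_coord_Ck:
  assumes D: "D \<in> unitary_connections k" and U: "(U, \<Phi>) \<in> T" and c: "c \<in> A"
  shows "Ck_on k (connection_form_coord D c \<Phi> \<xi>) (snd c ` (fst c \<inter> U))"
proof (rule Ck_on_local[OF _ open_chart_triv[OF c U]])
  fix p assume "p \<in> snd c ` (fst c \<inter> U)"
  then obtain x where x: "x \<in> fst c" "x \<in> U" "p = snd c x" by blast
  have "\<forall>v. \<exists>s V. s \<in> smooth_sections \<and> open V \<and> x \<in> V \<and> V \<subseteq> U \<and> (\<forall>y\<in>V. \<Phi> y (s y) = v)"
    using local_section[OF U x(2)] by metis
  then obtain s V where s: "\<And>v. s v \<in> smooth_sections" "\<And>v. open (V v)" "\<And>v. x \<in> V v" "\<And>v. V v \<subseteq> U"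
    "\<And>v y. y \<in> V v \<Longrightarrow> \<Phi> y (s v y) = v" by metis
  define W where "W = (\<Inter>j::'r. V (axis j 1))"
  have "W \<subseteq> V (axis undefined 1)" unfolding W_def by blast
  then have WU: "W \<subseteq> U" using s(4) by blast
  have W: "open W" "x \<in> W" "W \<subseteq> U" using s(2,3) WU by (auto simp: W_def intro!: open_INT)
  let ?W = "snd c ` (W \<inter> fst c)"
  have oW: "open ?W" by (rule open_chart_image[OF c W(1)])
  let ?g = "\<lambda>j p. \<Phi> (chart_inv c p) (D (s (axis j 1)) (chart_inv c p) (vec_of A c (chart_inv c p) \<xi>))"
  have "Ck_on k (?g j) ?W" for j
    by (rule Ck_on_subset[OF unitary_connectionsD(7)[OF D s(1) c U]]) (use W in blast)
  then have 1: "Ck_on k (\<lambda>p. \<Sum>j\<in>UNIV. col_matrix j (?g j p)) ?W"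
    by (intro Ck_on_sum[OF oW] Ck_on_linear_compose[OF bounded_linear_col_matrix oW])
  have "Ck_on k (connection_form_coord D c \<Phi> \<xi>) ?W"
  proof (rule Ck_on_cong[OF oW _ 1])
    fix p assume p: "p \<in> ?W"
    note y = chart_image_cases[OF c p]
    have yV: "chart_inv c p \<in> V (axis j 1)" for j using y(1) by (auto simp: W_def)
    have "connection_form_coord D c \<Phi> \<xi> p *v axis j 1 = ?g j p" for j
      unfolding connection_form_coord_def
      by (rule connection_form_const[where V = "V (axis j 1)", OF D U s(2) yV s(4) s(1) s(5) vec_of_in[OF c y(2)]])
    then show "(\<Sum>j\<in>UNIV. col_matrix j (?g j p)) = connection_form_coord D c \<Phi> \<xi> p"
      using sum_col_matrix[of "connection_form_coord D c \<Phi> \<xi> p"] by simp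
  qed
  then show "\<exists>U'. open U' \<and> p \<in> U' \<and> Ck_on k (connection_form_coord D c \<Phi> \<xi>) (U' \<inter> snd c ` (fst c \<inter> U))"
    by (intro exI[of _ ?W] conjI oW Ck_on_subset[OF _ Int_lower1]) (use W(2) x in auto)
qed

text \<open>The gauge transformation law. Applying it to \<open>G x *v v\<close> avoids the inverse
  of \<open>G\<close>.\<close>

lemma connection_form_trans:
  assumes D: "D \<in> unitary_connections k" and U: "(U, \<Phi>) \<in> T" and V: "(V, \<Psi>) \<in> T" and x: "x \<in> U" "x \<in> V"
    and G: "smooth_fun (U \<inter> V) G" "\<forall>x\<in>U \<inter> V. \<forall>e\<in>E x. \<Psi> x e = G x *v \<Phi> x e"
    and w: "w \<in> tangent_space A x"
  shows "connection_form D \<Psi> x w *v (G x *v v)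
    = G x *v (connection_form D \<Phi> x w *v v) - deriv_along A G x w *v v"
proof -
  have UV: "open (U \<inter> V)" "x \<in> U \<inter> V" using triv_open[OF U] triv_open[OF V] x by auto
  obtain s W where s: "s \<in> smooth_sections" "x \<in> W" "\<And>y. y \<in> W \<Longrightarrow> \<Phi> y (s y) = v"
    using local_section[OF U x(1)] by metis
  have sE: "s y \<in> E y" for y by (rule smooth_sectionsD(1)[OF s(1)])
  have v: "\<Phi> x (s x) = v" by (rule s(3)[OF s(2)])
  have "\<Psi> x (D s x w) = G x *v \<Phi> x (D s x w)"
    using G(2) UV(2) unitary_connectionsD(2)[OF D s(1) w] by blast
  moreover have "deriv_along A (\<lambda>y. \<Psi> y (s y)) x w
      = G x *v deriv_along A (\<lambda>y. \<Phi> y (s y)) x w + deriv_along A G x w *v v"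
  proof -
    have "deriv_along A (\<lambda>y. \<Psi> y (s y)) x w = deriv_along A (\<lambda>y. G y *v \<Phi> y (s y)) x w"
      by (rule deriv_along_cong[OF UV]) (use G(2) sE in blast)
    also have "\<dots> = G x *v deriv_along A (\<lambda>y. \<Phi> y (s y)) x w + deriv_along A G x w *v \<Phi> x (s x)"
      by (rule deriv_along_bilinear[OF bounded_bilinear_mv G(1) smooth_fun_subset[OF smooth_sectionsD(2)[OF s(1) U]] UV(2) w])
        blast
    finally show ?thesis by (simp only: v)
  qed
  moreover have "\<Psi> x (s x) = G x *v v" using G(2) UV(2) sE v by metis
  ultimately show ?thesis
    using connection_form_eq[OF D U x(1) w s(1)] connection_form_eq[OF D V x(2) w s(1)] v
    by (simp add: matrix_vector_right_distrib algebra_simps)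
qed

end

section \<open>Parallel transport along geodesics\<close>

context closed_riemannian_manifold
begin

lemma geodesic_at_tangent:
  assumes "geodesic_at \<sigma> t" shows "snd (\<sigma> t) \<in> tangent_space A (fst (\<sigma> t))"
  using assms by (simp add: geodesic_at_def tangent_bundle_iff)

lemma geodesic_chart_curve:
  assumes "geodesic_at \<sigma> t" "c \<in> A" "fst (\<sigma> t) \<in> fst c"
  shows "((\<lambda>s. snd c (fst (\<sigma> s))) has_vector_derivative snd (\<sigma> t) c) (at t)"
    and "isCont (\<lambda>s. snd (\<sigma> s) c) t"
proof -
  note d = geodesic_at_coords[OF assms]
  from has_derivative_fst[OF d[unfolded has_vector_derivative_def]]
  show "((\<lambda>s. snd c (fst (\<sigma> s))) has_vector_derivative snd (\<sigma> t) c) (at t)"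
    unfolding has_vector_derivative_def by (simp add: spray_def)
  have "isCont (\<lambda>s. coords c (\<sigma> s)) t" using d has_vector_derivative_continuous by blast
  from continuous_snd[OF this] show "isCont (\<lambda>s. snd (\<sigma> s) c) t" by simp
qed

lemma deriv_along_curve:
  assumes "geodesic_at \<sigma> t" and f: "smooth_fun U f" and U: "open U" "fst (\<sigma> t) \<in> U"
  shows "((\<lambda>s. f (fst (\<sigma> s))) has_vector_derivative deriv_along A f (fst (\<sigma> t)) (snd (\<sigma> t))) (at t)"
proof -
  define c where "c = chart_at A (fst (\<sigma> t))"
  have c: "c \<in> A" "fst (\<sigma> t) \<in> fst c" using chart_at by (auto simp: c_def)
  let ?f' = "frechet_derivative (f \<circ> chart_inv c) (at (snd c (fst (\<sigma> t))))"
  note f' = smooth_fun_has_derivative[OF f c(1) U(2) c(2)]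
  have 1: "((\<lambda>s. (f \<circ> chart_inv c) (snd c (fst (\<sigma> s)))) has_derivative (\<lambda>h. ?f' (h *\<^sub>R snd (\<sigma> t) c))) (at t)"
    by (rule has_derivative_compose[OF geodesic_chart_curve(1)[OF assms(1) c, unfolded has_vector_derivative_def] f'])
  have e: "\<forall>\<^sub>F s in nhds t. fst (\<sigma> s) \<in> fst c" by (rule geodesic_at_near[OF assms(1) chart_open[OF c(1)] c(2)])
  then have ev: "\<forall>\<^sub>F s in at t. (f \<circ> chart_inv c) (snd c (fst (\<sigma> s))) = f (fst (\<sigma> s))"
    unfolding eventually_at_filter by (rule eventually_mono) (use chart_inv_left[OF c(1)] in auto)
  have "((\<lambda>s. f (fst (\<sigma> s))) has_derivative (\<lambda>h. ?f' (h *\<^sub>R snd (\<sigma> t) c))) (at t)"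
    by (rule has_derivative_transform_eventually[OF 1 ev]) (use chart_inv_left[OF c] in auto)
  then show ?thesis
    unfolding has_vector_derivative_def linear_cmul[OF has_derivative_linear[OF f']]
      deriv_along_chart[OF f U(2) c geodesic_at_tangent[OF assms(1)]] .
qed

end

context hermitian_vector_bundle
begin

definition parallel_at ::
    "(('m \<Rightarrow> 'v) \<Rightarrow> 'm \<Rightarrow> ('m, 'e) tvec \<Rightarrow> 'v) \<Rightarrow> (real \<Rightarrow> 'm \<times> ('m, 'e) tvec) \<Rightarrow> (real \<Rightarrow> 'v) \<Rightarrow> real \<Rightarrow> bool"
where
  "parallel_at D \<sigma> e t \<longleftrightarrow> e t \<in> E (fst (\<sigma> t)) \<and> (\<forall>(U, \<Phi>)\<in>T. fst (\<sigma> t) \<in> U \<longrightarrow>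
     ((\<lambda>s. \<Phi> (fst (\<sigma> s)) (e s)) has_vector_derivative
       - (connection_form D \<Phi> (fst (\<sigma> t)) (snd (\<sigma> t)) *v \<Phi> (fst (\<sigma> t)) (e t))) (at t))"

lemma parallel_along_iff: "parallel_along D \<sigma> e \<longleftrightarrow> (\<forall>t. parallel_at D \<sigma> e t)"
  unfolding parallel_along_def parallel_at_def by blast

lemma parallel_atD:
  assumes "parallel_at D \<sigma> e t"
  shows "e t \<in> E (fst (\<sigma> t))"
    "(U, \<Phi>) \<in> T \<Longrightarrow> fst (\<sigma> t) \<in> U \<Longrightarrow> ((\<lambda>s. \<Phi> (fst (\<sigma> s)) (e s)) has_vector_derivative
       - (connection_form D \<Phi> (fst (\<sigma> t)) (snd (\<sigma> t)) *v \<Phi> (fst (\<sigma> t)) (e t))) (at t)"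
  using assms unfolding parallel_at_def by auto

lemma parallel_at_cong:
  assumes "parallel_at D \<sigma> e t" and ev: "\<forall>\<^sub>F s in nhds t. e s = e' s"
  shows "parallel_at D \<sigma> e' t"
proof -
  have t: "e t = e' t" using ev by (rule eventually_nhds_x_imp_x)
  have "((\<lambda>s. \<Phi> (fst (\<sigma> s)) (e s)) has_vector_derivative v) (at t)
      = ((\<lambda>s. \<Phi> (fst (\<sigma> s)) (e' s)) has_vector_derivative v) (at t)" for \<Phi> :: "'m \<Rightarrow> 'v \<Rightarrow> complex ^ 'r" and v
    by (rule has_vector_derivative_cong_ev) (use ev t in \<open>auto elim: eventually_mono\<close>)
  then show ?thesis using assms(1) unfolding parallel_at_def t by auto
qed

text \<open>By the gauge transformation law the derivative of \<open>G\<close> along the geodesic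
  cancels its inhomogeneous term, so the transport equation needs to be verified in one
  trivialisation only.\<close>

lemma parallel_at_triv:
  assumes D: "D \<in> unitary_connections k" and \<sigma>: "geodesic_at \<sigma> t"
    and U: "(U, \<Phi>) \<in> T" "fst (\<sigma> t) \<in> U" and e: "\<forall>\<^sub>F s in nhds t. e s \<in> E (fst (\<sigma> s))"
    and d: "((\<lambda>s. \<Phi> (fst (\<sigma> s)) (e s)) has_vector_derivative
       - (connection_form D \<Phi> (fst (\<sigma> t)) (snd (\<sigma> t)) *v \<Phi> (fst (\<sigma> t)) (e t))) (at t)"
  shows "parallel_at D \<sigma> e t"
proof -
  have et: "e t \<in> E (fst (\<sigma> t))" using e by (rule eventually_nhds_x_imp_x)
  let ?x = "fst (\<sigma> t)" and ?w = "snd (\<sigma> t)"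
  have "((\<lambda>s. \<Psi> (fst (\<sigma> s)) (e s)) has_vector_derivative - (connection_form D \<Psi> ?x ?w *v \<Psi> ?x (e t))) (at t)"
    if V: "(V, \<Psi>) \<in> T" "?x \<in> V" for V \<Psi>
  proof -
    obtain G where G: "smooth_fun (U \<inter> V) G" "\<forall>x\<in>U \<inter> V. \<forall>e\<in>E x. \<Psi> x e = G x *v \<Phi> x e"
      using triv_transition[OF U(1) V(1)] by blast
    have UV: "open (U \<inter> V)" "?x \<in> U \<inter> V" using triv_open U V by auto
    have dG: "((\<lambda>s. G (fst (\<sigma> s))) has_vector_derivative deriv_along A G ?x ?w) (at t)"
      by (rule deriv_along_curve[OF \<sigma> G(1) UV])
    let ?\<omega> = "connection_form D \<Phi> ?x ?w"
    have 1: "((\<lambda>s. G (fst (\<sigma> s)) *v \<Phi> (fst (\<sigma> s)) (e s)) has_vector_derivative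
      G ?x *v (- (?\<omega> *v \<Phi> ?x (e t))) + deriv_along A G ?x ?w *v \<Phi> ?x (e t)) (at t)"
      by (rule bounded_bilinear.has_vector_derivative[OF bounded_bilinear_mv dG d])
    have eq: "\<Psi> ?x (e t) = G ?x *v \<Phi> ?x (e t)" using G(2) UV(2) et by blast
    have val: "G ?x *v (- (?\<omega> *v \<Phi> ?x (e t))) + deriv_along A G ?x ?w *v \<Phi> ?x (e t)
        = - (connection_form D \<Psi> ?x ?w *v \<Psi> ?x (e t))"
      unfolding eq connection_form_trans[OF D U(1) V(1) U(2) V(2) G geodesic_at_tangent[OF \<sigma>]]
      by (simp add: bounded_bilinear.minus_right[OF bounded_bilinear_mv])
    have "\<forall>\<^sub>F s in nhds t. fst (\<sigma> s) \<in> U \<inter> V" by (rule geodesic_at_near[OF \<sigma> UV])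
    with e have "\<forall>\<^sub>F s in nhds t. G (fst (\<sigma> s)) *v \<Phi> (fst (\<sigma> s)) (e s) = \<Psi> (fst (\<sigma> s)) (e s)"
      by eventually_elim (use G(2) in auto)
    then have "((\<lambda>s. G (fst (\<sigma> s)) *v \<Phi> (fst (\<sigma> s)) (e s)) has_vector_derivative v) (at t)
      = ((\<lambda>s. \<Psi> (fst (\<sigma> s)) (e s)) has_vector_derivative v) (at t)" for v
      by (intro has_vector_derivative_cong_ev) (auto elim: eventually_mono dest: eventually_nhds_x_imp_x)
    then show ?thesis using 1 unfolding val by blast
  qed
  then show ?thesis using et unfolding parallel_at_def by blast
qed

lemma connection_form_curve_isCont:
  assumes D: "D \<in> unitary_connections k" and \<sigma>: "\<And>t. geodesic_at \<sigma> t"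
    and U: "(U, \<Phi>) \<in> T" "fst (\<sigma> t) \<in> U"
  shows "isCont (\<lambda>s. connection_form D \<Phi> (fst (\<sigma> s)) (snd (\<sigma> s))) t"
proof -
  define c where "c = chart_at A (fst (\<sigma> t))"
  have c: "c \<in> A" "fst (\<sigma> t) \<in> fst c" using chart_at by (auto simp: c_def)
  define q where "q s = snd c (fst (\<sigma> s))" for s
  have q: "isCont q t"
    using geodesic_chart_curve(1)[OF \<sigma> c] has_vector_derivative_continuous unfolding q_def by blast
  have "q t \<in> snd c ` (fst c \<inter> U)" using c U by (auto simp: q_def)
  then have "isCont (connection_form_coord D c \<Phi> b) (q t)" for b
    using Ck_on_continuous[OF connection_form_coord_Ck[OF D U(1) c(1)]]
      continuous_on_eq_continuous_at[OF open_chart_triv[OF c(1) U(1)]] by blast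
  then have 1: "isCont (\<lambda>s. \<Sum>b\<in>Basis. (snd (\<sigma> s) c \<bullet> b) *\<^sub>R connection_form_coord D c \<Phi> b (q s)) t"
    using geodesic_chart_curve(2)[OF \<sigma> c] isCont_o2[OF q] by (intro continuous_intros) auto
  have "\<forall>\<^sub>F s in nhds t. fst (\<sigma> s) \<in> fst c \<inter> U"
    by (rule geodesic_at_near[OF \<sigma>]) (use c U triv_open[OF U(1)] chart_open[OF c(1)] in auto)
  then have "\<forall>\<^sub>F s in nhds t. (\<Sum>b\<in>Basis. (snd (\<sigma> s) c \<bullet> b) *\<^sub>R connection_form_coord D c \<Phi> b (q s))
      = connection_form D \<Phi> (fst (\<sigma> s)) (snd (\<sigma> s))"
  proof (rule eventually_mono)
    fix s assume s: "fst (\<sigma> s) \<in> fst c \<inter> U"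
    then have s': "fst (\<sigma> s) \<in> fst c" "fst (\<sigma> s) \<in> U" by auto
    note l = linear_Basis_sum[OF connection_form_vec_of[OF D U(1) s'(2) c(1) s'(1)], of "snd (\<sigma> s) c"]
    show "(\<Sum>b\<in>Basis. (snd (\<sigma> s) c \<bullet> b) *\<^sub>R connection_form_coord D c \<Phi> b (q s))
      = connection_form D \<Phi> (fst (\<sigma> s)) (snd (\<sigma> s))"
      using l unfolding vec_of_coord[OF geodesic_at_tangent[OF \<sigma>] c(1) s'(1)]
      by (simp add: connection_form_coord_def q_def chart_inv_left[OF c(1) s'(1)])
  qed
  from isCont_cong[OF this] 1 show ?thesis by blast
qed

text \<open>Supplies a Lipschitz constant for the linear transport equation, uniform over a compact
  time interval.\<close>

lemma connection_form_curve_interval: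
  assumes D: "D \<in> unitary_connections k" and \<sigma>: "\<And>t. geodesic_at \<sigma> t"
    and U: "(U, \<Phi>) \<in> T" "fst (\<sigma> t) \<in> U"
  obtains \<delta> L where "\<delta> > 0" "L \<ge> 0" "\<And>s. s \<in> {t-\<delta>..t+\<delta>} \<Longrightarrow> fst (\<sigma> s) \<in> U"
    "continuous_on {t-\<delta>..t+\<delta>} (\<lambda>s. connection_form D \<Phi> (fst (\<sigma> s)) (snd (\<sigma> s)))"
    "\<And>s v. s \<in> {t-\<delta>..t+\<delta>} \<Longrightarrow> norm (connection_form D \<Phi> (fst (\<sigma> s)) (snd (\<sigma> s)) *v v) \<le> L * norm v"
proof -
  let ?\<omega> = "\<lambda>s. connection_form D \<Phi> (fst (\<sigma> s)) (snd (\<sigma> s))"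
  have "\<forall>\<^sub>F s in nhds t. fst (\<sigma> s) \<in> U" by (rule geodesic_at_near[OF \<sigma> triv_open[OF U(1)] U(2)])
  then obtain d where d: "d > 0" "\<And>s. dist s t < d \<Longrightarrow> fst (\<sigma> s) \<in> U" unfolding eventually_nhds_metric by blast
  have inU: "fst (\<sigma> s) \<in> U" if "s \<in> {t-d/2..t+d/2}" for s
    by (rule d(2)) (use that d(1) in \<open>auto simp: dist_real_def abs_if\<close>)
  have cont: "continuous_on {t-d/2..t+d/2} ?\<omega>"
    by (rule continuous_at_imp_continuous_on) (use connection_form_curve_isCont[OF D \<sigma> U(1) inU] in blast)
  obtain B where "\<forall>M\<in>?\<omega> ` {t-d/2..t+d/2}. norm M \<le> B"
    using compact_imp_bounded[OF compact_continuous_image[OF cont compact_Icc]] unfolding bounded_iff by blast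
  then have B: "norm (?\<omega> s) \<le> B" if "s \<in> {t-d/2..t+d/2}" for s using that by blast
  obtain K where K: "K > 0" "\<And>(M :: complex ^ 'r ^ 'r) v. norm (M *v v) \<le> norm M * norm v * K"
    using bounded_bilinear.pos_bounded[OF bounded_bilinear_mv] by blast
  have "B \<ge> 0" by (rule order.trans[OF norm_ge_zero B[of t]]) (use d(1) in simp)
  show ?thesis
  proof (rule that[of "d/2" "B * K"])
    fix s and v :: "complex ^ 'r" assume "s \<in> {t-d/2..t+d/2}"
    from B[OF this] have "norm (?\<omega> s) * norm v * K \<le> B * norm v * K" using K(1) by (intro mult_right_mono) auto
    then show "norm (?\<omega> s *v v) \<le> B * K * norm v" using K(2)[of "?\<omega> s" v] by (simp add: mult_ac)
  qed (use d inU cont K \<open>B \<ge> 0\<close> in auto)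
qed

text \<open>The argument for geodesics again: the equation in a trivialisation makes agreement open,
  and continuity of the coordinates makes disagreement open.\<close>

lemma parallel_unique:
  assumes D: "D \<in> unitary_connections k" and \<sigma>: "\<And>t. geodesic_at \<sigma> t"
    and e: "\<And>t. t \<in> {a<..<b} \<Longrightarrow> parallel_at D \<sigma> e t" "\<And>t. t \<in> {a<..<b} \<Longrightarrow> parallel_at D \<sigma> e' t"
    and t0: "t0 \<in> {a<..<b}" "e t0 = e' t0" and t: "t \<in> {a<..<b}"
  shows "e t = e' t"
proof (rule agree_on_interval[of t0 a b e e' t, OF t0 _ _ t])
  fix t assume t: "t \<in> {a<..<b}" and eq: "e t = e' t"
  obtain U \<Phi> where U: "(U, \<Phi>) \<in> T" "fst (\<sigma> t) \<in> U" by (rule triv_exists)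
  obtain \<delta> L where \<delta>: "\<delta> > 0" "L \<ge> 0" "\<And>s. s \<in> {t-\<delta>..t+\<delta>} \<Longrightarrow> fst (\<sigma> s) \<in> U"
    "continuous_on {t-\<delta>..t+\<delta>} (\<lambda>s. connection_form D \<Phi> (fst (\<sigma> s)) (snd (\<sigma> s)))"
    "\<And>s v. s \<in> {t-\<delta>..t+\<delta>} \<Longrightarrow> norm (connection_form D \<Phi> (fst (\<sigma> s)) (snd (\<sigma> s)) *v v) \<le> L * norm v"
    by (rule connection_form_curve_interval[OF D \<sigma> U]) blast
  define l r where "l = max a (t-\<delta>)" and "r = min b (t+\<delta>)"
  have lr: "t \<in> {l<..<r}" using t \<delta> by (auto simp: l_def r_def)
  have sub: "s \<in> {a<..<b}" "s \<in> {t-\<delta>..t+\<delta>}" if "s \<in> {l<..<r}" for s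
    using that by (auto simp: l_def r_def)
  have \<Phi>eq: "\<Phi> (fst (\<sigma> s)) (e s) = \<Phi> (fst (\<sigma> s)) (e' s)" if s: "s \<in> {l<..<r}" for s
  proof (rule ode_unique[of l r "\<lambda>s. \<Phi> (fst (\<sigma> s)) (e s)" _ "\<lambda>s. \<Phi> (fst (\<sigma> s)) (e' s)" _ L t])
    fix s assume s: "s \<in> {l<..<r}"
    show "((\<lambda>s. \<Phi> (fst (\<sigma> s)) (e s)) has_vector_derivative
       - (connection_form D \<Phi> (fst (\<sigma> s)) (snd (\<sigma> s)) *v \<Phi> (fst (\<sigma> s)) (e s))) (at s)"
      by (rule parallel_atD(2)[OF e(1)[OF sub(1)[OF s]] U(1) \<delta>(3)[OF sub(2)[OF s]]])
    show "((\<lambda>s. \<Phi> (fst (\<sigma> s)) (e' s)) has_vector_derivative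
       - (connection_form D \<Phi> (fst (\<sigma> s)) (snd (\<sigma> s)) *v \<Phi> (fst (\<sigma> s)) (e' s))) (at s)"
      by (rule parallel_atD(2)[OF e(2)[OF sub(1)[OF s]] U(1) \<delta>(3)[OF sub(2)[OF s]]])
    show "norm (- (connection_form D \<Phi> (fst (\<sigma> s)) (snd (\<sigma> s)) *v \<Phi> (fst (\<sigma> s)) (e s))
        - - (connection_form D \<Phi> (fst (\<sigma> s)) (snd (\<sigma> s)) *v \<Phi> (fst (\<sigma> s)) (e' s)))
        \<le> L * norm (\<Phi> (fst (\<sigma> s)) (e s) - \<Phi> (fst (\<sigma> s)) (e' s))"
      using \<delta>(5)[OF sub(2)[OF s], of "\<Phi> (fst (\<sigma> s)) (e s) - \<Phi> (fst (\<sigma> s)) (e' s)"]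
      by (simp add: bounded_bilinear.diff_right[OF bounded_bilinear_mv] norm_minus_commute)
  qed (use lr eq s in auto)
  have "e s = e' s" if s: "s \<in> {l<..<r}" for s
    by (rule triv_eqI[OF U(1) \<delta>(3)[OF sub(2)[OF s]] parallel_atD(1)[OF e(1)[OF sub(1)[OF s]]]
          parallel_atD(1)[OF e(2)[OF sub(1)[OF s]]] \<Phi>eq[OF s]])
  then show "\<forall>\<^sub>F s in nhds t. e s = e' s"
    using eventually_nhds_in_open[OF open_greaterThanLessThan lr] by (auto elim: eventually_mono)
next
  fix t assume t: "t \<in> {a<..<b}" and ne: "e t \<noteq> e' t"
  obtain U \<Phi> where U: "(U, \<Phi>) \<in> T" "fst (\<sigma> t) \<in> U" by (rule triv_exists)
  note p = parallel_atD[OF e(1)[OF t]] and p' = parallel_atD[OF e(2)[OF t]]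
  have k0: "\<Phi> (fst (\<sigma> t)) (e t) - \<Phi> (fst (\<sigma> t)) (e' t) \<noteq> 0"
    using triv_eqI[OF U p(1) p'(1)] ne by auto
  have "isCont (\<lambda>s. \<Phi> (fst (\<sigma> s)) (e s) - \<Phi> (fst (\<sigma> s)) (e' s)) t"
    using p(2)[OF U] p'(2)[OF U] has_vector_derivative_continuous by (intro continuous_diff) blast+
  then have "((\<lambda>s. \<Phi> (fst (\<sigma> s)) (e s) - \<Phi> (fst (\<sigma> s)) (e' s)) \<longlongrightarrow>
      \<Phi> (fst (\<sigma> t)) (e t) - \<Phi> (fst (\<sigma> t)) (e' t)) (nhds t)"
    by (simp add: isCont_def tendsto_nhds_iff)
  from tendsto_imp_eventually_ne[OF this k0] show "\<forall>\<^sub>F s in nhds t. e s \<noteq> e' s"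
    by (rule eventually_mono) auto
qed

text \<open>The transport equation is linear, so the existence time near \<open>t0\<close> does not
  depend on the initial vector and the admissible set is the entire fibre.\<close>

lemma parallel_exists:
  assumes D: "D \<in> unitary_connections k" and \<sigma>: "\<And>t. geodesic_at \<sigma> t" and f: "f \<in> E (fst (\<sigma> 0))"
  shows "\<exists>e. e 0 = f \<and> (\<forall>t. parallel_at D \<sigma> e t)"
proof (rule global_solution[where sol = "parallel_at D \<sigma>" and adm = "\<lambda>t e. e \<in> E (fst (\<sigma> t))"])
  show "parallel_at D \<sigma> e' t" if "parallel_at D \<sigma> e t" "\<forall>\<^sub>F s in nhds t. e s = e' s" for e e' t
    by (rule parallel_at_cong[OF that])
  show "e t = e' t" if "\<And>t. t \<in> {a<..<b} \<Longrightarrow> parallel_at D \<sigma> e t \<and> parallel_at D \<sigma> e' t" "t0 \<in> {a<..<b}"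
    "e t0 = e' t0" "t \<in> {a<..<b}" for e e' a b t0 t
    by (rule parallel_unique[of D k \<sigma> a b e e' t0 t, OF D \<sigma> _ _ that(2-4)]) (use that(1) in blast)+
  show "e t \<in> E (fst (\<sigma> t))" if "\<And>t. t \<in> {a<..<b} \<Longrightarrow> parallel_at D \<sigma> e t" "t1 \<in> {a<..<b}"
    "e t1 \<in> E (fst (\<sigma> t1))" "t \<in> {a<..<b}" for e a b t1 t
    by (rule parallel_atD(1)[OF that(1)[OF that(4)]])
  show "f \<in> E (fst (\<sigma> 0))" by (rule f)
  show "\<exists>\<epsilon>>0. \<forall>t1\<in>{t0-\<epsilon><..<t0+\<epsilon>}. \<forall>s. s \<in> E (fst (\<sigma> t1)) \<longrightarrow>
      (\<exists>e. e t1 = s \<and> (\<forall>t\<in>{t0-\<epsilon><..<t0+\<epsilon>}. parallel_at D \<sigma> e t))" for t0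
  proof -
    obtain U \<Phi> where U: "(U, \<Phi>) \<in> T" "fst (\<sigma> t0) \<in> U" by (rule triv_exists)
    let ?\<omega> = "\<lambda>s. connection_form D \<Phi> (fst (\<sigma> s)) (snd (\<sigma> s))"
    obtain \<delta> L where \<delta>: "\<delta> > 0" "L \<ge> 0" "\<And>s. s \<in> {t0-\<delta>..t0+\<delta>} \<Longrightarrow> fst (\<sigma> s) \<in> U"
      "continuous_on {t0-\<delta>..t0+\<delta>} ?\<omega>"
      "\<And>s v. s \<in> {t0-\<delta>..t0+\<delta>} \<Longrightarrow> norm (?\<omega> s *v v) \<le> L * norm v"
      by (rule connection_form_curve_interval[OF D \<sigma> U]) blast
    \<comment> \<open>At most \<open>\<delta>/2\<close>, so that an interval of radius
      \<open>\<eta>\<close> around any \<open>t1\<close> near \<open>t0\<close> remains in the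
      interval of radius \<open>\<delta>\<close>; the other bound makes the Picard operator
      contract.\<close>
    define \<eta> where "\<eta> = min (\<delta>/2) (1 / (8 * (L + 1)))"
    have \<eta>: "\<eta> > 0" "\<eta> \<le> \<delta>/2" using \<delta> by (auto simp: \<eta>_def)
    have \<eta>L: "8 * \<eta> * L \<le> 1"
    proof -
      have "\<eta> * (8 * (L + 1)) \<le> 1 / (8 * (L + 1)) * (8 * (L + 1))"
        by (rule mult_right_mono) (use \<delta> in \<open>auto simp: \<eta>_def\<close>)
      then have "8 * \<eta> * L + 8 * \<eta> \<le> 1" using \<delta>(2) by (simp add: algebra_simps)
      then show ?thesis using \<eta> by simp
    qed
    have "\<exists>e. e t1 = s \<and> (\<forall>t\<in>{t0-\<eta>/2<..<t0+\<eta>/2}. parallel_at D \<sigma> e t)"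
      if t1: "t1 \<in> {t0-\<eta>/2<..<t0+\<eta>/2}" and s: "s \<in> E (fst (\<sigma> t1))" for t1 s
    proof -
      have sub: "{t1-\<eta>..t1+\<eta>} \<subseteq> {t0-\<delta>..t0+\<delta>}" using t1 \<eta> by auto
      have sub2: "{t0-\<eta>/2<..<t0+\<eta>/2} \<subseteq> {t1-\<eta><..<t1+\<eta>}" using t1 by auto
      obtain u where u: "u t1 = \<Phi> (fst (\<sigma> t1)) s"
        "\<And>t. t \<in> {t1-\<eta><..<t1+\<eta>} \<Longrightarrow> (u has_vector_derivative - (?\<omega> t *v u t)) (at t)"
      proof (rule picard_local[of t1 \<eta> "\<lambda>t x. - (?\<omega> t *v x)" L "\<Phi> (fst (\<sigma> t1)) s"])
        show "continuous_on {t1-\<eta>..t1+\<eta>} (\<lambda>t. - (?\<omega> t *v v t))" if "continuous_on {t1-\<eta>..t1+\<eta>} v" for v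
          by (intro continuous_on_minus bounded_bilinear.continuous_on[OF bounded_bilinear_mv]
              continuous_on_subset[OF \<delta>(4) sub] that)
        show "norm (- (?\<omega> t *v x) - - (?\<omega> t *v y)) \<le> L * norm (x - y)" if "t \<in> {t1-\<eta>..t1+\<eta>}" for t x y
          using \<delta>(5)[of t "x - y"] that sub
          by (auto simp: bounded_bilinear.diff_right[OF bounded_bilinear_mv] norm_minus_commute)
      qed (use \<eta> \<eta>L \<delta> in auto)
      define e where "e t = inv_into (E (fst (\<sigma> t))) (\<Phi> (fst (\<sigma> t))) (u t)" for t
      have inU: "fst (\<sigma> t) \<in> U" if "t \<in> {t1-\<eta><..<t1+\<eta>}" for t
        by (rule \<delta>(3)) (use that sub in auto)
      have e: "e t \<in> E (fst (\<sigma> t))" "\<Phi> (fst (\<sigma> t)) (e t) = u t" if "t \<in> {t1-\<eta><..<t1+\<eta>}" for t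
        using triv_inv(1,2)[OF U(1) inU[OF that]] by (simp_all add: e_def)
      have "parallel_at D \<sigma> e t" if t: "t \<in> {t1-\<eta><..<t1+\<eta>}" for t
      proof (rule parallel_at_triv[OF D \<sigma> U(1) inU[OF t]])
        have ev: "\<forall>\<^sub>F r in nhds t. r \<in> {t1-\<eta><..<t1+\<eta>}"
          by (rule eventually_nhds_in_open[OF open_greaterThanLessThan t])
        then show "\<forall>\<^sub>F r in nhds t. e r \<in> E (fst (\<sigma> r))" by (rule eventually_mono) (rule e(1))
        have "((\<lambda>r. \<Phi> (fst (\<sigma> r)) (e r)) has_vector_derivative v) (at t) = (u has_vector_derivative v) (at t)" for v
          by (rule has_vector_derivative_cong_ev) (use ev e(2) t in \<open>auto elim: eventually_mono\<close>)
        then show "((\<lambda>r. \<Phi> (fst (\<sigma> r)) (e r)) has_vector_derivative - (?\<omega> t *v \<Phi> (fst (\<sigma> t)) (e t))) (at t)"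
          using u(2)[OF t] e(2)[OF t] by simp
      qed
      moreover have "e t1 = s"
        using triv_inv(3)[OF U(1) inU s] \<eta>(1) by (simp add: e_def u(1))
      ultimately show ?thesis using sub2 by blast
    qed
    then show ?thesis using \<eta>(1) by (intro exI[of _ "\<eta>/2"]) auto
  qed
qed

lemma parallel_transport_along:
  assumes D: "D \<in> unitary_connections k" and y: "y \<in> tangent_bundle A" and f: "f \<in> E (fst y)"
  shows "parallel_along D (\<lambda>s. geodesic_flow s y) (\<lambda>t. parallel_transport D y t f)"
    "parallel_transport D y 0 f = f"
proof -
  let ?\<sigma> = "\<lambda>s. geodesic_flow s y"
  have \<sigma>: "geodesic_at ?\<sigma> t" for t using geodesic_flow_orbit(1)[OF y] by (simp add: geodesic_orbit_iff)
  have "f \<in> E (fst (geodesic_flow 0 y))" using f geodesic_flow_orbit(2)[OF y] by simp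
  from parallel_exists[OF D \<sigma> this] obtain e where e: "e 0 = f" "\<And>t. parallel_at D ?\<sigma> e t" by blast
  have "\<exists>!e. parallel_along D ?\<sigma> e \<and> e 0 = f"
  proof (rule ex1I[of _ e])
    fix e' assume e': "parallel_along D ?\<sigma> e' \<and> e' 0 = f"
    show "e' = e"
    proof
      fix t
      show "e' t = e t"
        by (rule parallel_unique[of D k ?\<sigma> "- \<bar>t\<bar> - 1" "\<bar>t\<bar> + 1" e' e 0 t, OF D \<sigma>])
          (use e e' in \<open>auto simp: parallel_along_iff\<close>)
    qed
  qed (use e in \<open>simp add: parallel_along_iff\<close>)
  from theI'[OF this] show "parallel_along D ?\<sigma> (\<lambda>t. parallel_transport D y t f)"
    "parallel_transport D y 0 f = f"
    unfolding parallel_transport_def by simp_all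
qed

end

section \<open>Invariant subbundles: limits of subspaces, curvature and rank\<close>

section \<open>Limits of vectors in a continuous family of subspaces\<close>

text \<open>Bilinear rather than sesquilinear: a vector \<open>\<phi>\<close> represents the linear
  functional \<open>dotc \<phi>\<close>.\<close>

definition dotc :: "complex ^ 'n \<Rightarrow> complex ^ 'n::finite \<Rightarrow> complex" where
  "dotc \<phi> x = (\<Sum>k\<in>UNIV. \<phi> $ k * x $ k)"

lemma dotc_sum: "dotc \<phi> (\<Sum>i\<in>I. c i *s x i) = (\<Sum>i\<in>I. c i * dotc \<phi> (x i))"
proof -
  have "dotc \<phi> (\<Sum>i\<in>I. c i *s x i) = (\<Sum>k\<in>UNIV. \<Sum>i\<in>I. c i * (\<phi> $ k * x i $ k))"
    by (simp add: dotc_def sum_distrib_left mult_ac)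
  then show ?thesis by (subst (asm) sum.swap) (simp add: dotc_def sum_distrib_left)
qed

lemma tendsto_dotc: "(f \<longlongrightarrow> l) F \<Longrightarrow> ((\<lambda>s. dotc \<phi> (f s)) \<longlongrightarrow> dotc \<phi> l) F"
  unfolding dotc_def by (intro tendsto_intros)

text \<open>A linear map with prescribed values on the independent set exists, and a row of its
  matrix represents one coordinate of it. Any row index \<open>j\<close> serves.\<close>

lemma dual_vector:
  assumes "vec.independent (S :: (complex ^ 'n::finite) set)" "x \<in> S"
  shows "\<exists>\<phi>. dotc \<phi> x = 1 \<and> (\<forall>y\<in>S. y \<noteq> x \<longrightarrow> dotc \<phi> y = 0)"
proof -
  define j :: 'n where "j = undefined"
  obtain g :: "complex ^ 'n \<Rightarrow> complex ^ 'n" where g: "Vector_Spaces.linear (*s) (*s) g"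
    "\<forall>y\<in>S. g y = (if y = x then axis j 1 else 0)"
    using vec.linear_independent_extend[OF assms(1), of "\<lambda>y. if y = x then axis j 1 else 0"] by blast
  have d: "dotc (matrix g $ j) y = g y $ j" for y
    unfolding matrix_works[OF g(1), of y, symmetric] by (simp add: dotc_def matrix_vector_mult_def)
  show ?thesis
    by (rule exI[of _ "matrix g $ j"]) (use g(2) assms(2) in \<open>simp add: d axis_def\<close>)
qed

lemma span_family:
  fixes b :: "nat \<Rightarrow> complex ^ 'n::finite"
  assumes "inj_on b {..<n}"
  shows "u \<in> vec.span (b ` {..<n}) \<longleftrightarrow> (\<exists>c. u = (\<Sum>i<n. c i *s b i))"
proof
  assume "u \<in> vec.span (b ` {..<n})"
  then obtain c where "u = (\<Sum>v\<in>b ` {..<n}. c v *s v)" by (auto simp: vec.span_finite)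
  then have "u = (\<Sum>i<n. c (b i) *s b i)" by (simp add: sum.reindex[OF assms])
  then show "\<exists>c. u = (\<Sum>i<n. c i *s b i)" by (rule exI[of _ "\<lambda>i. c (b i)"])
next
  assume "\<exists>c. u = (\<Sum>i<n. c i *s b i)"
  then obtain c where u: "u = (\<Sum>i<n. c i *s b i)" by blast
  show "u \<in> vec.span (b ` {..<n})"
    unfolding u by (rule vec.span_sum, rule vec.span_scale, rule vec.span_base) simp
qed

text \<open>Against a dual family of functionals the Gram matrix of the frame stays close to the identity, which
  bounds the coefficients of \<open>u s\<close>; a functional separating \<open>v\<close> from the limit subspace would then tend
  to \<open>0\<close> along \<open>u s\<close>.\<close>

lemma span_limit:
  fixes b :: "nat \<Rightarrow> real \<Rightarrow> complex ^ 'n::finite"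
  assumes cont: "\<And>i. i < n \<Longrightarrow> isCont (b i) t"
    and inj: "inj_on (\<lambda>i. b i t) {..<n}" and ind: "vec.independent ((\<lambda>i. b i t) ` {..<n})"
    and u: "\<forall>\<^sub>F s in at t. inj_on (\<lambda>i. b i s) {..<n} \<and> u s \<in> vec.span ((\<lambda>i. b i s) ` {..<n})"
    and lim: "(u \<longlongrightarrow> v) (at t)"
  shows "v \<in> vec.span ((\<lambda>i. b i t) ` {..<n})"
proof (rule ccontr)
  let ?S = "(\<lambda>i. b i t) ` {..<n}"
  assume nv: "v \<notin> vec.span ?S"
  have vS: "v \<notin> ?S" using nv by (rule contrapos_nn) (rule vec.span_base)
  have "vec.independent (insert v ?S)" using ind nv vS by (simp add: vec.independent_insert)
  from dual_vector[OF this insertI1] obtain \<phi>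
    where \<phi>: "dotc \<phi> v = 1" "\<forall>y\<in>insert v ?S. y \<noteq> v \<longrightarrow> dotc \<phi> y = 0" by blast
  have "\<exists>\<phi>. dotc \<phi> (b i t) = 1 \<and> (\<forall>j<n. j \<noteq> i \<longrightarrow> dotc \<phi> (b j t) = 0)" if i: "i < n" for i
  proof -
    have "b i t \<in> ?S" using i by blast
    from dual_vector[OF ind this] obtain \<phi>
      where p: "dotc \<phi> (b i t) = 1" "\<forall>y\<in>?S. y \<noteq> b i t \<longrightarrow> dotc \<phi> y = 0" by blast
    have "dotc \<phi> (b j t) = 0" if "j < n" "j \<noteq> i" for j
      by (rule p(2)[rule_format]) (use that i inj in \<open>auto dest: inj_onD\<close>)
    then show ?thesis using p(1) by blast
  qed
  then obtain \<theta> where \<theta>: "\<And>i. i < n \<Longrightarrow> dotc (\<theta> i) (b i t) = 1"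
    "\<And>i j. i < n \<Longrightarrow> j < n \<Longrightarrow> j \<noteq> i \<Longrightarrow> dotc (\<theta> i) (b j t) = 0" by metis
  define \<delta> where "\<delta> i j = (if i = j then 1 else 0 :: complex)" for i j :: nat
  define M where "M i j s = dotc (\<theta> i) (b j s)" for i j s
  \<comment> \<open>Chosen so that \<open>n\<close> errors of size \<open>\<epsilon>\<close> add up
    to at most 1/2, which can be absorbed into the left-hand side.\<close>
  define \<epsilon> where "\<epsilon> = 1 / (2 * (real n + 1))"
  have \<epsilon>: "\<epsilon> > 0" "real n * \<epsilon> \<le> 1/2" by (auto simp: \<epsilon>_def field_simps)
  have Mlim: "(M i j \<longlongrightarrow> \<delta> i j) (at t)" if "i < n" "j < n" for i j
  proof -
    have "(M i j \<longlongrightarrow> dotc (\<theta> i) (b j t)) (at t)"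
      unfolding M_def using cont[OF that(2)] by (intro tendsto_dotc) (simp add: isCont_def)
    then show ?thesis using \<theta> that by (auto simp: \<delta>_def)
  qed
  have "\<forall>\<^sub>F s in at t. \<forall>i\<in>{..<n}. \<forall>j\<in>{..<n}. dist (M i j s) (\<delta> i j) < \<epsilon>"
    by (intro eventually_ball_finite ballI tendstoD Mlim \<epsilon>) auto
  then have evM: "\<forall>\<^sub>F s in at t. \<forall>i<n. \<forall>j<n. norm (\<delta> i j - M i j s) \<le> \<epsilon>"
    by (rule eventually_mono) (auto simp: dist_norm norm_minus_commute intro: less_imp_le)
  define C where "C = (\<Sum>i<n. norm (dotc (\<theta> i) v)) + 1"
  have "((\<lambda>s. \<Sum>i<n. norm (dotc (\<theta> i) (u s))) \<longlongrightarrow> (\<Sum>i<n. norm (dotc (\<theta> i) v))) (at t)"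
    by (intro tendsto_intros tendsto_dotc lim)
  then have evC: "\<forall>\<^sub>F s in at t. (\<Sum>i<n. norm (dotc (\<theta> i) (u s))) < C"
    by (rule order_tendstoD) (simp add: C_def)
  have C0: "C > 0" by (simp add: C_def add_nonneg_pos sum_nonneg)
  have ev: "\<forall>\<^sub>F s in at t. norm (dotc \<phi> (u s)) \<le> 2 * C * (\<Sum>j<n. norm (dotc \<phi> (b j s)))"
    using u evM evC
  proof eventually_elim
    case (elim s)
    then obtain c where c: "u s = (\<Sum>i<n. c i *s b i s)" using span_family[of "\<lambda>i. b i s" n "u s"] by blast
    let ?N = "\<Sum>i<n. norm (c i)"
    \<comment> \<open>The sum of the coefficients is bounded by the functionals of
      \<open>u s\<close> plus at most half of itself.\<close>
    have "?N \<le> (\<Sum>i<n. norm (dotc (\<theta> i) (u s)) + \<epsilon> * ?N)"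
    proof (rule sum_mono)
      fix i assume "i \<in> {..<n}"
      then have i: "i < n" by simp
      have "c i = (\<Sum>j<n. c j * \<delta> i j)" using i by (simp add: \<delta>_def if_distrib cong: if_cong)
      also have "\<dots> = dotc (\<theta> i) (u s) + (\<Sum>j<n. c j * (\<delta> i j - M i j s))"
        unfolding c dotc_sum by (simp add: M_def right_diff_distrib sum_subtractf)
      finally have "norm (c i) \<le> norm (dotc (\<theta> i) (u s)) + norm (\<Sum>j<n. c j * (\<delta> i j - M i j s))"
        using norm_triangle_ineq by metis
      also have "norm (\<Sum>j<n. c j * (\<delta> i j - M i j s)) \<le> (\<Sum>j<n. norm (c j) * \<epsilon>)"
        by (rule sum_norm_le) (use elim i in \<open>auto simp: norm_mult intro!: mult_left_mono\<close>)
      finally show "norm (c i) \<le> norm (dotc (\<theta> i) (u s)) + \<epsilon> * ?N"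
        by (simp add: sum_distrib_left mult.commute)
    qed
    also have "\<dots> = (\<Sum>i<n. norm (dotc (\<theta> i) (u s))) + (real n * \<epsilon>) * ?N" by (simp add: sum.distrib)
    also have "\<dots> \<le> C + 1/2 * ?N"
      using elim \<epsilon>(2) by (intro add_mono mult_right_mono) (auto intro: sum_nonneg less_imp_le)
    finally have N: "?N \<le> 2 * C" by simp
    have "norm (dotc \<phi> (u s)) \<le> (\<Sum>j<n. norm (c j) * norm (dotc \<phi> (b j s)))"
      unfolding c dotc_sum by (rule sum_norm_le) (simp add: norm_mult)
    also have "\<dots> \<le> (\<Sum>j<n. ?N * norm (dotc \<phi> (b j s)))"
      by (intro sum_mono mult_right_mono member_le_sum) auto
    also have "\<dots> = ?N * (\<Sum>j<n. norm (dotc \<phi> (b j s)))" by (simp add: sum_distrib_left)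
    also have "\<dots> \<le> 2 * C * (\<Sum>j<n. norm (dotc \<phi> (b j s)))"
      by (intro mult_right_mono N sum_nonneg) auto
    finally show ?case .
  qed
  have l: "((\<lambda>s. 2 * C * (\<Sum>j<n. norm (dotc \<phi> (b j s)))) \<longlongrightarrow> 2 * C * (\<Sum>j<n. norm (dotc \<phi> (b j t)))) (at t)"
    using cont by (intro tendsto_intros tendsto_dotc) (auto simp: isCont_def)
  have "dotc \<phi> (b j t) = 0" if "j < n" for j
  proof -
    have "b j t \<in> ?S" using that by blast
    then show ?thesis using \<phi>(2) vS by (metis insertI2)
  qed
  then have "2 * C * (\<Sum>j<n. norm (dotc \<phi> (b j t))) = 0" by simp
  with l have "((\<lambda>s. 2 * C * (\<Sum>j<n. norm (dotc \<phi> (b j s)))) \<longlongrightarrow> 0) (at t)" by (simp only:)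
  with ev have "((\<lambda>s. dotc \<phi> (u s)) \<longlongrightarrow> 0) (at t)" by (rule Lim_null_comparison)
  from tendsto_unique[OF _ this tendsto_dotc[OF lim]] \<phi>(1) show False by simp
qed

lemma vector_derivative_quotient:
  assumes "(z has_vector_derivative d) (at 0)" "z 0 = 0"
  shows "((\<lambda>s. (1 / s) *\<^sub>R z s) \<longlongrightarrow> d) (at 0)"
proof -
  have "((\<lambda>s. norm (z s - s *\<^sub>R d) / norm s) \<longlongrightarrow> 0) (at 0)"
    using assms unfolding has_vector_derivative_def has_derivative_at by simp
  moreover have "\<forall>\<^sub>F s in at 0. norm (z s - s *\<^sub>R d) / norm s = norm ((1 / s) *\<^sub>R z s - d)"
    unfolding eventually_at_filter
  proof (intro always_eventually allI impI)
    fix s :: real assume s: "s \<noteq> 0"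
    have "(1 / s) *\<^sub>R z s - d = (1 / s) *\<^sub>R (z s - s *\<^sub>R d)" using s by (simp add: scaleR_diff_right)
    then show "norm (z s - s *\<^sub>R d) / norm s = norm ((1 / s) *\<^sub>R z s - d)" by simp
  qed
  ultimately have "((\<lambda>s. norm ((1 / s) *\<^sub>R z s - d)) \<longlongrightarrow> 0) (at 0)" by (rule Lim_transform_eventually)
  then show ?thesis using Lim_null tendsto_norm_zero_iff by blast
qed

section \<open>Invariant subbundles are preserved by the curvature\<close>

context hermitian_vector_bundle
begin

definition fibre_coord :: "('m, 'e) chart \<Rightarrow> ('m \<Rightarrow> 'v \<Rightarrow> complex ^ 'r) \<Rightarrow> ('m \<Rightarrow> 'v set) \<Rightarrow> 'e \<Rightarrow> (complex ^ 'r) set" where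
  "fibre_coord c \<Phi> F p = \<Phi> (chart_inv c p) ` F (chart_inv c p)"

lemma subbundle_frame:
  assumes F: "smooth_subbundle F" and U: "(U, \<Phi>) \<in> T" and c: "c \<in> A" and p: "p \<in> snd c ` (fst c \<inter> U)"
  obtains P n b where "open P" "p \<in> P" "P \<subseteq> snd c ` (fst c \<inter> U)"
    "\<And>i::nat. i < n \<Longrightarrow> smooth_on (b i) P" "\<And>q. q \<in> P \<Longrightarrow> inj_on (\<lambda>i. b i q) {..<n}"
    "\<And>q. q \<in> P \<Longrightarrow> vec.independent ((\<lambda>i. b i q) ` {..<n})"
    "\<And>q. q \<in> P \<Longrightarrow> fibre_coord c \<Phi> F q = vec.span ((\<lambda>i. b i q) ` {..<n})"
proof -
  obtain x where x: "x \<in> fst c" "x \<in> U" "p = snd c x" using p by blast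
  have "\<forall>x\<in>U. \<exists>W (n::nat) (b :: nat \<Rightarrow> 'm \<Rightarrow> complex ^ 'r).
        open W \<and> x \<in> W \<and> W \<subseteq> U \<and> (\<forall>i<n. smooth_fun W (b i)) \<and>
        (\<forall>y\<in>W. inj_on (\<lambda>i. b i y) {..<n} \<and> vec.independent ((\<lambda>i. b i y) ` {..<n}) \<and>
           \<Phi> y ` F y = vec.span ((\<lambda>i. b i y) ` {..<n}))"
    using F[unfolded smooth_subbundle_def, THEN conjunct2, rule_format, OF U] by simp
  then obtain W n b where W: "open W" "x \<in> W" "W \<subseteq> U" "\<And>i::nat. i < n \<Longrightarrow> smooth_fun W (b i)"
    "\<And>y. y \<in> W \<Longrightarrow> inj_on (\<lambda>i. b i y) {..<n}" "\<And>y. y \<in> W \<Longrightarrow> vec.independent ((\<lambda>i. b i y) ` {..<n})"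
    "\<And>y. y \<in> W \<Longrightarrow> \<Phi> y ` F y = vec.span ((\<lambda>i. b i y) ` {..<n})"
    using x(2) by metis
  note q = chart_image_cases(1)[OF c]
  show ?thesis
  proof (rule that[of "snd c ` (W \<inter> fst c)" n "\<lambda>i p. b i (chart_inv c p)"])
    show "open (snd c ` (W \<inter> fst c))" by (rule open_chart_image[OF c W(1)])
    show "smooth_on (\<lambda>p. b i (chart_inv c p)) (snd c ` (W \<inter> fst c))" if "i < n" for i
      using smooth_funD[OF W(4)[OF that] c] by (simp add: comp_def)
    show "fibre_coord c \<Phi> F q = vec.span ((\<lambda>i. b i (chart_inv c q)) ` {..<n})" if "q \<in> snd c ` (W \<inter> fst c)" for q
      using W(7)[OF q[OF that]] by (simp add: fibre_coord_def)
  qed (use W x q in auto)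
qed

lemma fibre_coord_subspace:
  assumes "smooth_subbundle F" "(U, \<Phi>) \<in> T" "c \<in> A" "p \<in> snd c ` (fst c \<inter> U)"
  shows "vec.subspace (fibre_coord c \<Phi> F p)"
  using subbundle_frame[OF assms] vec.subspace_span by metis

text \<open>Along the geodesic with initial velocity \<open>\<eta>\<close>, both the parallel
  transport of \<open>B p\<close> and the values of \<open>B\<close> lie in \<open>F\<close>. Their
  difference vanishes at time 0, and its difference quotient tends to minus the covariant
  derivative; \<open>span_limit\<close> puts this limit into the fibre over \<open>p\<close>.
  Differentiability of \<open>B\<close> at the single point \<open>p\<close> suffices, so the lemma
  can be iterated for connections of finite regularity.\<close>

lemma invariant_deriv:
  assumes D: "D \<in> unitary_connections k" and F: "invariant_subbundle D F"
    and U: "(U, \<Phi>) \<in> T" and c: "c \<in> A" and P: "open P" "P \<subseteq> snd c ` (fst c \<inter> U)" "p \<in> P"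
    and B: "\<And>q. q \<in> P \<Longrightarrow> B q \<in> fibre_coord c \<Phi> F q" "B differentiable (at p)"
  shows "frechet_derivative B (at p) \<xi> + connection_form_coord D c \<Phi> \<xi> p *v B p \<in> fibre_coord c \<Phi> F p"
proof -
  have sF: "smooth_subbundle F" and inv: "\<And>y f t. y \<in> unit_tangent_bundle \<Longrightarrow> f \<in> F (fst y) \<Longrightarrow>
      parallel_transport D y t f \<in> F (fst (geodesic_flow t y))"
    using F unfolding invariant_subbundle_def by blast+
  have FE: "F x \<subseteq> E x" for x using sF unfolding smooth_subbundle_def by blast
  have pS: "p \<in> snd c ` (fst c \<inter> U)" using P by blast
  have pc: "p \<in> snd c ` fst c" using pS by blast
  define x where "x = chart_inv c p"
  have x: "x \<in> fst c" "x \<in> U" "snd c x = p"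
    using chart_image_cases[OF c, of p U] pS by (auto simp: x_def Int_commute)
  have sub: "vec.subspace (fibre_coord c \<Phi> F p)" by (rule fibre_coord_subspace[OF sF U c pS])
  let ?B' = "frechet_derivative B (at p)"
  have B': "(B has_derivative ?B') (at p)" using B(2) frechet_derivative_works by blast
  define \<Delta> where "\<Delta> \<xi> = ?B' \<xi> + connection_form_coord D c \<Phi> \<xi> p *v B p" for \<xi>
  note lin1 = has_derivative_linear[OF B'] and lin2 = connection_form_coord_linear[OF D U c pS]
  have lin: "\<Delta> (a *\<^sub>R \<xi>) = of_real a *s \<Delta> \<xi>" for a \<xi>
    unfolding \<Delta>_def linear_cmul[OF lin1] linear_cmul[OF lin2]
    by (simp add: bounded_bilinear.scaleR_left[OF bounded_bilinear_mv] vector_add_ldistrib flip: scaleR_eq_smult)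
  have unit: "\<Delta> \<eta> \<in> fibre_coord c \<Phi> F p" if \<eta>: "metric_coord c p \<eta> \<eta> = 1" for \<eta>
  proof -
    define y where "y = (x, vec_of A c x \<eta>)"
    have w: "vec_of A c x \<eta> \<in> tangent_space A x" by (rule vec_of_in[OF c x(1)])
    have yT: "y \<in> tangent_bundle A" using w by (simp add: y_def tangent_bundle_iff)
    have "g x (vec_of A c x \<eta>) (vec_of A c x \<eta>) = 1"
      using metric_coord_eq[OF c x(1) w w] \<eta> by (simp add: vec_of_self[OF c x(1)] x(3))
    then have yU: "y \<in> unit_tangent_bundle" using yT by (simp add: unit_tangent_bundle_def y_def)
    define \<sigma> where "\<sigma> s = geodesic_flow s y" for s
    have \<sigma>: "geodesic_at \<sigma> t" for t
      using geodesic_flow_orbit(1)[OF yT] by (simp add: geodesic_orbit_iff \<sigma>_def[abs_def])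
    have \<sigma>0: "\<sigma> 0 = y" "fst (\<sigma> 0) = x" "snd (\<sigma> 0) c = \<eta>"
      using geodesic_flow_orbit(2)[OF yT] vec_of_self[OF c x(1)] by (simp_all add: \<sigma>_def y_def)
    have "B p \<in> \<Phi> x ` F x" using B(1)[OF P(3)] by (simp add: fibre_coord_def x_def)
    then obtain f where fB: "B p = \<Phi> x f" "f \<in> F x" by (rule imageE)
    then have f: "f \<in> F x" "\<Phi> x f = B p" by simp_all
    define e where "e s = parallel_transport D y s f" for s
    have fE: "f \<in> E (fst y)" using f FE by (auto simp: y_def)
    have e: "parallel_at D \<sigma> e t" for t
      using parallel_transport_along(1)[OF D yT fE]
      unfolding parallel_along_iff \<sigma>_def[abs_def] e_def[abs_def] by blast
    have e0: "e 0 = f" using parallel_transport_along(2)[OF D yT fE] by (simp add: e_def)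
    have eF: "e s \<in> F (fst (\<sigma> s))" for s using inv[OF yU] f(1) by (simp add: e_def \<sigma>_def y_def)
    define q where "q s = snd c (fst (\<sigma> s))" for s
    have q0: "q 0 = p" using x(3) by (simp add: q_def \<sigma>0(2))
    have q': "(q has_vector_derivative \<eta>) (at 0)"
      using geodesic_chart_curve(1)[OF \<sigma>[of 0] c] x(1) by (simp add: q_def[abs_def] \<sigma>0(2,3))
    have Bq: "((\<lambda>s. B (q s)) has_vector_derivative ?B' \<eta>) (at 0)"
    proof -
      have "((\<lambda>s. B (q s)) has_derivative (\<lambda>h. ?B' (h *\<^sub>R \<eta>))) (at 0)"
        by (rule has_derivative_compose[OF q'[unfolded has_vector_derivative_def]]) (use B' q0 in simp)
      then show ?thesis unfolding has_vector_derivative_def linear_cmul[OF lin1] .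
    qed
    have \<omega>0: "connection_form D \<Phi> (fst (\<sigma> 0)) (snd (\<sigma> 0)) = connection_form_coord D c \<Phi> \<eta> p"
      unfolding \<sigma>0(1) by (simp add: connection_form_coord_def y_def x_def)
    have e': "((\<lambda>s. \<Phi> (fst (\<sigma> s)) (e s)) has_vector_derivative - (connection_form_coord D c \<Phi> \<eta> p *v B p)) (at 0)"
      using parallel_atD(2)[OF e[of 0] U] x(2) unfolding \<omega>0 by (simp add: \<sigma>0(2) e0 f(2))
    \<comment> \<open>Compares two vectors of the same fibre over the moving point, transport and
      section, so that the quotient by \<open>s\<close> stays in the subspace.\<close>
    define z where "z s = \<Phi> (fst (\<sigma> s)) (e s) - B (q s)" for s
    have "(z has_vector_derivative - (connection_form_coord D c \<Phi> \<eta> p *v B p) - ?B' \<eta>) (at 0)"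
      unfolding z_def[abs_def] by (rule has_vector_derivative_diff[OF e' Bq])
    moreover have "- (connection_form_coord D c \<Phi> \<eta> p *v B p) - ?B' \<eta> = - \<Delta> \<eta>" by (simp add: \<Delta>_def)
    ultimately have z': "(z has_vector_derivative - \<Delta> \<eta>) (at 0)" by simp
    have z0: "z 0 = 0" by (simp add: z_def e0 q0 \<sigma>0(2) f(2))
    have lim: "((\<lambda>s. (1 / s) *\<^sub>R z s) \<longlongrightarrow> - \<Delta> \<eta>) (at 0)" by (rule vector_derivative_quotient[OF z' z0])
    obtain P' n b where P': "open P'" "p \<in> P'" "P' \<subseteq> snd c ` (fst c \<inter> U)"
      "\<And>i::nat. i < n \<Longrightarrow> smooth_on (b i) P'" "\<And>q. q \<in> P' \<Longrightarrow> inj_on (\<lambda>i. b i q) {..<n}"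
      "\<And>q. q \<in> P' \<Longrightarrow> vec.independent ((\<lambda>i. b i q) ` {..<n})"
      "\<And>q. q \<in> P' \<Longrightarrow> fibre_coord c \<Phi> F q = vec.span ((\<lambda>i. b i q) ` {..<n})"
      using subbundle_frame[OF sF U c pS] by metis
    have qc: "isCont q 0" using q' has_vector_derivative_continuous by blast
    have "(q \<longlongrightarrow> p) (nhds 0)" using qc q0 by (simp add: isCont_def tendsto_nhds_iff)
    then have evP: "\<forall>\<^sub>F s in nhds 0. q s \<in> P \<inter> P'"
      by (rule topological_tendstoD) (use P P' in auto)
    have "\<forall>\<^sub>F s in nhds 0. fst (\<sigma> s) \<in> fst c"
      by (rule geodesic_at_near[OF \<sigma> chart_open[OF c]]) (simp add: \<sigma>0(2) x(1))
    then have "\<forall>\<^sub>F s in at 0. fst (\<sigma> s) \<in> fst c \<and> q s \<in> P \<inter> P'"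
      using evP by (auto simp: eventually_at_filter elim: eventually_elim2)
    then have ev: "\<forall>\<^sub>F s in at 0. inj_on (\<lambda>i. b i (q s)) {..<n} \<and>
        (1 / s) *\<^sub>R z s \<in> vec.span ((\<lambda>i. b i (q s)) ` {..<n})"
    proof (rule eventually_mono)
      fix s assume s: "fst (\<sigma> s) \<in> fst c \<and> q s \<in> P \<inter> P'"
      then have xs: "chart_inv c (q s) = fst (\<sigma> s)" using chart_inv_left[OF c] by (simp add: q_def)
      have qP: "q s \<in> P'" using s by blast
      have "\<Phi> (fst (\<sigma> s)) (e s) \<in> fibre_coord c \<Phi> F (q s)" using eF by (simp add: fibre_coord_def xs)
      moreover have "B (q s) \<in> fibre_coord c \<Phi> F (q s)" using B(1) s by blast
      ultimately have "z s \<in> vec.span ((\<lambda>i. b i (q s)) ` {..<n})"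
        unfolding z_def P'(7)[OF qP] by (rule vec.span_diff)
      then show "inj_on (\<lambda>i. b i (q s)) {..<n} \<and> (1 / s) *\<^sub>R z s \<in> vec.span ((\<lambda>i. b i (q s)) ` {..<n})"
        using P'(5)[OF qP] unfolding scaleR_eq_smult by (blast intro: vec.span_scale)
    qed
    have cb: "isCont (\<lambda>s. b i (q s)) 0" if "i < n" for i
      by (rule isCont_o2[OF qc])
        (use smooth_on_continuous[OF P'(4)[OF that]] P'(1,2) q0 in \<open>simp add: continuous_on_eq_continuous_at\<close>)
    have "- \<Delta> \<eta> \<in> vec.span ((\<lambda>i. b i (q 0)) ` {..<n})"
      by (rule span_limit[where b = "\<lambda>i s. b i (q s)", OF cb _ _ ev lim]) (use P'(2,5,6) in \<open>simp_all add: q0\<close>)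
    then have "- \<Delta> \<eta> \<in> fibre_coord c \<Phi> F p" by (simp add: q0 P'(7)[OF P'(2)])
    then show ?thesis using vec.subspace_neg[OF sub] by fastforce
  qed
  have "\<Delta> \<xi> \<in> fibre_coord c \<Phi> F p"
  proof (cases "\<xi> = 0")
    case True
    then show ?thesis using lin[of 0 0] vec.subspace_0[OF sub] by simp
  next
    case False
    \<comment> \<open>Invariance is assumed for unit vectors only; other directions are reached by
      rescaling with the length.\<close>
    define m where "m = metric_coord c p \<xi> \<xi>"
    have m: "m > 0" unfolding m_def by (rule metric_coord_pos[OF c pc False])
    have "metric_coord c p ((1 / sqrt m) *\<^sub>R \<xi>) ((1 / sqrt m) *\<^sub>R \<xi>) = (1 / sqrt m) * ((1 / sqrt m) * m)"
      unfolding linear_cmul[OF metric_coord_linear1[OF c pc]] linear_cmul[OF metric_coord_linear2[OF c pc]]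
        m_def real_scaleR_def ..
    also have "\<dots> = 1" using m by (simp add: field_simps)
    finally have "\<Delta> ((1 / sqrt m) *\<^sub>R \<xi>) \<in> fibre_coord c \<Phi> F p" by (rule unit)
    then have "of_real (sqrt m) *s \<Delta> ((1 / sqrt m) *\<^sub>R \<xi>) \<in> fibre_coord c \<Phi> F p"
      by (rule vec.subspace_scale[OF sub])
    then show ?thesis using m by (simp flip: lin)
  qed
  then show ?thesis by (simp add: \<Delta>_def)
qed

text \<open>The coordinate expression \<open>d\<omega> + \<omega> \<and> \<omega>\<close> evaluated
  on two constant coordinate fields.\<close>

definition curvature ::
    "(('m \<Rightarrow> 'v) \<Rightarrow> 'm \<Rightarrow> ('m, 'e) tvec \<Rightarrow> 'v) \<Rightarrow> ('m, 'e) chart \<Rightarrow> ('m \<Rightarrow> 'v \<Rightarrow> complex ^ 'r)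
      \<Rightarrow> 'e \<Rightarrow> 'e \<Rightarrow> 'e \<Rightarrow> complex ^ 'r ^ 'r" where
  "curvature D c \<Phi> v w p =
    frechet_derivative (connection_form_coord D c \<Phi> w) (at p) v
    - frechet_derivative (connection_form_coord D c \<Phi> v) (at p) w
    + connection_form_coord D c \<Phi> v p ** connection_form_coord D c \<Phi> w p
    - connection_form_coord D c \<Phi> w p ** connection_form_coord D c \<Phi> v p"

text \<open>The covariant derivative along the constant field \<open>v\<close> of the endomorphism
  field \<open>\<Omega>(v,w)\<close>: the commutator is the action of the connection form on
  endomorphisms.\<close>

definition curvature_deriv ::
    "(('m \<Rightarrow> 'v) \<Rightarrow> 'm \<Rightarrow> ('m, 'e) tvec \<Rightarrow> 'v) \<Rightarrow> ('m, 'e) chart \<Rightarrow> ('m \<Rightarrow> 'v \<Rightarrow> complex ^ 'r)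
      \<Rightarrow> 'e \<Rightarrow> 'e \<Rightarrow> 'e \<Rightarrow> complex ^ 'r ^ 'r" where
  "curvature_deriv D c \<Phi> v w p =
    frechet_derivative (curvature D c \<Phi> v w) (at p) v
    + connection_form_coord D c \<Phi> v p ** curvature D c \<Phi> v w p
    - curvature D c \<Phi> v w p ** connection_form_coord D c \<Phi> v p"

lemma curvature_C1:
  assumes D: "D \<in> unitary_connections k" "2 \<le> k" and U: "(U, \<Phi>) \<in> T" and c: "c \<in> A"
  shows "Ck_on 1 (curvature D c \<Phi> v w) (snd c ` (fst c \<inter> U))"
proof -
  note o = open_chart_triv[OF c U]
  have "Ck_on 2 (connection_form_coord D c \<Phi> \<xi>) (snd c ` (fst c \<inter> U))" for \<xi>
    by (rule Ck_on_le[OF connection_form_coord_Ck[OF D(1) U c] D(2)])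
  note 1 = Ck_on_2D[OF this]
  show ?thesis
    unfolding curvature_def[abs_def]
    by (intro Ck_on_diff[OF o] Ck_on_add[OF o] Ck_on_bilinear[OF bounded_bilinear_mm o] 1)
qed

text \<open>Applying \<open>invariant_deriv\<close> twice to a frame of \<open>F\<close> in both
  orders and subtracting produces the curvature, as the second derivatives of the frame cancel.
  Applying it once more, to the sections \<open>\<Omega> b_i\<close> of \<open>F\<close>, and
  subtracting \<open>\<Omega> \<nabla>_v b_i\<close> produces the derivative of the
  curvature.\<close>

lemma invariant_curvature:
  assumes D: "D \<in> unitary_connections k" "2 \<le> k" and F: "invariant_subbundle D F"
    and U: "(U, \<Phi>) \<in> T" and c: "c \<in> A" and p: "p \<in> snd c ` (fst c \<inter> U)" and f: "f \<in> fibre_coord c \<Phi> F p"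
  shows "curvature D c \<Phi> v w p *v f \<in> fibre_coord c \<Phi> F p"
    "curvature_deriv D c \<Phi> v w p *v f \<in> fibre_coord c \<Phi> F p"
proof -
  have sF: "smooth_subbundle F" using F unfolding invariant_subbundle_def by blast
  obtain P n b where P: "open P" "p \<in> P" "P \<subseteq> snd c ` (fst c \<inter> U)"
    "\<And>i::nat. i < n \<Longrightarrow> smooth_on (b i) P" "\<And>q. q \<in> P \<Longrightarrow> inj_on (\<lambda>i. b i q) {..<n}"
    "\<And>q. q \<in> P \<Longrightarrow> vec.independent ((\<lambda>i. b i q) ` {..<n})"
    "\<And>q. q \<in> P \<Longrightarrow> fibre_coord c \<Phi> F q = vec.span ((\<lambda>i. b i q) ` {..<n})"
    using subbundle_frame[OF sF U c p] by metis
  let ?F = "fibre_coord c \<Phi> F" and ?\<omega> = "connection_form_coord D c \<Phi>" and ?R = "curvature D c \<Phi> v w"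
  have sub: "vec.subspace (?F q)" if "q \<in> P" for q
    by (rule fibre_coord_subspace[OF sF U c]) (use that P(3) in blast)
  have bF: "b i q \<in> ?F q" if "q \<in> P" "i < n" for i q
    unfolding P(7)[OF that(1)] by (rule vec.span_base) (use that in blast)
  have \<omega>2: "Ck_on 2 (?\<omega> \<xi>) P" for \<xi>
    by (rule Ck_on_subset[OF Ck_on_le[OF connection_form_coord_Ck[OF D(1) U c] D(2)] P(3)])
  have \<omega>d: "(?\<omega> \<xi> has_derivative frechet_derivative (?\<omega> \<xi>) (at q)) (at q)" if "q \<in> P" for \<xi> q
    by (rule Ck_on_has_derivative[OF \<omega>2 _ that]) simp
  have Rd: "(?R has_derivative frechet_derivative ?R (at q)) (at q)" if "q \<in> P" for q
    by (rule Ck_on_has_derivative[OF Ck_on_subset[OF curvature_C1[OF D U c] P(3)] _ that]) simp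
  have step: "frechet_derivative B (at q) \<xi> + ?\<omega> \<xi> q *v B q \<in> ?F q"
    if "\<And>q. q \<in> P \<Longrightarrow> B q \<in> ?F q" "(B has_derivative B') (at q)" "q \<in> P" for B B' \<xi> q
    by (rule invariant_deriv[OF D(1) F U c P(1,3) that(3,1)]) (use that(2) differentiable_def in auto)
  \<comment> \<open>A matrix preserves the fibre as soon as it maps the frame into it.\<close>
  have ext: "M *v f \<in> ?F q" if q: "q \<in> P" and f: "f \<in> ?F q" and M: "\<And>i. i < n \<Longrightarrow> M *v b i q \<in> ?F q" for M f q
  proof -
    obtain a where "f = (\<Sum>i<n. a i *s b i q)"
      using f span_family[OF P(5)[OF q]] unfolding P(7)[OF q] by blast
    then have "M *v f = (\<Sum>i<n. a i *s (M *v b i q))"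
      by (simp add: bounded_bilinear.sum_right[OF bounded_bilinear_mv] vector_scalar_commute)
    then show ?thesis using M by (auto intro!: vec.subspace_sum[OF sub[OF q]] vec.subspace_scale[OF sub[OF q]])
  qed
  have bd: "(b i has_derivative frechet_derivative (b i) (at q)) (at q)" if "q \<in> P" "i < n" for i q
    by (rule smooth_on_has_derivative[OF P(4)[OF that(2)] that(1)])
  \<comment> \<open>The covariant derivative of the frame vector \<open>b i\<close> in direction
    \<open>\<xi>\<close>, again a section of \<open>F\<close>.\<close>
  define N where "N \<xi> i q = frechet_derivative (b i) (at q) \<xi> + ?\<omega> \<xi> q *v b i q" for \<xi> i q
  have NF: "N \<xi> i q \<in> ?F q" if "q \<in> P" "i < n" for \<xi> i q
    unfolding N_def by (rule step[OF _ bd[OF that] that(1)]) (rule bF[OF _ that(2)])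
  have Nd: "(N \<xi> i has_derivative (\<lambda>\<eta>. frechet_derivative (\<lambda>q. frechet_derivative (b i) (at q) \<xi>) (at q) \<eta>
      + (?\<omega> \<xi> q *v frechet_derivative (b i) (at q) \<eta> + frechet_derivative (?\<omega> \<xi>) (at q) \<eta> *v b i q))) (at q)"
    if "q \<in> P" "i < n" for \<xi> i q
    unfolding N_def[abs_def]
    by (intro has_derivative_add smooth_on_has_derivative[OF smooth_on_deriv[OF P(4)[OF that(2)]] that(1)]
        bounded_bilinear.FDERIV[OF bounded_bilinear_mv \<omega>d[OF that(1)] bd[OF that]])
  have Rb: "?R q *v b i q \<in> ?F q" if qi: "q \<in> P" "i < n" for q i
  proof -
    have NN: "frechet_derivative (N \<xi> i) (at q) \<eta> + ?\<omega> \<eta> q *v N \<xi> i q \<in> ?F q" for \<xi> \<eta>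
      by (rule step[OF _ Nd[OF qi] qi(1)]) (rule NF[OF _ qi(2)])
    have sym: "frechet_derivative (\<lambda>q. frechet_derivative (b i) (at q) v) (at q) w
        = frechet_derivative (\<lambda>q. frechet_derivative (b i) (at q) w) (at q) v"
      by (rule symmetric_second_derivative[OF P(1) qi(1) smooth_on_imp_Ck[OF P(4)[OF qi(2)]]])
    \<comment> \<open>The commutator of the two covariant derivatives on \<open>b i\<close>; the
      terms with first derivatives of the frame cancel as well.\<close>
    have "(frechet_derivative (N w i) (at q) v + ?\<omega> v q *v N w i q)
        - (frechet_derivative (N v i) (at q) w + ?\<omega> w q *v N v i q) = ?R q *v b i q"
      unfolding frechet_derivative_eqI[OF Nd[OF qi]] sym curvature_def N_def
      by (simp add: matrix_vector_right_distrib bounded_bilinear.add_left[OF bounded_bilinear_mv]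
          bounded_bilinear.diff_left[OF bounded_bilinear_mv] matrix_vector_mul_assoc algebra_simps)
    then show ?thesis using vec.subspace_diff[OF sub[OF qi(1)] NN NN] by metis
  qed
  show R1: "?R p *v f \<in> ?F p" by (rule ext[OF P(2) f Rb[OF P(2)]])
  have "curvature_deriv D c \<Phi> v w p *v b i p \<in> ?F p" if i: "i < n" for i
  proof -
    have d: "((\<lambda>q. ?R q *v b i q) has_derivative (\<lambda>\<eta>. ?R p *v frechet_derivative (b i) (at p) \<eta>
        + frechet_derivative ?R (at p) \<eta> *v b i p)) (at p)"
      by (rule bounded_bilinear.FDERIV[OF bounded_bilinear_mv Rd[OF P(2)] bd[OF P(2) i]])
    have 1: "frechet_derivative (\<lambda>q. ?R q *v b i q) (at p) v + ?\<omega> v p *v (?R p *v b i p) \<in> ?F p"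
      by (rule step[OF _ d P(2)]) (rule Rb[OF _ i])
    have 2: "?R p *v N v i p \<in> ?F p" by (rule ext[OF P(2) NF[OF P(2) i] Rb[OF P(2)]])
    have "frechet_derivative (\<lambda>q. ?R q *v b i q) (at p) v + ?\<omega> v p *v (?R p *v b i p) - ?R p *v N v i p
        = curvature_deriv D c \<Phi> v w p *v b i p"
      unfolding frechet_derivative_eqI[OF d] curvature_deriv_def N_def
      by (simp add: matrix_vector_right_distrib bounded_bilinear.add_left[OF bounded_bilinear_mv]
          bounded_bilinear.diff_left[OF bounded_bilinear_mv] matrix_vector_mul_assoc algebra_simps)
    then show ?thesis using vec.subspace_diff[OF sub[OF P(2)] 1 2] by simp
  qed
  then show "curvature_deriv D c \<Phi> v w p *v f \<in> ?F p" by (rule ext[OF P(2) f])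
qed

lemma subbundle_local_rank:
  assumes F: "smooth_subbundle F" and U: "(U, \<Phi>) \<in> T" "x \<in> U"
  obtains W n where "open W" "x \<in> W" "W \<subseteq> U" "\<And>y. y \<in> W \<Longrightarrow> vec.dim (\<Phi> y ` F y) = n"
    "\<And>y. y \<in> W \<Longrightarrow> vec.subspace (\<Phi> y ` F y)"
proof -
  have "\<forall>x\<in>U. \<exists>W (n::nat) (b :: nat \<Rightarrow> 'm \<Rightarrow> complex ^ 'r).
        open W \<and> x \<in> W \<and> W \<subseteq> U \<and> (\<forall>i<n. smooth_fun W (b i)) \<and>
        (\<forall>y\<in>W. inj_on (\<lambda>i. b i y) {..<n} \<and> vec.independent ((\<lambda>i. b i y) ` {..<n}) \<and>
           \<Phi> y ` F y = vec.span ((\<lambda>i. b i y) ` {..<n}))"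
    using F[unfolded smooth_subbundle_def, THEN conjunct2, rule_format, OF U(1)] by simp
  then obtain W n b where W: "open W" "x \<in> W" "W \<subseteq> U"
    "\<And>y. y \<in> W \<Longrightarrow> inj_on (\<lambda>i. b i y) {..<n}" "\<And>y. y \<in> W \<Longrightarrow> vec.independent ((\<lambda>i. b i y) ` {..<n})"
    "\<And>y. y \<in> W \<Longrightarrow> \<Phi> y ` F y = vec.span ((\<lambda>i. (b :: nat \<Rightarrow> _) i y) ` {..<n})"
    using U(2) by metis
  show ?thesis
  proof (rule that[OF W(1-3)])
    fix y assume y: "y \<in> W"
    show "vec.dim (\<Phi> y ` F y) = n"
      unfolding W(6)[OF y] vec.dim_span_eq_card_independent[OF W(5)[OF y]] by (simp add: card_image[OF W(4)[OF y]])
    show "vec.subspace (\<Phi> y ` F y)" unfolding W(6)[OF y] by (rule vec.subspace_span)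
  qed
qed

text \<open>The rank does not depend on the trivialisation, by dimension estimates in both
  directions, and it is constant near each point by local frames. Every preimage under it is
  therefore open, so a second value would disconnect the manifold.\<close>

lemma subbundle_rank_constant:
  assumes F: "smooth_subbundle F" and U: "(U, \<Phi>) \<in> T" "x \<in> U" and V: "(V, \<Psi>) \<in> T" "y \<in> V"
  shows "vec.dim (\<Phi> x ` F x) = vec.dim (\<Psi> y ` F y)"
proof -
  have FE: "F x \<subseteq> E x" for x using F unfolding smooth_subbundle_def by blast
  define \<rho> where "\<rho> z = vec.dim (triv_at z ` F z)" for z
  have \<rho>: "\<rho> z = vec.dim (\<Phi> z ` F z)" if U: "(U, \<Phi>) \<in> T" "z \<in> U" for U \<Phi> z
  proof -
    obtain V \<Psi> where V: "(V, \<Psi>) \<in> T" "z \<in> V" "triv_at z = \<Psi> z" by (rule triv_at_cases)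
    have le: "vec.dim (\<Phi>' z ` F z) \<le> vec.dim (\<Psi>' z ` F z)"
      if U': "(U', \<Phi>') \<in> T" "z \<in> U'" and V': "(V', \<Psi>') \<in> T" "z \<in> V'" for U' \<Phi>' V' \<Psi>'
    proof -
      obtain G where G: "\<forall>e\<in>E z. \<Phi>' z e = G *v \<Psi>' z e"
        using triv_transition[OF V'(1) U'(1)] U'(2) V'(2) by blast
      then have "\<Phi>' z ` F z = (*v) G ` (\<Psi>' z ` F z)" unfolding image_image using FE by (intro image_cong) auto
      then show ?thesis using vec.dim_image_le[OF matrix_vector_mul_linear_gen, of G "\<Psi>' z ` F z"] by simp
    qed
    show ?thesis unfolding \<rho>_def V(3) by (rule order.antisym[OF le[OF V(1,2) U] le[OF U V(1,2)]])
  qed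
  have loc: "\<exists>W. open W \<and> z \<in> W \<and> (\<forall>z'\<in>W. \<rho> z' = \<rho> z)" for z
  proof -
    obtain U \<Phi> where U: "(U, \<Phi>) \<in> T" "z \<in> U" by (rule triv_exists)
    obtain W n where W: "open W" "z \<in> W" "W \<subseteq> U" "\<And>y. y \<in> W \<Longrightarrow> vec.dim (\<Phi> y ` F y) = n"
      using subbundle_local_rank[OF F U] by metis
    have "\<rho> z' = n" if "z' \<in> W" for z' using \<rho>[OF U(1), of z'] W that by auto
    then show ?thesis using W by auto
  qed
  have op: "open {z. \<rho> z \<in> N}" for N :: "nat set"
  proof (subst open_subopen, rule ballI)
    fix z assume z: "z \<in> {z. \<rho> z \<in> N}"
    obtain W where W: "open W" "z \<in> W" "\<forall>z'\<in>W. \<rho> z' = \<rho> z" using loc by blast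
    have "\<rho> z' \<in> N" if "z' \<in> W" for z' using bspec[OF W(3) that] z by simp
    then show "\<exists>W. open W \<and> z \<in> W \<and> W \<subseteq> {z. \<rho> z \<in> N}" using W(1,2) by blast
  qed
  have 1: "{z. \<rho> z \<in> {\<rho> x}} \<inter> {z. \<rho> z \<in> - {\<rho> x}} \<inter> UNIV = {}" by blast
  have 2: "UNIV \<subseteq> {z. \<rho> z \<in> {\<rho> x}} \<union> {z. \<rho> z \<in> - {\<rho> x}}" by blast
  have "\<rho> y = \<rho> x" using connectedD[OF connected op op 1 2] by blast
  then show ?thesis using \<rho>[OF U] \<rho>[OF V] by simp
qed

text \<open>Constancy of the rank propagates the extreme values zero and full from one fibre to all,
  and a subspace of such dimension is determined.\<close>

lemma subbundle_trivial:
  assumes F: "smooth_subbundle F" and U: "(U, \<Phi>) \<in> T" "x \<in> U"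
    and x: "\<Phi> x ` F x = {0} \<or> \<Phi> x ` F x = UNIV"
  shows "F = E \<or> F = (\<lambda>x. {fib_zero x})"
proof -
  have FE: "F x \<subseteq> E x" for x using F unfolding smooth_subbundle_def by blast
  have dimy: "vec.dim (\<Psi> y ` F y) = vec.dim (\<Phi> x ` F x)" if "(V, \<Psi>) \<in> T" "y \<in> V" for V \<Psi> y
    by (rule subbundle_rank_constant[OF F that U])
  have suby: "vec.subspace (\<Psi> y ` F y)" if "(V, \<Psi>) \<in> T" "y \<in> V" for V \<Psi> y
    using subbundle_local_rank[OF F that] by metis
  show ?thesis using x
  proof
    assume 0: "\<Phi> x ` F x = {0}"
    have "F y = {fib_zero y}" for y
    proof -
      obtain V \<Psi> where V: "(V, \<Psi>) \<in> T" "y \<in> V" by (rule triv_exists)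
      have "vec.dim (\<Psi> y ` F y) = 0" using dimy[OF V] 0 vec.dim_eq_0[of "{0}"] by simp
      then have "\<Psi> y ` F y = {0}" using vec.dim_eq_0[of "\<Psi> y ` F y"] vec.subspace_0[OF suby[OF V]] by blast
      then have "\<Psi> y ` F y = \<Psi> y ` {fib_zero y}" using fib_ops(2)[OF V] by simp
      moreover have "inj_on (\<Psi> y) (E y)" using triv_bij[OF V] by (rule bij_betw_imp_inj_on)
      ultimately show ?thesis
        using inj_on_image_eq_iff[OF _ FE[of y], of "\<Psi> y" "{fib_zero y}"] fib_mem(1)[of y] by blast
    qed
    then show ?thesis by blast
  next
    assume 1: "\<Phi> x ` F x = UNIV"
    have "F y = E y" for y
    proof -
      obtain V \<Psi> where V: "(V, \<Psi>) \<in> T" "y \<in> V" by (rule triv_exists)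
      have "\<Psi> y ` F y = UNIV"
        by (rule vec.subspace_dim_equal[OF suby[OF V] vec.subspace_UNIV subset_UNIV]) (simp add: dimy[OF V] 1)
      then have "\<Psi> y ` F y = \<Psi> y ` E y" using triv_bij[OF V] by (simp add: bij_betw_def)
      moreover have "inj_on (\<Psi> y) (E y)" using triv_bij[OF V] by (rule bij_betw_imp_inj_on)
      ultimately show ?thesis using FE[of y] by (simp add: inj_on_image_eq_iff[of _ "E y"])
    qed
    then show ?thesis by blast
  qed
qed

end

section \<open>Linear algebra: word matrices and polynomial dependence\<close>

section \<open>Pairs of matrices without common invariant subspace\<close>

primrec mpow :: "complex ^ 'n::finite ^ 'n \<Rightarrow> nat \<Rightarrow> complex ^ 'n ^ 'n" where
  "mpow M 0 = mat 1"
| "mpow M (Suc a) = M ** mpow M a"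

text \<open>Numbers the index type by \<open>0, ..., CARD('n) - 1\<close>. Exponents of words are
  thereby indexed by the type that also indexes matrix entries, and \<open>words\<close> becomes a
  square matrix.\<close>

definition idx :: "'n::finite \<Rightarrow> nat" where
  "idx = (SOME f. bij_betw f UNIV {..<CARD('n)})"

lemma idx: "bij_betw (idx :: 'n::finite \<Rightarrow> nat) UNIV {..<CARD('n)}"
proof -
  have "\<exists>f :: 'n \<Rightarrow> nat. bij_betw f UNIV {..<CARD('n)}"
    using ex_bij_betw_finite_nat[of "UNIV :: 'n set"] by (simp add: lessThan_atLeast0)
  from someI_ex[OF this] show ?thesis by (simp add: idx_def)
qed

lemma idx_inj: "idx i = idx j \<longleftrightarrow> i = j"
  using bij_betw_imp_inj_on[OF idx] by (auto dest: injD)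

lemma idx_surj: "a < CARD('n::finite) \<Longrightarrow> \<exists>i :: 'n. idx i = a"
  using bij_betw_imp_surj_on[OF idx[where 'n='n]] by (metis imageE lessThan_iff)

text \<open>The rows list the entries of the words \<open>M\<^sup>a N M\<^sup>b\<close>, so that a nonzero determinant means that
  these words span the space of all matrices.\<close>

definition words :: "complex ^ 'n::finite ^ 'n \<Rightarrow> complex ^ 'n ^ 'n \<Rightarrow> complex ^ ('n \<times> 'n) ^ ('n \<times> 'n)" where
  "words M N = (\<chi> w e. (mpow M (idx (fst w)) ** N ** mpow M (idx (snd w))) $ fst e $ snd e)"

text \<open>If the words span all matrices, \<open>F\<close> is stable under every matrix. A
  rank-one matrix takes a nonzero vector of \<open>F\<close> to any prescribed vector.\<close>

lemma words_invariant_subspace: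
  fixes M N :: "complex ^ 'n::finite ^ 'n"
  assumes det: "det (words M N) \<noteq> 0" and F: "vec.subspace F"
    and M: "\<And>f. f \<in> F \<Longrightarrow> M *v f \<in> F" and N: "\<And>f. f \<in> F \<Longrightarrow> N *v f \<in> F"
  shows "F = {0} \<or> F = UNIV"
proof -
  define X where "X w = mpow M (idx (fst w)) ** N ** mpow M (idx (snd w))" for w :: "'n \<times> 'n"
  have mp: "mpow M a *v f \<in> F" if "f \<in> F" for a f
    using that by (induction a) (auto simp: M simp flip: matrix_vector_mul_assoc)
  have X: "X w *v f \<in> F" if "f \<in> F" for w f
    unfolding X_def by (simp add: mp N that flip: matrix_vector_mul_assoc)
  \<comment> \<open>Words are listed in the rows, so the coefficients of a linear combination of
    words solve a system with the transposed matrix.\<close>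
  have "invertible (transpose (words M N))" using det by (simp add: invertible_det_nz det_transpose)
  then obtain W' where W': "transpose (words M N) ** W' = mat 1" unfolding invertible_def by blast
  have all: "Y *v f \<in> F" if f: "f \<in> F" for Y :: "complex ^ 'n ^ 'n" and f
  proof -
    define c where "c = W' *v (\<chi> e. Y $ fst e $ snd e)"
    have "transpose (words M N) *v c = (\<chi> e. Y $ fst e $ snd e)"
      unfolding c_def matrix_vector_mul_assoc W' by simp
    then have "(\<Sum>w\<in>UNIV. words M N $ w $ (i, j) * c $ w) = Y $ i $ j" for i j
      by (simp add: vec_eq_iff matrix_vector_mult_def transpose_def)
    then have "Y $ i $ j = (\<Sum>w\<in>UNIV. c $ w * X w $ i $ j)" for i j
      by (simp add: words_def X_def mult.commute)
    then have "(Y *v f) $ i = (\<Sum>j\<in>UNIV. \<Sum>w\<in>UNIV. c $ w * (X w $ i $ j * f $ j))" for i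
      by (simp add: matrix_vector_mult_def sum_distrib_right mult.assoc)
    then have "(Y *v f) $ i = (\<Sum>w\<in>UNIV. c $ w *s (X w *v f)) $ i" for i
      by (subst (asm) sum.swap) (simp add: matrix_vector_mult_def sum_distrib_left)
    then have eq: "Y *v f = (\<Sum>w\<in>UNIV. c $ w *s (X w *v f))" unfolding vec_eq_iff by blast
    show ?thesis unfolding eq by (rule vec.subspace_sum[OF F], rule vec.subspace_scale[OF F], rule X[OF f])
  qed
  show ?thesis
  proof (cases "F = {0}")
    case False
    then obtain f where f: "f \<in> F" "f \<noteq> 0" using vec.subspace_0[OF F] by blast
    then obtain k where k: "f $ k \<noteq> 0" by (auto simp: vec_eq_iff)
    have "v \<in> F" for v
    proof -
      \<comment> \<open>The matrix that reads the nonzero \<open>k\<close>-th coordinate of a vector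
        and sends \<open>f\<close> to \<open>v\<close>.\<close>
      define Y :: "complex ^ 'n ^ 'n" where "Y = (\<chi> i j. if j = k then v $ i / f $ k else 0)"
      have "Y *v f = v"
        using k by (simp add: Y_def vec_eq_iff matrix_vector_mult_def if_distrib[of "\<lambda>x. x * _"] cong: if_cong)
      then show ?thesis using all[OF f(1), of Y] by simp
    qed
    then show ?thesis by blast
  qed simp
qed

text \<open>The equations are combined with the coefficients of the polynomial that vanishes at all
  nodes except \<open>l k\<close>; its degree is below \<open>CARD('n)\<close>, and only the term
  with \<open>d k\<close> survives.\<close>

lemma vandermonde_injective:
  fixes l d :: "'n::finite \<Rightarrow> complex"
  assumes inj: "inj l" and d: "\<And>a. a < CARD('n) \<Longrightarrow> (\<Sum>i\<in>UNIV. l i ^ a * d i) = 0"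
  shows "d k = 0"
proof -
  define p where "p = (\<Prod>j\<in>UNIV - {k}. [:- l j, 1:])"
  have "degree p \<le> (\<Sum>j\<in>UNIV - {k}. degree [:- l j, 1:])"
    unfolding p_def by (rule order.trans[OF degree_prod_sum_le]) auto
  then have "degree p \<le> CARD('n) - 1" by simp
  moreover have "0 < CARD('n)" by simp
  ultimately have deg: "degree p < CARD('n)" by linarith
  have "(\<Sum>i\<in>UNIV. poly p (l i) * d i) = (\<Sum>i\<in>UNIV. \<Sum>a\<le>degree p. coeff p a * (l i ^ a * d i))"
    by (simp add: poly_altdef sum_distrib_right mult.assoc)
  also have "\<dots> = (\<Sum>a\<le>degree p. coeff p a * (\<Sum>i\<in>UNIV. l i ^ a * d i))"
    by (subst sum.swap) (simp add: sum_distrib_left)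
  also have "\<dots> = 0" using d deg by (intro sum.neutral) simp
  finally have 0: "(\<Sum>i\<in>UNIV. poly p (l i) * d i) = 0" .
  have pz: "poly p (l i) = 0" if "i \<noteq> k" for i
    using that by (auto simp: p_def poly_prod)
  have "(\<Sum>i\<in>UNIV. poly p (l i) * d i) = poly p (l k) * d k"
    by (subst sum.remove[of _ k]) (simp_all add: pz)
  moreover have "poly p (l k) \<noteq> 0"
    using inj by (auto simp: p_def poly_prod dest: injD)
  ultimately show ?thesis using 0 by simp
qed

text \<open>For diagonal \<open>M\<close> with distinct eigenvalues and \<open>N\<close> with all
  entries 1, the matrix of words is the Kronecker product of two Vandermonde matrices; its kernel is
  killed one factor at a time.\<close>

lemma words_nonsingular_exists: "\<exists>M N :: complex ^ 'n::finite ^ 'n. det (words M N) \<noteq> 0"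
proof -
  define l :: "'n \<Rightarrow> complex" where "l i = of_nat (idx i)" for i
  have inj: "inj l" by (rule injI) (simp add: l_def idx_inj)
  define M :: "complex ^ 'n ^ 'n" where "M = (\<chi> i j. if i = j then l i else 0)"
  define N :: "complex ^ 'n ^ 'n" where "N = (\<chi> i j. 1)"
  have Mp: "mpow M a $ i $ j = (if i = j then l i ^ a else 0)" for a i j
  proof (induction a arbitrary: i j)
    case 0
    then show ?case by (simp add: mat_def)
  next
    case (Suc a)
    then show ?case
      by (simp add: matrix_matrix_mult_def M_def if_distrib[of "\<lambda>x. x * _"] cong: if_cong)
  qed
  have W: "words M N $ (a, b) $ (i, j) = l i ^ idx a * l j ^ idx b" for a b i j
    by (simp add: words_def matrix_matrix_mult_def Mp N_def if_distrib[of "\<lambda>x. x * _"]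
        if_distrib[of "\<lambda>x. _ * x"] cong: if_cong)
  have "c = 0" if c: "words M N *v c = 0" for c
  proof -
    have 1: "(\<Sum>i\<in>UNIV. l i ^ a * (\<Sum>j\<in>UNIV. l j ^ b * c $ (i, j))) = 0" if ab: "a < CARD('n)" "b < CARD('n)" for a b
    proof -
      obtain a' b' :: 'n where ab': "idx a' = a" "idx b' = b" using idx_surj ab by metis
      have "(words M N *v c) $ (a', b') = 0" using c by simp
      then have "(\<Sum>e\<in>UNIV \<times> UNIV. words M N $ (a', b') $ e * c $ e) = 0"
        by (simp add: matrix_vector_mult_def)
      then show ?thesis
        unfolding sum.cartesian_product' W ab' by (simp add: sum_distrib_left mult.assoc)
    qed
    have "(\<Sum>j\<in>UNIV. l j ^ b * c $ (i, j)) = 0" if "b < CARD('n)" for b i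
      by (rule vandermonde_injective[OF inj 1[OF _ that]])
    then have "c $ (i, j) = 0" for i j by (rule vandermonde_injective[OF inj])
    then show ?thesis by (simp add: vec_eq_iff)
  qed
  then have "invertible (words M N)"
    using matrix_left_invertible_ker[of "words M N"] invertible_left_inverse[of "words M N"] by blast
  then show ?thesis using invertible_det_nz by blast
qed

text \<open>Functions of a complex variable given by some polynomial. Closure under sums and
  products carries this through the determinant without matrices over a polynomial ring.\<close>

definition polyfun :: "(complex \<Rightarrow> complex) \<Rightarrow> bool" where
  "polyfun f \<longleftrightarrow> (\<exists>p. \<forall>t. f t = poly p t)"

lemma polyfun_const: "polyfun (\<lambda>t. c)" unfolding polyfun_def by (rule exI[of _ "[:c:]"]) simp
lemma polyfun_id: "polyfun (\<lambda>t. t)" unfolding polyfun_def by (rule exI[of _ "[:0, 1:]"]) simp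
lemma polyfun_add: "polyfun f \<Longrightarrow> polyfun g \<Longrightarrow> polyfun (\<lambda>t. f t + g t)"
  unfolding polyfun_def by (metis poly_add)
lemma polyfun_mult: "polyfun f \<Longrightarrow> polyfun g \<Longrightarrow> polyfun (\<lambda>t. f t * g t)"
  unfolding polyfun_def by (metis poly_mult)

lemma polyfun_sum:
  assumes "\<And>i. i \<in> I \<Longrightarrow> polyfun (f i)" shows "polyfun (\<lambda>t. \<Sum>i\<in>I. f i t)"
  using assms
proof (induction I rule: infinite_finite_induct)
  case (insert i I)
  then have "polyfun (\<lambda>t. f i t + (\<Sum>i\<in>I. f i t))" by (intro polyfun_add) auto
  then show ?case using insert by simp
qed (simp_all add: polyfun_const)

lemma polyfun_prod:
  assumes "\<And>i. i \<in> I \<Longrightarrow> polyfun (f i)" shows "polyfun (\<lambda>t. \<Prod>i\<in>I. f i t)"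
  using assms
proof (induction I rule: infinite_finite_induct)
  case (insert i I)
  then have "polyfun (\<lambda>t. f i t * (\<Prod>i\<in>I. f i t))" by (intro polyfun_mult) auto
  then show ?case using insert by simp
qed (simp_all add: polyfun_const)

text \<open>A nonzero polynomial has finitely many roots, while the real interval up to
  \<open>\<delta>\<close> is infinite.\<close>

lemma polyfun_nonzero_small:
  assumes "polyfun f" "f z \<noteq> 0" "\<delta> > 0"
  obtains t :: real where "0 < t" "t < \<delta>" "f (of_real t) \<noteq> 0"
proof -
  obtain p where p: "\<And>t. f t = poly p t" using assms(1) unfolding polyfun_def by blast
  have "p \<noteq> 0" using assms(2) p by auto
  then have "finite {z. poly p z = 0}" by (rule poly_roots_finite)
  moreover have "infinite (complex_of_real ` {0<..<\<delta>})"
    using assms(3) by (simp add: finite_image_iff inj_on_def infinite_Ioo)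
  ultimately have "\<not> complex_of_real ` {0<..<\<delta>} \<subseteq> {z. poly p z = 0}" using finite_subset by blast
  then obtain t where "t \<in> {0<..<\<delta>}" "poly p (of_real t) \<noteq> 0" by blast
  then show ?thesis by (intro that[of t]) (auto simp: p)
qed

lemma polyfun_matrix_mult:
  assumes "\<And>i j. polyfun (\<lambda>t. M t $ i $ j)" "\<And>i j. polyfun (\<lambda>t. N t $ i $ j)"
  shows "polyfun (\<lambda>t. (M t ** (N t :: complex ^ 'n::finite ^ 'n)) $ i $ j)"
  unfolding matrix_matrix_mult_def by (simp add: polyfun_sum polyfun_mult assms)

lemma polyfun_det_words:
  fixes M N :: "complex \<Rightarrow> complex ^ 'n::finite ^ 'n"
  assumes M: "\<And>i j. polyfun (\<lambda>t. M t $ i $ j)" and N: "\<And>i j. polyfun (\<lambda>t. N t $ i $ j)"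
  shows "polyfun (\<lambda>t. det (words (M t) (N t)))"
proof -
  have mp: "polyfun (\<lambda>t. mpow (M t) a $ i $ j)" for a i j
  proof (induction a arbitrary: i j)
    case 0
    then show ?case by (simp add: polyfun_const)
  next
    case (Suc a)
    then show ?case by (simp add: polyfun_matrix_mult M)
  qed
  have "polyfun (\<lambda>t. words (M t) (N t) $ w $ e)" for w e
    unfolding words_def by (simp add: polyfun_matrix_mult mp N)
  then show ?thesis unfolding det_def by (intro polyfun_sum polyfun_mult polyfun_const polyfun_prod)
qed

definition mscale :: "complex \<Rightarrow> complex ^ 'n ^ 'n \<Rightarrow> complex ^ 'n ^ 'n" where
  "mscale a M = (\<chi> i j. a * M $ i $ j)"

lemma mscale_nth: "mscale a M $ i $ j = a * M $ i $ j" by (simp add: mscale_def)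

text \<open>The determinant is nonzero at the parameters 1 and the imaginary unit. It is polynomial
  in each parameter separately, so first the second and then the first can be replaced by small
  positive reals.\<close>

lemma words_nonsingular_small:
  fixes M N :: "complex ^ 'n::finite ^ 'n"
  assumes "det (words (M + B1 + mscale \<i> B1') (N + B2 + mscale \<i> B2')) \<noteq> 0" and \<delta>: "\<delta> > 0"
  obtains t s :: real where "0 < t" "t < \<delta>" "0 < s" "s < \<delta>"
    "det (words (M + (t *\<^sub>R B1 + s *\<^sub>R B1')) (N + (t *\<^sub>R B2 + s *\<^sub>R B2'))) \<noteq> 0"
proof -
  define f where "f t s = det (words (M + mscale t B1 + mscale s B1') (N + mscale t B2 + mscale s B2'))" for t s
  have pf1: "polyfun (\<lambda>s. f t s)" for t
    unfolding f_def
    by (rule polyfun_det_words) (auto simp: mscale_nth intro!: polyfun_add polyfun_mult polyfun_const polyfun_id)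
  have pf2: "polyfun (\<lambda>t. f t s)" for s
    unfolding f_def
    by (rule polyfun_det_words) (auto simp: mscale_nth intro!: polyfun_add polyfun_mult polyfun_const polyfun_id)
  have "mscale 1 B = B" for B :: "complex ^ 'n ^ 'n" by (simp add: mscale_def vec_eq_iff)
  then have "f 1 \<i> \<noteq> 0" using assms(1) by (simp add: f_def)
  then obtain s where s: "0 < s" "s < \<delta>" "f 1 (of_real s) \<noteq> 0" using polyfun_nonzero_small[OF pf1 _ \<delta>] by blast
  obtain t where t: "0 < t" "t < \<delta>" "f (of_real t) (of_real s) \<noteq> 0" using polyfun_nonzero_small[OF pf2 s(3) \<delta>] by blast
  have sc: "mscale (of_real t) B = t *\<^sub>R B" for t and B :: "complex ^ 'n ^ 'n"
  proof -
    have "mscale (of_real t) B $ i $ j = (t *\<^sub>R B) $ i $ j" for i j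
      unfolding mscale_nth vector_scaleR_component scaleR_conv_of_real[of t "_ :: complex"] ..
    then show ?thesis by (simp only: vec_eq_iff) blast
  qed
  show ?thesis by (rule that[OF t(1,2) s(1,2)]) (use t(3) in \<open>simp add: f_def sc add.assoc\<close>)
qed

lemma isCont_words:
  fixes M N :: "'a::t2_space \<Rightarrow> complex ^ 'n::finite ^ 'n"
  assumes "isCont M x" "isCont N x"
  shows "isCont (\<lambda>x. det (words (M x) (N x))) x"
proof -
  note mm = bounded_bilinear.isCont[OF bounded_bilinear_mm]
  have mp: "isCont (\<lambda>x. mpow (M x) a) x" for a
    by (induction a) (auto intro: mm assms)
  have "isCont (\<lambda>x. words (M x) (N x) $ w $ e) x" for w e
    unfolding words_def by (simp, intro isCont_vec_nth mm mp assms)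
  then show ?thesis
    unfolding det_def by (intro continuous_sum continuous_mult continuous_const continuous_prod)
qed

section \<open>Perturbation of connections, openness and density\<close>

section \<open>Iterated derivatives\<close>

lemma iter_deriv_cong:
  assumes "open S" "\<And>x. x \<in> S \<Longrightarrow> f x = g x" "p \<in> S"
  shows "iter_deriv vs f p = iter_deriv vs g p"
  using assms(2,3)
proof (induction vs arbitrary: f g)
  case (Cons v vs)
  have "frechet_derivative f (at x) v = frechet_derivative g (at x) v" if "x \<in> S" for x
    using frechet_derivative_cong_open[OF assms(1) that Cons.prems(1)] by simp
  from Cons.IH[OF this Cons.prems(2)] show ?case by simp
qed simp

lemma iter_deriv_add:
  assumes S: "open S" "p \<in> S" and "Ck_on k f S" "Ck_on k g S" "length vs \<le> k"
  shows "iter_deriv vs (\<lambda>x. f x + g x) p = iter_deriv vs f p + iter_deriv vs g p"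
  using assms(3-)
proof (induction vs arbitrary: f g k)
  case (Cons v vs)
  then obtain m where k: "k = Suc m" by (cases k) auto
  have 1: "frechet_derivative (\<lambda>x. f x + g x) (at x) v = frechet_derivative f (at x) v + frechet_derivative g (at x) v"
    if "x \<in> S" for x
    using frechet_derivative_eqI[OF has_derivative_add[OF Ck_on_has_derivative[OF Cons.prems(1) _ that]
          Ck_on_has_derivative[OF Cons.prems(2) _ that]]] k by simp
  have "iter_deriv (v # vs) (\<lambda>x. f x + g x) p
      = iter_deriv vs (\<lambda>x. frechet_derivative f (at x) v + frechet_derivative g (at x) v) p"
    using iter_deriv_cong[OF S(1) 1 S(2)] by simp
  also have "\<dots> = iter_deriv (v # vs) f p + iter_deriv (v # vs) g p"
    using Cons.IH[of m "\<lambda>x. frechet_derivative f (at x) v" "\<lambda>x. frechet_derivative g (at x) v"] Cons.prems k by simp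
  finally show ?case .
qed simp

lemma iter_deriv_scaleR:
  assumes S: "open S" "p \<in> S" and "Ck_on k f S" "length vs \<le> k"
  shows "iter_deriv vs (\<lambda>x. a *\<^sub>R f x) p = a *\<^sub>R iter_deriv vs f p"
  using assms(3-)
proof (induction vs arbitrary: f k)
  case (Cons v vs)
  then obtain m where k: "k = Suc m" by (cases k) auto
  have 1: "frechet_derivative (\<lambda>x. a *\<^sub>R f x) (at x) v = a *\<^sub>R frechet_derivative f (at x) v"
    if "x \<in> S" for x
    using frechet_derivative_eqI[OF has_derivative_scaleR_right[OF Ck_on_has_derivative[OF Cons.prems(1) _ that]]] k by simp
  have "iter_deriv (v # vs) (\<lambda>x. a *\<^sub>R f x) p = iter_deriv vs (\<lambda>x. a *\<^sub>R frechet_derivative f (at x) v) p"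
    using iter_deriv_cong[OF S(1) 1 S(2)] by simp
  also have "\<dots> = a *\<^sub>R iter_deriv (v # vs) f p"
    using Cons.IH[of m "\<lambda>x. frechet_derivative f (at x) v"] Cons.prems k by simp
  finally show ?case .
qed simp

lemma iter_deriv_continuous:
  assumes "Ck_on k f S" "length vs \<le> k" shows "continuous_on S (iter_deriv vs f)"
  by (rule Ck_on_continuous[OF Ck_on_iter_deriv[OF assms]])

section \<open>Perturbing a unitary connection\<close>

definition skew_hermitian :: "complex ^ 'n ^ 'n \<Rightarrow> bool" where
  "skew_hermitian M \<longleftrightarrow> (\<forall>i j. M $ i $ j + cnj (M $ j $ i) = 0)"

lemma skew_hermitian_lincomb:
  "skew_hermitian M \<Longrightarrow> skew_hermitian N \<Longrightarrow> skew_hermitian (a *\<^sub>R M + b *\<^sub>R N)"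
  "skew_hermitian M \<Longrightarrow> skew_hermitian (a *\<^sub>R M)"
proof -
  have e: "(a *\<^sub>R M + b *\<^sub>R N) $ i $ j + cnj ((a *\<^sub>R M + b *\<^sub>R N) $ j $ i)
      = a *\<^sub>R (M $ i $ j + cnj (M $ j $ i)) + b *\<^sub>R (N $ i $ j + cnj (N $ j $ i))" for a b M N i j
    unfolding vector_add_component vector_scaleR_component by (simp add: scaleR_conv_of_real algebra_simps)
  show "skew_hermitian M \<Longrightarrow> skew_hermitian N \<Longrightarrow> skew_hermitian (a *\<^sub>R M + b *\<^sub>R N)"
    unfolding skew_hermitian_def e by simp
  show "skew_hermitian M \<Longrightarrow> skew_hermitian (a *\<^sub>R M)"
    using e[of a M 0 M] unfolding skew_hermitian_def by simp
qed

text \<open>The analogue of real and imaginary parts: the space of all matrices is the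
  complexification of the skew-Hermitian ones.\<close>

lemma skew_hermitian_decomp:
  obtains K K' where "skew_hermitian K" "skew_hermitian K'" "C = K + mscale \<i> K'"
proof (rule that)
  show "skew_hermitian (\<chi> i j. (C $ i $ j - cnj (C $ j $ i)) / 2)"
    by (simp add: skew_hermitian_def field_simps)
  show "skew_hermitian (\<chi> i j. (C $ i $ j + cnj (C $ j $ i)) / (2 * \<i>))"
    by (simp add: skew_hermitian_def field_simps)
  show "C = (\<chi> i j. (C $ i $ j - cnj (C $ j $ i)) / 2) + mscale \<i> (\<chi> i j. (C $ i $ j + cnj (C $ j $ i)) / (2 * \<i>))"
    by (simp add: vec_eq_iff mscale_nth field_simps)
qed

lemma complex_linear_axis_sum:
  fixes \<phi> :: "complex ^ 'n::finite \<Rightarrow> complex"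
  assumes "\<And>a u v. \<phi> (a *s u + v) = a * \<phi> u + \<phi> v"
  shows "\<phi> v = (\<Sum>l\<in>UNIV. v $ l * \<phi> (axis l 1))"
proof -
  have 0: "\<phi> 0 = 0" using assms[of "-1" 0 0] by simp
  have "\<phi> (\<Sum>l\<in>J. v $ l *s axis l 1) = (\<Sum>l\<in>J. v $ l * \<phi> (axis l 1))" for J
    by (induction J rule: infinite_finite_induct) (simp_all add: 0 assms)
  from this[of UNIV] show ?thesis by (simp only: basis_expansion)
qed

context hermitian_vector_bundle
begin

lemma fib_scale_1:
  assumes "e \<in> E x" shows "fib_scale x 1 e = e"
proof -
  obtain U \<Phi> where U: "(U, \<Phi>) \<in> T" "x \<in> U" by (rule triv_exists)
  show ?thesis by (rule triv_eqI[OF U]) (simp_all add: fib_ops[OF U] assms)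
qed

lemma fib_add_zero:
  assumes "e \<in> E x" shows "fib_add x e (fib_zero x) = e"
proof -
  obtain U \<Phi> where U: "(U, \<Phi>) \<in> T" "x \<in> U" by (rule triv_exists)
  show ?thesis by (rule triv_eqI[OF U]) (simp_all add: fib_ops[OF U] assms)
qed

lemma herm_add: "e \<in> E x \<Longrightarrow> e' \<in> E x \<Longrightarrow> f \<in> E x \<Longrightarrow> h x (fib_add x e e') f = h x e f + h x e' f"
  using herm_linear[of e x e' f 1] by (simp add: fib_scale_1)

lemma herm_zero: "f \<in> E x \<Longrightarrow> h x (fib_zero x) f = 0"
  using herm_add[of "fib_zero x" x "fib_zero x" f] by (simp add: fib_mem fib_add_zero)

lemma herm_scale: "e \<in> E x \<Longrightarrow> f \<in> E x \<Longrightarrow> h x (fib_scale x a e) f = a * h x e f"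
  using herm_linear[of e x "fib_zero x" f a] by (simp add: fib_mem fib_add_zero herm_zero)

lemma herm_add2: "e \<in> E x \<Longrightarrow> f \<in> E x \<Longrightarrow> f' \<in> E x \<Longrightarrow> h x e (fib_add x f f') = h x e f + h x e f'"
  using herm_sym[of "fib_add x f f'" x e] herm_sym[of f x e] herm_sym[of f' x e]
  by (simp add: fib_mem herm_add)

definition basis_vec :: "('m \<Rightarrow> 'v \<Rightarrow> complex ^ 'r) \<Rightarrow> 'm \<Rightarrow> 'r \<Rightarrow> 'v" where
  "basis_vec \<Phi> x j = inv_into (E x) (\<Phi> x) (axis j 1)"

text \<open>Trivialisations need not be unitary, so this matrix carries the Hermitian metric. The
  order of its indices makes \<open>gram \<Phi> x *v \<Phi> x e\<close> the vector of products of
  \<open>e\<close> with the basis vectors.\<close>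

definition gram :: "('m \<Rightarrow> 'v \<Rightarrow> complex ^ 'r) \<Rightarrow> 'm \<Rightarrow> complex ^ 'r ^ 'r" where
  "gram \<Phi> x = (\<chi> k l. h x (basis_vec \<Phi> x l) (basis_vec \<Phi> x k))"

lemma herm_expand:
  assumes U: "(U, \<Phi>) \<in> T" "x \<in> U" and f: "f \<in> E x"
  shows "h x (inv_into (E x) (\<Phi> x) v) f = (\<Sum>l\<in>UNIV. v $ l * h x (basis_vec \<Phi> x l) f)"
proof -
  note inv = triv_inv[OF U]
  have "inv_into (E x) (\<Phi> x) (a *s u + v) = fib_add x (fib_scale x a (inv_into (E x) (\<Phi> x) u)) (inv_into (E x) (\<Phi> x) v)"
    for a u v
    by (rule triv_eqI[OF U]) (simp_all add: inv fib_ops[OF U])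
  then have "h x (inv_into (E x) (\<Phi> x) (a *s u + v)) f
      = a * h x (inv_into (E x) (\<Phi> x) u) f + h x (inv_into (E x) (\<Phi> x) v) f" for a u v
    using herm_linear[OF inv(1) inv(1) f] by simp
  from complex_linear_axis_sum[of "\<lambda>v. h x (inv_into (E x) (\<Phi> x) v) f", OF this, of v]
  show ?thesis by (simp add: basis_vec_def)
qed

lemma herm_gram:
  assumes U: "(U, \<Phi>) \<in> T" "x \<in> U" and e: "e \<in> E x"
  shows "h x e (basis_vec \<Phi> x k) = (gram \<Phi> x *v \<Phi> x e) $ k"
  using herm_expand[OF U, of "basis_vec \<Phi> x k" "\<Phi> x e"] triv_inv[OF U] e
  by (simp add: gram_def matrix_vector_mult_def basis_vec_def mult.commute)

text \<open>In coordinates the metric is given by the Hermitian matrix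
  \<open>H = gram \<Phi> x\<close>, and \<open>H K H\<close> is skew-Hermitian together with
  \<open>K\<close>. Thus skew-Hermitian \<open>K\<close> describe, through \<open>K ** H\<close>,
  endomorphisms that are skew for the metric in an arbitrary trivialisation.\<close>

lemma gram_skew:
  assumes U: "(U, \<Phi>) \<in> T" "x \<in> U" and K: "skew_hermitian K" and ef: "e \<in> E x" "f \<in> E x"
  shows "h x (inv_into (E x) (\<Phi> x) ((K ** gram \<Phi> x) *v \<Phi> x e)) f
    + h x e (inv_into (E x) (\<Phi> x) ((K ** gram \<Phi> x) *v \<Phi> x f)) = 0"
proof -
  note inv = triv_inv[OF U]
  have b: "basis_vec \<Phi> x j \<in> E x" for j unfolding basis_vec_def by (rule inv(1))
  have 1: "h x (inv_into (E x) (\<Phi> x) ((K ** gram \<Phi> x) *v \<Phi> x e)) f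
    = (\<Sum>j\<in>UNIV. \<Sum>k\<in>UNIV. K $ j $ k * (h x e (basis_vec \<Phi> x k) * h x (basis_vec \<Phi> x j) f))"
    if "e \<in> E x" "f \<in> E x" for e f
  proof -
    have "((K ** gram \<Phi> x) *v \<Phi> x e) $ j = (\<Sum>k\<in>UNIV. K $ j $ k * h x e (basis_vec \<Phi> x k))" for j
      unfolding herm_gram[OF U that(1)] matrix_vector_mul_assoc[symmetric] by (simp add: matrix_vector_mult_def)
    then show ?thesis
      unfolding herm_expand[OF U that(2)] by (simp add: sum_distrib_right mult.assoc)
  qed
  have "h x e (inv_into (E x) (\<Phi> x) ((K ** gram \<Phi> x) *v \<Phi> x f))
      = cnj (h x (inv_into (E x) (\<Phi> x) ((K ** gram \<Phi> x) *v \<Phi> x f)) e)"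
    by (rule herm_sym[OF inv(1) ef(1)])
  also have "\<dots> = (\<Sum>j\<in>UNIV. \<Sum>k\<in>UNIV. cnj (K $ j $ k) * (h x (basis_vec \<Phi> x k) f * h x e (basis_vec \<Phi> x j)))"
    unfolding 1[OF ef(2,1)] using herm_sym[OF ef(2) b] herm_sym[OF b ef(1)] by simp
  also have "\<dots> = (\<Sum>k\<in>UNIV. \<Sum>j\<in>UNIV. cnj (K $ j $ k) * (h x (basis_vec \<Phi> x k) f * h x e (basis_vec \<Phi> x j)))"
    by (rule sum.swap)
  finally have 2: "h x e (inv_into (E x) (\<Phi> x) ((K ** gram \<Phi> x) *v \<Phi> x f))
    = (\<Sum>j\<in>UNIV. \<Sum>k\<in>UNIV. cnj (K $ k $ j) * (h x e (basis_vec \<Phi> x k) * h x (basis_vec \<Phi> x j) f))"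
    by (simp add: mult_ac)
  show ?thesis
    unfolding 1[OF ef] 2 sum.distrib[symmetric] distrib_right[symmetric]
    using K by (simp add: skew_hermitian_def)
qed

lemma gram_smooth:
  assumes U: "(U, \<Phi>) \<in> T" shows "smooth_fun U (gram \<Phi>)"
proof -
  note o = triv_open[OF U]
  have "smooth_fun U (\<lambda>x. \<Sum>l\<in>UNIV. col_matrix l (\<Sum>k\<in>UNIV. h x (basis_vec \<Phi> x l) (basis_vec \<Phi> x k) *s axis k 1))"
    by (intro smooth_fun_sum[OF o] smooth_fun_linear[OF bounded_linear_col_matrix o]
        smooth_fun_bilinear[OF bounded_bilinear_smult o _ smooth_fun_const])
      (unfold basis_vec_def, rule herm_smooth[OF U])
  moreover have "(\<Sum>l\<in>UNIV. col_matrix l (\<Sum>k\<in>UNIV. h x (basis_vec \<Phi> x l) (basis_vec \<Phi> x k) *s axis k 1)) = gram \<Phi> x" for x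
    by (simp add: vec_eq_iff gram_def col_matrix_def axis_def if_distrib cong: if_cong)
  ultimately show ?thesis by simp
qed

text \<open>A vector in the kernel would have zero product with itself. The left inverse later
  allows \<open>K ** H\<close> to be prescribed arbitrarily over the complex numbers.\<close>

lemma gram_invertible:
  assumes U: "(U, \<Phi>) \<in> T" "x \<in> U" obtains H' where "H' ** gram \<Phi> x = mat 1"
proof -
  note inv = triv_inv[OF U]
  have b: "basis_vec \<Phi> x j \<in> E x" for j unfolding basis_vec_def by (rule inv(1))
  have "v = 0" if v: "gram \<Phi> x *v v = 0" for v
  proof (rule ccontr)
    assume v0: "v \<noteq> 0"
    define e where "e = inv_into (E x) (\<Phi> x) v"
    have e: "e \<in> E x" "\<Phi> x e = v" using inv by (auto simp: e_def)
    have "e \<noteq> fib_zero x" using e(2) v0 fib_ops(2)[OF U] by auto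
    from herm_pos[OF e(1) this] have pos: "Re (h x e e) > 0" .
    have "h x e (basis_vec \<Phi> x k) = 0" for k using herm_gram[OF U e(1), of k] e(2) v by simp
    then have "h x (basis_vec \<Phi> x k) e = 0" for k using herm_sym[OF e(1) b] by simp
    then have "h x e e = 0" using herm_expand[OF U e(1), of v] by (simp flip: e_def)
    with pos show False by simp
  qed
  then show ?thesis using that matrix_left_invertible_ker[of "gram \<Phi> x"] by blast
qed

text \<open>Adds the one-form paired with \<open>\<eta>\<close> times the skew endomorphism given by
  \<open>\<kappa>\<close>. In the applications \<open>\<kappa>\<close> is supported in
  \<open>U \<inter> fst c\<close>, so leaving \<open>D\<close> unchanged elsewhere is consistent;
  the value \<open>undefined\<close> follows the convention of
  \<open>unitary_connections\<close>.\<close>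

definition perturb ::
    "('m, 'e) chart \<Rightarrow> 'm set \<Rightarrow> ('m \<Rightarrow> 'v \<Rightarrow> complex ^ 'r) \<Rightarrow> 'e \<Rightarrow> ('m \<Rightarrow> complex ^ 'r ^ 'r)
      \<Rightarrow> (('m \<Rightarrow> 'v) \<Rightarrow> 'm \<Rightarrow> ('m, 'e) tvec \<Rightarrow> 'v) \<Rightarrow> ('m \<Rightarrow> 'v) \<Rightarrow> 'm \<Rightarrow> ('m, 'e) tvec \<Rightarrow> 'v" where
  "perturb c U \<Phi> \<eta> \<kappa> D = (\<lambda>s x w. if s \<in> smooth_sections \<and> w \<in> tangent_space A x then
     (if x \<in> U \<inter> fst c then fib_add x (D s x w)
        (fib_scale x (of_real (w c \<bullet> \<eta>)) (inv_into (E x) (\<Phi> x) ((\<kappa> x ** gram \<Phi> x) *v \<Phi> x (s x))))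
      else D s x w) else undefined)"

text \<open>The matrix of the added endomorphism in a second trivialisation, conjugated by the
  transition functions in both directions.\<close>

definition perturb_matrix ::
    "('m, 'e) chart \<Rightarrow> 'm set \<Rightarrow> ('m \<Rightarrow> 'v \<Rightarrow> complex ^ 'r) \<Rightarrow> ('m \<Rightarrow> complex ^ 'r ^ 'r)
      \<Rightarrow> ('m \<Rightarrow> complex ^ 'r ^ 'r) \<Rightarrow> ('m \<Rightarrow> complex ^ 'r ^ 'r) \<Rightarrow> 'm \<Rightarrow> complex ^ 'r ^ 'r" where
  "perturb_matrix c U \<Phi> \<kappa> G G' x = (if x \<in> U \<inter> fst c then G x ** ((\<kappa> x ** gram \<Phi> x) ** G' x) else 0)"

text \<open>Keeps the transition functions in both directions with their smoothness, so that no
  matrix has to be inverted smoothly.\<close>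

definition transition_pair :: "'m set \<Rightarrow> ('m \<Rightarrow> 'v \<Rightarrow> complex ^ 'r) \<Rightarrow> 'm set \<Rightarrow> ('m \<Rightarrow> 'v \<Rightarrow> complex ^ 'r)
    \<Rightarrow> ('m \<Rightarrow> complex ^ 'r ^ 'r) \<Rightarrow> ('m \<Rightarrow> complex ^ 'r ^ 'r) \<Rightarrow> bool" where
  "transition_pair U \<Phi> V \<Psi> G G' \<longleftrightarrow> smooth_fun (U \<inter> V) G \<and> smooth_fun (U \<inter> V) G' \<and>
    (\<forall>x\<in>U \<inter> V. \<forall>e\<in>E x. \<Psi> x e = G x *v \<Phi> x e \<and> \<Phi> x e = G' x *v \<Psi> x e)"

lemma transition_pair_exists:
  assumes "(U, \<Phi>) \<in> T" "(V, \<Psi>) \<in> T" obtains G G' where "transition_pair U \<Phi> V \<Psi> G G'"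
proof -
  obtain G where "smooth_fun (U \<inter> V) G" "\<forall>x\<in>U \<inter> V. \<forall>e\<in>E x. \<Psi> x e = G x *v \<Phi> x e"
    using triv_transition[OF assms] by blast
  moreover obtain G' where "smooth_fun (V \<inter> U) G'" "\<forall>x\<in>V \<inter> U. \<forall>e\<in>E x. \<Phi> x e = G' x *v \<Psi> x e"
    using triv_transition[OF assms(2,1)] by blast
  ultimately show ?thesis using that[of G G'] by (simp add: transition_pair_def Int_commute)
qed

lemma perturb_triv:
  assumes D: "D \<in> unitary_connections k" and U: "(U, \<Phi>) \<in> T" and V: "(V, \<Psi>) \<in> T" "x \<in> V"
    and G: "transition_pair U \<Phi> V \<Psi> G G'" and s: "s \<in> smooth_sections" and w: "w \<in> tangent_space A x"
  shows "perturb c U \<Phi> \<eta> \<kappa> D s x w \<in> E x"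
    "\<Psi> x (perturb c U \<Phi> \<eta> \<kappa> D s x w) = \<Psi> x (D s x w)
      + (w c \<bullet> \<eta>) *\<^sub>R (perturb_matrix c U \<Phi> \<kappa> G G' x *v \<Psi> x (s x))"
proof -
  note DE = unitary_connectionsD(2)[OF D s w] and sE = smooth_sectionsD(1)[OF s, of x]
  show "perturb c U \<Phi> \<eta> \<kappa> D s x w \<in> E x"
    using s w DE triv_inv(1)[OF U, of x] by (auto simp: perturb_def intro!: fib_mem)
  show "\<Psi> x (perturb c U \<Phi> \<eta> \<kappa> D s x w) = \<Psi> x (D s x w)
      + (w c \<bullet> \<eta>) *\<^sub>R (perturb_matrix c U \<Phi> \<kappa> G G' x *v \<Psi> x (s x))"
  proof (cases "x \<in> U \<inter> fst c")
    case True
    let ?N = "\<kappa> x ** gram \<Phi> x"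
    let ?i = "inv_into (E x) (\<Phi> x) (?N *v \<Phi> x (s x))"
    have xU: "x \<in> U" using True by blast
    note inv = triv_inv[OF U xU]
    have GG: "\<Psi> x e = G x *v \<Phi> x e" "\<Phi> x e = G' x *v \<Psi> x e" if "e \<in> E x" for e
      using G V(2) xU that unfolding transition_pair_def by blast+
    have "\<Psi> x ?i = G x *v (?N *v (G' x *v \<Psi> x (s x)))"
      using GG(1)[OF inv(1)] inv(2) GG(2)[OF sE] by simp
    then have "\<Psi> x ?i = perturb_matrix c U \<Phi> \<kappa> G G' x *v \<Psi> x (s x)"
      using True by (simp add: perturb_matrix_def matrix_vector_mul_assoc matrix_mul_assoc)
    then show ?thesis
      using True s w by (simp add: perturb_def fib_ops[OF V] DE inv(1) scaleR_eq_smult)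
  next
    case False
    then show ?thesis using s w by (auto simp: perturb_def perturb_matrix_def)
  qed
qed

text \<open>Over \<open>U \<inter> fst c\<close> all factors are smooth; off the closed support
  \<open>K\<close> the expression vanishes. These two open sets cover every point.\<close>

lemma perturb_matrix_smooth:
  assumes U: "(U, \<Phi>) \<in> T" and V: "(V, \<Psi>) \<in> T" and c: "c \<in> A" and d: "d \<in> A"
    and G: "transition_pair U \<Phi> V \<Psi> G G'"
    and \<kappa>: "smooth_fun (U \<inter> fst c) \<kappa>" and K: "closed K" "K \<subseteq> U \<inter> fst c" "\<And>x. x \<notin> K \<Longrightarrow> \<kappa> x = 0"
  shows "smooth_on (\<lambda>p. (vec_of A d (chart_inv d p) \<xi> c \<bullet> \<eta>) *\<^sub>R perturb_matrix c U \<Phi> \<kappa> G G' (chart_inv d p))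
    (snd d ` (fst d \<inter> V))" (is "smooth_on ?f ?S")
proof (rule smooth_on_local[OF _ open_chart_triv[OF d V]])
  fix p assume "p \<in> ?S"
  then obtain x where x: "x \<in> fst d" "x \<in> V" "p = snd d x" by blast
  have oU: "open (U \<inter> fst c \<inter> V)" using triv_open[OF U] triv_open[OF V] chart_open[OF c] by blast
  show "\<exists>W. open W \<and> p \<in> W \<and> smooth_on ?f (W \<inter> ?S)"
  proof (cases "x \<in> U \<inter> fst c")
    case True
    let ?W = "snd d ` (U \<inter> fst c \<inter> V \<inter> fst d)"
    have oW: "open ?W" by (rule open_chart_image[OF d oU])
    have "smooth_fun (U \<inter> fst c \<inter> V) (\<lambda>x. G x ** ((\<kappa> x ** gram \<Phi> x) ** G' x))"
      by (intro smooth_fun_bilinear[OF bounded_bilinear_mm oU] smooth_fun_subset[OF \<kappa>]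
          smooth_fun_subset[OF gram_smooth[OF U]])
        (use G in \<open>auto simp: transition_pair_def elim: smooth_fun_subset\<close>)
    from smooth_funD[OF this d]
    have 1: "smooth_on (\<lambda>p. G (chart_inv d p) ** ((\<kappa> (chart_inv d p) ** gram \<Phi> (chart_inv d p)) ** G' (chart_inv d p))) ?W"
      by (simp add: comp_def)
    have "smooth_on (\<lambda>p. dtrans d c p \<xi>) ?W"
      unfolding dtrans_def by (rule smooth_on_subset[OF smooth_on_deriv[OF transition[OF d c]]]) blast
    from smooth_on_linear_compose[OF bounded_linear_inner_left oW this]
    have "smooth_on (\<lambda>p. (dtrans d c p \<xi> \<bullet> \<eta>) *\<^sub>R
        (G (chart_inv d p) ** ((\<kappa> (chart_inv d p) ** gram \<Phi> (chart_inv d p)) ** G' (chart_inv d p)))) ?W"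
      by (rule smooth_on_bilinear[OF bounded_bilinear_scaleR oW _ 1])
    then have "smooth_on ?f ?W"
      by (rule smooth_on_cong[OF oW, rotated])
        (use c in \<open>auto simp: perturb_matrix_def vec_of_eq chart_inv_left[OF d]\<close>)
    then show ?thesis
      by (intro exI[of _ ?W] conjI oW smooth_on_subset[OF _ Int_lower1]) (use x True in auto)
  next
    case False
    let ?W = "snd d ` (- K \<inter> fst d)"
    have oW: "open ?W" by (rule open_chart_image[OF d]) (use K in auto)
    have "smooth_on ?f ?W"
      by (rule smooth_on_cong[OF oW _ smooth_on_const[of 0]])
        (auto simp: perturb_matrix_def chart_inv_left[OF d] K(3))
    then show ?thesis
      by (intro exI[of _ ?W] conjI oW smooth_on_subset[OF _ Int_lower1]) (use x False K(2) in auto)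
  qed
qed

text \<open>The added term is linear over functions in the section and linear in the vector, so
  additivity and the Leibniz rule carry over. Compatibility with the metric is where skewness
  enters: the two extra terms cancel by \<open>gram_skew\<close>.\<close>

lemma perturb_connection:
  assumes D: "D \<in> unitary_connections k" and U: "(U, \<Phi>) \<in> T" and c: "c \<in> A"
    and \<kappa>: "smooth_fun (U \<inter> fst c) \<kappa>" and K: "closed K" "K \<subseteq> U \<inter> fst c" "\<And>x. x \<notin> K \<Longrightarrow> \<kappa> x = 0"
    and skew: "\<And>x. skew_hermitian (\<kappa> x)"
  shows "perturb c U \<Phi> \<eta> \<kappa> D \<in> unitary_connections k"
proof -
  let ?D = "perturb c U \<Phi> \<eta> \<kappa> D"
  note DD = unitary_connectionsD[OF D]
  have ex: "\<exists>V \<Psi> G G'. (V, \<Psi>) \<in> T \<and> x \<in> V \<and> transition_pair U \<Phi> V \<Psi> G G'" for x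
    by (rule triv_exists[of x], rule transition_pair_exists[OF U]) blast+
  have PE: "?D s x w \<in> E x" if "s \<in> smooth_sections" "w \<in> tangent_space A x" for s x w
    using ex[of x] perturb_triv(1)[OF D U _ _ _ that] by blast
  have wlin: "?D s x (\<lambda>c. a *\<^sub>R w c + w' c) = fib_add x (fib_scale x (of_real a) (?D s x w)) (?D s x w')"
    if s: "s \<in> smooth_sections" and w: "w \<in> tangent_space A x" "w' \<in> tangent_space A x" for s x w w' a
  proof -
    obtain V \<Psi> G G' where V: "(V, \<Psi>) \<in> T" "x \<in> V" and G: "transition_pair U \<Phi> V \<Psi> G G'" using ex[of x] by blast
    note P = perturb_triv(2)[OF D U V G s]
    show ?thesis
    proof (rule triv_eqI[OF V])
      show "\<Psi> x (?D s x (\<lambda>c. a *\<^sub>R w c + w' c)) = \<Psi> x (fib_add x (fib_scale x (of_real a) (?D s x w)) (?D s x w'))"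
        unfolding P[OF tangent_space_lincomb[OF w]] DD(3)[OF s w]
        by (simp add: fib_ops[OF V] fib_mem PE[OF s] w DD(2)[OF s] P inner_add_left
            scaleR_add_left scaleR_add_right flip: scaleR_eq_smult)
    qed (auto intro!: fib_mem PE s w tangent_space_lincomb)
  qed
  have sadd: "?D (\<lambda>y. fib_add y (s y) (s' y)) x w = fib_add x (?D s x w) (?D s' x w)"
    if s: "s \<in> smooth_sections" "s' \<in> smooth_sections" and w: "w \<in> tangent_space A x" for s s' x w
  proof -
    obtain V \<Psi> G G' where V: "(V, \<Psi>) \<in> T" "x \<in> V" and G: "transition_pair U \<Phi> V \<Psi> G G'" using ex[of x] by blast
    note P = perturb_triv(2)[OF D U V G _ w]
    have ss: "(\<lambda>y. fib_add y (s y) (s' y)) \<in> smooth_sections" by (rule smooth_sections_add[OF s])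
    show ?thesis
    proof (rule triv_eqI[OF V])
      show "\<Psi> x (?D (\<lambda>y. fib_add y (s y) (s' y)) x w) = \<Psi> x (fib_add x (?D s x w) (?D s' x w))"
        unfolding P[OF ss] DD(4)[OF s w]
        by (simp add: fib_ops[OF V] PE[OF _ w] s DD(2)[OF _ w] P smooth_sectionsD(1) matrix_vector_right_distrib scaleR_add_right)
    qed (auto intro!: fib_mem PE s w ss)
  qed
  have leibniz: "?D (\<lambda>y. fib_scale y (f y) (s y)) x w =
      fib_add x (fib_scale x (deriv_along A f x w) (s x)) (fib_scale x (f x) (?D s x w))"
    if s: "s \<in> smooth_sections" and f: "smooth_fun UNIV f" and w: "w \<in> tangent_space A x" for s f x w
  proof -
    obtain V \<Psi> G G' where V: "(V, \<Psi>) \<in> T" "x \<in> V" and G: "transition_pair U \<Phi> V \<Psi> G G'" using ex[of x] by blast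
    note P = perturb_triv(2)[OF D U V G _ w]
    have ss: "(\<lambda>y. fib_scale y (f y) (s y)) \<in> smooth_sections" by (rule smooth_sections_scale[OF s f])
    show ?thesis
    proof (rule triv_eqI[OF V])
      show "\<Psi> x (?D (\<lambda>y. fib_scale y (f y) (s y)) x w) =
        \<Psi> x (fib_add x (fib_scale x (deriv_along A f x w) (s x)) (fib_scale x (f x) (?D s x w)))"
        unfolding P[OF ss] DD(5)[OF s f w]
        by (simp add: fib_ops[OF V] fib_mem PE[OF s w] DD(2)[OF s w] P[OF s] smooth_sectionsD(1)[OF s]
            vector_scalar_commute vector_add_ldistrib scaleR_eq_smult vector_smult_assoc mult.commute)
    qed (auto intro!: fib_mem PE s w ss smooth_sectionsD(1)[OF s])
  qed
  have metric: "deriv_along A (\<lambda>y. h y (s y) (s' y)) x w = h x (?D s x w) (s' x) + h x (s x) (?D s' x w)"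
    if s: "s \<in> smooth_sections" "s' \<in> smooth_sections" and w: "w \<in> tangent_space A x" for s s' x w
  proof -
    note sE = smooth_sectionsD(1)[OF s(1), of x] smooth_sectionsD(1)[OF s(2), of x]
    have "h x (?D s x w) (s' x) + h x (s x) (?D s' x w) = h x (D s x w) (s' x) + h x (s x) (D s' x w)"
    proof (cases "x \<in> U \<inter> fst c")
      case True
      then have xU: "x \<in> U" by blast
      let ?i = "\<lambda>s. inv_into (E x) (\<Phi> x) ((\<kappa> x ** gram \<Phi> x) *v \<Phi> x (s x))"
      note i = triv_inv(1)[OF U xU] and sk = gram_skew[OF U xU skew sE]
      have hs2: "h x (s x) (fib_scale x (of_real a) (?i s')) = of_real a * h x (s x) (?i s')" for a
        using herm_sym[OF fib_mem(3)[OF i] sE(1)] herm_sym[OF i sE(1)] herm_scale[OF i sE(1)] by simp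
      have "h x (?D s x w) (s' x) + h x (s x) (?D s' x w) = h x (D s x w) (s' x) + h x (s x) (D s' x w)
          + of_real (w c \<bullet> \<eta>) * (h x (?i s) (s' x) + h x (s x) (?i s'))"
        using True s w
        by (simp add: perturb_def herm_add herm_add2 herm_scale hs2 sE i fib_mem DD(2) distrib_left)
      then show ?thesis unfolding sk by simp
    next
      case False
      then show ?thesis using s w by (auto simp: perturb_def)
    qed
    then show ?thesis using DD(6)[OF s w] by simp
  qed
  have Ck: "Ck_on k (\<lambda>p. \<Psi> (chart_inv d p) (?D s (chart_inv d p) (vec_of A d (chart_inv d p) \<xi>))) (snd d ` (fst d \<inter> V))"
    if s: "s \<in> smooth_sections" and d: "d \<in> A" and V: "(V, \<Psi>) \<in> T" for s d V \<Psi> \<xi>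
  proof -
    obtain G G' where G: "transition_pair U \<Phi> V \<Psi> G G'" by (rule transition_pair_exists[OF U V])
    note o = open_chart_triv[OF d V]
    have s\<Psi>: "smooth_on (\<lambda>p. \<Psi> (chart_inv d p) (s (chart_inv d p))) (snd d ` (fst d \<inter> V))"
      using smooth_funD[OF smooth_sectionsD(2)[OF s V] d] by (simp add: comp_def Int_commute)
    have "Ck_on k (\<lambda>p. \<Psi> (chart_inv d p) (D s (chart_inv d p) (vec_of A d (chart_inv d p) \<xi>))
      + ((vec_of A d (chart_inv d p) \<xi> c \<bullet> \<eta>) *\<^sub>R perturb_matrix c U \<Phi> \<kappa> G G' (chart_inv d p))
        *v \<Psi> (chart_inv d p) (s (chart_inv d p))) (snd d ` (fst d \<inter> V))"
      by (intro Ck_on_add[OF o DD(7)[OF s d V]] smooth_on_imp_Ck smooth_on_bilinear[OF bounded_bilinear_mv o] s\<Psi>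
          perturb_matrix_smooth[OF U V c d G \<kappa> K])
    then show ?thesis
    proof (rule Ck_on_cong[OF o, rotated])
      fix p assume p: "p \<in> snd d ` (fst d \<inter> V)"
      have x: "chart_inv d p \<in> V" "chart_inv d p \<in> fst d"
        using chart_image_cases[OF d, of p V] p by (auto simp: Int_commute)
      show "\<Psi> (chart_inv d p) (D s (chart_inv d p) (vec_of A d (chart_inv d p) \<xi>))
        + ((vec_of A d (chart_inv d p) \<xi> c \<bullet> \<eta>) *\<^sub>R perturb_matrix c U \<Phi> \<kappa> G G' (chart_inv d p))
          *v \<Psi> (chart_inv d p) (s (chart_inv d p))
        = \<Psi> (chart_inv d p) (?D s (chart_inv d p) (vec_of A d (chart_inv d p) \<xi>))"
        unfolding perturb_triv(2)[OF D U V x(1) G s vec_of_in[OF d x(2)]]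
        by (simp only: bounded_bilinear.scaleR_left[OF bounded_bilinear_mv])
    qed
  qed
  have und: "?D s x w = undefined" if "\<not> (s \<in> smooth_sections \<and> w \<in> tangent_space A x)" for s x w
    by (simp only: perturb_def that if_False)
  show ?thesis
    unfolding unitary_connections_def mem_Collect_eq
    by (intro conjI allI ballI impI und PE wlin sadd leibniz metric) (auto intro!: Ck)
qed

lemma perturb_form:
  assumes D: "D \<in> unitary_connections k" and D': "perturb c U \<Phi> \<eta> \<kappa> D \<in> unitary_connections k'"
    and U: "(U, \<Phi>) \<in> T" and V: "(V, \<Psi>) \<in> T" "x \<in> V"
    and G: "transition_pair U \<Phi> V \<Psi> G G'" and w: "w \<in> tangent_space A x"
  shows "connection_form (perturb c U \<Phi> \<eta> \<kappa> D) \<Psi> x w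
    = connection_form D \<Psi> x w + (w c \<bullet> \<eta>) *\<^sub>R perturb_matrix c U \<Phi> \<kappa> G G' x"
proof (rule connection_form_unique[OF D' V w])
  fix s assume s: "s \<in> smooth_sections"
  show "\<Psi> x (perturb c U \<Phi> \<eta> \<kappa> D s x w) = deriv_along A (\<lambda>y. \<Psi> y (s y)) x w
    + (connection_form D \<Psi> x w + (w c \<bullet> \<eta>) *\<^sub>R perturb_matrix c U \<Phi> \<kappa> G G' x) *v \<Psi> x (s x)"
    unfolding perturb_triv(2)[OF D U V G s w] connection_form_eq[OF D V w s]
    by (simp add: bounded_bilinear.add_left[OF bounded_bilinear_mv] bounded_bilinear.scaleR_left[OF bounded_bilinear_mv])
qed

lemma perturb_form_coord:
  assumes D: "D \<in> unitary_connections k" and D': "perturb c U \<Phi> \<eta> \<kappa> D \<in> unitary_connections k'"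
    and U: "(U, \<Phi>) \<in> T" and V: "(V, \<Psi>) \<in> T" and d: "d \<in> A" and p: "p \<in> snd d ` (fst d \<inter> V)"
    and G: "transition_pair U \<Phi> V \<Psi> G G'"
  shows "connection_form_coord (perturb c U \<Phi> \<eta> \<kappa> D) d \<Psi> \<xi> p = connection_form_coord D d \<Psi> \<xi> p
    + (vec_of A d (chart_inv d p) \<xi> c \<bullet> \<eta>) *\<^sub>R perturb_matrix c U \<Phi> \<kappa> G G' (chart_inv d p)"
proof -
  have x: "chart_inv d p \<in> V" "chart_inv d p \<in> fst d"
    using chart_image_cases[OF d, of p V] p by (auto simp: Int_commute)
  show ?thesis unfolding connection_form_coord_def
    by (rule perturb_form[OF D D' U V x(1) G vec_of_in[OF d x(2)]])
qed

lemma bounded_on_chart_compact: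
  fixes f :: "'e \<Rightarrow> 'b::real_normed_vector"
  assumes d: "d \<in> A" and V: "(V, \<Psi>) \<in> T" and K: "compact K" "K \<subseteq> fst d \<inter> V"
    and f: "continuous_on (snd d ` (fst d \<inter> V)) f"
  shows "compact (f ` snd d ` K)"
proof -
  have "compact (snd d ` K)"
    by (rule compact_continuous_image[OF continuous_on_subset[OF chart_continuous[OF d]] K(1)]) (use K in blast)
  then show ?thesis by (rule compact_continuous_image[OF continuous_on_subset[OF f], rotated]) (use K in blast)
qed

text \<open>\<open>D\<close> need not be the centre \<open>D1\<close> of the ball. Compactness of
  \<open>K\<close> leaves a positive margin in each of the finitely many strict inequalities, and
  the derivatives of the perturbation are linear in \<open>t\<close> and \<open>s\<close>, so small
  parameters do not use it up.\<close>

lemma perturb_in_ball: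
  assumes D: "D \<in> Ck_ball k D1 d \<Psi> K \<epsilon>" and D1: "D1 \<in> unitary_connections k" and d: "d \<in> A"
    and V: "(V, \<Psi>) \<in> T" and K: "compact K" "K \<subseteq> fst d \<inter> V" and \<epsilon>: "\<epsilon> > 0"
    and U: "(U, \<Phi>) \<in> T" and c: "c \<in> A" and Z: "closed Z" "Z \<subseteq> U \<inter> fst c"
    and \<kappa>: "smooth_fun (U \<inter> fst c) \<kappa>1" "\<And>x. x \<notin> Z \<Longrightarrow> \<kappa>1 x = 0" "\<And>x. skew_hermitian (\<kappa>1 x)"
      "smooth_fun (U \<inter> fst c) \<kappa>2" "\<And>x. x \<notin> Z \<Longrightarrow> \<kappa>2 x = 0" "\<And>x. skew_hermitian (\<kappa>2 x)"
  shows "\<exists>\<delta>>0. \<forall>t s. 0 < t \<longrightarrow> t < \<delta> \<longrightarrow> 0 < s \<longrightarrow> s < \<delta> \<longrightarrow>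
    perturb c U \<Phi> \<eta> (\<lambda>x. t *\<^sub>R \<kappa>1 x + s *\<^sub>R \<kappa>2 x) D \<in> Ck_ball k D1 d \<Psi> K \<epsilon>"
proof -
  let ?S = "snd d ` (fst d \<inter> V)"
  note o = open_chart_triv[OF d V]
  have Du: "D \<in> unitary_connections k" using D by (simp add: Ck_ball_def)
  obtain G G' where G: "transition_pair U \<Phi> V \<Psi> G G'" by (rule transition_pair_exists[OF U V])
  have oUc: "open (U \<inter> fst c)" using triv_open[OF U] chart_open[OF c] by blast
  define \<kappa> where "\<kappa> t s = (\<lambda>x. t *\<^sub>R \<kappa>1 x + s *\<^sub>R \<kappa>2 x)" for t s
  have Du': "perturb c U \<Phi> \<eta> (\<kappa> t s) D \<in> unitary_connections k" for t s
    unfolding \<kappa>_def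
    by (rule perturb_connection[OF Du U c _ Z])
      (simp_all add: \<kappa> skew_hermitian_lincomb smooth_fun_add[OF oUc] smooth_fun_linear[OF bounded_linear_scaleR_right oUc])
  define \<beta> where "\<beta> \<kappa> \<xi> p = (vec_of A d (chart_inv d p) \<xi> c \<bullet> \<eta>) *\<^sub>R perturb_matrix c U \<Phi> \<kappa> G G' (chart_inv d p)" for \<kappa> \<xi> p
  have \<beta>s: "smooth_on (\<beta> \<kappa>1 \<xi>) ?S" "smooth_on (\<beta> \<kappa>2 \<xi>) ?S" for \<xi>
    unfolding \<beta>_def
    by (rule perturb_matrix_smooth[OF U V c d G \<kappa>(1) Z \<kappa>(2)], assumption)
      (rule perturb_matrix_smooth[OF U V c d G \<kappa>(4) Z \<kappa>(5)], assumption)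
  have \<beta>lin: "\<beta> (\<kappa> t s) \<xi> p = t *\<^sub>R \<beta> \<kappa>1 \<xi> p + s *\<^sub>R \<beta> \<kappa>2 \<xi> p" for t s \<xi> p
    by (simp add: \<beta>_def perturb_matrix_def \<kappa>_def bounded_bilinear.add_left[OF bounded_bilinear_mm]
        bounded_bilinear.scaleR_left[OF bounded_bilinear_mm] bounded_bilinear.add_right[OF bounded_bilinear_mm]
        bounded_bilinear.scaleR_right[OF bounded_bilinear_mm] scaleR_add_right mult.commute)
  define \<omega>0 where "\<omega>0 \<xi> q = connection_form_coord D d \<Psi> \<xi> q - connection_form_coord D1 d \<Psi> \<xi> q" for \<xi> q
  have \<omega>0: "Ck_on k (\<omega>0 \<xi>) ?S" for \<xi>
    unfolding \<omega>0_def
    by (rule Ck_on_diff[OF o connection_form_coord_Ck[OF Du V d] connection_form_coord_Ck[OF D1 V d]])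
  \<comment> \<open>The finitely many pairs of a form component and a multi-derivative that occur in
    \<open>Ck_ball\<close>.\<close>
  define I where "I = (Basis :: 'e set) \<times> {vs. set vs \<subseteq> (Basis :: 'e set) \<and> length vs \<le> k}"
  have fI: "finite I" unfolding I_def by (intro finite_cartesian_product finite_lists_length_le) auto
  have it: "iter_deriv vs (\<lambda>q. connection_form_coord (perturb c U \<Phi> \<eta> (\<kappa> t s) D) d \<Psi> \<xi> q
      - connection_form_coord D1 d \<Psi> \<xi> q) p
    = iter_deriv vs (\<omega>0 \<xi>) p + (t *\<^sub>R iter_deriv vs (\<beta> \<kappa>1 \<xi>) p + s *\<^sub>R iter_deriv vs (\<beta> \<kappa>2 \<xi>) p)"
    if p: "p \<in> ?S" and vs: "length vs \<le> k" for p vs \<xi> t s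
  proof -
    have C: "Ck_on k (\<beta> \<kappa>1 \<xi>) ?S" "Ck_on k (\<beta> \<kappa>2 \<xi>) ?S" using \<beta>s smooth_on_imp_Ck by blast+
    have C': "Ck_on k (\<lambda>q. t *\<^sub>R \<beta> \<kappa>1 \<xi> q) ?S" "Ck_on k (\<lambda>q. s *\<^sub>R \<beta> \<kappa>2 \<xi> q) ?S"
      by (rule Ck_on_linear_compose[OF bounded_linear_scaleR_right o C(1)],
          rule Ck_on_linear_compose[OF bounded_linear_scaleR_right o C(2)])
    have "iter_deriv vs (\<lambda>q. connection_form_coord (perturb c U \<Phi> \<eta> (\<kappa> t s) D) d \<Psi> \<xi> q
        - connection_form_coord D1 d \<Psi> \<xi> q) p
      = iter_deriv vs (\<lambda>q. \<omega>0 \<xi> q + (t *\<^sub>R \<beta> \<kappa>1 \<xi> q + s *\<^sub>R \<beta> \<kappa>2 \<xi> q)) p"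
    proof (rule iter_deriv_cong[OF o _ p])
      fix q assume q: "q \<in> ?S"
      show "connection_form_coord (perturb c U \<Phi> \<eta> (\<kappa> t s) D) d \<Psi> \<xi> q - connection_form_coord D1 d \<Psi> \<xi> q
        = \<omega>0 \<xi> q + (t *\<^sub>R \<beta> \<kappa>1 \<xi> q + s *\<^sub>R \<beta> \<kappa>2 \<xi> q)"
        unfolding perturb_form_coord[OF Du Du' U V d q G] \<beta>lin[symmetric] by (simp add: \<omega>0_def \<beta>_def)
    qed
    also have "\<dots> = iter_deriv vs (\<omega>0 \<xi>) p + (t *\<^sub>R iter_deriv vs (\<beta> \<kappa>1 \<xi>) p + s *\<^sub>R iter_deriv vs (\<beta> \<kappa>2 \<xi>) p)"
      unfolding iter_deriv_add[OF o p \<omega>0 Ck_on_add[OF o C'] vs] iter_deriv_add[OF o p C' vs]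
        iter_deriv_scaleR[OF o p C(1) vs] iter_deriv_scaleR[OF o p C(2) vs] ..
    finally show ?thesis .
  qed
  have "\<exists>\<delta>>0. \<forall>t s. 0 < t \<longrightarrow> t < \<delta> \<longrightarrow> 0 < s \<longrightarrow> s < \<delta> \<longrightarrow> (\<forall>p\<in>snd d ` K.
      norm (iter_deriv vs (\<omega>0 \<xi>) p + (t *\<^sub>R iter_deriv vs (\<beta> \<kappa>1 \<xi>) p + s *\<^sub>R iter_deriv vs (\<beta> \<kappa>2 \<xi>) p)) < \<epsilon>)"
    if "(\<xi>, vs) \<in> I" for \<xi> vs
  proof (cases "K = {}")
    case True
    then show ?thesis by (intro exI[of _ 1]) simp
  next
    case False
    have vs: "length vs \<le> k" "set vs \<subseteq> Basis" "\<xi> \<in> Basis" using that by (auto simp: I_def)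
    have c0: "continuous_on ?S (\<lambda>p. norm (iter_deriv vs (\<omega>0 \<xi>) p))"
      by (intro continuous_on_norm iter_deriv_continuous[OF \<omega>0 vs(1)])
    have cb: "continuous_on ?S (\<lambda>p. norm (iter_deriv vs (\<beta> \<kappa>' \<xi>) p))" if "smooth_on (\<beta> \<kappa>' \<xi>) ?S" for \<kappa>'
      by (intro continuous_on_norm iter_deriv_continuous[OF smooth_on_imp_Ck[OF that] vs(1)])
    let ?N = "\<lambda>f. (\<lambda>p. norm (iter_deriv vs f p)) ` snd d ` K"
    have "?N (\<omega>0 \<xi>) \<noteq> {}" using False by blast
    then obtain m where m: "m \<in> ?N (\<omega>0 \<xi>)" "\<And>y. y \<in> ?N (\<omega>0 \<xi>) \<Longrightarrow> y \<le> m"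
      using compact_attains_sup[OF bounded_on_chart_compact[OF d V K c0]] by blast
    have m\<epsilon>: "m < \<epsilon>" using m(1) D vs unfolding Ck_ball_def \<omega>0_def by auto
    obtain B1 where B1: "\<And>y. y \<in> ?N (\<beta> \<kappa>1 \<xi>) \<Longrightarrow> norm y \<le> B1"
      using compact_imp_bounded[OF bounded_on_chart_compact[OF d V K cb[OF \<beta>s(1)]]] unfolding bounded_iff by blast
    obtain B2 where B2: "\<And>y. y \<in> ?N (\<beta> \<kappa>2 \<xi>) \<Longrightarrow> norm y \<le> B2"
      using compact_imp_bounded[OF bounded_on_chart_compact[OF d V K cb[OF \<beta>s(2)]]] unfolding bounded_iff by blast
    define B where "B = \<bar>B1\<bar> + \<bar>B2\<bar> + 1"
    \<comment> \<open>The margin \<open>\<epsilon> - m\<close> divided by a strict upper bound for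
      the combined size of the two perturbation terms.\<close>
    define \<delta> where "\<delta> = (\<epsilon> - m) / B"
    have B: "B > 0" by (simp add: B_def)
    have \<delta>: "\<delta> > 0" using B m\<epsilon> by (simp add: \<delta>_def)
    have "norm (iter_deriv vs (\<omega>0 \<xi>) p + (t *\<^sub>R iter_deriv vs (\<beta> \<kappa>1 \<xi>) p + s *\<^sub>R iter_deriv vs (\<beta> \<kappa>2 \<xi>) p)) < \<epsilon>"
      if ts: "0 < t" "t < \<delta>" "0 < s" "s < \<delta>" and p: "p \<in> snd d ` K" for t s p
    proof -
      have n0: "norm (iter_deriv vs (\<omega>0 \<xi>) p) \<le> m" using m(2) p by blast
      have n1: "norm (iter_deriv vs (\<beta> \<kappa>1 \<xi>) p) \<le> \<bar>B1\<bar>" using B1[OF imageI[OF p]] by simp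
      have n2: "norm (iter_deriv vs (\<beta> \<kappa>2 \<xi>) p) \<le> \<bar>B2\<bar>" using B2[OF imageI[OF p]] by simp
      have "norm (iter_deriv vs (\<omega>0 \<xi>) p + (t *\<^sub>R iter_deriv vs (\<beta> \<kappa>1 \<xi>) p + s *\<^sub>R iter_deriv vs (\<beta> \<kappa>2 \<xi>) p))
          \<le> norm (iter_deriv vs (\<omega>0 \<xi>) p) + (t * norm (iter_deriv vs (\<beta> \<kappa>1 \<xi>) p) + s * norm (iter_deriv vs (\<beta> \<kappa>2 \<xi>) p))"
        using ts by (intro norm_triangle_le add_mono order_refl) auto
      also have "\<dots> \<le> m + (\<delta> * \<bar>B1\<bar> + \<delta> * \<bar>B2\<bar>)"
        using ts by (intro add_mono n0 mult_mono n1 n2) auto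
      also have "\<dots> < m + \<delta> * B" using \<delta> by (simp add: B_def algebra_simps)
      also have "\<dots> = \<epsilon>" using B by (simp add: \<delta>_def)
      finally show ?thesis .
    qed
    then show ?thesis using \<delta> by blast
  qed
  then have "\<forall>i\<in>I. \<exists>\<delta>>0. \<forall>t s. 0 < t \<longrightarrow> t < \<delta> \<longrightarrow> 0 < s \<longrightarrow> s < \<delta> \<longrightarrow> (\<forall>p\<in>snd d ` K.
      norm (iter_deriv (snd i) (\<omega>0 (fst i)) p + (t *\<^sub>R iter_deriv (snd i) (\<beta> \<kappa>1 (fst i)) p
        + s *\<^sub>R iter_deriv (snd i) (\<beta> \<kappa>2 (fst i)) p)) < \<epsilon>)" by simp
  from bchoice[OF this] obtain \<delta> where \<delta>0: "\<forall>i\<in>I. \<delta> i > 0 \<and>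
      (\<forall>t s. 0 < t \<longrightarrow> t < \<delta> i \<longrightarrow> 0 < s \<longrightarrow> s < \<delta> i \<longrightarrow> (\<forall>p\<in>snd d ` K.
      norm (iter_deriv (snd i) (\<omega>0 (fst i)) p + (t *\<^sub>R iter_deriv (snd i) (\<beta> \<kappa>1 (fst i)) p
        + s *\<^sub>R iter_deriv (snd i) (\<beta> \<kappa>2 (fst i)) p)) < \<epsilon>))" ..
  note \<delta> = bspec[OF \<delta>0, THEN conjunct1] bspec[OF \<delta>0, THEN conjunct2, rule_format]
  \<comment> \<open>Inserting 1 makes the minimum well defined without inspecting whether
    \<open>I\<close> is empty.\<close>
  define e where "e = Min (insert 1 (\<delta> ` I))"
  have e: "e > 0" "\<And>i. i \<in> I \<Longrightarrow> e \<le> \<delta> i" unfolding e_def using fI \<delta>(1) by auto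
  have SK: "p \<in> ?S" if "p \<in> snd d ` K" for p using that K(2) by blast
  have "perturb c U \<Phi> \<eta> (\<kappa> t s) D \<in> Ck_ball k D1 d \<Psi> K \<epsilon>" if ts: "0 < t" "t < e" "0 < s" "s < e" for t s
    unfolding Ck_ball_def mem_Collect_eq
  proof (intro conjI Du' ballI allI impI)
    fix \<xi> vs p assume \<xi>: "\<xi> \<in> (Basis :: 'e set)" and vs: "set vs \<subseteq> (Basis :: 'e set)" "length vs \<le> k" and p: "p \<in> snd d ` K"
    have i: "(\<xi>, vs) \<in> I" using \<xi> vs by (simp add: I_def)
    show "norm (iter_deriv vs (\<lambda>q. connection_form_coord (perturb c U \<Phi> \<eta> (\<kappa> t s) D) d \<Psi> \<xi> q
        - connection_form_coord D1 d \<Psi> \<xi> q) p) < \<epsilon>"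
      unfolding it[OF SK[OF p] vs(2)]
      using \<delta>(2)[OF i ts(1) _ ts(3) _ p] e(2)[OF i] ts by simp
  qed
  then show ?thesis using e(1) unfolding \<kappa>_def by blast
qed

end

section \<open>Opaque connections are generic\<close>

text \<open>The curvature and its covariant derivative at a point in terms of the 2-jet of the connection
  form: \<open>a\<close> and \<open>b\<close> are its values on the coordinate vectors \<open>v\<close> and \<open>w\<close>, and \<open>av\<close>, \<open>aw\<close>, \<open>bv\<close>, \<open>awv\<close>, \<open>bvv\<close> their
  partial derivatives.\<close>

definition jet_curv :: "complex ^ 'n::finite ^ 'n \<Rightarrow> complex ^ 'n ^ 'n \<Rightarrow> complex ^ 'n ^ 'n \<Rightarrow> complex ^ 'n ^ 'n
    \<Rightarrow> complex ^ 'n ^ 'n" where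
  "jet_curv a b aw bv = bv - aw + a ** b - b ** a"

definition jet_curv_deriv :: "complex ^ 'n::finite ^ 'n \<Rightarrow> complex ^ 'n ^ 'n \<Rightarrow> complex ^ 'n ^ 'n \<Rightarrow> complex ^ 'n ^ 'n
    \<Rightarrow> complex ^ 'n ^ 'n \<Rightarrow> complex ^ 'n ^ 'n \<Rightarrow> complex ^ 'n ^ 'n \<Rightarrow> complex ^ 'n ^ 'n" where
  "jet_curv_deriv a b aw bv av awv bvv = bvv - awv + (a ** bv + av ** b) - (b ** av + bv ** a)
    + a ** jet_curv a b aw bv - jet_curv a b aw bv ** a"

text \<open>The determinant depends continuously on the seven matrices of the jet. The norm on the
  product is at most the sum of the seven norms, hence the radius
  \<open>\<delta> / 7\<close>.\<close>

lemma jet_nonsingular_open: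
  fixes a :: "complex ^ 'n::finite ^ 'n"
  assumes "det (words (jet_curv a b aw bv) (jet_curv_deriv a b aw bv av awv bvv)) \<noteq> 0"
  shows "\<exists>\<epsilon>>0. \<forall>a' b' aw' bv' av' awv' bvv'. norm a' < \<epsilon> \<longrightarrow> norm b' < \<epsilon> \<longrightarrow> norm aw' < \<epsilon> \<longrightarrow> norm bv' < \<epsilon> \<longrightarrow>
    norm av' < \<epsilon> \<longrightarrow> norm awv' < \<epsilon> \<longrightarrow> norm bvv' < \<epsilon> \<longrightarrow>
    det (words (jet_curv (a + a') (b + b') (aw + aw') (bv + bv'))
      (jet_curv_deriv (a + a') (b + b') (aw + aw') (bv + bv') (av + av') (awv + awv') (bvv + bvv'))) \<noteq> 0"
proof -
  define J where "J = (\<lambda>(a', b', aw', bv', av', awv', bvv').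
    det (words (jet_curv (a + a') (b + b') (aw + aw') (bv + bv'))
      (jet_curv_deriv (a + a') (b + b') (aw + aw') (bv + bv') (av + av') (awv + awv') (bvv + bvv'))))"
  note mm = bounded_bilinear.isCont[OF bounded_bilinear_mm]
  have "isCont J 0"
    unfolding J_def case_prod_unfold jet_curv_deriv_def jet_curv_def
    by (intro isCont_words continuous_add continuous_diff mm continuous_const continuous_fst continuous_snd continuous_ident)
  then have "(J \<longlongrightarrow> J 0) (nhds 0)" by (simp add: isCont_def tendsto_nhds_iff)
  moreover have "J 0 \<noteq> 0" using assms by (simp add: J_def zero_prod_def)
  ultimately have "\<forall>\<^sub>F z in nhds 0. J z \<noteq> 0" by (rule tendsto_imp_eventually_ne)
  then obtain \<delta> where \<delta>: "\<delta> > 0" "\<And>z. dist z 0 < \<delta> \<Longrightarrow> J z \<noteq> 0" unfolding eventually_nhds_metric by blast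
  have "J (a', b', aw', bv', av', awv', bvv') \<noteq> 0"
    if "norm a' < \<delta> / 7" "norm b' < \<delta> / 7" "norm aw' < \<delta> / 7" "norm bv' < \<delta> / 7" "norm av' < \<delta> / 7"
      "norm awv' < \<delta> / 7" "norm bvv' < \<delta> / 7" for a' b' aw' bv' av' awv' bvv'
  proof (rule \<delta>(2))
    have "norm (a', b', aw', bv', av', awv', bvv')
        \<le> norm a' + (norm b' + (norm aw' + (norm bv' + (norm av' + (norm awv' + norm bvv')))))"
      by (intro order.trans[OF norm_Pair_le] add_mono order_refl)
    then show "dist (a', b', aw', bv', av', awv', bvv') 0 < \<delta>" using that by (simp only: dist_0_norm dist_commute[of _ 0])
  qed
  then show ?thesis using \<delta>(1) by (intro exI[of _ "\<delta> / 7"]) (simp add: J_def)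
qed

context hermitian_vector_bundle
begin

text \<open>In \<open>iter_deriv\<close> the head of the list is differentiated first:
  \<open>[w, v]\<close> stands for the derivative along \<open>v\<close> of the derivative along
  \<open>w\<close>.\<close>

lemma curvature_jet:
  assumes D: "D \<in> unitary_connections k" "2 \<le> k" and U: "(U, \<Phi>) \<in> T" and c: "c \<in> A" and p: "p \<in> snd c ` (fst c \<inter> U)"
  defines "\<omega> \<equiv> connection_form_coord D c \<Phi>"
  shows "curvature D c \<Phi> v w p = jet_curv (\<omega> v p) (\<omega> w p) (iter_deriv [w] (\<omega> v) p) (iter_deriv [v] (\<omega> w) p)"
    "curvature_deriv D c \<Phi> v w p = jet_curv_deriv (\<omega> v p) (\<omega> w p) (iter_deriv [w] (\<omega> v) p) (iter_deriv [v] (\<omega> w) p)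
      (iter_deriv [v] (\<omega> v) p) (iter_deriv [w, v] (\<omega> v) p) (iter_deriv [v, v] (\<omega> w) p)"
proof -
  show R: "curvature D c \<Phi> v w p = jet_curv (\<omega> v p) (\<omega> w p) (iter_deriv [w] (\<omega> v) p) (iter_deriv [v] (\<omega> w) p)"
    by (simp add: curvature_def jet_curv_def \<omega>_def)
  have 2: "Ck_on 2 (\<omega> \<xi>) (snd c ` (fst c \<inter> U))" for \<xi>
    unfolding \<omega>_def by (rule Ck_on_le[OF connection_form_coord_Ck[OF D(1) U c] D(2)])
  have d: "(\<omega> \<xi> has_derivative frechet_derivative (\<omega> \<xi>) (at p)) (at p)" for \<xi>
    by (rule Ck_on_has_derivative[OF 2 _ p]) simp
  have dd: "((\<lambda>q. frechet_derivative (\<omega> \<xi>) (at q) u) has_derivative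
      frechet_derivative (\<lambda>q. frechet_derivative (\<omega> \<xi>) (at q) u) (at p)) (at p)" for \<xi> u
    by (rule Ck_on_has_derivative[OF Ck_on_2D(2)[OF 2] _ p]) simp
  have "(curvature D c \<Phi> v w has_derivative (\<lambda>x. frechet_derivative (\<lambda>q. frechet_derivative (\<omega> w) (at q) v) (at p) x
      - frechet_derivative (\<lambda>q. frechet_derivative (\<omega> v) (at q) w) (at p) x
      + (\<omega> v p ** frechet_derivative (\<omega> w) (at p) x + frechet_derivative (\<omega> v) (at p) x ** \<omega> w p)
      - (\<omega> w p ** frechet_derivative (\<omega> v) (at p) x + frechet_derivative (\<omega> w) (at p) x ** \<omega> v p))) (at p)"
    unfolding curvature_def[abs_def] \<omega>_def[symmetric]
    by (intro has_derivative_add has_derivative_diff dd bounded_bilinear.FDERIV[OF bounded_bilinear_mm] d)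
  from frechet_derivative_eqI[OF this]
  show "curvature_deriv D c \<Phi> v w p = jet_curv_deriv (\<omega> v p) (\<omega> w p) (iter_deriv [w] (\<omega> v) p) (iter_deriv [v] (\<omega> w) p)
      (iter_deriv [v] (\<omega> v) p) (iter_deriv [w, v] (\<omega> v) p) (iter_deriv [v, v] (\<omega> w) p)"
    unfolding curvature_deriv_def R by (simp add: jet_curv_deriv_def flip: \<omega>_def)
qed

definition nonsingular_at ::
    "('m, 'e) chart \<Rightarrow> ('m \<Rightarrow> 'v \<Rightarrow> complex ^ 'r) \<Rightarrow> 'e \<Rightarrow> 'e \<Rightarrow> 'e
      \<Rightarrow> (('m \<Rightarrow> 'v) \<Rightarrow> 'm \<Rightarrow> ('m, 'e) tvec \<Rightarrow> 'v) \<Rightarrow> bool" where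
  "nonsingular_at c \<Phi> v w p D \<longleftrightarrow> det (words (curvature D c \<Phi> v w p) (curvature_deriv D c \<Phi> v w p)) \<noteq> 0"

lemma nonsingular_opaque:
  assumes D: "D \<in> unitary_connections k" "2 \<le> k" and U: "(U, \<Phi>) \<in> T" and c: "c \<in> A" and p: "p \<in> snd c ` (fst c \<inter> U)"
    and ns: "nonsingular_at c \<Phi> v w p D"
  shows "opaque D"
  unfolding opaque_def
proof (intro allI impI)
  fix F assume F: "invariant_subbundle D F"
  then have sF: "smooth_subbundle F" unfolding invariant_subbundle_def by blast
  have x: "chart_inv c p \<in> U" using chart_image_cases(1)[OF c, of p U] p by (simp add: Int_commute)
  have "fibre_coord c \<Phi> F p = {0} \<or> fibre_coord c \<Phi> F p = UNIV"
    by (rule words_invariant_subspace[OF ns[unfolded nonsingular_at_def] fibre_coord_subspace[OF sF U c p]])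
      (rule invariant_curvature[OF D F U c p], assumption)+
  then show "F = E \<or> F = (\<lambda>x. {fib_zero x})"
    unfolding fibre_coord_def by (rule subbundle_trivial[OF sF U x])
qed

lemma Ck_ball_self: "D \<in> unitary_connections k \<Longrightarrow> \<epsilon> > 0 \<Longrightarrow> D \<in> Ck_ball k D c \<Phi> K \<epsilon>"
proof -
  have "iter_deriv vs (\<lambda>q::'e. 0 :: complex ^ 'r ^ 'r) p = 0" for vs p
    by (induction vs) (simp_all add: frechet_derivative_const)
  then show "D \<in> unitary_connections k \<Longrightarrow> \<epsilon> > 0 \<Longrightarrow> D \<in> Ck_ball k D c \<Phi> K \<epsilon>" by (simp add: Ck_ball_def)
qed

text \<open>Only derivatives up to order two at the single point \<open>x\<close> enter, so the
  seminorm over the compact set \<open>{x}\<close> is enough. It measures derivatives along basis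
  vectors, which is why \<open>v\<close> and \<open>w\<close> are taken from the basis.\<close>

lemma nonsingular_open:
  assumes D: "D \<in> unitary_connections k" "2 \<le> k" and U: "(U, \<Phi>) \<in> T" and c: "c \<in> A" and x: "x \<in> fst c \<inter> U"
    and vw: "v \<in> Basis" "w \<in> Basis" and ns: "nonsingular_at c \<Phi> v w (snd c x) D"
  shows "\<exists>\<epsilon>>0. \<forall>D'\<in>Ck_ball k D c \<Phi> {x} \<epsilon>. nonsingular_at c \<Phi> v w (snd c x) D'"
proof -
  let ?p = "snd c x" and ?\<omega> = "\<lambda>D. connection_form_coord D c \<Phi>"
  have p: "?p \<in> snd c ` (fst c \<inter> U)" using x by blast
  note o = open_chart_triv[OF c U]
  obtain \<epsilon> where \<epsilon>: "\<epsilon> > 0" "\<And>a' b' aw' bv' av' awv' bvv'. norm a' < \<epsilon> \<Longrightarrow> norm b' < \<epsilon> \<Longrightarrow> norm aw' < \<epsilon> \<Longrightarrow> norm bv' < \<epsilon> \<Longrightarrow>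
    norm av' < \<epsilon> \<Longrightarrow> norm awv' < \<epsilon> \<Longrightarrow> norm bvv' < \<epsilon> \<Longrightarrow>
    det (words (jet_curv (?\<omega> D v ?p + a') (?\<omega> D w ?p + b') (iter_deriv [w] (?\<omega> D v) ?p + aw') (iter_deriv [v] (?\<omega> D w) ?p + bv'))
      (jet_curv_deriv (?\<omega> D v ?p + a') (?\<omega> D w ?p + b') (iter_deriv [w] (?\<omega> D v) ?p + aw') (iter_deriv [v] (?\<omega> D w) ?p + bv')
       (iter_deriv [v] (?\<omega> D v) ?p + av') (iter_deriv [w, v] (?\<omega> D v) ?p + awv') (iter_deriv [v, v] (?\<omega> D w) ?p + bvv'))) \<noteq> 0"
    using jet_nonsingular_open[OF ns[unfolded nonsingular_at_def curvature_jet[OF D U c p]]] by blast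
  have "nonsingular_at c \<Phi> v w ?p D'" if D': "D' \<in> Ck_ball k D c \<Phi> {x} \<epsilon>" for D'
  proof -
    have Du: "D' \<in> unitary_connections k" using D' by (simp add: Ck_ball_def)
    define \<alpha> where "\<alpha> \<xi> q = ?\<omega> D' \<xi> q - ?\<omega> D \<xi> q" for \<xi> q
    have \<alpha>: "Ck_on k (\<alpha> \<xi>) (snd c ` (fst c \<inter> U))" for \<xi>
      unfolding \<alpha>_def by (rule Ck_on_diff[OF o connection_form_coord_Ck[OF Du U c] connection_form_coord_Ck[OF D(1) U c]])
    have small: "norm (iter_deriv vs (\<alpha> \<xi>) ?p) < \<epsilon>" if "\<xi> \<in> Basis" "set vs \<subseteq> Basis" "length vs \<le> k" for \<xi> vs
      using D' that unfolding Ck_ball_def \<alpha>_def by simp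
    have eq: "iter_deriv vs (?\<omega> D' \<xi>) ?p = iter_deriv vs (?\<omega> D \<xi>) ?p + iter_deriv vs (\<alpha> \<xi>) ?p" if "length vs \<le> k" for \<xi> vs
      using iter_deriv_add[OF o p connection_form_coord_Ck[OF D(1) U c] \<alpha> that, of \<xi> \<xi>] by (simp add: \<alpha>_def)
    have eq0: "?\<omega> D' \<xi> ?p = ?\<omega> D \<xi> ?p + iter_deriv [] (\<alpha> \<xi>) ?p" for \<xi> by (simp add: \<alpha>_def)
    have l: "length [v] \<le> k" "length [w] \<le> k" "length [v, v] \<le> k" "length [w, v] \<le> k" "length ([] :: 'e list) \<le> k"
      using D(2) by auto
    show ?thesis
      unfolding nonsingular_at_def curvature_jet[OF Du D(2) U c p] eq[OF l(1)] eq[OF l(2)] eq[OF l(3)] eq[OF l(4)] eq0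
      by (rule \<epsilon>(2); rule small) (use vw l in auto)
  qed
  then show ?thesis using \<epsilon>(1) by blast
qed

text \<open>The factor \<open>(p - p0) \<bullet> v\<close> vanishes at \<open>p0\<close> and has
  derivative 1 along \<open>v\<close>. The linear term thus sets the first derivative, and the
  quadratic term adjusts the second one independently of it.\<close>

lemma quadratic_jet:
  fixes F1 F2 :: "'e \<Rightarrow> complex ^ 'r ^ 'r"
  assumes S: "open S" "p0 \<in> S" and F: "smooth_on F1 S" "smooth_on F2 S" and v: "v \<bullet> v = 1"
  defines "f \<equiv> \<lambda>p. ((p - p0) \<bullet> v) *\<^sub>R F1 p + (((p - p0) \<bullet> v)\<^sup>2 / 2) *\<^sub>R F2 p"
  shows "iter_deriv [v] f p0 = F1 p0"
    "iter_deriv [v, v] f p0 = 2 *\<^sub>R frechet_derivative F1 (at p0) v + F2 p0"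
proof -
  let ?l = "\<lambda>p. (p - p0) \<bullet> v"
  have l: "(?l has_derivative (\<lambda>h. h \<bullet> v)) (at p)" for p by (auto intro!: derivative_eq_intros)
  have l2: "((\<lambda>p. (?l p)\<^sup>2 / 2) has_derivative (\<lambda>h. ?l p * (h \<bullet> v))) (at p)" for p
    by (auto intro!: derivative_eq_intros)
  let ?F1' = "\<lambda>p. frechet_derivative F1 (at p)" and ?F2' = "\<lambda>p. frechet_derivative F2 (at p)"
  have d1: "frechet_derivative f (at p) v
      = ?l p *\<^sub>R (?F1' p v + F2 p) + (F1 p + ((?l p)\<^sup>2 / 2) *\<^sub>R ?F2' p v)" if "p \<in> S" for p
  proof -
    have "(f has_derivative (\<lambda>h. (?l p *\<^sub>R ?F1' p h + (h \<bullet> v) *\<^sub>R F1 p)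
        + (((?l p)\<^sup>2 / 2) *\<^sub>R ?F2' p h + (?l p * (h \<bullet> v)) *\<^sub>R F2 p))) (at p)"
      unfolding f_def
      by (intro has_derivative_add has_derivative_scaleR l l2 smooth_on_has_derivative[OF F(1) that] smooth_on_has_derivative[OF F(2) that])
    from frechet_derivative_eqI[OF this] show ?thesis using v by (simp add: scaleR_add_right)
  qed
  from d1[OF S(2)] show "iter_deriv [v] f p0 = F1 p0" by simp
  have F12: "smooth_on (\<lambda>p. ?F1' p v + F2 p) S" by (rule smooth_on_add[OF S(1) smooth_on_deriv[OF F(1)] F(2)])
  note dF12 = smooth_on_has_derivative[OF F12 S(2)] and dF2' = smooth_on_has_derivative[OF smooth_on_deriv[OF F(2), of v] S(2)]
  have 2: "((\<lambda>p. ?l p *\<^sub>R (?F1' p v + F2 p) + (F1 p + ((?l p)\<^sup>2 / 2) *\<^sub>R ?F2' p v)) has_derivative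
    (\<lambda>h. (?l p0 *\<^sub>R frechet_derivative (\<lambda>p. ?F1' p v + F2 p) (at p0) h + (h \<bullet> v) *\<^sub>R (?F1' p0 v + F2 p0))
       + (?F1' p0 h + (((?l p0)\<^sup>2 / 2) *\<^sub>R frechet_derivative (\<lambda>p. ?F2' p v) (at p0) h + (?l p0 * (h \<bullet> v)) *\<^sub>R ?F2' p0 v)))) (at p0)"
    by (intro has_derivative_add has_derivative_scaleR l l2 dF12 dF2' smooth_on_has_derivative[OF F(1) S(2)])
  have "iter_deriv [v, v] f p0 = frechet_derivative (\<lambda>p. ?l p *\<^sub>R (?F1' p v + F2 p) + (F1 p + ((?l p)\<^sup>2 / 2) *\<^sub>R ?F2' p v)) (at p0) v"
    using frechet_derivative_cong_open[OF S d1] by simp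
  also have "\<dots> = 2 *\<^sub>R ?F1' p0 v + F2 p0" unfolding frechet_derivative_eqI[OF 2] using v by (simp add: scaleR_2)
  finally show "iter_deriv [v, v] f p0 = 2 *\<^sub>R ?F1' p0 v + F2 p0" .
qed

text \<open>Only the \<open>w\<close>-component of the form is changed, and its value at the point
  is kept. The curvature then moves by \<open>K1 ** H0\<close>, while its derivative moves by a
  linear expression in which \<open>K2 ** H0\<close> is a free summand. Over the complex numbers
  both shifts can be prescribed, one after the other.\<close>

lemma nonsingular_dense:
  assumes D: "D \<in> unitary_connections k" "2 \<le> k" and U: "(U, \<Phi>) \<in> T" and c: "c \<in> A" and x: "x \<in> fst c \<inter> U"
    and vw: "v \<in> Basis" "w \<in> Basis" "v \<noteq> w" and W: "openin (Ck_topology k) W" "D \<in> W"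
  shows "\<exists>D'\<in>W. nonsingular_at c \<Phi> v w (snd c x) D'"
proof -
  let ?p = "snd c x" and ?\<omega> = "connection_form_coord D c \<Phi>"
  have xU: "x \<in> U" "x \<in> fst c" using x by auto
  have p: "?p \<in> snd c ` (fst c \<inter> U)" using x by blast
  have oO: "open (U \<inter> fst c)" using triv_open[OF U] chart_open[OF c] by blast
  obtain \<psi> :: "'m \<Rightarrow> real" and V K where b: "smooth_fun UNIV \<psi>" "open V" "x \<in> V" "\<And>y. y \<in> V \<Longrightarrow> \<psi> y = 1"
    "closed K" "K \<subseteq> U \<inter> fst c" "V \<subseteq> K" "\<And>y. y \<notin> K \<Longrightarrow> \<psi> y = 0"
    using bump_function[OF oO] xU by blast
  have vv: "v \<bullet> v = 1" "v \<bullet> w = 0" "w \<bullet> w = 1" using vw by (auto simp: inner_Basis)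
  define l where "l y = (snd c y - ?p) \<bullet> v" for y
  define \<kappa> where "\<kappa> K1 K2 y = \<psi> y *\<^sub>R (l y *\<^sub>R K1 + ((l y)\<^sup>2 / 2) *\<^sub>R K2)" for K1 K2 :: "complex ^ 'r ^ 'r" and y
  have \<kappa>: "smooth_fun (U \<inter> fst c) (\<kappa> K1 K2)" for K1 K2
  proof -
    have "smooth_on (\<lambda>q. (q - ?p) \<bullet> v) S" if "open S" for S
    proof -
      have "smooth_on (\<lambda>q. q + (- ?p)) S"
        by (rule smooth_on_add[OF that smooth_on_bounded_linear[OF bounded_linear_ident] smooth_on_const])
      from smooth_on_linear_compose[OF bounded_linear_inner_left that this] show ?thesis by simp
    qed
    note ls = this[OF open_chart_image[OF c oO]]
    have "smooth_fun (U \<inter> fst c) l"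
    proof (rule smooth_fun_chart[OF c oO Int_lower2])
      have eq: "snd c ` (U \<inter> fst c \<inter> fst c) = snd c ` (U \<inter> fst c)" by (simp add: Int_assoc)
      show "smooth_on (l \<circ> chart_inv c) (snd c ` (U \<inter> fst c))"
        by (rule smooth_on_cong[OF open_chart_image[OF c triv_open[OF U]] _ ls[unfolded eq]])
          (auto simp: l_def chart_inv_left[OF c])
    qed
    note l = this
    have "smooth_fun (U \<inter> fst c) (\<lambda>y. l y * l y * (1/2))"
      by (intro smooth_fun_bilinear[OF bounded_bilinear_mult oO] l smooth_fun_const)
    then have l2: "smooth_fun (U \<inter> fst c) (\<lambda>y. (l y)\<^sup>2 / 2)" by (simp add: power2_eq_square)
    show ?thesis unfolding \<kappa>_def
      by (intro smooth_fun_bilinear[OF bounded_bilinear_scaleR oO] smooth_fun_add[OF oO] l l2 smooth_fun_const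
          smooth_fun_subset[OF b(1) subset_UNIV])
  qed
  have \<kappa>0: "\<kappa> K1 K2 y = 0" if "y \<notin> K" for K1 K2 y using b(8)[OF that] by (simp add: \<kappa>_def)
  have \<kappa>s: "skew_hermitian (\<kappa> K1 K2 y)" if "skew_hermitian K1" "skew_hermitian K2" for K1 K2 y
    unfolding \<kappa>_def by (intro skew_hermitian_lincomb that)
  have \<kappa>l: "(\<lambda>y. t *\<^sub>R \<kappa> K1 K2 y + s *\<^sub>R \<kappa> K1' K2' y) = \<kappa> (t *\<^sub>R K1 + s *\<^sub>R K1') (t *\<^sub>R K2 + s *\<^sub>R K2')" for t s K1 K2 K1' K2'
    by (simp add: \<kappa>_def fun_eq_iff algebra_simps)
  let ?P = "\<lambda>K1 K2. perturb c U \<Phi> w (\<kappa> K1 K2) D"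
  have Pu: "?P K1 K2 \<in> unitary_connections k" if "skew_hermitian K1" "skew_hermitian K2" for K1 K2
    by (rule perturb_connection[OF D(1) U c \<kappa> b(5,6) \<kappa>0 \<kappa>s[OF that]])
  \<comment> \<open>Induction over the generation of the open set: balls are treated by
    \<open>perturb_in_ball\<close>, and an intersection takes the smaller parameter bound.\<close>
  have P_open: "\<exists>\<delta>>0. \<forall>t s. 0 < t \<longrightarrow> t < \<delta> \<longrightarrow> 0 < s \<longrightarrow> s < \<delta> \<longrightarrow>
      ?P (t *\<^sub>R K1 + s *\<^sub>R K1') (t *\<^sub>R K2 + s *\<^sub>R K2') \<in> W"
    if K: "skew_hermitian K1" "skew_hermitian K2" "skew_hermitian K1'" "skew_hermitian K2'" for K1 K2 K1' K2'
  proof -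
    have "generate_topology_on {Ck_ball k D c \<Phi> K \<epsilon> | D c U \<Phi> K \<epsilon>.
       D \<in> unitary_connections k \<and> c \<in> A \<and> (U, \<Phi>) \<in> T \<and> compact K \<and> K \<subseteq> fst c \<inter> U \<and> \<epsilon> > 0} W"
      using W(1) unfolding Ck_topology_def openin_topology_generated_by_iff .
    then show ?thesis using W(2)
    proof (induction rule: generate_topology_on.induct)
      case Empty
      then show ?case by simp
    next
      case (Int W1 W2)
      then obtain \<delta>1 \<delta>2 where "\<delta>1 > 0" "\<delta>2 > 0" and
        d: "\<forall>t s. 0 < t \<longrightarrow> t < \<delta>1 \<longrightarrow> 0 < s \<longrightarrow> s < \<delta>1 \<longrightarrow> ?P (t *\<^sub>R K1 + s *\<^sub>R K1') (t *\<^sub>R K2 + s *\<^sub>R K2') \<in> W1"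
        "\<forall>t s. 0 < t \<longrightarrow> t < \<delta>2 \<longrightarrow> 0 < s \<longrightarrow> s < \<delta>2 \<longrightarrow> ?P (t *\<^sub>R K1 + s *\<^sub>R K1') (t *\<^sub>R K2 + s *\<^sub>R K2') \<in> W2"
        by blast
      then show ?case by (intro exI[of _ "min \<delta>1 \<delta>2"]) auto
    next
      case (UN \<W>)
      then obtain W' where W': "W' \<in> \<W>" "D \<in> W'" by blast
      from UN.IH[OF this] obtain \<delta> where "\<delta> > 0"
        "\<forall>t s. 0 < t \<longrightarrow> t < \<delta> \<longrightarrow> 0 < s \<longrightarrow> s < \<delta> \<longrightarrow> ?P (t *\<^sub>R K1 + s *\<^sub>R K1') (t *\<^sub>R K2 + s *\<^sub>R K2') \<in> W'" by blast
      then show ?case using W'(1) by (intro exI[of _ \<delta>]) blast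
    next
      case (Basis B)
      then obtain D1 d V \<Psi> K' \<epsilon> where B: "B = Ck_ball k D1 d \<Psi> K' \<epsilon>" "D1 \<in> unitary_connections k" "d \<in> A"
        "(V, \<Psi>) \<in> T" "compact K'" "K' \<subseteq> fst d \<inter> V" "\<epsilon> > 0" by blast
      have "D \<in> Ck_ball k D1 d \<Psi> K' \<epsilon>" using Basis.prems B(1) by simp
      from perturb_in_ball[OF this B(2-7) U c b(5,6) \<kappa> \<kappa>0 \<kappa>s[OF K(1,2)] \<kappa> \<kappa>0 \<kappa>s[OF K(3,4)], of w]
      show ?case unfolding B(1) \<kappa>l .
    qed
  qed
  define H where "H q = gram \<Phi> (chart_inv c q)" for q
  \<comment> \<open>On the neighbourhood \<open>V\<close> the cut-off equals 1, so over
    \<open>S\<close> the perturbation is exactly the quadratic expression \<open>f\<close>.\<close>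
  define S where "S = snd c ` (V \<inter> fst c)"
  have S: "open S" "?p \<in> S" unfolding S_def using open_chart_image[OF c b(2)] b(3) xU by auto
  have SU: "S \<subseteq> snd c ` (fst c \<inter> U)" unfolding S_def using b(6,7) by blast
  have Hs: "smooth_on H S"
    using smooth_on_subset[OF smooth_funD[OF gram_smooth[OF U] c], of S] SU by (simp add: H_def[abs_def] comp_def Int_commute)
  have KHs: "smooth_on (\<lambda>q. K1 ** H q) S" for K1 :: "complex ^ 'r ^ 'r"
    by (rule smooth_on_linear_compose[OF bounded_bilinear.bounded_linear_right[OF bounded_bilinear_mm] S(1) Hs])
  have dKH: "frechet_derivative (\<lambda>q. K1 ** H q) (at ?p) v = K1 ** frechet_derivative H (at ?p) v" for K1 :: "complex ^ 'r ^ 'r"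
    by (rule frechet_derivative_linear_compose[OF bounded_bilinear.bounded_linear_right[OF bounded_bilinear_mm]
          smooth_on_differentiable[OF Hs S(2)]])
  have tp: "transition_pair U \<Phi> U \<Phi> (\<lambda>_. mat 1) (\<lambda>_. mat 1)"
    by (simp add: transition_pair_def smooth_fun_const)
  define f where "f K1 K2 = (\<lambda>q. ((q - ?p) \<bullet> v) *\<^sub>R (K1 ** H q) + (((q - ?p) \<bullet> v)\<^sup>2 / 2) *\<^sub>R (K2 ** H q))" for K1 K2 :: "complex ^ 'r ^ 'r"
  have coord: "connection_form_coord (?P K1 K2) c \<Phi> \<xi> q = ?\<omega> \<xi> q + (\<xi> \<bullet> w) *\<^sub>R f K1 K2 q"
    if K: "skew_hermitian K1" "skew_hermitian K2" and q: "q \<in> S" for K1 K2 \<xi> q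
  proof -
    have qU: "q \<in> snd c ` (fst c \<inter> U)" using q SU by blast
    obtain y where y: "y \<in> V" "y \<in> fst c" "q = snd c y" using q unfolding S_def by blast
    have yU: "y \<in> U" using y b(6,7) by blast
    have "\<kappa> K1 K2 y ** gram \<Phi> y = f K1 K2 q"
      using b(4)[OF y(1)] by (simp add: \<kappa>_def f_def H_def l_def y(3) chart_inv_left[OF c y(2)]
          bounded_bilinear.add_left[OF bounded_bilinear_mm] bounded_bilinear.scaleR_left[OF bounded_bilinear_mm])
    then show ?thesis
      unfolding perturb_form_coord[OF D(1) Pu[OF K] U U c qU tp]
      using y(2) yU by (simp add: perturb_matrix_def y(3) chart_inv_left[OF c y(2)] vec_of_self[OF c y(2)])
  qed
  define a where "a = ?\<omega> v ?p"
  define H0 where "H0 = H ?p"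
  define H1 where "H1 = frechet_derivative H (at ?p) v"
  define M where "M = curvature D c \<Phi> v w ?p"
  define N where "N = curvature_deriv D c \<Phi> v w ?p"
  \<comment> \<open>The shift of the derivative of the curvature. The commutator of \<open>a\<close>
    with \<open>K1 ** H0\<close> occurs twice: from differentiating the products of connection forms
    and from the commutator with the shifted curvature.\<close>
  define L where "L K1 K2 = 2 *\<^sub>R (K1 ** H1) + K2 ** H0 + 2 *\<^sub>R (a ** (K1 ** H0) - (K1 ** H0) ** a)" for K1 K2
  have curv: "curvature (?P K1 K2) c \<Phi> v w ?p = M + K1 ** H0" "curvature_deriv (?P K1 K2) c \<Phi> v w ?p = N + L K1 K2"
    if K: "skew_hermitian K1" "skew_hermitian K2" for K1 K2
  proof -
    let ?\<omega>' = "connection_form_coord (?P K1 K2) c \<Phi>"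
    have fs: "smooth_on (f K1 K2) S"
    proof -
      have "smooth_on (\<lambda>q. q + (- ?p)) S"
        by (rule smooth_on_add[OF S(1) smooth_on_bounded_linear[OF bounded_linear_ident] smooth_on_const])
      from smooth_on_linear_compose[OF bounded_linear_inner_left S(1) this, of v]
      have ls: "smooth_on (\<lambda>q. (q - ?p) \<bullet> v) S" by simp
      have "smooth_on (\<lambda>q. ((q - ?p) \<bullet> v) * ((q - ?p) \<bullet> v) * (1/2)) S"
        by (intro smooth_on_bilinear[OF bounded_bilinear_mult S(1)] ls smooth_on_const)
      then have l2s: "smooth_on (\<lambda>q. ((q - ?p) \<bullet> v)\<^sup>2 / 2) S" by (simp add: power2_eq_square)
      show ?thesis unfolding f_def
        by (intro smooth_on_add[OF S(1)] smooth_on_bilinear[OF bounded_bilinear_scaleR S(1)] ls l2s KHs)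
    qed
    have \<omega>S: "Ck_on k (?\<omega> \<xi>) S" for \<xi> by (rule Ck_on_subset[OF connection_form_coord_Ck[OF D(1) U c] SU])
    have cv: "?\<omega>' v q = ?\<omega> v q" if "q \<in> S" for q using coord[OF K that, of v] vv by simp
    have cw: "?\<omega>' w q = ?\<omega> w q + f K1 K2 q" if "q \<in> S" for q using coord[OF K that, of w] vv by simp
    have iv: "iter_deriv vs (?\<omega>' v) ?p = iter_deriv vs (?\<omega> v) ?p" for vs by (rule iter_deriv_cong[OF S(1) cv S(2)])
    have iw: "iter_deriv vs (?\<omega>' w) ?p = iter_deriv vs (?\<omega> w) ?p + iter_deriv vs (f K1 K2) ?p" if "length vs \<le> k" for vs
      by (rule trans[OF iter_deriv_cong[OF S(1) cw S(2)] iter_deriv_add[OF S \<omega>S smooth_on_imp_Ck[OF fs] that]])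
    have f0: "f K1 K2 ?p = 0" by (simp add: f_def)
    have f1: "iter_deriv [v] (f K1 K2) ?p = K1 ** H0"
      unfolding f_def H0_def by (rule quadratic_jet(1)[OF S KHs KHs vv(1)])
    have f2: "iter_deriv [v, v] (f K1 K2) ?p = 2 *\<^sub>R (K1 ** H1) + K2 ** H0"
      unfolding f_def H0_def H1_def quadratic_jet(2)[OF S KHs KHs vv(1)] dKH ..
    have l: "length [v] \<le> k" "length [v, v] \<le> k" using D(2) by auto
    note J = curvature_jet[OF Pu[OF K] D(2) U c p, of v w] curvature_jet[OF D U c p, of v w]
    show R: "curvature (?P K1 K2) c \<Phi> v w ?p = M + K1 ** H0"
      unfolding M_def J(1,3) iv iw[OF l(1)] f1 cv[OF S(2)] cw[OF S(2)] f0
      by (simp add: jet_curv_def del: iter_deriv.simps)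
    show "curvature_deriv (?P K1 K2) c \<Phi> v w ?p = N + L K1 K2"
      unfolding N_def L_def J(2,4) iv iw[OF l(1)] iw[OF l(2)] f1 f2 cv[OF S(2)] cw[OF S(2)] f0 jet_curv_deriv_def jet_curv_def a_def
      by (simp add: bounded_bilinear.add_left[OF bounded_bilinear_mm] bounded_bilinear.add_right[OF bounded_bilinear_mm]
          bounded_bilinear.diff_left[OF bounded_bilinear_mm] bounded_bilinear.diff_right[OF bounded_bilinear_mm]
          scaleR_2 algebra_simps del: iter_deriv.simps)
  qed
  \<comment> \<open>The target pair: the complex perturbation constructed next turns the curvature
    and its derivative into exactly these matrices.\<close>
  obtain M0 N0 :: "complex ^ 'r ^ 'r" where MN0: "det (words M0 N0) \<noteq> 0" using words_nonsingular_exists by blast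
  obtain H' where "H' ** gram \<Phi> x = mat 1" by (rule gram_invertible[OF U xU(1)])
  then have HH: "H' ** H0 = mat 1" by (simp add: H0_def H_def chart_inv_left[OF c xU(2)])
  have solve: "(X ** H') ** H0 = X" for X :: "complex ^ 'r ^ 'r" by (simp add: HH flip: matrix_mul_assoc)
  \<comment> \<open>\<open>C1\<close> is fixed by the curvature alone; \<open>C2\<close> then
    compensates for what \<open>C1\<close> does to the derivative.\<close>
  define C1 where "C1 = (M0 - M) ** H'"
  define C2 where "C2 = (N0 - N - L C1 0) ** H'"
  have C1: "C1 ** H0 = M0 - M" unfolding C1_def by (rule solve)
  have L0: "L K1 K2 = L K1 0 + K2 ** H0" for K1 K2 by (simp add: L_def bounded_bilinear.zero_left[OF bounded_bilinear_mm])
  have "C2 ** H0 = N0 - N - L C1 0" unfolding C2_def by (rule solve)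
  then have C2: "L C1 C2 = N0 - N" using L0[of C1 C2] by simp
  have msm: "mscale z X ** Y = mscale z (X ** Y)" "Y ** mscale z X = mscale z (Y ** X)" for z and X Y :: "complex ^ 'r ^ 'r"
    by (simp_all add: vec_eq_iff matrix_matrix_mult_def mscale_nth sum_distrib_left mult_ac)
  have msa: "mscale z (X + Y) = mscale z X + mscale z Y" "mscale z (X - Y) = mscale z X - mscale z Y" for z and X Y :: "complex ^ 'r ^ 'r"
    by (simp_all add: vec_eq_iff mscale_nth algebra_simps)
  have msr: "mscale z (t *\<^sub>R X) = t *\<^sub>R mscale z X" for z t and X :: "complex ^ 'r ^ 'r"
    by (simp add: vec_eq_iff mscale_nth)
  \<comment> \<open>\<open>L\<close> is complex linear although only its skew-Hermitian arguments
    correspond to unitary connections; this is what permits the passage to the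
    complexification.\<close>
  have Lz: "L (K1 + mscale \<i> K1') (K2 + mscale \<i> K2') = L K1 K2 + mscale \<i> (L K1' K2')" for K1 K2 K1' K2'
    by (simp add: L_def bounded_bilinear.add_left[OF bounded_bilinear_mm] bounded_bilinear.add_right[OF bounded_bilinear_mm]
        msm msa msr scaleR_add_right scaleR_diff_right)
  have Lr: "L (t *\<^sub>R K1 + s *\<^sub>R K1') (t *\<^sub>R K2 + s *\<^sub>R K2') = t *\<^sub>R L K1 K2 + s *\<^sub>R L K1' K2'" for t s K1 K2 K1' K2'
    by (simp add: L_def bounded_bilinear.add_left[OF bounded_bilinear_mm] bounded_bilinear.add_right[OF bounded_bilinear_mm]
        bounded_bilinear.scaleR_left[OF bounded_bilinear_mm] bounded_bilinear.scaleR_right[OF bounded_bilinear_mm]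
        algebra_simps)
  obtain K1 K1' where K1: "skew_hermitian K1" "skew_hermitian K1'" "C1 = K1 + mscale \<i> K1'" by (rule skew_hermitian_decomp)
  obtain K2 K2' where K2: "skew_hermitian K2" "skew_hermitian K2'" "C2 = K2 + mscale \<i> K2'" by (rule skew_hermitian_decomp)
  have "M + K1 ** H0 + mscale \<i> (K1' ** H0) = M0"
    using C1 unfolding K1(3) by (simp add: bounded_bilinear.add_left[OF bounded_bilinear_mm] msm algebra_simps)
  moreover have "N + L K1 K2 + mscale \<i> (L K1' K2') = N0"
    using C2 unfolding K1(3) K2(3) Lz by (simp add: algebra_simps)
  ultimately have ns: "det (words (M + K1 ** H0 + mscale \<i> (K1' ** H0)) (N + L K1 K2 + mscale \<i> (L K1' K2'))) \<noteq> 0"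
    using MN0 by simp
  obtain \<delta> where \<delta>: "\<delta> > 0" "\<forall>t s. 0 < t \<longrightarrow> t < \<delta> \<longrightarrow> 0 < s \<longrightarrow> s < \<delta> \<longrightarrow>
      ?P (t *\<^sub>R K1 + s *\<^sub>R K1') (t *\<^sub>R K2 + s *\<^sub>R K2') \<in> W"
    using P_open[OF K1(1) K2(1) K1(2) K2(2)] by blast
  obtain t s where ts: "0 < t" "t < \<delta>" "0 < s" "s < \<delta>"
    "det (words (M + (t *\<^sub>R (K1 ** H0) + s *\<^sub>R (K1' ** H0))) (N + (t *\<^sub>R L K1 K2 + s *\<^sub>R L K1' K2'))) \<noteq> 0"
    by (rule words_nonsingular_small[OF ns \<delta>(1)])
  have sk: "skew_hermitian (t *\<^sub>R K1 + s *\<^sub>R K1')" "skew_hermitian (t *\<^sub>R K2 + s *\<^sub>R K2')"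
    by (intro skew_hermitian_lincomb K1 K2)+
  have "nonsingular_at c \<Phi> v w ?p (?P (t *\<^sub>R K1 + s *\<^sub>R K1') (t *\<^sub>R K2 + s *\<^sub>R K2'))"
    unfolding nonsingular_at_def curv[OF sk] Lr
    using ts(5) by (simp add: bounded_bilinear.add_left[OF bounded_bilinear_mm] bounded_bilinear.scaleR_left[OF bounded_bilinear_mm])
  then show ?thesis using \<delta>(2) ts by blast
qed

text \<open>One fixed point \<open>x\<close> decides: nonsingularity there already forces every
  invariant subbundle to be trivial on the whole connected manifold.\<close>

lemma opaque_generic:
  assumes dim: "DIM('e) \<ge> 2" and k: "2 \<le> k"
  shows "\<exists>\<U>. openin (Ck_topology k) \<U> \<and> Ck_topology k closure_of \<U> = unitary_connections k \<and> (\<forall>D\<in>\<U>. opaque D)"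
proof -
  \<comment> \<open>Two different coordinate directions are required, since over a curve the
    curvature of every connection vanishes.\<close>
  have "\<not> DIM('e) \<le> Suc 0" using dim by simp
  then obtain v w :: 'e where vw: "v \<in> Basis" "w \<in> Basis" "v \<noteq> w"
    unfolding card_le_Suc0_iff_eq[OF finite_Basis] by blast
  obtain x :: 'm where True by blast
  obtain U \<Phi> where U: "(U, \<Phi>) \<in> T" "x \<in> U" by (rule triv_exists)
  define c where "c = chart_at A x"
  have c: "c \<in> A" "x \<in> fst c" using chart_at by (auto simp: c_def)
  have x: "x \<in> fst c \<inter> U" and p: "snd c x \<in> snd c ` (fst c \<inter> U)" using c U by auto
  let ?ns = "nonsingular_at c \<Phi> v w (snd c x)"
  \<comment> \<open>A union of generating balls is open at once; by \<open>nonsingular_open\<close>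
    it contains every connection that is nonsingular at \<open>x\<close>.\<close>
  define \<B> where "\<B> = {Ck_ball k D c \<Phi> {x} \<epsilon> | D \<epsilon>. D \<in> unitary_connections k \<and> \<epsilon> > 0 \<and>
    (\<forall>D'\<in>Ck_ball k D c \<Phi> {x} \<epsilon>. ?ns D')}"
  have "openin (Ck_topology k) B" if B: "B \<in> \<B>" for B
  proof -
    obtain D \<epsilon> where "B = Ck_ball k D c \<Phi> {x} \<epsilon>" "D \<in> unitary_connections k" "\<epsilon> > 0"
      using B unfolding \<B>_def by blast
    moreover have "compact {x}" "{x} \<subseteq> fst c \<inter> U" using x by auto
    ultimately show ?thesis
      unfolding Ck_topology_def using c(1) U(1) by (intro topology_generated_by_Basis) blast
  qed
  then have o: "openin (Ck_topology k) (\<Union>\<B>)" by blast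
  have op: "opaque D" if "D \<in> \<Union>\<B>" for D
  proof -
    have "D \<in> unitary_connections k" "?ns D" using that unfolding \<B>_def Ck_ball_def by auto
    then show ?thesis by (intro nonsingular_opaque[OF _ k U(1) c(1) p])
  qed
  have inB: "D \<in> \<Union>\<B>" if D: "D \<in> unitary_connections k" "?ns D" for D
  proof -
    obtain \<epsilon> where e: "\<epsilon> > 0" "\<forall>D'\<in>Ck_ball k D c \<Phi> {x} \<epsilon>. ?ns D'"
      using nonsingular_open[OF D(1) k U(1) c(1) x vw(1,2) D(2)] by blast
    then have "Ck_ball k D c \<Phi> {x} \<epsilon> \<in> \<B>" using D(1) unfolding \<B>_def by blast
    then show ?thesis using Ck_ball_self[OF D(1) e(1)] by blast
  qed
  have "Ck_topology k closure_of \<Union>\<B> = unitary_connections k"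
  proof
    show "Ck_topology k closure_of \<Union>\<B> \<subseteq> unitary_connections k"
      using closure_of_subset_topspace[of "Ck_topology k" "\<Union>\<B>"] unfolding topspace_Ck_topology .
    show "unitary_connections k \<subseteq> Ck_topology k closure_of \<Union>\<B>"
    proof
      fix D assume D: "D \<in> unitary_connections k"
      have "\<exists>D'\<in>\<Union>\<B>. D' \<in> W" if W: "D \<in> W" "openin (Ck_topology k) W" for W
      proof -
        obtain D' where D': "D' \<in> W" "?ns D'" using nonsingular_dense[OF D k U(1) c(1) x vw W(2,1)] by blast
        have "D' \<in> unitary_connections k" using openin_subset[OF W(2)] D'(1) unfolding topspace_Ck_topology by blast
        then show ?thesis using inB D' by blast
      qed
      then show "D \<in> Ck_topology k closure_of \<Union>\<B>" using D unfolding in_closure_of topspace_Ck_topology by blast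
    qed
  qed
  then show ?thesis using o op by blast
qed

end

theorem theorem1p6:
  fixes A :: "('m::t2_space, 'e::euclidean_space) chart set"
    and g :: "'m \<Rightarrow> ('m, 'e) tvec \<Rightarrow> ('m, 'e) tvec \<Rightarrow> real"
    and E :: "'m \<Rightarrow> 'v set"
    and T :: "('m, 'v, 'r::finite) triv set"
    and h :: "'m \<Rightarrow> 'v \<Rightarrow> 'v \<Rightarrow> complex"
  assumes dim: "DIM('e) \<ge> 2"
    and riemannian: "closed_riemannian_manifold A g"
    and anosov: "closed_riemannian_manifold.anosov A g"
    and hermitian: "hermitian_vector_bundle A g E T h"
  shows "\<exists>k0::nat. \<forall>k\<ge>k0. \<exists>\<U>.
    openin (hermitian_vector_bundle.Ck_topology A E T h k) \<U> \<and>
    hermitian_vector_bundle.Ck_topology A E T h k closure_of \<U>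
      = hermitian_vector_bundle.unitary_connections A E T h k \<and>
    (\<forall>D\<in>\<U>. hermitian_vector_bundle.opaque A g E T D)"
  \<comment> \<open>The threshold \<open>k0\<close> is 2, the number of derivatives of the
    connection form that enter the determinant.\<close>
  using hermitian_vector_bundle.opaque_generic[OF hermitian dim] by blast

end
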